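(* Let $(\mu_1)$ be the sentence $(\exists\mu_1^{1\to1})(\forall f^1)\big((\exists g^1)(\forall x^0)(f(\overline gx)=0)\to(\forall x^0)(f(\overline{\mu_1(f)}x)=0)\big)$, let $\Pi^1_1\text{-}\mathsf{TRANS}$ be $$(\forall^{\mathrm{st}}f^1)\big[(\exists g^1)(\forall x^0)(f(\overline gx)=0)\to(\exists^{\mathrm{st}}g^1)(\forall x^0)(f(\overline gx)=0)\big],$$ and let $(\kappa^3)$ be $(\exists\kappa^{2\to1})(\forall Y^2)\big[(\exists f^1\le_11)(Y(f)=0)\to[Y(\kappa(Y))=0\wedge\kappa(Y)\le_11]\big]$. Then $\mathsf B_0+(\kappa^3)$ proves $(\mu_1)\leftrightarrow\Pi^1_1\text{-}\mathsf{TRANS}$, while $\mathsf B_0^-+(\kappa^3)$ does not.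
   Context: Finite types are generated from $0$ (natural numbers) by $\to$; type $n+1$ is $n\to0$; superscripts on variables denote types; $f\le_11$ means $(\forall n^0)(f(n)\le1)$. $\mathsf{E\text{-}EFA}^\omega$ is the extensional finite-type arithmetic of first-order strength $\mathsf{EFA}=I\Delta_0+\mathrm{EXP}$, namely Kohlenbach's system $\mathsf{E\text{-}G}_3\mathsf A^\omega$ ("Applied Proof Theory", Ch. 3). The nonstandard language adds unary predicates $\mathrm{st}^\sigma$ and quantifiers $\forall^{\mathrm{st}}x^\sigma,\exists^{\mathrm{st}}x^\sigma$ for every finite type $\sigma$; formulas without these symbols are called internal. $\mathsf{E\text{-}EFA}^{\omega}_{\mathrm{st}}$ is $\mathsf{E\text{-}EFA}^\omega$ plus: (EQ) $\forall^{\mathrm{st}}x\,\Phi(x)\leftrightarrow\forall x(\mathrm{st}(x)\to\Phi(x))$ and $\exists^{\mathrm{st}}x\,\Phi(x)\leftrightarrow\exists x(\mathrm{st}(x)\wedge\Phi(x))$ for arbitrary $\Phi$; ($\mathcal T_{\mathrm{st}}$) $\mathrm{st}(x)\wedge x=y\to\mathrm{st}(y)$; $\mathrm{st}(t)$ for each closed term $t$; $\mathrm{st}(f)\wedge\mathrm{st}(x)\to\mathrm{st}(fx)$; $\mathrm{st}^0(x)\wedge y\le x\to\mathrm{st}^0(y)$. Finite sequences of objects of type $\sigma$ are coded as single objects of type $\sigma$, such that every object codes a finite sequence; $x\in y$ means $x$ equals a component of the sequence coded by $y$; $\cup$ is concatenation; for $Y$ of type $\sigma\to\tau$, $Y[x]:=\bigcup_{f\in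 Y}f(x)$; for $g^1$ and $k^0$, $\overline gk$ is (the code of) $\langle g(0),\dots,g(k-1)\rangle$. Further axioms ($\varphi$ internal; $A$ quantifier-free internal): ($\mathsf I$) $\forall^{\mathrm{st}}y'\,\exists x\,\forall y\in y'\,\varphi(x,y)\to\exists x\,\forall^{\mathrm{st}}y\,\varphi(x,y)$; ($\mathsf{HAC}_{\mathrm{int}}$) $\forall^{\mathrm{st}}x^\sigma\,\exists^{\mathrm{st}}y^\tau\,\varphi(x,y)\to\exists^{\mathrm{st}}Y^{\sigma\to\tau}\,\forall^{\mathrm{st}}x^\sigma\,\exists y^\tau\in Y[x]\ \varphi(x,y)$ (parameters allowed in both); ($\mathsf{PF\text{-}TP}_\forall$) $\forall^{\mathrm{st}}\underline x\,\varphi(\underline x)\to\forall\underline x\,\varphi(\underline x)$, where $\varphi(\underline x)$ has no free variables besides $\underline x$; ($\mathsf{QF\text{-}AC}^{1,0}$) $(\forall x^1)(\exists y^0)A(x,y)\to(\exists Y^{1\to0})(\forall x^1)A(x,Y(x))$. $\mathsf B_0:=\mathsf{E\text{-}EFA}^{\omega}_{\mathrm{st}}+\mathsf I+\mathsf{HAC}_{\mathrm{int}}+\mathsf{PF\text{-}TP}_\forall+\mathsf{QF\text{-}AC}^{1,0}$, and $\mathsf B_0^-$ is $\mathsf B_0$ without $\mathsf{PF\text{-}TP}_\forall$. *)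

theory Defs
  imports Main
begin

section \<open>Types and terms\<close>

text \<open>\<open>N\<close> is the type 0 of natural numbers.\<close>

datatype ty = N | Fn ty ty (infixr "\<rightarrow>" 60)

abbreviation T1 :: ty where "T1 \<equiv> N \<rightarrow> N"
abbreviation T2 :: ty where "T2 \<equiv> T1 \<rightarrow> N"

fun arg_tys :: "ty \<Rightarrow> ty list" where
  "arg_tys N = []"
| "arg_tys (\<sigma> \<rightarrow> \<tau>) = \<sigma> # arg_tys \<tau>"

text \<open>The constants of Kohlenbach's \<open>G\<^sub>3A\<^sup>\<omega>\<close>: zero, successor, minimum, maximum, the branches
  \<open>A\<^sub>0, \<dots>, A\<^sub>3\<close> of the Ackermann function (successor, sum, product, power), the functionals
  \<open>\<Phi>\<^sub>1, \<Phi>\<^sub>2, \<Phi>\<^sub>3\<close> (maximum, sum and product of \<open>f 0, \<dots>, f x\<close>), bounded search, the bounded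
  predicative recursors, and the combinators. They are characterised by the axioms further below.\<close>

datatype cst =
    CZero | CSuc | CMin | CMax | CA0 | CA1 | CA2 | CA3 | CPhi1 | CPhi2 | CPhi3 | CMu
  | CRec ty | CPi ty ty | CSigma ty ty ty

fun cst_ty :: "cst \<Rightarrow> ty" where
  "cst_ty CZero = N"
| "cst_ty CSuc = N \<rightarrow> N"
| "cst_ty CMin = N \<rightarrow> N \<rightarrow> N"
| "cst_ty CMax = N \<rightarrow> N \<rightarrow> N"
| "cst_ty CA0 = N \<rightarrow> N \<rightarrow> N"
| "cst_ty CA1 = N \<rightarrow> N \<rightarrow> N"
| "cst_ty CA2 = N \<rightarrow> N \<rightarrow> N"
| "cst_ty CA3 = N \<rightarrow> N \<rightarrow> N"
| "cst_ty CPhi1 = T1 \<rightarrow> N \<rightarrow> N"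
| "cst_ty CPhi2 = T1 \<rightarrow> N \<rightarrow> N"
| "cst_ty CPhi3 = T1 \<rightarrow> N \<rightarrow> N"
| "cst_ty CMu = (N \<rightarrow> N \<rightarrow> N) \<rightarrow> N \<rightarrow> N"
| "cst_ty (CRec \<rho>) = N \<rightarrow> \<rho> \<rightarrow> (N \<rightarrow> N \<rightarrow> \<rho>) \<rightarrow> (N \<rightarrow> \<rho>) \<rightarrow> \<rho>"
| "cst_ty (CPi \<rho> \<tau>) = \<rho> \<rightarrow> \<tau> \<rightarrow> \<rho>"
| "cst_ty (CSigma \<delta> \<rho> \<tau>) = (\<delta> \<rightarrow> \<rho> \<rightarrow> \<tau>) \<rightarrow> (\<delta> \<rightarrow> \<rho>) \<rightarrow> \<delta> \<rightarrow> \<tau>"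

text \<open>A variable is an index together with its type, so there are infinitely many variables of
  every type and variables of different types are different.\<close>

type_synonym var = "nat \<times> ty"

datatype tm = V var | Cn cst | App tm tm (infixl "\<cdot>" 100)

text \<open>The value of \<^term>\<open>ty_of\<close> is meaningful for well-typed terms only.\<close>

fun ty_of :: "tm \<Rightarrow> ty" where
  "ty_of (V x) = snd x"
| "ty_of (Cn c) = cst_ty c"
| "ty_of (s \<cdot> t) = (case ty_of s of N \<Rightarrow> N | \<sigma> \<rightarrow> \<tau> \<Rightarrow> \<tau>)"

fun wt :: "tm \<Rightarrow> bool" where
  "wt (V x) \<longleftrightarrow> True"
| "wt (Cn c) \<longleftrightarrow> True"
| "wt (s \<cdot> t) \<longleftrightarrow> wt s \<and> wt t \<and> (case ty_of s of N \<Rightarrow> False | \<sigma> \<rightarrow> \<tau> \<Rightarrow> ty_of t = \<sigma>)"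

fun tvars :: "tm \<Rightarrow> var set" where
  "tvars (V x) = {x}"
| "tvars (Cn c) = {}"
| "tvars (s \<cdot> t) = tvars s \<union> tvars t"

fun tsubst :: "var \<Rightarrow> tm \<Rightarrow> tm \<Rightarrow> tm" where
  "tsubst x u (V y) = (if x = y then u else V y)"
| "tsubst x u (Cn c) = Cn c"
| "tsubst x u (s \<cdot> t) = tsubst x u s \<cdot> tsubst x u t"

text \<open>A strict upper bound of the indices of the variables of a term, for choosing fresh variables.\<close>

fun ub :: "tm \<Rightarrow> nat" where
  "ub (V x) = Suc (fst x)"
| "ub (Cn c) = 0"
| "ub (s \<cdot> t) = max (ub s) (ub t)"

definition apps :: "tm \<Rightarrow> tm list \<Rightarrow> tm" where
  "apps t ts = foldl App t ts"

text \<open>Abstraction is defined by the usual translation into combinators.\<close>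

fun lam :: "var \<Rightarrow> tm \<Rightarrow> tm" where
  "lam x (V y) =
     (if x = y
      then Cn (CSigma (snd x) (snd x \<rightarrow> snd x) (snd x))
             \<cdot> Cn (CPi (snd x) (snd x \<rightarrow> snd x)) \<cdot> Cn (CPi (snd x) (snd x))
      else Cn (CPi (snd y) (snd x)) \<cdot> V y)"
| "lam x (Cn c) = Cn (CPi (cst_ty c) (snd x)) \<cdot> Cn c"
| "lam x (s \<cdot> t) =
     (if x \<notin> tvars (s \<cdot> t) then Cn (CPi (ty_of (s \<cdot> t)) (snd x)) \<cdot> (s \<cdot> t)
      else Cn (CSigma (snd x) (ty_of t) (ty_of (s \<cdot> t))) \<cdot> lam x s \<cdot> lam x t)"

definition lams :: "var list \<Rightarrow> tm \<Rightarrow> tm" where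
  "lams xs t = foldr lam xs t"


section \<open>Formulas\<close>

text \<open>The logic is classical; the connectives and quantifiers missing here are defined below.\<close>

datatype fm =
    Eq tm tm (infix "\<^bold>=" 50)
  | Le tm tm (infix "\<^bold>\<le>" 50)
  | St tm
  | Bot
  | Imp fm fm (infixr "\<^bold>\<longrightarrow>" 25)
  | All var fm
  | AllSt var fm

definition Neg :: "fm \<Rightarrow> fm" where "Neg A = (A \<^bold>\<longrightarrow> Bot)"
definition And :: "fm \<Rightarrow> fm \<Rightarrow> fm" (infixr "\<^bold>\<and>" 35) where "(A \<^bold>\<and> B) = Neg (A \<^bold>\<longrightarrow> Neg B)"
definition Or :: "fm \<Rightarrow> fm \<Rightarrow> fm" (infixr "\<^bold>\<or>" 30) where "(A \<^bold>\<or> B) = (Neg A \<^bold>\<longrightarrow> B)"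
definition Iff :: "fm \<Rightarrow> fm \<Rightarrow> fm" (infix "\<^bold>\<longleftrightarrow>" 25) where
  "(A \<^bold>\<longleftrightarrow> B) = ((A \<^bold>\<longrightarrow> B) \<^bold>\<and> (B \<^bold>\<longrightarrow> A))"
definition Ex :: "var \<Rightarrow> fm \<Rightarrow> fm" where "Ex x A = Neg (All x (Neg A))"
definition ExSt :: "var \<Rightarrow> fm \<Rightarrow> fm" where "ExSt x A = Neg (AllSt x (Neg A))"

fun wf_fm :: "fm \<Rightarrow> bool" where
  "wf_fm (s \<^bold>= t) \<longleftrightarrow> wt s \<and> wt t \<and> ty_of s = N \<and> ty_of t = N"
| "wf_fm (s \<^bold>\<le> t) \<longleftrightarrow> wt s \<and> wt t \<and> ty_of s = N \<and> ty_of t = N"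
| "wf_fm (St t) \<longleftrightarrow> wt t"
| "wf_fm Bot \<longleftrightarrow> True"
| "wf_fm (A \<^bold>\<longrightarrow> B) \<longleftrightarrow> wf_fm A \<and> wf_fm B"
| "wf_fm (All x A) \<longleftrightarrow> wf_fm A"
| "wf_fm (AllSt x A) \<longleftrightarrow> wf_fm A"

fun fvars :: "fm \<Rightarrow> var set" where
  "fvars (s \<^bold>= t) = tvars s \<union> tvars t"
| "fvars (s \<^bold>\<le> t) = tvars s \<union> tvars t"
| "fvars (St t) = tvars t"
| "fvars Bot = {}"
| "fvars (A \<^bold>\<longrightarrow> B) = fvars A \<union> fvars B"
| "fvars (All x A) = fvars A - {x}"
| "fvars (AllSt x A) = fvars A - {x}"

fun internal :: "fm \<Rightarrow> bool" where
  "internal (s \<^bold>= t) \<longleftrightarrow> True"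
| "internal (s \<^bold>\<le> t) \<longleftrightarrow> True"
| "internal (St t) \<longleftrightarrow> False"
| "internal Bot \<longleftrightarrow> True"
| "internal (A \<^bold>\<longrightarrow> B) \<longleftrightarrow> internal A \<and> internal B"
| "internal (All x A) \<longleftrightarrow> internal A"
| "internal (AllSt x A) \<longleftrightarrow> False"

fun qfree_internal :: "fm \<Rightarrow> bool" where
  "qfree_internal (s \<^bold>= t) \<longleftrightarrow> True"
| "qfree_internal (s \<^bold>\<le> t) \<longleftrightarrow> True"
| "qfree_internal (St t) \<longleftrightarrow> False"
| "qfree_internal Bot \<longleftrightarrow> True"
| "qfree_internal (A \<^bold>\<longrightarrow> B) \<longleftrightarrow> qfree_internal A \<and> qfree_internal B"
| "qfree_internal (All x A) \<longleftrightarrow> False"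
| "qfree_internal (AllSt x A) \<longleftrightarrow> False"

text \<open>Substitution does not rename bound variables; \<open>free_for u x A\<close> says that no variable of \<open>u\<close>
  is captured when \<open>u\<close> is substituted for \<open>x\<close> in \<open>A\<close>.\<close>

fun fsubst :: "var \<Rightarrow> tm \<Rightarrow> fm \<Rightarrow> fm" where
  "fsubst x u (s \<^bold>= t) = (tsubst x u s \<^bold>= tsubst x u t)"
| "fsubst x u (s \<^bold>\<le> t) = (tsubst x u s \<^bold>\<le> tsubst x u t)"
| "fsubst x u (St t) = St (tsubst x u t)"
| "fsubst x u Bot = Bot"
| "fsubst x u (A \<^bold>\<longrightarrow> B) = (fsubst x u A \<^bold>\<longrightarrow> fsubst x u B)"
| "fsubst x u (All y A) = All y (if x = y then A else fsubst x u A)"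
| "fsubst x u (AllSt y A) = AllSt y (if x = y then A else fsubst x u A)"

fun free_for :: "tm \<Rightarrow> var \<Rightarrow> fm \<Rightarrow> bool" where
  "free_for u x (s \<^bold>= t) \<longleftrightarrow> True"
| "free_for u x (s \<^bold>\<le> t) \<longleftrightarrow> True"
| "free_for u x (St t) \<longleftrightarrow> True"
| "free_for u x Bot \<longleftrightarrow> True"
| "free_for u x (A \<^bold>\<longrightarrow> B) \<longleftrightarrow> free_for u x A \<and> free_for u x B"
| "free_for u x (All y A) \<longleftrightarrow> x \<notin> fvars (All y A) \<or> y \<notin> tvars u \<and> free_for u x A"
| "free_for u x (AllSt y A) \<longleftrightarrow> x \<notin> fvars (AllSt y A) \<or> y \<notin> tvars u \<and> free_for u x A"


section \<open>Derivability\<close>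

text \<open>Natural deduction for many-sorted classical logic. Free variables of the axioms \<open>T\<close> are
  implicitly universally quantified, those of the hypotheses \<open>\<Gamma>\<close> are parameters. Only
  well-formed formulas enter a derivation, which imposes the type constraints on the axiom
  schemes below. The standard quantifier has no rules of its own; it is governed by
  the axioms \<open>EQ\<close> below.\<close>

inductive derives :: "fm set \<Rightarrow> fm set \<Rightarrow> fm \<Rightarrow> bool" for T :: "fm set" where
  ax: "A \<in> T \<Longrightarrow> wf_fm A \<Longrightarrow> derives T \<Gamma> A"
| hyp: "A \<in> \<Gamma> \<Longrightarrow> wf_fm A \<Longrightarrow> derives T \<Gamma> A"
| impI: "derives T (insert A \<Gamma>) B \<Longrightarrow> wf_fm A \<Longrightarrow> derives T \<Gamma> (A \<^bold>\<longrightarrow> B)"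
| impE: "derives T \<Gamma> (A \<^bold>\<longrightarrow> B) \<Longrightarrow> derives T \<Gamma> A \<Longrightarrow> derives T \<Gamma> B"
| raa: "derives T (insert (Neg A) \<Gamma>) Bot \<Longrightarrow> wf_fm A \<Longrightarrow> derives T \<Gamma> A"
| allI: "derives T \<Gamma> A \<Longrightarrow> (\<forall>B\<in>\<Gamma>. x \<notin> fvars B) \<Longrightarrow> derives T \<Gamma> (All x A)"
| allE: "derives T \<Gamma> (All x A) \<Longrightarrow> wt u \<Longrightarrow> ty_of u = snd x \<Longrightarrow> free_for u x A
           \<Longrightarrow> derives T \<Gamma> (fsubst x u A)"

definition proves :: "fm set \<Rightarrow> fm \<Rightarrow> bool" (infix "\<^bold>\<turnstile>" 20) where
  "(T \<^bold>\<turnstile> A) \<longleftrightarrow> derives T {} A"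


section \<open>The internal system\<close>

abbreviation Zr :: tm where "Zr \<equiv> Cn CZero"
abbreviation Sc :: "tm \<Rightarrow> tm" where "Sc t \<equiv> Cn CSuc \<cdot> t"
abbreviation Lt :: "tm \<Rightarrow> tm \<Rightarrow> fm" (infix "\<^bold><" 50) where "s \<^bold>< t \<equiv> Sc s \<^bold>\<le> t"

text \<open>Extensional equality at type \<open>\<sigma>\<close>.\<close>

fun eq :: "ty \<Rightarrow> tm \<Rightarrow> tm \<Rightarrow> fm" where
  "eq N s t = (s \<^bold>= t)"
| "eq (\<sigma> \<rightarrow> \<tau>) s t = (let v = (max (ub s) (ub t), \<sigma>) in All v (eq \<tau> (s \<cdot> V v) (t \<cdot> V v)))"

inductive_set E_EFA :: "fm set" where
  eq_refl: "(x \<^bold>= x) \<in> E_EFA"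
| eq_sym: "(x \<^bold>= y \<^bold>\<longrightarrow> y \<^bold>= x) \<in> E_EFA"
| eq_trans: "(x \<^bold>= y \<^bold>\<longrightarrow> y \<^bold>= z \<^bold>\<longrightarrow> x \<^bold>= z) \<in> E_EFA"
| ext: "(eq \<rho> x y \<^bold>\<longrightarrow> eq \<tau> (z \<cdot> x) (z \<cdot> y)) \<in> E_EFA"
| le_cong: "(x \<^bold>= x' \<^bold>\<longrightarrow> y \<^bold>= y' \<^bold>\<longrightarrow> x \<^bold>\<le> y \<^bold>\<longrightarrow> x' \<^bold>\<le> y') \<in> E_EFA"
| suc_nonzero: "Neg (Sc x \<^bold>= Zr) \<in> E_EFA"
| suc_inj: "(Sc x \<^bold>= Sc y \<^bold>\<longrightarrow> x \<^bold>= y) \<in> E_EFA"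
| le_zero: "(x \<^bold>\<le> Zr \<^bold>\<longleftrightarrow> x \<^bold>= Zr) \<in> E_EFA"
| le_suc: "(x \<^bold>\<le> Sc y \<^bold>\<longleftrightarrow> (x \<^bold>\<le> y \<^bold>\<or> x \<^bold>= Sc y)) \<in> E_EFA"
| min1: "(x \<^bold>\<le> y \<^bold>\<longrightarrow> Cn CMin \<cdot> x \<cdot> y \<^bold>= x) \<in> E_EFA"
| min2: "(y \<^bold>\<le> x \<^bold>\<longrightarrow> Cn CMin \<cdot> x \<cdot> y \<^bold>= y) \<in> E_EFA"
| max1: "(x \<^bold>\<le> y \<^bold>\<longrightarrow> Cn CMax \<cdot> x \<cdot> y \<^bold>= y) \<in> E_EFA"
| max2: "(y \<^bold>\<le> x \<^bold>\<longrightarrow> Cn CMax \<cdot> x \<cdot> y \<^bold>= x) \<in> E_EFA"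
| qf_ind: "qfree_internal A \<Longrightarrow> snd x = N \<Longrightarrow>
    (fsubst x Zr A \<^bold>\<longrightarrow> All x (A \<^bold>\<longrightarrow> fsubst x (Sc (V x)) A) \<^bold>\<longrightarrow> All x A) \<in> E_EFA"
| pi: "eq \<rho> (Cn (CPi \<rho> \<tau>) \<cdot> x \<cdot> y) x \<in> E_EFA"
| sigma: "eq \<tau> (Cn (CSigma \<delta> \<rho> \<tau>) \<cdot> x \<cdot> y \<cdot> z) (x \<cdot> z \<cdot> (y \<cdot> z)) \<in> E_EFA"
| A0: "(Cn CA0 \<cdot> x \<cdot> y \<^bold>= Sc y) \<in> E_EFA"
| A1_zero: "(Cn CA1 \<cdot> x \<cdot> Zr \<^bold>= x) \<in> E_EFA"
| A1_suc: "(Cn CA1 \<cdot> x \<cdot> Sc y \<^bold>= Cn CA0 \<cdot> x \<cdot> (Cn CA1 \<cdot> x \<cdot> y)) \<in> E_EFA"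
| A2_zero: "(Cn CA2 \<cdot> x \<cdot> Zr \<^bold>= Zr) \<in> E_EFA"
| A2_suc: "(Cn CA2 \<cdot> x \<cdot> Sc y \<^bold>= Cn CA1 \<cdot> x \<cdot> (Cn CA2 \<cdot> x \<cdot> y)) \<in> E_EFA"
| A3_zero: "(Cn CA3 \<cdot> x \<cdot> Zr \<^bold>= Sc Zr) \<in> E_EFA"
| A3_suc: "(Cn CA3 \<cdot> x \<cdot> Sc y \<^bold>= Cn CA2 \<cdot> x \<cdot> (Cn CA3 \<cdot> x \<cdot> y)) \<in> E_EFA"
| Phi1_zero: "(Cn CPhi1 \<cdot> f \<cdot> Zr \<^bold>= f \<cdot> Zr) \<in> E_EFA"
| Phi1_suc: "(Cn CPhi1 \<cdot> f \<cdot> Sc x \<^bold>= Cn CMax \<cdot> (f \<cdot> Sc x) \<cdot> (Cn CPhi1 \<cdot> f \<cdot> x)) \<in> E_EFA"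
| Phi2_zero: "(Cn CPhi2 \<cdot> f \<cdot> Zr \<^bold>= f \<cdot> Zr) \<in> E_EFA"
| Phi2_suc: "(Cn CPhi2 \<cdot> f \<cdot> Sc x \<^bold>= Cn CA1 \<cdot> (f \<cdot> Sc x) \<cdot> (Cn CPhi2 \<cdot> f \<cdot> x)) \<in> E_EFA"
| Phi3_zero: "(Cn CPhi3 \<cdot> f \<cdot> Zr \<^bold>= f \<cdot> Zr) \<in> E_EFA"
| Phi3_suc: "(Cn CPhi3 \<cdot> f \<cdot> Sc x \<^bold>= Cn CA2 \<cdot> (f \<cdot> Sc x) \<cdot> (Cn CPhi3 \<cdot> f \<cdot> x)) \<in> E_EFA"
| mu_found: "(y \<^bold>\<le> x \<^bold>\<and> f \<cdot> x \<cdot> y \<^bold>= Zr \<^bold>\<longrightarrow> f \<cdot> x \<cdot> (Cn CMu \<cdot> f \<cdot> x) \<^bold>= Zr) \<in> E_EFA"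
| mu_least: "(y \<^bold>< Cn CMu \<cdot> f \<cdot> x \<^bold>\<longrightarrow> Neg (f \<cdot> x \<cdot> y \<^bold>= Zr)) \<in> E_EFA"
| mu_default: "(Cn CMu \<cdot> f \<cdot> x \<^bold>= Zr
    \<^bold>\<or> f \<cdot> x \<cdot> (Cn CMu \<cdot> f \<cdot> x) \<^bold>= Zr \<^bold>\<and> Cn CMu \<cdot> f \<cdot> x \<^bold>\<le> x) \<in> E_EFA"
| rec_zero: "(apps (Cn (CRec \<rho>) \<cdot> Zr \<cdot> y \<cdot> z \<cdot> v) ws \<^bold>= apps y ws) \<in> E_EFA"
| rec_suc: "(apps (Cn (CRec \<rho>) \<cdot> Sc x \<cdot> y \<cdot> z \<cdot> v) ws \<^bold>=
      Cn CMin \<cdot> apps (z \<cdot> apps (Cn (CRec \<rho>) \<cdot> x \<cdot> y \<cdot> z \<cdot> v) ws \<cdot> x) ws \<cdot> apps (v \<cdot> x) ws)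
    \<in> E_EFA"


section \<open>Coding of finite sequences\<close>

text \<open>Sequences of numbers are coded by numbers via the bijection with \<open>\<langle>\<rangle> = 0\<close> and
  \<open>\<langle>a\<rangle> * s = 2\<^sup>a (2 s + 1)\<close>. The head of a code \<open>n > 0\<close> is thus the exponent of 2 in \<open>n\<close>, and its
  tail is \<open>n\<close> shifted right by one more than that exponent.\<close>

abbreviation (input) n0 :: tm where "n0 \<equiv> V (0, N)"
abbreviation (input) n1 :: tm where "n1 \<equiv> V (1, N)"
abbreviation (input) n2 :: tm where "n2 \<equiv> V (2, N)"

definition pred_tm :: tm where
  "pred_tm = lam (0, N) (Cn (CRec N) \<cdot> n0 \<cdot> Zr \<cdot> lams [(1, N), (2, N)] n2 \<cdot> lam (2, N) n2)"

definition monus_tm :: tm where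
  "monus_tm = lams [(0, N), (1, N)]
     (Cn (CRec N) \<cdot> n1 \<cdot> n0 \<cdot> lams [(2, N), (3, N)] (pred_tm \<cdot> n2) \<cdot> lam (3, N) n0)"

definition pow2 :: "tm \<Rightarrow> tm" where
  "pow2 t = Cn CA3 \<cdot> Sc (Sc Zr) \<cdot> t"

text \<open>\<open>shift_tm \<cdot> n \<cdot> p\<close> is \<open>n div 2\<^sup>p\<close>, the least \<open>q \<le> n\<close> with \<open>n < (q + 1) 2\<^sup>p\<close>.\<close>

definition shift_tm :: tm where
  "shift_tm = lams [(0, N), (1, N)]
     (Cn CMu \<cdot> lams [(3, N), (2, N)] (monus_tm \<cdot> Sc n0 \<cdot> (Cn CA2 \<cdot> Sc n2 \<cdot> pow2 n1)) \<cdot> n0)"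

text \<open>The least \<open>p \<le> n\<close> such that \<open>2\<^bsup>p + 1\<^esup>\<close> does not divide \<open>n\<close>, and 0 if \<open>n = 0\<close>.\<close>

definition hd_tm :: tm where
  "hd_tm = lam (0, N)
     (Cn CMu \<cdot> lams [(2, N), (1, N)]
        (monus_tm \<cdot> Sc (Cn CA2 \<cdot> (shift_tm \<cdot> n0 \<cdot> Sc n1) \<cdot> pow2 (Sc n1)) \<cdot> n0) \<cdot> n0)"

definition tl_tm :: tm where
  "tl_tm = lam (0, N) (shift_tm \<cdot> n0 \<cdot> Sc (hd_tm \<cdot> n0))"

definition drop_tm :: tm where
  "drop_tm = lams [(0, N), (1, N)]
     (Cn (CRec N) \<cdot> n1 \<cdot> n0 \<cdot> lams [(2, N), (3, N)] (tl_tm \<cdot> n2) \<cdot> lam (3, N) n0)"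

text \<open>\<open>nth_tm \<cdot> n \<cdot> i\<close> is the component with index \<open>i\<close> (0 if there is none), \<open>lh_tm \<cdot> n\<close> the length.\<close>

definition nth_tm :: tm where
  "nth_tm = lams [(0, N), (1, N)] (hd_tm \<cdot> (drop_tm \<cdot> n0 \<cdot> n1))"

definition lh_tm :: tm where
  "lh_tm = lam (0, N) (Cn CMu \<cdot> drop_tm \<cdot> n0)"

text \<open>\<open>psum_tm \<cdot> h \<cdot> k\<close> is the sum of \<open>h j\<close> over \<open>j < k\<close>: shift \<open>h\<close> by one, putting 0 in front.\<close>

definition psum_tm :: tm where
  "psum_tm = lam (0, T1)
     (Cn CPhi2 \<cdot> lam (0, N)
        (Cn (CRec N) \<cdot> n0 \<cdot> Zr
           \<cdot> lams [(1, N), (2, N)] (V (0, T1) \<cdot> n2) \<cdot> lam (2, N) (V (0, T1) \<cdot> n2)))"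

text \<open>\<open>code_tm \<cdot> g \<cdot> k\<close> is the code of \<open>\<langle>g 0, \<dots>, g (k - 1)\<rangle>\<close>. Unwinding the recursion for \<open>*\<close>, it is
  the sum over \<open>j < k\<close> of the powers of 2 with exponent \<open>j + (g 0 + \<dots> + g j)\<close>.\<close>

definition code_tm :: tm where
  "code_tm = lam (0, T1)
     (psum_tm \<cdot> lam (0, N) (pow2 (Cn CA1 \<cdot> n0 \<cdot> (Cn CPhi2 \<cdot> V (0, T1) \<cdot> n0))))"

text \<open>\<open>flat_tm \<cdot> l \<cdot> e \<cdot> k\<close> is the code of the concatenation of the sequences
  \<open>\<langle>e i 0, \<dots>, e i (l i - 1)\<rangle>\<close> for \<open>i < k\<close>. With \<open>s k = l 0 + \<dots> + l (k - 1)\<close>, it has length \<open>s k\<close>, and its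
  component with index \<open>m\<close> is \<open>e i (m - s i)\<close> for the least \<open>i\<close> with \<open>m < s (i + 1)\<close>.\<close>

definition flat_tm :: tm where
  "flat_tm = (let l = V (0, T1); e = V (0, N \<rightarrow> N \<rightarrow> N); k = n0; m = n1;
       i = Cn CMu \<cdot> lams [(3, N), (2, N)] (monus_tm \<cdot> Sc m \<cdot> (psum_tm \<cdot> l \<cdot> Sc n2)) \<cdot> k
     in lams [(0, T1), (0, N \<rightarrow> N \<rightarrow> N), (0, N)]
          (code_tm \<cdot> lam (1, N) (e \<cdot> i \<cdot> (monus_tm \<cdot> m \<cdot> (psum_tm \<cdot> l \<cdot> i))) \<cdot> (psum_tm \<cdot> l \<cdot> k)))"

text \<open>An object \<open>y\<close> of type \<open>\<sigma>\<close> codes the sequence whose length is that of the number sequence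
  \<open>y 0 \<dots> 0\<close> and whose component with index \<open>i\<close> takes arguments \<open>w\<close> to the component with index \<open>i\<close> of
  \<open>y w\<close>. So every object codes a finite sequence, and every finite sequence is coded.\<close>

fun zero_tm :: "ty \<Rightarrow> tm" where
  "zero_tm N = Zr"
| "zero_tm (\<sigma> \<rightarrow> \<tau>) = Cn (CPi \<tau> \<sigma>) \<cdot> zero_tm \<tau>"

definition arg_vars :: "ty \<Rightarrow> var list" where
  "arg_vars \<sigma> = zip [10..<10 + length (arg_tys \<sigma>)] (arg_tys \<sigma>)"

definition len_tm :: "ty \<Rightarrow> tm" where
  "len_tm \<sigma> = lam (0, \<sigma>) (lh_tm \<cdot> apps (V (0, \<sigma>)) (map zero_tm (arg_tys \<sigma>)))"

definition comp_tm :: "ty \<Rightarrow> tm" where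
  "comp_tm \<sigma> = lams ((0, \<sigma>) # (1, N) # arg_vars \<sigma>)
     (nth_tm \<cdot> apps (V (0, \<sigma>)) (map V (arg_vars \<sigma>)) \<cdot> n1)"

definition Mem :: "ty \<Rightarrow> tm \<Rightarrow> tm \<Rightarrow> fm" where
  "Mem \<sigma> x y = (let i = (max (ub x) (ub y), N) in
     Ex i (V i \<^bold>< len_tm \<sigma> \<cdot> y \<^bold>\<and> eq \<sigma> x (comp_tm \<sigma> \<cdot> y \<cdot> V i)))"

text \<open>\<open>img_tm \<sigma> \<tau> \<cdot> Y \<cdot> x\<close> is \<open>Y[x]\<close>, the concatenation of the sequences coded by the \<open>f x\<close> of type \<open>\<tau>\<close>,
  for the components \<open>f\<close> of the sequence coded by \<open>Y\<close>.\<close>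

definition img_tm :: "ty \<Rightarrow> ty \<Rightarrow> tm" where
  "img_tm \<sigma> \<tau> = (let Y = V (0, \<sigma> \<rightarrow> \<tau>); x = V (1, \<sigma>); i = V (2, N); j = V (3, N);
       fx = comp_tm (\<sigma> \<rightarrow> \<tau>) \<cdot> Y \<cdot> i \<cdot> x
     in lams ((0, \<sigma> \<rightarrow> \<tau>) # (1, \<sigma>) # arg_vars \<tau>)
          (flat_tm \<cdot> lam (2, N) (len_tm \<tau> \<cdot> fx)
             \<cdot> lams [(2, N), (3, N)] (apps (comp_tm \<tau> \<cdot> fx \<cdot> j) (map V (arg_vars \<tau>)))
             \<cdot> (len_tm (\<sigma> \<rightarrow> \<tau>) \<cdot> Y)))"


section \<open>The nonstandard systems\<close>

inductive_set EQ :: "fm set" where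
  "(AllSt x A \<^bold>\<longleftrightarrow> All x (St (V x) \<^bold>\<longrightarrow> A)) \<in> EQ"
| "(ExSt x A \<^bold>\<longleftrightarrow> Ex x (St (V x) \<^bold>\<and> A)) \<in> EQ"

inductive_set T_st :: "fm set" where
  "(St x \<^bold>\<and> eq \<sigma> x y \<^bold>\<longrightarrow> St y) \<in> T_st"
| "tvars t = {} \<Longrightarrow> St t \<in> T_st"
| "(St f \<^bold>\<and> St x \<^bold>\<longrightarrow> St (f \<cdot> x)) \<in> T_st"
| "(St x \<^bold>\<and> y \<^bold>\<le> x \<^bold>\<longrightarrow> St y) \<in> T_st"

definition E_EFA_st :: "fm set" where
  "E_EFA_st = E_EFA \<union> EQ \<union> T_st"

inductive_set Idealization :: "fm set" where
  "internal A \<Longrightarrow> snd y' = snd y \<Longrightarrow> distinct [x, y, y'] \<Longrightarrow> y' \<notin> fvars A \<Longrightarrow>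
   (AllSt y' (Ex x (All y (Mem (snd y) (V y) (V y') \<^bold>\<longrightarrow> A))) \<^bold>\<longrightarrow> Ex x (AllSt y A))
     \<in> Idealization"

inductive_set HAC_int :: "fm set" where
  "internal A \<Longrightarrow> snd Y = (snd x \<rightarrow> snd y) \<Longrightarrow> distinct [x, y, Y] \<Longrightarrow> Y \<notin> fvars A \<Longrightarrow>
   (AllSt x (ExSt y A) \<^bold>\<longrightarrow>
    ExSt Y (AllSt x (Ex y (Mem (snd y) (V y) (img_tm (snd x) (snd y) \<cdot> V Y \<cdot> V x) \<^bold>\<and> A))))
     \<in> HAC_int"

inductive_set PF_TP_all :: "fm set" where
  "internal A \<Longrightarrow> fvars A \<subseteq> set xs \<Longrightarrow> (foldr AllSt xs A \<^bold>\<longrightarrow> foldr All xs A) \<in> PF_TP_all"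

inductive_set QF_AC_10 :: "fm set" where
  "qfree_internal A \<Longrightarrow> snd x = T1 \<Longrightarrow> snd y = N \<Longrightarrow> snd Y = T2 \<Longrightarrow> Y \<notin> fvars A \<Longrightarrow>
   (All x (Ex y A) \<^bold>\<longrightarrow> Ex Y (All x (fsubst y (V Y \<cdot> V x) A))) \<in> QF_AC_10"

definition B0_minus :: "fm set" where
  "B0_minus = E_EFA_st \<union> Idealization \<union> HAC_int \<union> QF_AC_10"

definition B0 :: "fm set" where
  "B0 = B0_minus \<union> PF_TP_all"


section \<open>The sentences\<close>

definition mu1 :: fm where
  "mu1 = (let \<mu> = (0, T1 \<rightarrow> T1); f = (0, T1); g = (1, T1); x = (0, N) in
     Ex \<mu> (All f
       (Ex g (All x (V f \<cdot> (code_tm \<cdot> V g \<cdot> V x) \<^bold>= Zr)) \<^bold>\<longrightarrow>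
        All x (V f \<cdot> (code_tm \<cdot> (V \<mu> \<cdot> V f) \<cdot> V x) \<^bold>= Zr))))"

definition Pi11_TRANS :: fm where
  "Pi11_TRANS = (let f = (0, T1); g = (1, T1); x = (0, N) in
     AllSt f
       (Ex g (All x (V f \<cdot> (code_tm \<cdot> V g \<cdot> V x) \<^bold>= Zr)) \<^bold>\<longrightarrow>
        ExSt g (All x (V f \<cdot> (code_tm \<cdot> V g \<cdot> V x) \<^bold>= Zr))))"

text \<open>\<open>binary f\<close> is \<open>f \<le>\<^sub>1 1\<close>.\<close>

definition binary :: "tm \<Rightarrow> fm" where
  "binary f = (let n = (ub f, N) in All n (f \<cdot> V n \<^bold>\<le> Sc Zr))"

definition kappa3 :: fm where
  "kappa3 = (let \<kappa> = (0, T2 \<rightarrow> T1); Y = (0, T2); f = (0, T1) in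
     Ex \<kappa> (All Y
       (Ex f (binary (V f) \<^bold>\<and> V Y \<cdot> V f \<^bold>= Zr) \<^bold>\<longrightarrow>
        V Y \<cdot> (V \<kappa> \<cdot> V Y) \<^bold>= Zr \<^bold>\<and> binary (V \<kappa> \<cdot> V Y))))"

end

theory Submission
  imports Defs "HOL-Library.Countable"
begin

text \<open>The equivalence is checked in an arbitrary model of \<open>B\<^sub>0 + (\<kappa>\<^sup>3)\<close>, which suffices by completeness. Transfer
  makes \<open>\<mu>\<^sub>1\<close> and \<open>\<kappa>\<close> standard, and a standard \<open>\<mu>\<^sub>1\<close> maps standard trees to standard paths. Conversely,
  \<open>\<Pi>\<^sup>1\<^sub>1-TRANS\<close> gives every standard \<open>f\<close> with a zero a standard zero, so \<open>HAC\<close> gives a standard functional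
  bounding these zeros. With the help of \<open>\<kappa>\<close> one finds a point of discontinuity of this functional, and
  Grilliot's trick yields the number quantifier \<open>\<exists>\<^sup>2\<close>; with \<open>QF-AC\<close> this becomes an unbounded search operator.
  The search operator turns ``\<open>h\<close> codes a path of \<open>f\<close>'' into a functional of the binary function \<open>h\<close>, to which
  \<open>\<kappa>\<close> applies.

  For the underivability without transfer, take an extensional type structure over the standard numbers that is
  full enough for \<open>(\<mu>\<^sub>1)\<close> and \<open>(\<kappa>\<^sup>3)\<close> to hold, and force over it, adding a generic tree \<open>f\<close>. The standard objects
  are those in sequences of bounded length generated from \<open>f\<close> by closed terms, idealization and \<open>HAC\<close> being
  handled by further generic objects. The tree is the one whose paths are the functions \<open>g\<close> with \<open>g 0 = m\<close> for a
  generic number \<open>m\<close>, and the conditions promise that \<open>m\<close> is not the first value of a standard function. This is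
  consistent since closed terms applied to the uniformly bounded family of these trees only reach a bounded
  set of first values. So \<open>\<Pi>\<^sup>1\<^sub>1-TRANS\<close> fails, while the internal sentence \<open>(\<mu>\<^sub>1)\<close> is true.\<close>

section \<open>Extensional type structures\<close>

text \<open>A model in the positive part may contain nonstandard numbers and satisfies
  quantifier-free induction only. Arithmetic is therefore rebuilt inside the model, each induction
  with an explicit formula.

  In the negative part, a name is a function on assignments over one ground structure, and internal
  formulas are evaluated pointwise, as in the theorem of Los. Every internal sentence true in the
  ground structure is thus forced, and only standardness depends on the conditions. A standard
  object is a member of a generated sequence below a generated bound rather than a generated object,
  because numbers below a standard number have to be standard. Consistency of a condition is a
  compactness notion: only finitely many generated sequences, up to one bound, are inspected at a
  time, and this finiteness is what \<open>HAC_int\<close> and idealization turn into finite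
  sequences of candidates.

  The ground structure is not the full set-theoretic hierarchy, whose levels at all finite types do
  not fit together into one HOL type. Fullness is arranged at the types of the functionals that the
  sentences and \<open>QF_AC_10\<close> ask for.\<close>

lemma lam_typed: "wt t \<Longrightarrow> wt (lam x t) \<and> ty_of (lam x t) = snd x \<rightarrow> ty_of t"
proof (induction t)
  case (App s t)
  then obtain \<sigma> \<tau> where "ty_of s = \<sigma> \<rightarrow> \<tau>" "ty_of t = \<sigma>" "wt s" "wt t"
    by (auto split: ty.splits)
  then show ?case using App.IH by simp
qed auto

lemma wt_lam [simp]: "wt t \<Longrightarrow> wt (lam x t)"
  and ty_of_lam [simp]: "wt t \<Longrightarrow> ty_of (lam x t) = snd x \<rightarrow> ty_of t"
  using lam_typed by auto

text \<open>The carrier is untyped and \<open>dom\<close> selects the objects of each type. Among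
  the constants only the combinators get equations here, since this is what the term model and the
  structure of computable terms share at this level.\<close>

locale fts =
  fixes dom :: "ty \<Rightarrow> 'a set" and ap :: "'a \<Rightarrow> 'a \<Rightarrow> 'a" (infixl "\<bullet>" 100) and co :: "cst \<Rightarrow> 'a"
  assumes ap_dom: "f \<in> dom (\<sigma> \<rightarrow> \<tau>) \<Longrightarrow> x \<in> dom \<sigma> \<Longrightarrow> f \<bullet> x \<in> dom \<tau>"
    and co_dom: "co c \<in> dom (cst_ty c)"
    and ext: "f \<in> dom (\<sigma> \<rightarrow> \<tau>) \<Longrightarrow> g \<in> dom (\<sigma> \<rightarrow> \<tau>) \<Longrightarrow> (\<And>x. x \<in> dom \<sigma> \<Longrightarrow> f \<bullet> x = g \<bullet> x) \<Longrightarrow> f = g"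
    and K: "x \<in> dom \<rho> \<Longrightarrow> y \<in> dom \<tau> \<Longrightarrow> co (CPi \<rho> \<tau>) \<bullet> x \<bullet> y = x"
    and S: "x \<in> dom (\<delta> \<rightarrow> \<rho> \<rightarrow> \<tau>) \<Longrightarrow> y \<in> dom (\<delta> \<rightarrow> \<rho>) \<Longrightarrow> z \<in> dom \<delta>
      \<Longrightarrow> co (CSigma \<delta> \<rho> \<tau>) \<bullet> x \<bullet> y \<bullet> z = x \<bullet> z \<bullet> (y \<bullet> z)"
begin

definition tenv :: "(var \<Rightarrow> 'a) \<Rightarrow> bool" where
  "tenv e \<longleftrightarrow> (\<forall>x. e x \<in> dom (snd x))"

primrec val :: "tm \<Rightarrow> (var \<Rightarrow> 'a) \<Rightarrow> 'a" where
  "val (V x) e = e x"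
| "val (Cn c) e = co c"
| "val (s \<cdot> t) e = val s e \<bullet> val t e"

lemma tenv_upd: "tenv e \<Longrightarrow> a \<in> dom (snd x) \<Longrightarrow> tenv (e(x := a))"
  by (auto simp: tenv_def)

lemma val_dom: "tenv e \<Longrightarrow> wt t \<Longrightarrow> val t e \<in> dom (ty_of t)"
proof (induction t)
  case (App s t)
  then obtain \<sigma> \<tau> where "ty_of s = \<sigma> \<rightarrow> \<tau>" "ty_of t = \<sigma>" by (auto split: ty.splits)
  then show ?case using App ap_dom by auto
qed (auto simp: tenv_def co_dom)

lemma val_cong: "(\<And>x. x \<in> tvars t \<Longrightarrow> e x = e' x) \<Longrightarrow> val t e = val t e'"
  by (induction t) auto

lemma val_upd_fresh: "x \<notin> tvars t \<Longrightarrow> val t (e(x := a)) = val t e"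
  by (rule val_cong) auto

lemma val_tsubst: "val (tsubst x u t) e = val t (e(x := val u e))"
  by (induction t) auto

text \<open>Beta conversion for the combinator translation. An application in which the variable
  does not occur is translated by a single \<open>CPi\<close>, so that case is settled by the
  equation \<open>K\<close> for the whole application.\<close>

lemma val_lam:
  "wt t \<Longrightarrow> tenv e \<Longrightarrow> a \<in> dom (snd x) \<Longrightarrow> val (lam x t) e \<bullet> a = val t (e(x := a))"
proof (induction t)
  case (V y)
  have e: "e y \<in> dom (snd y)" using V.prems(2) unfolding tenv_def by blast
  show ?case
  proof (cases "x = y")
    case True
    let ?\<sigma> = "snd x"
    have c: "co (CPi ?\<sigma> (?\<sigma> \<rightarrow> ?\<sigma>)) \<in> dom (?\<sigma> \<rightarrow> (?\<sigma> \<rightarrow> ?\<sigma>) \<rightarrow> ?\<sigma>)"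
      "co (CPi ?\<sigma> ?\<sigma>) \<in> dom (?\<sigma> \<rightarrow> ?\<sigma> \<rightarrow> ?\<sigma>)"
      using co_dom[of "CPi ?\<sigma> (?\<sigma> \<rightarrow> ?\<sigma>)"] co_dom[of "CPi ?\<sigma> ?\<sigma>"] by simp_all
    show ?thesis using True S[OF c V.prems(3)] K[OF V.prems(3) ap_dom[OF c(2) V.prems(3)]] by simp
  next
    case False
    then show ?thesis using K[OF e V.prems(3)] by simp
  qed
next
  case (Cn c)
  then show ?case using co_dom K by auto
next
  case (App s t)
  obtain \<sigma> \<tau> where st: "ty_of s = \<sigma> \<rightarrow> \<tau>" "ty_of t = \<sigma>" "wt s" "wt t"
    using App.prems by (auto split: ty.splits)
  show ?case
  proof (cases "x \<in> tvars (s \<cdot> t)")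
    case True
    have l: "val (lam x s) e \<in> dom (snd x \<rightarrow> \<sigma> \<rightarrow> \<tau>)" "val (lam x t) e \<in> dom (snd x \<rightarrow> \<sigma>)"
      using val_dom[OF App.prems(2)] lam_typed st by metis+
    show ?thesis using True App.IH[OF _ App.prems(2,3)] st
      by (simp add: S[OF l App.prems(3)])
  next
    case False
    have "val (s \<cdot> t) e \<in> dom \<tau>"
      using val_dom[OF App.prems(2,1)] st by simp
    then have "val (lam x (s \<cdot> t)) e \<bullet> a = val (s \<cdot> t) e"
      using False K[OF _ App.prems(3)] st by simp
    then show ?thesis using val_upd_fresh[OF False] by metis
  qed
qed

end

lemma tvars_lam [simp]: "tvars (lam x t) = tvars t - {x}"
  by (induction t) auto

lemma tvars_lams [simp]: "tvars (lams xs t) = tvars t - set xs"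
  by (induction xs) (auto simp: lams_def)

lemma tvars_apps [simp]: "tvars (apps t ts) = tvars t \<union> (\<Union>u\<in>set ts. tvars u)"
  by (induction ts arbitrary: t) (auto simp: apps_def)

lemma tvars_ub: "x \<in> tvars t \<Longrightarrow> fst x < ub t"
  by (induction t) auto

lemma finite_tvars [simp]: "finite (tvars t)"
  by (induction t) auto

lemma finite_fvars [simp]: "finite (fvars A)"
  by (induction A) auto

lemma fvars_connectives [simp]:
  "fvars (Neg A) = fvars A" "fvars (A \<^bold>\<and> B) = fvars A \<union> fvars B"
  "fvars (A \<^bold>\<or> B) = fvars A \<union> fvars B" "fvars (A \<^bold>\<longleftrightarrow> B) = fvars A \<union> fvars B"
  "fvars (Ex x A) = fvars A - {x}" "fvars (ExSt x A) = fvars A - {x}"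
  by (auto simp: Neg_def And_def Or_def Iff_def Ex_def ExSt_def)

lemma wf_fm_connectives [simp]:
  "wf_fm (Neg A) = wf_fm A" "wf_fm (A \<^bold>\<and> B) \<longleftrightarrow> wf_fm A \<and> wf_fm B"
  "wf_fm (A \<^bold>\<or> B) \<longleftrightarrow> wf_fm A \<and> wf_fm B" "wf_fm (A \<^bold>\<longleftrightarrow> B) \<longleftrightarrow> wf_fm A \<and> wf_fm B"
  "wf_fm (Ex x A) = wf_fm A" "wf_fm (ExSt x A) = wf_fm A"
  by (auto simp: Neg_def And_def Or_def Iff_def Ex_def ExSt_def)

lemma internal_connectives [simp]:
  "internal (Neg A) = internal A" "internal (A \<^bold>\<and> B) \<longleftrightarrow> internal A \<and> internal B"
  "internal (A \<^bold>\<or> B) \<longleftrightarrow> internal A \<and> internal B" "internal (A \<^bold>\<longleftrightarrow> B) \<longleftrightarrow> internal A \<and> internal B"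
  "internal (Ex x A) = internal A"
  by (auto simp: Neg_def And_def Or_def Iff_def Ex_def)

lemma internal_eq [simp]: "internal (eq \<sigma> s t)"
  by (induction \<sigma> arbitrary: s t) (auto simp: Let_def)

lemma wf_fm_eq: "wf_fm (eq \<sigma> s t) \<longleftrightarrow> wt s \<and> wt t \<and> ty_of s = \<sigma> \<and> ty_of t = \<sigma>"
  by (induction \<sigma> arbitrary: s t) (auto simp: Let_def split: ty.splits)

lemma qfree_internal_imp: "qfree_internal A \<Longrightarrow> internal A"
  by (induction A) auto

lemma free_for_qfree: "qfree_internal A \<Longrightarrow> free_for u x A"
  by (induction A) auto

lemma tsubst_fresh: "x \<notin> tvars t \<Longrightarrow> tsubst x u t = t"
  by (induction t) auto

lemma fsubst_fresh: "x \<notin> fvars A \<Longrightarrow> fsubst x u A = A"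
  by (induction A) (auto simp: tsubst_fresh)

section \<open>Satisfaction of formulas in a type structure with an order and a standardness
  predicate\<close>

locale ftm = fts dom ap co
  for dom :: "ty \<Rightarrow> 'a set" and ap :: "'a \<Rightarrow> 'a \<Rightarrow> 'a" (infixl "\<bullet>" 100) and co :: "cst \<Rightarrow> 'a" +
  fixes le :: "'a \<Rightarrow> 'a \<Rightarrow> bool" and stp :: "'a \<Rightarrow> bool"
begin

primrec sat :: "fm \<Rightarrow> (var \<Rightarrow> 'a) \<Rightarrow> bool" where
  "sat (s \<^bold>= t) e \<longleftrightarrow> val s e = val t e"
| "sat (s \<^bold>\<le> t) e \<longleftrightarrow> le (val s e) (val t e)"
| "sat (St t) e \<longleftrightarrow> stp (val t e)"
| "sat Bot e \<longleftrightarrow> False"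
| "sat (A \<^bold>\<longrightarrow> B) e \<longleftrightarrow> (sat A e \<longrightarrow> sat B e)"
| "sat (All x A) e \<longleftrightarrow> (\<forall>a\<in>dom (snd x). sat A (e(x := a)))"
| "sat (AllSt x A) e \<longleftrightarrow> (\<forall>a\<in>dom (snd x). stp a \<longrightarrow> sat A (e(x := a)))"

lemma sat_connectives [simp]:
  "sat (Neg A) e \<longleftrightarrow> \<not> sat A e" "sat (A \<^bold>\<and> B) e \<longleftrightarrow> sat A e \<and> sat B e"
  "sat (A \<^bold>\<or> B) e \<longleftrightarrow> sat A e \<or> sat B e" "sat (A \<^bold>\<longleftrightarrow> B) e \<longleftrightarrow> (sat A e \<longleftrightarrow> sat B e)"
  "sat (Ex x A) e \<longleftrightarrow> (\<exists>a\<in>dom (snd x). sat A (e(x := a)))"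
  "sat (ExSt x A) e \<longleftrightarrow> (\<exists>a\<in>dom (snd x). stp a \<and> sat A (e(x := a)))"
  by (auto simp: Neg_def And_def Or_def Iff_def Ex_def ExSt_def)

lemma sat_cong: "(\<And>x. x \<in> fvars A \<Longrightarrow> e x = e' x) \<Longrightarrow> sat A e = sat A e'"
proof (induction A arbitrary: e e')
  case (Eq s t)
  then show ?case using val_cong[of s e e'] val_cong[of t e e'] by simp
next
  case (Le s t)
  then show ?case using val_cong[of s e e'] val_cong[of t e e'] by simp
next
  case (St t)
  then show ?case using val_cong[of t e e'] by simp
next
  case (Imp A B)
  have "sat A e = sat A e'" "sat B e = sat B e'"
    by (rule Imp.IH; use Imp.prems in auto)+
  then show ?case by simp
next
  case (All x A)
  have "sat A (e(x := a)) = sat A (e'(x := a))" for a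
    by (rule All.IH) (use All.prems in auto)
  then show ?case by simp
next
  case (AllSt x A)
  have "sat A (e(x := a)) = sat A (e'(x := a))" for a
    by (rule AllSt.IH) (use AllSt.prems in auto)
  then show ?case by simp
qed auto

text \<open>Shared by both quantifiers. Either there is nothing to substitute under the binder, or
  the bound variable avoids \<open>u\<close> and differs from \<open>x\<close>, so that the two
  updates of the environment commute.\<close>

lemma sat_fsubst_binder:
  assumes IH: "\<And>e. free_for u x A \<Longrightarrow> sat (fsubst x u A) e = sat A (e(x := val u e))"
    and f: "x \<notin> fvars A - {y} \<or> y \<notin> tvars u \<and> free_for u x A"
  shows "sat (if x = y then A else fsubst x u A) (e(y := a)) = sat A (e(x := val u e, y := a))"
proof (cases "x \<in> fvars A - {y}")
  case True
  then have *: "x \<noteq> y" "y \<notin> tvars u" "free_for u x A" using f by auto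
  have "sat (fsubst x u A) (e(y := a)) = sat A (e(y := a, x := val u e))"
    by (simp only: IH[OF *(3)] val_upd_fresh[OF *(2)])
  moreover have "e(y := a, x := val u e) = e(x := val u e, y := a)" by (rule fun_upd_twist) (use * in auto)
  ultimately show ?thesis using * by (simp only: if_False)
next
  case False
  have "sat A (e(y := a)) = sat A (e(x := val u e, y := a))"
    by (rule sat_cong) (use False in auto)
  moreover have "(if x = y then A else fsubst x u A) = A" using False by (auto simp: fsubst_fresh)
  ultimately show ?thesis by (simp only:)
qed

lemma sat_fsubst: "free_for u x A \<Longrightarrow> sat (fsubst x u A) e = sat A (e(x := val u e))"
proof (induction A arbitrary: e)
  case (All y A)
  show ?case unfolding fsubst.simps sat.simps
    by (subst sat_fsubst_binder[OF All.IH]) (use All.prems in auto)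
next
  case (AllSt y A)
  show ?case unfolding fsubst.simps sat.simps
    by (subst sat_fsubst_binder[OF AllSt.IH]) (use AllSt.prems in auto)
qed (auto simp: val_tsubst)

text \<open>The variable bound by \<open>eq\<close> has an index above those of both terms, so their
  values do not change under the quantifier, and \<open>ext\<close> turns agreement at all arguments
  into identity.\<close>

lemma sat_eq:
  "tenv e \<Longrightarrow> wt s \<Longrightarrow> wt t \<Longrightarrow> ty_of s = \<sigma> \<Longrightarrow> ty_of t = \<sigma> \<Longrightarrow> sat (eq \<sigma> s t) e \<longleftrightarrow> val s e = val t e"
proof (induction \<sigma> arbitrary: s t e)
  case (Fn \<sigma> \<tau>)
  let ?v = "(max (ub s) (ub t), \<sigma>)"
  have v: "?v \<notin> tvars s" "?v \<notin> tvars t" using tvars_ub by fastforce+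
  have "sat (eq \<tau> (s \<cdot> V ?v) (t \<cdot> V ?v)) (e(?v := a)) \<longleftrightarrow> val s e \<bullet> a = val t e \<bullet> a" if "a \<in> dom \<sigma>" for a
    using that Fn.prems v by (subst Fn.IH(2)) (auto simp: tenv_upd val_upd_fresh)
  moreover have "val s e \<in> dom (\<sigma> \<rightarrow> \<tau>)" "val t e \<in> dom (\<sigma> \<rightarrow> \<tau>)"
    using Fn.prems val_dom by metis+
  ultimately show ?case using ext by (auto simp: Let_def)
qed auto

end

section \<open>Extensional quotients\<close>

text \<open>Instantiated twice: with provable equality in a maximal consistent set, and with
  computability of applicative terms. Objects that are not related to themselves do not enter the
  quotient.\<close>

locale per =
  fixes R :: "ty \<Rightarrow> 'u \<Rightarrow> 'u \<Rightarrow> bool" and app :: "'u \<Rightarrow> 'u \<Rightarrow> 'u" and k :: "cst \<Rightarrow> 'u"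
  assumes R_sym: "R \<sigma> x y \<Longrightarrow> R \<sigma> y x"
    and R_trans: "R \<sigma> x y \<Longrightarrow> R \<sigma> y z \<Longrightarrow> R \<sigma> x z"
    and R_app: "R (\<sigma> \<rightarrow> \<tau>) f g \<Longrightarrow> R \<sigma> x y \<Longrightarrow> R \<tau> (app f x) (app g y)"
    and R_ext: "R (\<sigma> \<rightarrow> \<tau>) f f \<Longrightarrow> R (\<sigma> \<rightarrow> \<tau>) g g \<Longrightarrow>
       (\<And>x. R \<sigma> x x \<Longrightarrow> R \<tau> (app f x) (app g x)) \<Longrightarrow> R (\<sigma> \<rightarrow> \<tau>) f g"
    and R_co: "R (cst_ty c) (k c) (k c)"
    and R_K: "R \<rho> x x \<Longrightarrow> R \<tau> y y \<Longrightarrow> R \<rho> (app (app (k (CPi \<rho> \<tau>)) x) y) x"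
    and R_S: "R (\<delta> \<rightarrow> \<rho> \<rightarrow> \<tau>) x x \<Longrightarrow> R (\<delta> \<rightarrow> \<rho>) y y \<Longrightarrow> R \<delta> z z
      \<Longrightarrow> R \<tau> (app (app (app (k (CSigma \<delta> \<rho> \<tau>)) x) y) z) (app (app x z) (app y z))"
begin

text \<open>A class is represented by a chosen member together with its type. The type is stored
  because application is untyped and \<open>qap\<close> has to know the type of the result in order
  to choose its representative.\<close>

definition cl :: "ty \<Rightarrow> 'u \<Rightarrow> ty \<times> 'u" where "cl \<sigma> x = (\<sigma>, SOME y. R \<sigma> y x)"
definition qdom :: "ty \<Rightarrow> (ty \<times> 'u) set" where "qdom \<sigma> = {cl \<sigma> x |x. R \<sigma> x x}"
definition qap :: "ty \<times> 'u \<Rightarrow> ty \<times> 'u \<Rightarrow> ty \<times> 'u" where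
  "qap a b = (case fst a of N \<Rightarrow> a | \<sigma> \<rightarrow> \<tau> \<Rightarrow> cl \<tau> (app (snd a) (snd b)))"
definition qco :: "cst \<Rightarrow> ty \<times> 'u" where "qco c = cl (cst_ty c) (k c)"

lemma cl_rep: "R \<sigma> x x \<Longrightarrow> R \<sigma> (snd (cl \<sigma> x)) x"
  unfolding cl_def by (auto intro: someI)

lemma cl_eqI: "R \<sigma> x y \<Longrightarrow> cl \<sigma> x = cl \<sigma> y"
proof -
  assume "R \<sigma> x y"
  then have "(\<lambda>z. R \<sigma> z x) = (\<lambda>z. R \<sigma> z y)" using R_sym R_trans by blast
  then show ?thesis by (simp add: cl_def)
qed

lemma cl_eq: "R \<sigma> x x \<Longrightarrow> R \<sigma> y y \<Longrightarrow> cl \<sigma> x = cl \<sigma> y \<longleftrightarrow> R \<sigma> x y"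
  using cl_rep cl_eqI R_sym R_trans by metis

lemma qap_cl: "R (\<sigma> \<rightarrow> \<tau>) f f \<Longrightarrow> R \<sigma> x x \<Longrightarrow> qap (cl (\<sigma> \<rightarrow> \<tau>) f) (cl \<sigma> x) = cl \<tau> (app f x)"
  using cl_rep[of "\<sigma> \<rightarrow> \<tau>" f] cl_rep[of \<sigma> x]
  by (auto simp: qap_def cl_def[of "\<sigma> \<rightarrow> \<tau>"] intro!: cl_eqI R_app)

lemma qdomI: "R \<sigma> x x \<Longrightarrow> cl \<sigma> x \<in> qdom \<sigma>"
  by (auto simp: qdom_def)

lemma R_app_refl: "R (\<sigma> \<rightarrow> \<tau>) f f \<Longrightarrow> R \<sigma> x x \<Longrightarrow> R \<tau> (app f x) (app f x)"
  by (rule R_app)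

lemma fts_quotient: "fts qdom qap qco"
proof
  fix f x \<sigma> \<tau> assume "f \<in> qdom (\<sigma> \<rightarrow> \<tau>)" "x \<in> qdom \<sigma>"
  then show "qap f x \<in> qdom \<tau>" by (auto simp: qdom_def qap_cl) (use R_app in blast)
next
  fix c show "qco c \<in> qdom (cst_ty c)" using R_co by (auto simp: qdom_def qco_def)
next
  fix f g \<sigma> \<tau> assume a: "f \<in> qdom (\<sigma> \<rightarrow> \<tau>)" "g \<in> qdom (\<sigma> \<rightarrow> \<tau>)"
    "\<And>x. x \<in> qdom \<sigma> \<Longrightarrow> qap f x = qap g x"
  obtain f' g' where f: "f = cl (\<sigma> \<rightarrow> \<tau>) f'" "R (\<sigma> \<rightarrow> \<tau>) f' f'"
    and g: "g = cl (\<sigma> \<rightarrow> \<tau>) g'" "R (\<sigma> \<rightarrow> \<tau>) g' g'" using a by (auto simp: qdom_def)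
  have "R \<tau> (app f' x) (app g' x)" if "R \<sigma> x x" for x
    using a(3)[of "cl \<sigma> x"] that f g
    by (simp add: qdomI qap_cl cl_eq R_app_refl[of \<sigma> \<tau>])
  then show "f = g" using f g by (auto intro!: cl_eqI R_ext)
next
  fix x y \<rho> \<tau> assume "x \<in> qdom \<rho>" "y \<in> qdom \<tau>"
  then obtain x' y' where x: "x = cl \<rho> x'" "R \<rho> x' x'" and y: "y = cl \<tau> y'" "R \<tau> y' y'"
    by (auto simp: qdom_def)
  have c: "R (\<rho> \<rightarrow> \<tau> \<rightarrow> \<rho>) (k (CPi \<rho> \<tau>)) (k (CPi \<rho> \<tau>))" using R_co[of "CPi \<rho> \<tau>"] by simp
  show "qap (qap (qco (CPi \<rho> \<tau>)) x) y = x"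
    using x y c by (simp add: qco_def qap_cl R_app_refl[OF c] cl_eqI[OF R_K])
next
  fix x y z \<delta> \<rho> \<tau> assume "x \<in> qdom (\<delta> \<rightarrow> \<rho> \<rightarrow> \<tau>)" "y \<in> qdom (\<delta> \<rightarrow> \<rho>)" "z \<in> qdom \<delta>"
  then obtain x' y' z' where x: "x = cl (\<delta> \<rightarrow> \<rho> \<rightarrow> \<tau>) x'" "R (\<delta> \<rightarrow> \<rho> \<rightarrow> \<tau>) x' x'"
    and y: "y = cl (\<delta> \<rightarrow> \<rho>) y'" "R (\<delta> \<rightarrow> \<rho>) y' y'" and z: "z = cl \<delta> z'" "R \<delta> z' z'"
    by (auto simp: qdom_def)
  have c: "R ((\<delta> \<rightarrow> \<rho> \<rightarrow> \<tau>) \<rightarrow> (\<delta> \<rightarrow> \<rho>) \<rightarrow> \<delta> \<rightarrow> \<tau>) (k (CSigma \<delta> \<rho> \<tau>)) (k (CSigma \<delta> \<rho> \<tau>))"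
    using R_co[of "CSigma \<delta> \<rho> \<tau>"] by simp
  show "qap (qap (qap (qco (CSigma \<delta> \<rho> \<tau>)) x) y) z = qap (qap x z) (qap y z)"
    using x y z c
    by (simp add: qco_def qap_cl R_app_refl[OF c] R_app_refl[OF R_app_refl[OF c]] cl_eqI[OF R_S]
        R_app_refl[of \<delta> \<rho>] R_app_refl[of \<delta> "\<rho> \<rightarrow> \<tau>"])
qed

end

section \<open>Completeness\<close>

instance ty :: countable by countable_datatype
instance cst :: countable by countable_datatype
instance tm :: countable by countable_datatype
instance fm :: countable by countable_datatype

text \<open>Bound variables count as well. A variable whose index is at least this bound can be
  substituted for any other without capture.\<close>

primrec fmub :: "fm \<Rightarrow> nat" where
  "fmub (s \<^bold>= t) = max (ub s) (ub t)"
| "fmub (s \<^bold>\<le> t) = max (ub s) (ub t)"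
| "fmub (St t) = ub t"
| "fmub Bot = 0"
| "fmub (A \<^bold>\<longrightarrow> B) = max (fmub A) (fmub B)"
| "fmub (All x A) = max (Suc (fst x)) (fmub A)"
| "fmub (AllSt x A) = max (Suc (fst x)) (fmub A)"

lemma fvars_fmub: "x \<in> fvars A \<Longrightarrow> fst x < fmub A"
proof (induction A)
  case (Eq s t)
  then show ?case using tvars_ub[of x s] tvars_ub[of x t] by auto
next
  case (Le s t)
  then show ?case using tvars_ub[of x s] tvars_ub[of x t] by auto
next
  case (St t)
  then show ?case using tvars_ub[of x t] by auto
qed auto

lemma tsubst_typed:
  "wt t \<Longrightarrow> wt u \<Longrightarrow> ty_of u = snd x \<Longrightarrow> wt (tsubst x u t) \<and> ty_of (tsubst x u t) = ty_of t"
proof (induction t)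
  case (App s t)
  then obtain \<sigma> \<tau> where "ty_of s = \<sigma> \<rightarrow> \<tau>" "ty_of t = \<sigma>" "wt s" "wt t"
    by (auto split: ty.splits)
  then show ?case using App by simp
qed auto

lemma wf_fsubst: "wf_fm A \<Longrightarrow> wt u \<Longrightarrow> ty_of u = snd x \<Longrightarrow> wf_fm (fsubst x u A)"
  by (induction A) (auto simp: tsubst_typed)

lemma tsubst_id [simp]: "tsubst x (V x) t = t"
  by (induction t) auto

lemma fsubst_id [simp]: "fsubst x (V x) A = A"
  by (induction A) auto

lemma free_for_self: "free_for (V x) x A"
  by (induction A) auto

lemma derives_wf: "derives T \<Gamma> A \<Longrightarrow> wf_fm A"
  by (induction rule: derives.induct) (auto simp: wf_fsubst)

lemma tsubst_tsubst_fresh: "ub t \<le> fst v \<Longrightarrow> tsubst v (V x) (tsubst x (V v) t) = t"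
  by (induction t) auto

lemma fsubst_fsubst_fresh: "fmub A \<le> fst v \<Longrightarrow> fsubst v (V x) (fsubst x (V v) A) = A"
proof (induction A)
  case (All y A)
  then have "v \<notin> fvars A" using fvars_fmub[of v A] by fastforce
  then show ?case using All by (auto simp: fsubst_fresh)
next
  case (AllSt y A)
  then have "v \<notin> fvars A" using fvars_fmub[of v A] by fastforce
  then show ?case using AllSt by (auto simp: fsubst_fresh)
qed (auto simp: tsubst_tsubst_fresh)

lemma free_for_fsubst_fresh: "fmub A \<le> fst v \<Longrightarrow> free_for (V x) v (fsubst x (V v) A)"
proof (induction A)
  case (All y A)
  then have "v \<notin> fvars A" using fvars_fmub[of v A] by fastforce
  then show ?case using All by auto
next
  case (AllSt y A)
  then have "v \<notin> fvars A" using fvars_fmub[of v A] by fastforce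
  then show ?case using AllSt by auto
qed auto

text \<open>Axiomatic consequence from a possibly infinite set: theorems and hypotheses closed under
  modus ponens. In \<open>derives\<close> an additional hypothesis can violate the variable
  condition of \<open>allI\<close>, whereas here weakening and compactness are immediate.\<close>

inductive ded :: "fm set \<Rightarrow> fm set \<Rightarrow> fm \<Rightarrow> bool" for T :: "fm set" and \<Gamma> :: "fm set" where
  base: "derives T {} A \<Longrightarrow> ded T \<Gamma> A"
| hyp: "A \<in> \<Gamma> \<Longrightarrow> wf_fm A \<Longrightarrow> ded T \<Gamma> A"
| mp: "ded T \<Gamma> (A \<^bold>\<longrightarrow> B) \<Longrightarrow> ded T \<Gamma> A \<Longrightarrow> ded T \<Gamma> B"

lemma ded_wf: "ded T \<Gamma> A \<Longrightarrow> wf_fm A"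
  by (induction rule: ded.induct) (auto dest: derives_wf)

lemma ded_mono: "ded T \<Gamma> A \<Longrightarrow> \<Gamma> \<subseteq> \<Delta> \<Longrightarrow> ded T \<Delta> A"
  by (induction rule: ded.induct) (auto intro: ded.intros)

lemma ded_finite: "ded T \<Gamma> A \<Longrightarrow> \<exists>\<Delta>. finite \<Delta> \<and> \<Delta> \<subseteq> \<Gamma> \<and> ded T \<Delta> A"
proof (induction rule: ded.induct)
  case (hyp A)
  then show ?case by (intro exI[of _ "{A}"]) (auto intro: ded.hyp)
next
  case (mp A B)
  then obtain \<Delta>1 \<Delta>2 where "finite \<Delta>1" "\<Delta>1 \<subseteq> \<Gamma>" "ded T \<Delta>1 (A \<^bold>\<longrightarrow> B)" "finite \<Delta>2" "\<Delta>2 \<subseteq> \<Gamma>" "ded T \<Delta>2 A"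
    by auto
  then show ?case by (intro exI[of _ "\<Delta>1 \<union> \<Delta>2"]) (auto intro: ded.mp ded_mono)
qed (auto intro: ded.base)

lemma derives_K: "wf_fm A \<Longrightarrow> wf_fm B \<Longrightarrow> derives T {} (A \<^bold>\<longrightarrow> B \<^bold>\<longrightarrow> A)"
  by (intro derives.impI derives.hyp) auto

lemma derives_S:
  assumes "wf_fm A" "wf_fm B" "wf_fm C"
  shows "derives T {} ((A \<^bold>\<longrightarrow> B \<^bold>\<longrightarrow> C) \<^bold>\<longrightarrow> (A \<^bold>\<longrightarrow> B) \<^bold>\<longrightarrow> A \<^bold>\<longrightarrow> C)"
proof -
  let ?G = "{A, A \<^bold>\<longrightarrow> B, A \<^bold>\<longrightarrow> B \<^bold>\<longrightarrow> C}"
  have "derives T ?G (A \<^bold>\<longrightarrow> B \<^bold>\<longrightarrow> C)" "derives T ?G (A \<^bold>\<longrightarrow> B)" "derives T ?G A"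
    using assms by (auto intro!: derives.hyp)
  then have "derives T ?G C" using derives.impE by blast
  then show ?thesis using assms by (intro derives.impI) auto
qed

lemma derives_DN: "wf_fm A \<Longrightarrow> derives T {} (Neg (Neg A) \<^bold>\<longrightarrow> A)"
proof -
  assume w: "wf_fm A"
  have "derives T {Neg A, Neg (Neg A)} (Neg A \<^bold>\<longrightarrow> Bot)" "derives T {Neg A, Neg (Neg A)} (Neg A)"
    using w by (auto intro!: derives.hyp simp: Neg_def)
  then have "derives T {Neg A, Neg (Neg A)} Bot" by (rule derives.impE)
  then have "derives T {Neg (Neg A)} A" using w by (rule derives.raa)
  then show ?thesis using w by (intro derives.impI) auto
qed

lemma deduction: "ded T (insert A \<Gamma>) B \<Longrightarrow> wf_fm A \<Longrightarrow> ded T \<Gamma> (A \<^bold>\<longrightarrow> B)"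
proof (induction rule: ded.induct)
  case (base B)
  then show ?case using derives_K[of B A T] derives_wf ded.intros by metis
next
  case (hyp B)
  show ?case
  proof (cases "B = A")
    case True
    have "derives T {} (A \<^bold>\<longrightarrow> A)" using hyp True by (intro derives.impI derives.hyp) auto
    then show ?thesis using True ded.base by blast
  next
    case False
    then show ?thesis using hyp derives_K[of B A T] ded.intros by (metis insertE)
  qed
next
  case (mp B C)
  then have "wf_fm B" "wf_fm C" using ded_wf by fastforce+
  then show ?case using derives_S[of A B C T] mp ded.intros by meson
qed

lemma ded_raa: "ded T (insert (Neg A) \<Gamma>) Bot \<Longrightarrow> wf_fm A \<Longrightarrow> ded T \<Gamma> A"
  using deduction[of T "Neg A" \<Gamma> Bot] derives_DN[of A T] ded.base ded.mp
  by (metis Neg_def wf_fm_connectives(1))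

text \<open>Generalisation is pushed to the leaves: theorems are generalised by \<open>allI\<close>,
  a hypothesis implies its own vacuous generalisation, and modus ponens goes through because the
  quantifier distributes over implication.\<close>

lemma ded_gen: "ded T \<Gamma> A \<Longrightarrow> (\<And>B. B \<in> \<Gamma> \<Longrightarrow> x \<notin> fvars B) \<Longrightarrow> ded T \<Gamma> (All x A)"
proof (induction rule: ded.induct)
  case (base A)
  then show ?case by (auto intro!: ded.base derives.allI)
next
  case (hyp A)
  then have "derives T {} (A \<^bold>\<longrightarrow> All x A)"
    by (intro derives.impI derives.allI derives.hyp) auto
  then show ?case using hyp ded.intros by blast
next
  case (mp A B)
  have w: "wf_fm A" "wf_fm B" using mp ded_wf by fastforce+
  let ?G = "{All x A, All x (A \<^bold>\<longrightarrow> B)}"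
  have "derives T ?G (fsubst x (V x) (A \<^bold>\<longrightarrow> B))" "derives T ?G (fsubst x (V x) A)"
    using w by (intro derives.allE derives.hyp; auto simp: free_for_self)+
  then have "derives T ?G B" using derives.impE by fastforce
  then have d: "derives T {} (All x (A \<^bold>\<longrightarrow> B) \<^bold>\<longrightarrow> All x A \<^bold>\<longrightarrow> All x B)"
    using w by (intro derives.impI derives.allI) auto
  have "ded T \<Gamma> (All x (A \<^bold>\<longrightarrow> B))" "ded T \<Gamma> (All x A)" using mp by auto
  then show ?case using ded.mp[OF ded.mp[OF ded.base[OF d]]] by blast
qed

text \<open>If the negated instance were refutable, the instance at the new variable would follow
  from \<Gamma>, hence so would its generalisation, and renaming the new variable back gives the
  universal formula that \<Gamma> negates.\<close>

lemma ded_henkin: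
  assumes c: "\<not> ded T \<Gamma> Bot" and n: "Neg (All x B) \<in> \<Gamma>" "wf_fm B"
    and f: "\<And>C. C \<in> \<Gamma> \<Longrightarrow> fmub C \<le> k"
  shows "\<not> ded T (insert (Neg (fsubst x (V (k, snd x)) B)) \<Gamma>) Bot"
proof
  let ?v = "(k, snd x)" and ?B = "fsubst x (V (k, snd x)) B"
  assume "ded T (insert (Neg ?B) \<Gamma>) Bot"
  then have "ded T \<Gamma> ?B" by (rule ded_raa) (use n wf_fsubst in auto)
  then have a: "ded T \<Gamma> (All ?v ?B)"
    using f fvars_fmub by (intro ded_gen) fastforce+
  have k: "fmub B \<le> fst ?v" using f[OF n(1)] by (simp add: Neg_def)
  have w: "wf_fm ?B" using n wf_fsubst by auto
  have "derives T {All ?v ?B} (fsubst ?v (V x) ?B)"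
    using w free_for_fsubst_fresh[OF k, of x] by (intro derives.allE derives.hyp) auto
  then have "derives T {All ?v ?B} B" using fsubst_fsubst_fresh[OF k] by simp
  \<comment> \<open>Unless \<open>x\<close> is the new variable itself, the substitution has removed
    all its free occurrences, so \<open>x\<close> may be generalised.\<close>
  moreover have "x \<notin> fvars (All ?v ?B)"
  proof -
    have t: "x \<noteq> ?v \<Longrightarrow> x \<notin> tvars (tsubst x (V ?v) t)" for t by (induction t) auto
    have "x \<noteq> ?v \<Longrightarrow> x \<notin> fvars (fsubst x (V ?v) C)" for C
      by (induction C) (auto simp: t)
    then show ?thesis by (cases "x = ?v") auto
  qed
  ultimately have "derives T {All ?v ?B} (All x B)" by (auto intro: derives.allI)
  then have "derives T {} (All ?v ?B \<^bold>\<longrightarrow> All x B)" using w by (auto intro: derives.impI)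
  then have "ded T \<Gamma> (All x B)" using ded.mp[OF ded.base a] by blast
  moreover have "ded T \<Gamma> (All x B \<^bold>\<longrightarrow> Bot)"
    unfolding Neg_def[symmetric] by (rule ded.hyp) (use n in auto)
  ultimately show False using c ded.mp[of T \<Gamma> "All x B" Bot] by blast
qed

text \<open>Variables serve as witnesses, so the language is not extended; this works because every
  stage is finite. The enumeration runs over pairs, so each formula is treated at infinitely many
  stages, and the summand \<open>n\<close> in the index pushes the witnesses for one negated
  universal formula arbitrarily far out.\<close>

primrec henk :: "fm set \<Rightarrow> fm \<Rightarrow> nat \<Rightarrow> fm set" where
  "henk T A 0 = {Neg A}"
| "henk T A (Suc n) = (let \<Gamma> = henk T A n; B = fst (from_nat n :: fm \<times> nat); \<Delta> = insert B \<Gamma>;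
      k = n + (\<Sum>C\<in>\<Delta>. fmub C)
    in if ded T \<Delta> Bot \<or> \<not> wf_fm B then \<Gamma>
       else \<Delta> \<union> {Neg (fsubst x (V (k, snd x)) C) |x C. B = Neg (All x C)})"

lemma henk_step:
  assumes B: "fst (from_nat n :: fm \<times> nat) = Neg (All x C)" and D: "\<Delta> = insert (Neg (All x C)) (henk T A n)"
    and k: "k = n + (\<Sum>C\<in>\<Delta>. fmub C)" and c: "\<not> ded T \<Delta> Bot" and w: "wf_fm C"
  shows "henk T A (Suc n) = insert (Neg (fsubst x (V (k, snd x)) C)) \<Delta>"
proof -
  let ?f = "\<lambda>x C. Neg (fsubst x (V (k, snd x)) C)"
  have s: "{?f x' C' |x' C'. Neg (All x C) = Neg (All x' C')} = {?f x C}"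
    by (simp only: Neg_def fm.inject) blast
  have "\<not> (ded T \<Delta> Bot \<or> \<not> wf_fm (Neg (All x C)))" using c w by simp
  then have "henk T A (Suc n) = \<Delta> \<union> {?f x' C' |x' C'. Neg (All x C) = Neg (All x' C')}"
    unfolding D k by (simp only: henk.simps Let_def if_False B)
  then show ?thesis unfolding s by simp
qed

lemma henk_props:
  assumes "\<not> ded T {} A" "wf_fm A"
  shows "finite (henk T A n) \<and> \<not> ded T (henk T A n) Bot \<and> (\<forall>B\<in>henk T A n. wf_fm B)"
proof (induction n)
  case 0
  show ?case using ded_raa[of T A "{}"] assms by auto
next
  case (Suc n)
  let ?B = "fst (from_nat n :: fm \<times> nat)"
  let ?D = "insert ?B (henk T A n)"
  let ?k = "n + (\<Sum>C\<in>?D. fmub C)"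
  show ?case
  proof (cases "ded T ?D Bot \<or> \<not> wf_fm ?B")
    case True
    then show ?thesis using Suc by (simp add: Let_def)
  next
    case False
    have le: "fmub C \<le> ?k" if "C \<in> ?D" for C
      using Suc member_le_sum[of C ?D fmub] that by auto
    show ?thesis
    proof (cases "\<exists>x C. ?B = Neg (All x C)")
      case True
      then obtain x C where B: "?B = Neg (All x C)" by blast
      have e: "henk T A (Suc n) = insert (Neg (fsubst x (V (?k, snd x)) C)) ?D"
        by (rule henk_step[OF B]) (use False B in auto)
      have "wf_fm C" using False B by simp
      moreover have "\<not> ded T (insert (Neg (fsubst x (V (?k, snd x)) C)) ?D) Bot"
        by (rule ded_henkin) (use False B le \<open>wf_fm C\<close> in auto)
      ultimately show ?thesis unfolding e using Suc False wf_fsubst by auto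
    next
      case F: False
      then have e: "henk T A (Suc n) = ?D" using False by (auto simp: Let_def)
      show ?thesis unfolding e using Suc False by auto
    qed
  qed
qed

lemma henk_mono: "n \<le> m \<Longrightarrow> henk T A n \<subseteq> henk T A m"
  by (rule lift_Suc_mono_le[of "henk T A"]) (auto simp: Let_def)

text \<open>The lower bound \<open>m\<close> in \<open>M_henkin\<close> allows a counterexample to
  be chosen clear of the variables of finitely many given terms and of the variables bound in a
  given formula.\<close>

locale henkin =
  fixes T M :: "fm set"
  assumes T: "E_EFA_st \<subseteq> T"
    and M_ded: "ded T M A \<Longrightarrow> A \<in> M" and M_Bot: "Bot \<notin> M"
    and M_henkin: "wf_fm (All x B) \<Longrightarrow> All x B \<notin> M \<Longrightarrow>
      \<exists>k\<ge>m. fsubst x (V (k, snd x)) B \<notin> M"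
    and M_wf: "A \<in> M \<Longrightarrow> wf_fm A"
    and M_dec: "wf_fm A \<Longrightarrow> A \<notin> M \<Longrightarrow> Neg A \<in> M"

lemma lindenbaum:
  assumes T: "E_EFA_st \<subseteq> T" and A: "\<not> derives T {} A" "wf_fm A"
  shows "\<exists>M. henkin T M \<and> A \<notin> M"
proof -
  have A': "\<not> ded T {} A"
  proof
    assume "ded T {} A" then have "derives T {} A"
      by (induction rule: ded.induct) (auto intro: derives.impE)
    with A show False by blast
  qed
  note hp = henk_props[OF A' A(2)]
  define M where "M = (\<Union>n. henk T A n)"
  have fin: "\<exists>n. \<Delta> \<subseteq> henk T A n" if "finite \<Delta>" "\<Delta> \<subseteq> M" for \<Delta>
    using that
  proof (induction rule: finite_induct)
    case (insert B \<Delta>)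
    then obtain n m where "\<Delta> \<subseteq> henk T A n" "B \<in> henk T A m" by (auto simp: M_def)
    then show ?case using henk_mono[of n "max n m" T A] henk_mono[of m "max n m" T A]
      by (intro exI[of _ "max n m"]) auto
  qed auto
  have con: "\<not> ded T M Bot"
  proof
    assume "ded T M Bot"
    then obtain \<Delta> n where "ded T \<Delta> Bot" "\<Delta> \<subseteq> henk T A n" using ded_finite fin by metis
    then show False using hp ded_mono by blast
  qed
  have sub: "henk T A n \<subseteq> M" for n by (auto simp: M_def)
  have wf: "B \<in> M \<Longrightarrow> wf_fm B" for B using hp by (auto simp: M_def)
  \<comment> \<open>A formula consistent with the limit is consistent with the smaller set at the
    stage that treats it, so it was accepted there.\<close>
  have mem: "B \<in> M" if "\<not> ded T (insert B M) Bot" "wf_fm B" for B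
  proof -
    let ?n = "to_nat (B, 0::nat)"
    have "\<not> ded T (insert B (henk T A ?n)) Bot" using that sub ded_mono by (meson insert_mono)
    then have "B \<in> henk T A (Suc ?n)" using that by (simp add: Let_def)
    then show ?thesis using sub by blast
  qed
  have ded_M: "B \<in> M" if "ded T M B" for B
  proof (rule mem)
    show "\<not> ded T (insert B M) Bot"
      using that con deduction[of T B M Bot] ded_wf ded.mp[of T M B Bot] by blast
  qed (use that ded_wf in blast)
  have dec: "Neg B \<in> M" if "wf_fm B" "B \<notin> M" for B
    using that mem deduction[of T B M Bot] ded_M unfolding Neg_def by blast
  have notboth: "\<not> (B \<in> M \<and> Neg B \<in> M)" for B
    using con wf ded.hyp[of _ M T] ded.mp[of T M B Bot] unfolding Neg_def by blast
  have "henkin T M"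
  proof
    fix x B m assume w: "wf_fm (All x B)" and n: "All x B \<notin> M"
    let ?\<phi> = "Neg (All x B)"
    \<comment> \<open>The codes of the pairs with first component \<open>?\<phi>\<close> are
      unbounded, so some stage beyond \<open>m\<close> treats this formula.\<close>
    have "\<not> finite (range (\<lambda>j. to_nat (?\<phi>, j :: nat)))"
      by (auto simp: finite_image_iff inj_on_def)
    then have "\<exists>i\<in>range (\<lambda>j. to_nat (?\<phi>, j :: nat)). \<not> i < m"
      using finite_nat_set_iff_bounded by blast
    then obtain j where j: "to_nat (?\<phi>, j :: nat) \<ge> m" unfolding bex_simps not_less by blast
    let ?n = "to_nat (?\<phi>, j)"
    let ?D = "insert ?\<phi> (henk T A ?n)"
    let ?k = "?n + (\<Sum>C\<in>?D. fmub C)"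
    have "?\<phi> \<in> M" using dec[OF w n] .
    then have "\<not> ded T ?D Bot" using con sub ded_mono by (metis insert_subset)
    then have "Neg (fsubst x (V (?k, snd x)) B) \<in> henk T A (Suc ?n)"
      by (subst henk_step[of ?n x B ?D T A ?k]) (use w in \<open>simp_all del: henk.simps\<close>)
    then have "fsubst x (V (?k, snd x)) B \<notin> M" using sub notboth by blast
    then show "\<exists>k\<ge>m. fsubst x (V (k, snd x)) B \<notin> M" using j by (intro exI[of _ ?k]) auto
  next
    show "Bot \<notin> M" using con ded.hyp wf by blast
  qed (use T ded_M wf dec in auto)
  moreover have "A \<notin> M" using notboth[of A] sub[of 0] by auto
  ultimately show ?thesis by blast
qed

section \<open>The term model of a maximal consistent set with witnesses\<close>

declare split_paired_All [simp del] split_paired_Ex [simp del]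

text \<open>\<open>eqk k\<close> is \<^const>\<open>eq\<close> with the bound variables numbered from \<open>k\<close> on.\<close>

fun eqk :: "nat \<Rightarrow> ty \<Rightarrow> tm \<Rightarrow> tm \<Rightarrow> fm" where
  "eqk k N s t = (s \<^bold>= t)"
| "eqk k (\<sigma> \<rightarrow> \<tau>) s t = All (k, \<sigma>) (eqk (Suc k) \<tau> (s \<cdot> V (k, \<sigma>)) (t \<cdot> V (k, \<sigma>)))"

text \<open>The indices excluded are those that \<open>eqk k \<sigma>\<close> binds, so this is the
  condition under which \<open>u\<close> can be put into such a formula without capture.\<close>

definition away :: "nat \<Rightarrow> ty \<Rightarrow> tm \<Rightarrow> bool" where
  "away k \<sigma> u \<longleftrightarrow> (\<forall>x\<in>tvars u. fst x < k \<or> k + length (arg_tys \<sigma>) \<le> fst x)"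

lemma away_Suc: "away k (\<sigma> \<rightarrow> \<tau>) u \<Longrightarrow> away (Suc k) \<tau> u"
  unfolding away_def by fastforce

lemma away_App [simp]: "away k \<sigma> (s \<cdot> t) \<longleftrightarrow> away k \<sigma> s \<and> away k \<sigma> t"
  unfolding away_def by auto

lemma away_V [simp]: "away k \<sigma> (V (i, \<tau>)) \<longleftrightarrow> i < k \<or> k + length (arg_tys \<sigma>) \<le> i"
  unfolding away_def by auto

lemma away_ub: "ub u \<le> k \<Longrightarrow> away k \<sigma> u"
  unfolding away_def using tvars_ub by fastforce

text \<open>The variable bound by \<open>eq\<close> depends on the terms compared and so changes
  when something is substituted into them. With a fixed starting index the formula keeps its shape,
  which is why arguments about \<open>M\<close> go through \<open>eqk\<close>.\<close>

lemma eq_eqk: "ub s \<le> k \<Longrightarrow> ub t \<le> k \<Longrightarrow> ub s = k \<or> ub t = k \<Longrightarrow> eq \<sigma> s t = eqk k \<sigma> s t"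
  by (induction \<sigma> arbitrary: s t k) (auto simp: Let_def)

lemma fsubst_eqk: "fst x < k \<Longrightarrow> fsubst x w (eqk k \<sigma> s t) = eqk k \<sigma> (tsubst x w s) (tsubst x w t)"
  by (induction \<sigma> arbitrary: s t k) auto

lemma free_for_eqk: "away k \<sigma> w \<Longrightarrow> free_for w x (eqk k \<sigma> s t)"
proof (induction \<sigma> arbitrary: s t k)
  case (Fn \<sigma> \<tau>)
  have "(k, \<sigma>) \<notin> tvars w" using Fn.prems unfolding away_def by fastforce
  then show ?case using Fn away_Suc by auto
qed auto

lemma wf_fm_eqk: "wf_fm (eqk k \<sigma> s t) \<longleftrightarrow> wt s \<and> wt t \<and> ty_of s = \<sigma> \<and> ty_of t = \<sigma>"
  by (induction \<sigma> arbitrary: s t k) (auto split: ty.splits)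

primrec tinst :: "(var \<Rightarrow> tm) \<Rightarrow> tm \<Rightarrow> tm" where
  "tinst r (V x) = r x"
| "tinst r (Cn c) = Cn c"
| "tinst r (s \<cdot> t) = tinst r s \<cdot> tinst r t"

text \<open>Simultaneous substitution of representatives for variables. Nothing is renamed; capture
  is excluded by keeping the indices of the formula and those of the representatives apart, see
  \<open>free_for_finst\<close>.\<close>

primrec finst :: "fm \<Rightarrow> (var \<Rightarrow> tm) \<Rightarrow> fm" where
  "finst (s \<^bold>= t) r = (tinst r s \<^bold>= tinst r t)"
| "finst (s \<^bold>\<le> t) r = (tinst r s \<^bold>\<le> tinst r t)"
| "finst (St t) r = St (tinst r t)"
| "finst Bot r = Bot"
| "finst (A \<^bold>\<longrightarrow> B) r = (finst A r \<^bold>\<longrightarrow> finst B r)"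
| "finst (All x A) r = All x (finst A (r(x := V x)))"
| "finst (AllSt x A) r = AllSt x (finst A (r(x := V x)))"

lemma tinst_typed:
  "wt t \<Longrightarrow> (\<And>x. wt (r x) \<and> ty_of (r x) = snd x) \<Longrightarrow> wt (tinst r t) \<and> ty_of (tinst r t) = ty_of t"
proof (induction t)
  case (App s t)
  then obtain \<sigma> \<tau> where "ty_of s = \<sigma> \<rightarrow> \<tau>" "ty_of t = \<sigma>" "wt s" "wt t"
    by (auto split: ty.splits)
  then show ?case using App by simp
qed auto

lemma finst_wf: "wf_fm A \<Longrightarrow> (\<And>x. wt (r x) \<and> ty_of (r x) = snd x) \<Longrightarrow> wf_fm (finst A r)"
proof (induction A arbitrary: r)
  case (All x A)
  have "wf_fm (finst A (r(x := V x)))" by (rule All.IH) (use All.prems in auto)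
  then show ?case by simp
next
  case (AllSt x A)
  have "wf_fm (finst A (r(x := V x)))" by (rule AllSt.IH) (use AllSt.prems in auto)
  then show ?case by simp
qed (auto simp: tinst_typed)

lemma tinst_self: "(\<And>x. x \<in> tvars t \<Longrightarrow> r x = V x) \<Longrightarrow> tinst r t = t"
  by (induction t) auto

lemma finst_self: "(\<And>x. x \<in> fvars A \<Longrightarrow> r x = V x) \<Longrightarrow> finst A r = A"
  by (induction A arbitrary: r) (auto simp: tinst_self)

lemma tsubst_tinst:
  "(\<And>y. y \<in> tvars t - {x} \<Longrightarrow> x \<notin> tvars (r y)) \<Longrightarrow> tsubst x u (tinst (r(x := V x)) t) = tinst (r(x := u)) t"
  by (induction t) (auto simp: tsubst_fresh)

lemma fsubst_finst:
  "(\<And>y. y \<in> fvars A - {x} \<Longrightarrow> x \<notin> tvars (r y)) \<Longrightarrow> fsubst x u (finst A (r(x := V x))) = finst A (r(x := u))"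
proof (induction A arbitrary: r)
  case (All z A)
  show ?case
  proof (cases "z = x")
    case False
    have "fsubst x u (finst A ((r(z := V z))(x := V x))) = finst A ((r(z := V z))(x := u))"
      by (rule All.IH) (use All.prems False in auto)
    moreover have "r(z := V z, x := w) = r(x := w, z := V z)" for w
      by (rule fun_upd_twist) (use False in auto)
    ultimately show ?thesis using False by (auto simp only: finst.simps fsubst.simps split: if_split)
  next
    case True
    then show ?thesis by (simp only: finst.simps fsubst.simps fun_upd_upd if_True simp_thms)
  qed
next
  case (AllSt z A)
  show ?case
  proof (cases "z = x")
    case False
    have "fsubst x u (finst A ((r(z := V z))(x := V x))) = finst A ((r(z := V z))(x := u))"
      by (rule AllSt.IH) (use AllSt.prems False in auto)
    moreover have "r(z := V z, x := w) = r(x := w, z := V z)" for w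
      by (rule fun_upd_twist) (use False in auto)
    ultimately show ?thesis using False by (auto simp only: finst.simps fsubst.simps split: if_split)
  next
    case True
    then show ?thesis by (simp only: finst.simps fsubst.simps fun_upd_upd if_True simp_thms)
  qed
next
  case (Eq s t)
  have "tsubst x u (tinst (r(x := V x)) s) = tinst (r(x := u)) s"
    "tsubst x u (tinst (r(x := V x)) t) = tinst (r(x := u)) t"
    by (rule tsubst_tinst; use Eq in simp)+
  then show ?case by (simp only: finst.simps fsubst.simps)
next
  case (Le s t)
  have "tsubst x u (tinst (r(x := V x)) s) = tinst (r(x := u)) s"
    "tsubst x u (tinst (r(x := V x)) t) = tinst (r(x := u)) t"
    by (rule tsubst_tinst; use Le in simp)+
  then show ?case by (simp only: finst.simps fsubst.simps)
next
  case (St t)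
  have "tsubst x u (tinst (r(x := V x)) t) = tinst (r(x := u)) t"
    by (rule tsubst_tinst; use St in simp)+
  then show ?case by (simp only: finst.simps fsubst.simps)
next
  case (Imp A B)
  have "fsubst x u (finst A (r(x := V x))) = finst A (r(x := u))"
    "fsubst x u (finst B (r(x := V x))) = finst B (r(x := u))"
    by (rule Imp.IH; use Imp.prems in simp)+
  then show ?case by (simp only: finst.simps fsubst.simps)
qed simp_all

lemma free_for_finst: "fmub A \<le> m \<Longrightarrow> (\<And>z. z \<in> tvars u \<Longrightarrow> m \<le> fst z) \<Longrightarrow> free_for u x (finst A r)"
proof (induction A arbitrary: r)
  case (All y A)
  then have "y \<notin> tvars u" by fastforce
  then show ?case using All by auto
next
  case (AllSt y A)
  then have "y \<notin> tvars u" by fastforce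
  then show ?case using AllSt by auto
qed auto

lemma fmub_foldr_All: "fmub A \<le> m \<Longrightarrow> (\<And>x. x \<in> set xs \<Longrightarrow> fst x < m) \<Longrightarrow> fmub (foldr All xs A) \<le> m"
  by (induction xs) (auto simp: Suc_le_eq)

lemma fvars_foldr_All [simp]: "fvars (foldr All xs A) = fvars A - set xs"
  by (induction xs) auto

lemma wf_foldr_All [simp]: "wf_fm (foldr All xs A) = wf_fm A"
  by (induction xs) auto

lemma derives_foldr_All: "derives T {} A \<Longrightarrow> derives T {} (foldr All xs A)"
  by (induction xs) (auto intro: derives.allI)

lemma (in ftm) sat_foldr_All: "sat (foldr All xs A) e \<Longrightarrow> tenv e \<Longrightarrow> sat A e"
proof (induction xs)
  case (Cons x xs)
  then have "sat (foldr All xs A) (e(x := e x))"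
    unfolding tenv_def foldr.simps comp_apply sat.simps by blast
  then show ?case using Cons by (simp only: fun_upd_triv)
qed simp

context henkin
begin

lemma M_thm: "A \<in> T \<Longrightarrow> wf_fm A \<Longrightarrow> A \<in> M"
  by (intro M_ded ded.base derives.ax)

lemma M_mp: "(A \<^bold>\<longrightarrow> B) \<in> M \<Longrightarrow> A \<in> M \<Longrightarrow> B \<in> M"
  by (rule M_ded, rule ded.mp[of _ _ A]) (auto intro: ded.hyp M_wf)

lemma M_imp: "wf_fm (A \<^bold>\<longrightarrow> B) \<Longrightarrow> (A \<^bold>\<longrightarrow> B) \<in> M \<longleftrightarrow> (A \<in> M \<longrightarrow> B \<in> M)"
proof (intro iffI impI)
  assume w: "wf_fm (A \<^bold>\<longrightarrow> B)" and i: "A \<in> M \<longrightarrow> B \<in> M"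
  show "(A \<^bold>\<longrightarrow> B) \<in> M"
  proof (cases "A \<in> M")
    case True
    then show ?thesis using i w M_mp[of B "A \<^bold>\<longrightarrow> B"] M_ded[OF ded.base[OF derives_K[of B A]]] by auto
  next
    case False
    then have n: "(A \<^bold>\<longrightarrow> Bot) \<in> M" using M_dec[of A] w by (simp add: Neg_def)
    let ?G = "{Neg B, A, A \<^bold>\<longrightarrow> Bot}"
    have "derives T ?G (A \<^bold>\<longrightarrow> Bot)" "derives T ?G A"
      using w by (auto intro!: derives.hyp)
    then have "derives T ?G Bot" by (rule derives.impE)
    then have "derives T {A, A \<^bold>\<longrightarrow> Bot} B" by (rule derives.raa) (use w in auto)
    then have "derives T {} ((A \<^bold>\<longrightarrow> Bot) \<^bold>\<longrightarrow> A \<^bold>\<longrightarrow> B)" using w by (intro derives.impI) auto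
    then show ?thesis using n M_mp M_ded[OF ded.base] by blast
  qed
qed (use M_mp in blast)

lemma M_Neg: "wf_fm A \<Longrightarrow> Neg A \<in> M \<longleftrightarrow> A \<notin> M"
  using M_imp[of A Bot] M_Bot by (auto simp: Neg_def)

lemma M_And: "wf_fm A \<Longrightarrow> wf_fm B \<Longrightarrow> (A \<^bold>\<and> B) \<in> M \<longleftrightarrow> A \<in> M \<and> B \<in> M"
  by (simp add: And_def M_Neg M_imp)

lemma M_Iff: "wf_fm A \<Longrightarrow> wf_fm B \<Longrightarrow> (A \<^bold>\<longleftrightarrow> B) \<in> M \<longleftrightarrow> (A \<in> M \<longleftrightarrow> B \<in> M)"
  by (auto simp: Iff_def M_And M_imp)

lemma M_allE:
  assumes "All x A \<in> M" "wt u" "ty_of u = snd x" "free_for u x A"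
  shows "fsubst x u A \<in> M"
proof -
  have w: "wf_fm (All x A)" using assms M_wf by blast
  have "derives T {All x A} (fsubst x u A)"
    by (rule derives.allE[OF derives.hyp]) (use assms w in auto)
  then have "derives T {} (All x A \<^bold>\<longrightarrow> fsubst x u A)" using w by (rule derives.impI)
  then show ?thesis using assms M_mp M_ded[OF ded.base] by blast
qed

text \<open>The elements of the term model have variables of index at least 100 only, and truth is computed for
  formulas all of whose variables have smaller indices, so no substitution below captures a variable.\<close>

definition Tm :: "ty \<Rightarrow> tm set" where
  "Tm \<sigma> = {u. wt u \<and> ty_of u = \<sigma> \<and> (\<forall>x\<in>tvars u. 100 \<le> fst x)}"

lemma Tm_App: "f \<in> Tm (\<sigma> \<rightarrow> \<tau>) \<Longrightarrow> x \<in> Tm \<sigma> \<Longrightarrow> f \<cdot> x \<in> Tm \<tau>"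
  unfolding Tm_def by auto

lemma Tm_V: "100 \<le> k \<Longrightarrow> V (k, \<sigma>) \<in> Tm \<sigma>"
  unfolding Tm_def by auto

lemma Tm_Cn: "Cn c \<in> Tm (cst_ty c)"
  unfolding Tm_def by auto

lemma TmD: "u \<in> Tm \<sigma> \<Longrightarrow> wt u \<and> ty_of u = \<sigma>"
  unfolding Tm_def by auto

fun E :: "ty \<Rightarrow> tm \<Rightarrow> tm \<Rightarrow> bool" where
  "E N u v \<longleftrightarrow> (u \<^bold>= v) \<in> M"
| "E (\<sigma> \<rightarrow> \<tau>) u v \<longleftrightarrow> (\<forall>w\<in>Tm \<sigma>. E \<tau> (u \<cdot> w) (v \<cdot> w))"

lemma eqk_henkin:
  assumes "eqk k (\<sigma> \<rightarrow> \<tau>) u v \<notin> M" "u \<in> Tm (\<sigma> \<rightarrow> \<tau>)" "v \<in> Tm (\<sigma> \<rightarrow> \<tau>)"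
    "away k (\<sigma> \<rightarrow> \<tau>) u" "away k (\<sigma> \<rightarrow> \<tau>) v"
  shows "\<exists>h\<ge>m. eqk (Suc k) \<tau> (u \<cdot> V (h, \<sigma>)) (v \<cdot> V (h, \<sigma>)) \<notin> M"
proof -
  have k: "(k, \<sigma>) \<notin> tvars u" "(k, \<sigma>) \<notin> tvars v" using assms unfolding away_def by fastforce+
  have "wf_fm (eqk k (\<sigma> \<rightarrow> \<tau>) u v)" using assms TmD by (simp only: wf_fm_eqk)
  then show ?thesis using M_henkin[OF _ assms(1)[unfolded eqk.simps], of m]
    by (auto simp: fsubst_eqk tsubst_fresh k)
qed

lemma eqk_inst:
  assumes "eqk k (\<sigma> \<rightarrow> \<tau>) u v \<in> M" "w \<in> Tm \<sigma>"
    "away k (\<sigma> \<rightarrow> \<tau>) u" "away k (\<sigma> \<rightarrow> \<tau>) v" "away (Suc k) \<tau> w"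
  shows "eqk (Suc k) \<tau> (u \<cdot> w) (v \<cdot> w) \<in> M"
proof -
  have k: "(k, \<sigma>) \<notin> tvars u" "(k, \<sigma>) \<notin> tvars v" using assms unfolding away_def by fastforce+
  show ?thesis using M_allE[OF assms(1)[unfolded eqk.simps], of w] TmD[OF assms(2)]
      free_for_eqk[OF assms(5)] by (simp add: fsubst_eqk tsubst_fresh k)
qed

text \<open>The relation \<open>E\<close> does not mention a starting index, so membership in
  \<open>M\<close> must not depend on it either. Two starting indices are compared through a Henkin
  variable that lies outside the ranges bound by both formulas.\<close>

lemma E_eqk: "u \<in> Tm \<sigma> \<Longrightarrow> v \<in> Tm \<sigma> \<Longrightarrow> away k \<sigma> u \<Longrightarrow> away k \<sigma> v \<Longrightarrow> eqk k \<sigma> u v \<in> M \<longleftrightarrow> E \<sigma> u v"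
proof (induction \<sigma> arbitrary: u v k)
  case (Fn \<sigma> \<tau>)
  have IH: "eqk (Suc j) \<tau> (u \<cdot> w) (v \<cdot> w) \<in> M \<longleftrightarrow> E \<tau> (u \<cdot> w) (v \<cdot> w)"
    if "w \<in> Tm \<sigma>" "away j (\<sigma> \<rightarrow> \<tau>) u" "away j (\<sigma> \<rightarrow> \<tau>) v" "away (Suc j) \<tau> w" for j w
    by (rule Fn.IH(2)) (use that Fn.prems Tm_App away_Suc in auto)
  show ?case
  proof
    assume a: "eqk k (\<sigma> \<rightarrow> \<tau>) u v \<in> M"
    show "E (\<sigma> \<rightarrow> \<tau>) u v" unfolding E.simps
    proof
      fix w assume w: "w \<in> Tm \<sigma>"
      define k' where "k' = max (ub u) (max (ub v) (ub w))"
      have k': "away k' (\<sigma> \<rightarrow> \<tau>) u" "away k' (\<sigma> \<rightarrow> \<tau>) v" "away (Suc k') \<tau> w"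
        unfolding k'_def by (intro away_ub; simp)+
      have "eqk k' (\<sigma> \<rightarrow> \<tau>) u v \<in> M"
      proof (rule ccontr)
        assume "eqk k' (\<sigma> \<rightarrow> \<tau>) u v \<notin> M"
        then obtain h where h: "h \<ge> 100 + k + k' + Suc (length (arg_tys \<tau>))"
          "eqk (Suc k') \<tau> (u \<cdot> V (h, \<sigma>)) (v \<cdot> V (h, \<sigma>)) \<notin> M"
          using eqk_henkin[OF _ Fn.prems(1,2) k'(1,2)] by blast
        have hT: "V (h, \<sigma>) \<in> Tm \<sigma>" using h by (intro Tm_V) auto
        have "eqk (Suc k) \<tau> (u \<cdot> V (h, \<sigma>)) (v \<cdot> V (h, \<sigma>)) \<in> M"
          by (rule eqk_inst[OF a hT Fn.prems(3,4)]) (use h in auto)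
        then have "E \<tau> (u \<cdot> V (h, \<sigma>)) (v \<cdot> V (h, \<sigma>))"
          using IH[OF hT Fn.prems(3,4)] h by auto
        then show False using IH[OF hT k'(1,2)] h by auto
      qed
      then show "E \<tau> (u \<cdot> w) (v \<cdot> w)" using eqk_inst[OF _ w k'] IH[OF w k'] by blast
    qed
  next
    assume a: "E (\<sigma> \<rightarrow> \<tau>) u v"
    show "eqk k (\<sigma> \<rightarrow> \<tau>) u v \<in> M"
    proof (rule ccontr)
      assume "eqk k (\<sigma> \<rightarrow> \<tau>) u v \<notin> M"
      then obtain h where h: "h \<ge> 100 + k + Suc (length (arg_tys \<tau>))"
        "eqk (Suc k) \<tau> (u \<cdot> V (h, \<sigma>)) (v \<cdot> V (h, \<sigma>)) \<notin> M"
        using eqk_henkin[OF _ Fn.prems] by blast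
      have hT: "V (h, \<sigma>) \<in> Tm \<sigma>" using h by (intro Tm_V) auto
      then show False using a IH[OF hT Fn.prems(3,4)] h by auto
    qed
  qed
qed simp

lemma E_eq: "u \<in> Tm \<sigma> \<Longrightarrow> v \<in> Tm \<sigma> \<Longrightarrow> eq \<sigma> u v \<in> M \<longleftrightarrow> E \<sigma> u v"
  using eq_eqk[of u "max (ub u) (ub v)" v \<sigma>] E_eqk[of u \<sigma> v "max (ub u) (ub v)"]
  by (auto simp: away_ub max_def)

lemma E_refl: "u \<in> Tm \<sigma> \<Longrightarrow> E \<sigma> u u"
proof (induction \<sigma> arbitrary: u)
  case N
  then show ?case using E_EFA.eq_refl[of u] T TmD
    by (auto intro!: M_thm simp: E_EFA_st_def)
qed (auto intro: Tm_App)

lemma M_axiom: "A \<in> E_EFA \<Longrightarrow> wf_fm A \<Longrightarrow> A \<in> M"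
  using T by (intro M_thm) (auto simp: E_EFA_st_def)

lemma E_sym: "u \<in> Tm \<sigma> \<Longrightarrow> v \<in> Tm \<sigma> \<Longrightarrow> E \<sigma> u v \<Longrightarrow> E \<sigma> v u"
proof (induction \<sigma> arbitrary: u v)
  case N
  then have "(u \<^bold>= v \<^bold>\<longrightarrow> v \<^bold>= u) \<in> M" using TmD by (intro M_axiom E_EFA.eq_sym) auto
  then show ?case using N M_mp unfolding E.simps by blast
next
  case (Fn \<sigma> \<tau>)
  then show ?case by (meson E.simps(2) Tm_App)
qed

lemma E_trans: "u \<in> Tm \<sigma> \<Longrightarrow> v \<in> Tm \<sigma> \<Longrightarrow> w \<in> Tm \<sigma> \<Longrightarrow> E \<sigma> u v \<Longrightarrow> E \<sigma> v w \<Longrightarrow> E \<sigma> u w"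
proof (induction \<sigma> arbitrary: u v w)
  case N
  then have "(u \<^bold>= v \<^bold>\<longrightarrow> v \<^bold>= w \<^bold>\<longrightarrow> u \<^bold>= w) \<in> M" using TmD by (intro M_axiom E_EFA.eq_trans) auto
  then show ?case using N M_mp unfolding E.simps by blast
next
  case (Fn \<sigma> \<tau>)
  then show ?case by (meson E.simps(2) Tm_App)
qed

lemma E_cong:
  assumes "x \<in> Tm \<sigma>" "y \<in> Tm \<sigma>" "z \<in> Tm (\<sigma> \<rightarrow> \<tau>)" "E \<sigma> x y"
  shows "E \<tau> (z \<cdot> x) (z \<cdot> y)"
proof -
  have "(eq \<sigma> x y \<^bold>\<longrightarrow> eq \<tau> (z \<cdot> x) (z \<cdot> y)) \<in> M"
    by (rule M_axiom[OF E_EFA.ext]) (use assms TmD in \<open>auto simp: wf_fm_eq\<close>)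
  then show ?thesis using M_mp E_eq assms Tm_App by meson
qed

definition R :: "ty \<Rightarrow> tm \<Rightarrow> tm \<Rightarrow> bool" where
  "R \<sigma> u v \<longleftrightarrow> u \<in> Tm \<sigma> \<and> v \<in> Tm \<sigma> \<and> E \<sigma> u v"

lemma per_R: "per R App Cn"
proof
  fix \<sigma> \<tau> f g x y assume "R (\<sigma> \<rightarrow> \<tau>) f g" "R \<sigma> x y"
  then show "R \<tau> (f \<cdot> x) (g \<cdot> y)" unfolding R_def using E_cong E_trans Tm_App E.simps(2) by meson
next
  fix \<sigma> \<tau> f g assume "R (\<sigma> \<rightarrow> \<tau>) f f" "R (\<sigma> \<rightarrow> \<tau>) g g" "\<And>x. R \<sigma> x x \<Longrightarrow> R \<tau> (f \<cdot> x) (g \<cdot> x)"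
  then show "R (\<sigma> \<rightarrow> \<tau>) f g" unfolding R_def using E_refl by auto
next
  fix \<rho> \<tau> x y assume a: "R \<rho> x x" "R \<tau> y y"
  have t: "Cn (CPi \<rho> \<tau>) \<cdot> x \<cdot> y \<in> Tm \<rho>"
    using a Tm_Cn[of "CPi \<rho> \<tau>"] unfolding R_def by (intro Tm_App) auto
  have "eq \<rho> (Cn (CPi \<rho> \<tau>) \<cdot> x \<cdot> y) x \<in> M"
    using a TmD[OF t] by (intro M_axiom E_EFA.pi) (auto simp: wf_fm_eq R_def dest: TmD)
  then show "R \<rho> (Cn (CPi \<rho> \<tau>) \<cdot> x \<cdot> y) x" using a t E_eq unfolding R_def by blast
next
  fix \<delta> \<rho> \<tau> x y z assume a: "R (\<delta> \<rightarrow> \<rho> \<rightarrow> \<tau>) x x" "R (\<delta> \<rightarrow> \<rho>) y y" "R \<delta> z z"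
  have t: "Cn (CSigma \<delta> \<rho> \<tau>) \<cdot> x \<cdot> y \<cdot> z \<in> Tm \<tau>" "x \<cdot> z \<cdot> (y \<cdot> z) \<in> Tm \<tau>"
    using a Tm_Cn[of "CSigma \<delta> \<rho> \<tau>"] Tm_App unfolding R_def cst_ty.simps by meson+
  have "eq \<tau> (Cn (CSigma \<delta> \<rho> \<tau>) \<cdot> x \<cdot> y \<cdot> z) (x \<cdot> z \<cdot> (y \<cdot> z)) \<in> M"
    using TmD[OF t(1)] TmD[OF t(2)] by (intro M_axiom E_EFA.sigma) (simp only: wf_fm_eq)
  then show "R \<tau> (Cn (CSigma \<delta> \<rho> \<tau>) \<cdot> x \<cdot> y \<cdot> z) (x \<cdot> z \<cdot> (y \<cdot> z))" using t E_eq unfolding R_def by blast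
qed (auto simp: R_def intro: E_sym E_refl Tm_Cn intro: E_trans)

end

sublocale henkin \<subseteq> per R App Cn by (rule per_R)

text \<open>Order and standardness are read off the chosen representatives. \<open>le_cong\<close>,
  and for standardness the first scheme of \<open>T_st\<close>, make this independent of the
  choice.\<close>

definition (in henkin) qle :: "ty \<times> tm \<Rightarrow> ty \<times> tm \<Rightarrow> bool" where
  "qle a b \<longleftrightarrow> (snd a \<^bold>\<le> snd b) \<in> M"

definition (in henkin) qst :: "ty \<times> tm \<Rightarrow> bool" where
  "qst a \<longleftrightarrow> St (snd a) \<in> M"

sublocale henkin \<subseteq> Q: ftm qdom qap qco qle qst
  by (intro ftm.intro fts_quotient)

context henkin
begin

lemma R_refl: "u \<in> Tm \<sigma> \<longleftrightarrow> R \<sigma> u u"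
  using E_refl by (auto simp: R_def)

lemma qdom_Tm: "qdom \<sigma> = cl \<sigma> ` Tm \<sigma>"
  unfolding qdom_def R_refl[symmetric] by blast

lemma qle_cl:
  assumes "u \<in> Tm N" "v \<in> Tm N" shows "qle (cl N u) (cl N v) \<longleftrightarrow> (u \<^bold>\<le> v) \<in> M"
proof -
  have *: "(x \<^bold>\<le> y) \<in> M \<Longrightarrow> (x' \<^bold>\<le> y') \<in> M" if "R N x x'" "R N y y'" for x y x' y'
  proof -
    have "(x \<^bold>= x' \<^bold>\<longrightarrow> y \<^bold>= y' \<^bold>\<longrightarrow> x \<^bold>\<le> y \<^bold>\<longrightarrow> x' \<^bold>\<le> y') \<in> M"
      by (rule M_axiom[OF E_EFA.le_cong]) (use that TmD in \<open>auto simp: R_def\<close>)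
    then show "(x \<^bold>\<le> y) \<in> M \<Longrightarrow> (x' \<^bold>\<le> y') \<in> M" using that M_mp unfolding R_def E.simps by blast
  qed
  have "R N (snd (cl N u)) u" "R N (snd (cl N v)) v" using assms cl_rep R_refl by blast+
  then show ?thesis unfolding qle_def using * R_sym by blast
qed

lemma qst_cl:
  assumes "u \<in> Tm \<sigma>" shows "qst (cl \<sigma> u) \<longleftrightarrow> St u \<in> M"
proof -
  have *: "St x \<in> M \<Longrightarrow> St y \<in> M" if "R \<sigma> x y" for x y
  proof -
    have w: "wf_fm (St x)" "wf_fm (eq \<sigma> x y)" "wf_fm (St y)"
      using that TmD by (auto simp: R_def wf_fm_eq)
    then have "(St x \<^bold>\<and> eq \<sigma> x y \<^bold>\<longrightarrow> St y) \<in> M"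
      using T T_st.intros(1)[of x \<sigma> y] by (intro M_thm) (auto simp: E_EFA_st_def)
    then show "St x \<in> M \<Longrightarrow> St y \<in> M"
      using M_mp M_And[OF w(1,2)] E_eq that unfolding R_def by blast
  qed
  have "R \<sigma> (snd (cl \<sigma> u)) u" using assms cl_rep R_refl by blast
  then show ?thesis unfolding qst_def using * R_sym by blast
qed

lemma tinst_Tm: "wt t \<Longrightarrow> (\<And>x. r x \<in> Tm (snd x)) \<Longrightarrow> tinst r t \<in> Tm (ty_of t)"
proof (induction t)
  case (App s t)
  then obtain \<sigma> \<tau> where "ty_of s = \<sigma> \<rightarrow> \<tau>" "ty_of t = \<sigma>" "wt s" "wt t"
    by (auto split: ty.splits)
  then show ?case using App Tm_App by simp
qed (auto simp: Tm_Cn)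

lemma val_cl:
  "wt t \<Longrightarrow> (\<And>x. r x \<in> Tm (snd x)) \<Longrightarrow> Q.val t (\<lambda>x. cl (snd x) (r x)) = cl (ty_of t) (tinst r t)"
proof (induction t)
  case (App s t)
  then obtain \<sigma> \<tau> where "ty_of s = \<sigma> \<rightarrow> \<tau>" "ty_of t = \<sigma>" "wt s" "wt t"
    by (auto split: ty.splits)
  then show ?case using App tinst_Tm[of s r] tinst_Tm[of t r] R_refl by (simp add: qap_cl)
qed (auto simp: qco_def)

lemma cl_upd: "(\<lambda>x. cl (snd x) (r x))(y := cl (snd y) u) = (\<lambda>x. cl (snd x) ((r(y := u)) x))"
  by (rule HOL.ext) simp

text \<open>The truth lemma. When a universal formula is missing from \<open>M\<close>, a Henkin
  variable of index at least 100 is a counterexample in the model; conversely, instances at elements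
  are free of capture because the formula only has smaller indices. The standard quantifier has no
  rules of its own and is reduced to the ordinary one by \<open>EQ\<close>.\<close>

lemma sat_cl:
  "wf_fm A \<Longrightarrow> fmub A \<le> 100 \<Longrightarrow> (\<And>x. r x \<in> Tm (snd x)) \<Longrightarrow> Q.sat A (\<lambda>x. cl (snd x) (r x)) \<longleftrightarrow> finst A r \<in> M"
proof (induction A arbitrary: r)
  case (Eq s t)
  have st: "tinst r s \<in> Tm N" "tinst r t \<in> Tm N"
    using Eq.prems tinst_Tm[of s r] tinst_Tm[of t r] by simp_all
  have "cl N (tinst r s) = cl N (tinst r t) \<longleftrightarrow> R N (tinst r s) (tinst r t)"
    using st cl_eq R_refl by blast
  also have "\<dots> \<longleftrightarrow> (tinst r s \<^bold>= tinst r t) \<in> M" using st by (simp add: R_def)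
  finally show ?case using Eq.prems by (simp add: val_cl)
next
  case (Le s t)
  have "tinst r s \<in> Tm N" "tinst r t \<in> Tm N"
    using Le.prems tinst_Tm[of s r] tinst_Tm[of t r] by simp_all
  then show ?case using Le.prems by (simp add: val_cl qle_cl)
next
  case (St t)
  then have "tinst r t \<in> Tm (ty_of t)" using tinst_Tm[of t r] by simp
  then show ?case using St.prems by (simp add: val_cl qst_cl)
next
  case Bot
  then show ?case using M_Bot by simp
next
  case (Imp A B)
  have "wf_fm (finst (A \<^bold>\<longrightarrow> B) r)" by (rule finst_wf) (use Imp.prems TmD in auto)
  then show ?case using Imp by (simp add: M_imp)
next
  case (All x A)
  have wr: "wt (r y) \<and> ty_of (r y) = snd y" for y using All.prems(3) TmD by blast
  have w: "wf_fm (finst (All x A) r)" by (rule finst_wf) (use All.prems wr in auto)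
  have x: "fst x < 100" using All.prems by auto
  have nx: "x \<notin> tvars u" if "u \<in> Tm \<sigma>" for u \<sigma> using that x unfolding Tm_def by fastforce
  have fs: "fsubst x u (finst A (r(x := V x))) = finst A (r(x := u))" for u
    by (rule fsubst_finst) (use nx All.prems(3) in blast)
  have IH: "Q.sat A ((\<lambda>y. cl (snd y) (r y))(x := cl (snd x) u)) \<longleftrightarrow> finst A (r(x := u)) \<in> M" if "u \<in> Tm (snd x)" for u
    unfolding cl_upd by (rule All.IH) (use All.prems that in auto)
  have "Q.sat (All x A) (\<lambda>x. cl (snd x) (r x)) \<longleftrightarrow> (\<forall>u\<in>Tm (snd x). finst A (r(x := u)) \<in> M)"
    by (simp only: Q.sat.simps qdom_Tm ball_simps IH cong: ball_cong)
  also have "\<dots> \<longleftrightarrow> finst (All x A) r \<in> M"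
  proof
    assume a: "\<forall>u\<in>Tm (snd x). finst A (r(x := u)) \<in> M"
    show "finst (All x A) r \<in> M"
    proof (rule ccontr)
      assume "finst (All x A) r \<notin> M"
      then obtain k where "k \<ge> 100" "fsubst x (V (k, snd x)) (finst A (r(x := V x))) \<notin> M"
        using M_henkin w unfolding finst.simps by blast
      then show False using a Tm_V fs by auto
    qed
  next
    assume a: "finst (All x A) r \<in> M"
    show "\<forall>u\<in>Tm (snd x). finst A (r(x := u)) \<in> M"
    proof
      fix u assume u: "u \<in> Tm (snd x)"
      have "free_for u x (finst A (r(x := V x)))"
        by (rule free_for_finst[of A 100]) (use All.prems u in \<open>auto simp: Tm_def\<close>)
      then show "finst A (r(x := u)) \<in> M" using M_allE[of x _ u] a TmD[OF u] fs by fastforce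
    qed
  qed
  finally show ?case .
next
  case (AllSt x A)
  have wr: "wt (r y) \<and> ty_of (r y) = snd y" for y using AllSt.prems(3) TmD by blast
  have w: "wf_fm (finst (AllSt x A) r)" by (rule finst_wf) (use AllSt.prems wr in auto)
  let ?A = "finst A (r(x := V x))" and ?r' = "r(x := V x)"
  have x: "fst x < 100" using AllSt.prems by auto
  have nx: "x \<notin> tvars u" if "u \<in> Tm \<sigma>" for u \<sigma> using that x unfolding Tm_def by fastforce
  have fs: "fsubst x u ?A = finst A (r(x := u))" for u
    by (rule fsubst_finst) (use nx AllSt.prems(3) in blast)
  have "wf_fm ?A" using w by simp
  then have "(AllSt x ?A \<^bold>\<longleftrightarrow> All x (St (V x) \<^bold>\<longrightarrow> ?A)) \<in> M"
    using T EQ.intros(1)[of x ?A] by (intro M_thm) (auto simp: E_EFA_st_def)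
  then have e: "AllSt x ?A \<in> M \<longleftrightarrow> All x (St (V x) \<^bold>\<longrightarrow> ?A) \<in> M"
    using M_Iff \<open>wf_fm ?A\<close> by simp
  have IH: "Q.sat A ((\<lambda>y. cl (snd y) (r y))(x := cl (snd x) u)) \<longleftrightarrow> finst A (r(x := u)) \<in> M" if "u \<in> Tm (snd x)" for u
    unfolding cl_upd by (rule AllSt.IH) (use AllSt.prems that in auto)
  have "Q.sat (AllSt x A) (\<lambda>x. cl (snd x) (r x)) \<longleftrightarrow> (\<forall>u\<in>Tm (snd x). St u \<in> M \<longrightarrow> finst A (r(x := u)) \<in> M)"
    by (simp only: Q.sat.simps qdom_Tm ball_simps IH qst_cl[of _ "snd x"] cong: ball_cong)
  also have "\<dots> \<longleftrightarrow> All x (St (V x) \<^bold>\<longrightarrow> ?A) \<in> M"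
  proof
    assume a: "\<forall>u\<in>Tm (snd x). St u \<in> M \<longrightarrow> finst A (r(x := u)) \<in> M"
    show "All x (St (V x) \<^bold>\<longrightarrow> ?A) \<in> M"
    proof (rule ccontr)
      assume "All x (St (V x) \<^bold>\<longrightarrow> ?A) \<notin> M"
      then obtain k where k: "k \<ge> 100" "fsubst x (V (k, snd x)) (St (V x) \<^bold>\<longrightarrow> ?A) \<notin> M"
        using M_henkin[of x "St (V x) \<^bold>\<longrightarrow> ?A" 100] w by auto
      have "wf_fm (fsubst x (V (k, snd x)) (St (V x) \<^bold>\<longrightarrow> ?A))"
        by (rule wf_fsubst) (use \<open>wf_fm ?A\<close> in auto)
      then show False using k a Tm_V[OF k(1), of "snd x"] fs by (auto simp: M_imp)
    qed
  next
    assume a: "All x (St (V x) \<^bold>\<longrightarrow> ?A) \<in> M"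
    have "finst A (r(x := u)) \<in> M" if u: "u \<in> Tm (snd x)" "St u \<in> M" for u
    proof -
      have "free_for u x ?A"
        by (rule free_for_finst[of A 100]) (use AllSt.prems u in \<open>auto simp: Tm_def\<close>)
      then have "fsubst x u (St (V x) \<^bold>\<longrightarrow> ?A) \<in> M" using M_allE[OF a, of u] TmD[OF u(1)] by simp
      then show ?thesis using M_mp u fs by simp
    qed
    then show "\<forall>u\<in>Tm (snd x). St u \<in> M \<longrightarrow> finst A (r(x := u)) \<in> M" by blast
  qed
  also have "\<dots> \<longleftrightarrow> finst (AllSt x A) r \<in> M" using e by simp
  finally show ?case .
qed

lemma cl_env: assumes "Q.tenv e" shows "\<exists>r. e = (\<lambda>x. cl (snd x) (r x)) \<and> (\<forall>x. r x \<in> Tm (snd x))"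
proof -
  have "\<exists>u. u \<in> Tm (snd x) \<and> e x = cl (snd x) u" for x
    using assms unfolding Q.tenv_def qdom_Tm by blast
  then obtain r where "\<forall>x. r x \<in> Tm (snd x) \<and> e x = cl (snd x) (r x)" by metis
  then show ?thesis by (intro exI[of _ r]) auto
qed

lemma sat_closed: "wf_fm A \<Longrightarrow> fmub A \<le> 100 \<Longrightarrow> fvars A = {} \<Longrightarrow> Q.tenv e \<Longrightarrow> Q.sat A e \<longleftrightarrow> A \<in> M"
  using cl_env[of e] sat_cl[of A] finst_self[of A] by fastforce

lemma sat_thm:
  assumes "derives T {} A" "fmub A \<le> 100" "Q.tenv e" shows "Q.sat A e"
proof -
  obtain xs where xs: "set xs = fvars A" using finite_list[OF finite_fvars[of A]] by blast
  have "foldr All xs A \<in> M" using M_ded[OF ded.base[OF derives_foldr_All[OF assms(1)]]] .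
  moreover have "fmub (foldr All xs A) \<le> 100"
    by (rule fmub_foldr_All[OF assms(2)]) (use xs assms(2) fvars_fmub[of _ A] less_le_trans in blast)
  ultimately have "Q.sat (foldr All xs A) e"
    using sat_closed[of "foldr All xs A"] derives_wf[OF assms(1)] assms(3) xs by simp
  then show ?thesis using Q.sat_foldr_All assms by blast
qed

lemma tenv_ex: "\<exists>e. Q.tenv e"
proof -
  have "Q.tenv (\<lambda>x. cl (snd x) (V (100, snd x)))"
    unfolding Q.tenv_def qdom_Tm using Tm_V[of 100] by blast
  then show ?thesis by blast
qed

end

text \<open>Theorems are offered to the semantic argument only within the index bound of the truth
  lemma. The closed coding terms stay within it automatically, since the translation into
  combinators leaves no variables behind, see \<open>ub_closed\<close>.\<close>

theorem completeness:
  fixes A :: fm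
  assumes "E_EFA_st \<subseteq> T" "wf_fm A" "fmub A \<le> 100" "fvars A = {}"
    and sem: "\<And>(dom :: ty \<Rightarrow> (ty \<times> tm) set) ap co le stp e. ftm dom ap co \<Longrightarrow>
      (\<And>B e. derives T {} B \<Longrightarrow> fmub B \<le> 100 \<Longrightarrow> fts.tenv dom e \<Longrightarrow> ftm.sat dom ap co le stp B e) \<Longrightarrow>
      fts.tenv dom e \<Longrightarrow> ftm.sat dom ap co le stp A e"
  shows "T \<^bold>\<turnstile> A"
proof (rule ccontr)
  assume "\<not> (T \<^bold>\<turnstile> A)"
  then obtain M where "henkin T M" "A \<notin> M" using lindenbaum[OF assms(1) _ assms(2)] unfolding proves_def by blast
  then interpret henkin T M by simp
  obtain e where e: "Q.tenv e" using tenv_ex by blast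
  have "Q.sat A e" by (rule sem[OF Q.ftm_axioms _ e]) (rule sat_thm)
  then show False using sat_closed[OF assms(2-4) e] \<open>A \<notin> M\<close> by blast
qed

lemma ub_closed: "tvars t = {} \<Longrightarrow> ub t = 0"
  by (induction t) auto

lemma fmub_connectives [simp]:
  "fmub (Neg A) = fmub A" "fmub (A \<^bold>\<and> B) = max (fmub A) (fmub B)"
  "fmub (A \<^bold>\<or> B) = max (fmub A) (fmub B)" "fmub (A \<^bold>\<longleftrightarrow> B) = max (fmub A) (fmub B)"
  "fmub (Ex x A) = max (Suc (fst x)) (fmub A)" "fmub (ExSt x A) = max (Suc (fst x)) (fmub A)"
  by (auto simp: Neg_def And_def Or_def Iff_def Ex_def ExSt_def)

lemma qfree_connectives [simp]:
  "qfree_internal (Neg A) = qfree_internal A" "qfree_internal (A \<^bold>\<and> B) \<longleftrightarrow> qfree_internal A \<and> qfree_internal B"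
  "qfree_internal (A \<^bold>\<or> B) \<longleftrightarrow> qfree_internal A \<and> qfree_internal B"
  by (auto simp: Neg_def And_def Or_def)

lemma ub_tsubst: "ub (tsubst x u t) \<le> max (ub t) (ub u)"
  by (induction t) auto

lemma fmub_fsubst: "fmub (fsubst x u A) \<le> max (fmub A) (ub u)"
proof (induction A)
  case (Eq s t)
  then show ?case using ub_tsubst[of x u s] ub_tsubst[of x u t] by auto
next
  case (Le s t)
  then show ?case using ub_tsubst[of x u s] ub_tsubst[of x u t] by auto
next
  case (St t)
  then show ?case using ub_tsubst[of x u t] by auto
qed auto

section \<open>Terms for case distinction and subtraction; typing of the coding terms\<close>

definition cndT :: "tm \<Rightarrow> tm \<Rightarrow> tm \<Rightarrow> tm" where
  "cndT a b c = Cn (CRec N) \<cdot> a \<cdot> b \<cdot> (Cn (CPi T1 N) \<cdot> (Cn (CPi N N) \<cdot> c)) \<cdot> (Cn (CPi N N) \<cdot> c)"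

text \<open>The recursor takes the minimum with its last argument in each step, so a bound has to be
  supplied along with the step function. Here both return the predecessor, and the minimum has no
  effect.\<close>

definition pdT :: "tm \<Rightarrow> tm" where
  "pdT a = Cn (CRec N) \<cdot> a \<cdot> Zr \<cdot> (Cn (CPi T1 N) \<cdot> lam (0, N) (V (0, N))) \<cdot> lam (0, N) (V (0, N))"

definition mnT :: "tm \<Rightarrow> tm \<Rightarrow> tm" where
  "mnT a b = Cn (CRec N) \<cdot> b \<cdot> a \<cdot> lams [(0, N), (1, N)] (pdT (V (0, N))) \<cdot> (Cn (CPi N N) \<cdot> a)"

text \<open>Truth is represented by the value 0 throughout. The distance of two numbers thus
  expresses their equality.\<close>

definition eqT :: "tm \<Rightarrow> tm \<Rightarrow> tm" where
  "eqT a b = Cn CA1 \<cdot> mnT a b \<cdot> mnT b a"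

lemma tvars_T [simp]:
  "tvars (cndT a b c) = tvars a \<union> tvars b \<union> tvars c" "tvars (pdT a) = tvars a"
  "tvars (mnT a b) = tvars a \<union> tvars b" "tvars (eqT a b) = tvars a \<union> tvars b"
  by (auto simp: cndT_def pdT_def mnT_def eqT_def)

lemma ub_lamI [simp]: "ub (lam (0, N) (V (0, N))) = 0"
  by (rule ub_closed) simp

lemma ub_T [simp]:
  "ub (cndT a b c) = max (ub a) (max (ub b) (ub c))" "ub (pdT a) = ub a"
  "ub (mnT a b) = max (ub a) (ub b)" "ub (eqT a b) = max (ub a) (ub b)"
proof -
  have "ub (lams [(0, N), (1, N)] (pdT (V (0, N)))) = 0" by (rule ub_closed) simp
  then show "ub (mnT a b) = max (ub a) (ub b)" "ub (eqT a b) = max (ub a) (ub b)"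
    by (auto simp: mnT_def eqT_def)
qed (auto simp: cndT_def pdT_def)

lemma tvars_coding [simp]:
  "tvars pred_tm = {}" "tvars monus_tm = {}" "tvars (pow2 t) = tvars t" "tvars shift_tm = {}"
  "tvars hd_tm = {}" "tvars tl_tm = {}" "tvars drop_tm = {}" "tvars nth_tm = {}" "tvars lh_tm = {}"
  "tvars psum_tm = {}" "tvars code_tm = {}" "tvars flat_tm = {}" "tvars (zero_tm \<sigma>) = {}"
  "tvars (len_tm \<sigma>) = {}" "tvars (comp_tm \<sigma>) = {}" "tvars (img_tm \<sigma> \<tau>) = {}"
proof -
  have z: "tvars (zero_tm \<sigma>) = {}" for \<sigma> by (induction \<sigma>) auto
  show pred: "tvars pred_tm = {}" by (auto simp: pred_tm_def)
  show monus: "tvars monus_tm = {}" by (auto simp: monus_tm_def pred)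
  show pow2: "tvars (pow2 t) = tvars t" for t by (auto simp: pow2_def)
  show shift: "tvars shift_tm = {}" by (auto simp: shift_tm_def monus pow2)
  show hd: "tvars hd_tm = {}" by (auto simp: hd_tm_def monus pow2 shift)
  show tl: "tvars tl_tm = {}" by (auto simp: tl_tm_def shift hd)
  show drp: "tvars drop_tm = {}" by (auto simp: drop_tm_def tl)
  show nth: "tvars nth_tm = {}" by (auto simp: nth_tm_def hd drp)
  show lh: "tvars lh_tm = {}" by (auto simp: lh_tm_def drp)
  show psum: "tvars psum_tm = {}" by (auto simp: psum_tm_def)
  show code: "tvars code_tm = {}" by (auto simp: code_tm_def psum pow2)
  show flat: "tvars flat_tm = {}" by (auto simp: flat_tm_def Let_def psum monus code)
  show "tvars (zero_tm \<sigma>) = {}" by (rule z)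
  show len: "tvars (len_tm \<sigma>) = {}" for \<sigma> by (auto simp: len_tm_def lh z)
  show comp: "tvars (comp_tm \<sigma>) = {}" for \<sigma> by (auto simp: comp_tm_def nth)
  show "tvars (img_tm \<sigma> \<tau>) = {}" by (auto simp: img_tm_def Let_def flat len comp)
qed

lemma ub_coding [simp]:
  "ub code_tm = 0" "ub (len_tm \<sigma>) = 0" "ub (comp_tm \<sigma>) = 0" "ub (img_tm \<sigma> \<tau>) = 0"
  by (rule ub_closed; simp)+

lemma wt_lams [simp]: "wt t \<Longrightarrow> wt (lams xs t)"
  and ty_of_lams: "wt t \<Longrightarrow> ty_of (lams xs t) = foldr (\<rightarrow>) (map snd xs) (ty_of t)"
  by (induction xs) (simp_all add: lams_def)

lemma ty_of_lams_Cons [simp]: "wt t \<Longrightarrow> ty_of (lams (x # xs) t) = snd x \<rightarrow> ty_of (lams xs t)"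
  "ty_of (lams [] t) = ty_of t"
  by (simp_all add: lams_def) (metis lams_def wt_lams ty_of_lam)

lemma apps_typed: "wt t \<Longrightarrow> ty_of t = foldr (\<rightarrow>) \<sigma>s \<tau> \<Longrightarrow> list_all2 (\<lambda>u \<sigma>. wt u \<and> ty_of u = \<sigma>) us \<sigma>s
  \<Longrightarrow> wt (apps t us) \<and> ty_of (apps t us) = \<tau>"
proof (induction us arbitrary: t \<sigma>s)
  case (Cons u us)
  then obtain \<sigma> \<sigma>s' where "\<sigma>s = \<sigma> # \<sigma>s'" "wt u" "ty_of u = \<sigma>" "list_all2 (\<lambda>u \<sigma>. wt u \<and> ty_of u = \<sigma>) us \<sigma>s'"
    by (auto simp: list_all2_Cons1)
  then show ?case using Cons.IH[of "t \<cdot> u" \<sigma>s'] Cons.prems by (simp add: apps_def)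
qed (auto simp: apps_def)

lemma arg_tys_foldr: "foldr (\<rightarrow>) (arg_tys \<sigma>) N = \<sigma>"
  by (induction \<sigma>) auto

lemma zero_tm_typed [simp]: "wt (zero_tm \<sigma>)" "ty_of (zero_tm \<sigma>) = \<sigma>"
proof -
  have "wt (zero_tm \<sigma>) \<and> ty_of (zero_tm \<sigma>) = \<sigma>" by (induction \<sigma>) auto
  then show "wt (zero_tm \<sigma>)" "ty_of (zero_tm \<sigma>) = \<sigma>" by auto
qed

lemma apps_arg_vars [simp]:
  assumes "wt t" "ty_of t = \<sigma>"
  shows "wt (apps t (map V (arg_vars \<sigma>)))" "ty_of (apps t (map V (arg_vars \<sigma>))) = N"
    "wt (apps t (map zero_tm (arg_tys \<sigma>)))" "ty_of (apps t (map zero_tm (arg_tys \<sigma>))) = N"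
proof -
  have "list_all2 (\<lambda>u \<sigma>. wt u \<and> ty_of u = \<sigma>) (map V (arg_vars \<sigma>)) (arg_tys \<sigma>)"
    by (auto simp: list_all2_conv_all_nth arg_vars_def)
  from apps_typed[OF assms(1) _ this, of N] assms arg_tys_foldr
  show "wt (apps t (map V (arg_vars \<sigma>)))" "ty_of (apps t (map V (arg_vars \<sigma>))) = N" by simp_all
  have "list_all2 (\<lambda>u \<sigma>. wt u \<and> ty_of u = \<sigma>) (map zero_tm (arg_tys \<sigma>)) (arg_tys \<sigma>)"
    by (auto simp: list_all2_conv_all_nth)
  from apps_typed[OF assms(1) _ this, of N] assms arg_tys_foldr
  show "wt (apps t (map zero_tm (arg_tys \<sigma>)))" "ty_of (apps t (map zero_tm (arg_tys \<sigma>))) = N" by simp_all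
qed

lemma foldr_arg_vars [simp]: "foldr (\<rightarrow>) (map snd (arg_vars \<sigma>)) N = \<sigma>"
  by (simp add: arg_vars_def arg_tys_foldr)

lemma coding_typed [simp]:
  "wt pred_tm" "ty_of pred_tm = N \<rightarrow> N" "wt monus_tm" "ty_of monus_tm = N \<rightarrow> N \<rightarrow> N"
  "wt (pow2 t) \<longleftrightarrow> wt t \<and> ty_of t = N" "ty_of (pow2 t) = N" "wt shift_tm" "ty_of shift_tm = N \<rightarrow> N \<rightarrow> N"
  "wt hd_tm" "ty_of hd_tm = N \<rightarrow> N" "wt tl_tm" "ty_of tl_tm = N \<rightarrow> N" "wt drop_tm" "ty_of drop_tm = N \<rightarrow> N \<rightarrow> N"
  "wt nth_tm" "ty_of nth_tm = N \<rightarrow> N \<rightarrow> N" "wt lh_tm" "ty_of lh_tm = N \<rightarrow> N"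
  "wt psum_tm" "ty_of psum_tm = T1 \<rightarrow> N \<rightarrow> N" "wt code_tm" "ty_of code_tm = T1 \<rightarrow> N \<rightarrow> N"
  "wt flat_tm" "ty_of flat_tm = T1 \<rightarrow> (N \<rightarrow> N \<rightarrow> N) \<rightarrow> N \<rightarrow> N"
  "wt (len_tm \<sigma>)" "ty_of (len_tm \<sigma>) = \<sigma> \<rightarrow> N" "wt (comp_tm \<sigma>)" "ty_of (comp_tm \<sigma>) = \<sigma> \<rightarrow> N \<rightarrow> \<sigma>"
  "wt (img_tm \<sigma> \<tau>)" "ty_of (img_tm \<sigma> \<tau>) = (\<sigma> \<rightarrow> \<tau>) \<rightarrow> \<sigma> \<rightarrow> \<tau>"
proof -
  show pred: "wt pred_tm" "ty_of pred_tm = N \<rightarrow> N" by (simp_all add: pred_tm_def)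
  show monus: "wt monus_tm" "ty_of monus_tm = N \<rightarrow> N \<rightarrow> N" by (simp_all add: monus_tm_def pred)
  show pow2: "wt (pow2 t) \<longleftrightarrow> wt t \<and> ty_of t = N" "ty_of (pow2 t) = N" for t by (auto simp: pow2_def)
  show shift: "wt shift_tm" "ty_of shift_tm = N \<rightarrow> N \<rightarrow> N" by (simp_all add: shift_tm_def monus pow2)
  show hd: "wt hd_tm" "ty_of hd_tm = N \<rightarrow> N" by (simp_all add: hd_tm_def monus pow2 shift)
  show tl: "wt tl_tm" "ty_of tl_tm = N \<rightarrow> N" by (simp_all add: tl_tm_def shift hd)
  show drp: "wt drop_tm" "ty_of drop_tm = N \<rightarrow> N \<rightarrow> N" by (simp_all add: drop_tm_def tl)
  show nth: "wt nth_tm" "ty_of nth_tm = N \<rightarrow> N \<rightarrow> N" by (simp_all add: nth_tm_def hd drp)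
  show lh: "wt lh_tm" "ty_of lh_tm = N \<rightarrow> N" by (simp_all add: lh_tm_def drp)
  show psum: "wt psum_tm" "ty_of psum_tm = T1 \<rightarrow> N \<rightarrow> N" by (simp_all add: psum_tm_def)
  show code: "wt code_tm" "ty_of code_tm = T1 \<rightarrow> N \<rightarrow> N" by (simp_all add: code_tm_def psum pow2)
  show flat: "wt flat_tm" "ty_of flat_tm = T1 \<rightarrow> (N \<rightarrow> N \<rightarrow> N) \<rightarrow> N \<rightarrow> N"
    by (simp_all add: flat_tm_def Let_def psum monus code)
  show len: "wt (len_tm \<sigma>)" "ty_of (len_tm \<sigma>) = \<sigma> \<rightarrow> N" for \<sigma> by (simp_all add: len_tm_def lh)
  show comp: "wt (comp_tm \<sigma>)" "ty_of (comp_tm \<sigma>) = \<sigma> \<rightarrow> N \<rightarrow> \<sigma>" for \<sigma>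
    by (simp_all add: comp_tm_def nth) (simp add: ty_of_lams nth)
  show img: "wt (img_tm \<sigma> \<tau>)" "ty_of (img_tm \<sigma> \<tau>) = (\<sigma> \<rightarrow> \<tau>) \<rightarrow> \<sigma> \<rightarrow> \<tau>"
    by (simp_all add: img_tm_def Let_def flat len comp) (simp add: ty_of_lams flat len comp)
qed

lemma T_typed [simp]:
  "wt a \<and> ty_of a = N \<and> wt b \<and> ty_of b = N \<and> wt c \<and> ty_of c = N \<Longrightarrow> wt (cndT a b c)" "ty_of (cndT a b c) = N"
  "wt a \<and> ty_of a = N \<Longrightarrow> wt (pdT a)" "ty_of (pdT a) = N"
  "wt a \<and> ty_of a = N \<and> wt b \<and> ty_of b = N \<Longrightarrow> wt (mnT a b)" "ty_of (mnT a b) = N"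
  "wt a \<and> ty_of a = N \<and> wt b \<and> ty_of b = N \<Longrightarrow> wt (eqT a b)" "ty_of (eqT a b) = N"
  by (simp_all add: cndT_def pdT_def mnT_def eqT_def)

context fts
begin

lemma val_lams_Cons [simp]:
  "wt t \<Longrightarrow> tenv e \<Longrightarrow> a \<in> dom (snd x) \<Longrightarrow> val (lams (x # xs) t) e \<bullet> a = val (lams xs t) (e(x := a))"
  "val (lams [] t) e = val t e"
  using val_lam[of "lams xs t" e a x] by (simp_all add: lams_def) (metis lams_def wt_lams)

lemma dom_ex: "\<exists>a. a \<in> dom \<sigma>"
proof (induction \<sigma>)
  case N
  then show ?case using co_dom[of CZero] by auto
next
  case (Fn \<sigma> \<tau>)
  then show ?case using co_dom[of "CPi \<tau> \<sigma>"] ap_dom by fastforce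
qed

definition e0 :: "var \<Rightarrow> 'a" where "e0 x = (SOME a. a \<in> dom (snd x))"

lemma tenv_e0 [simp]: "tenv e0"
  unfolding tenv_def e0_def using someI_ex[OF dom_ex] by blast

declare tenv_upd [simp]

lemma val_in [simp]: "tenv e \<Longrightarrow> wt t \<Longrightarrow> ty_of t = \<sigma> \<Longrightarrow> val t e \<in> dom \<sigma>"
  using val_dom by blast

declare val_lam [simp]

end

declare lam.simps [simp del]

section \<open>Arithmetic in models of \<open>B0\<close>\<close>

text \<open>An arbitrary model. Its numbers need not be those of \<open>nat\<close>, and its objects
  of type 1 need not comprise all functions, so every property of them has to come from the axioms,
  taken within the index bound of the completeness theorem.\<close>

locale b0 = ftm +
  assumes valid: "A \<in> B0 \<union> {kappa3} \<Longrightarrow> wf_fm A \<Longrightarrow> fmub A \<le> 100 \<Longrightarrow> tenv e \<Longrightarrow> sat A e"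
begin

lemma axiom_valid: "A \<in> E_EFA \<Longrightarrow> wf_fm A \<Longrightarrow> fmub A \<le> 100 \<Longrightarrow> tenv e \<Longrightarrow> sat A e"
  by (rule valid) (auto simp: B0_def B0_minus_def E_EFA_st_def)

abbreviation D :: "'a set" where "D \<equiv> dom N"
abbreviation z :: 'a where "z \<equiv> co CZero"
abbreviation sc :: "'a \<Rightarrow> 'a" where "sc a \<equiv> co CSuc \<bullet> a"
abbreviation pl :: "'a \<Rightarrow> 'a \<Rightarrow> 'a" where "pl a b \<equiv> co CA1 \<bullet> a \<bullet> b"
abbreviation ml :: "'a \<Rightarrow> 'a \<Rightarrow> 'a" where "ml a b \<equiv> co CA2 \<bullet> a \<bullet> b"
abbreviation pw :: "'a \<Rightarrow> 'a \<Rightarrow> 'a" where "pw a b \<equiv> co CA3 \<bullet> a \<bullet> b"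
abbreviation mx :: "'a \<Rightarrow> 'a \<Rightarrow> 'a" where "mx a b \<equiv> co CMax \<bullet> a \<bullet> b"
abbreviation mi :: "'a \<Rightarrow> 'a \<Rightarrow> 'a" where "mi a b \<equiv> co CMin \<bullet> a \<bullet> b"
abbreviation v0 :: tm where "v0 \<equiv> V (0, N)"
abbreviation v1 :: tm where "v1 \<equiv> V (1, N)"
abbreviation v2 :: tm where "v2 \<equiv> V (2, N)"

lemma z_D [simp]: "z \<in> D" using co_dom[of CZero] by simp

lemma co_suc_dom [simp]: "co CSuc \<in> dom (N \<rightarrow> N)" using co_dom[of CSuc] by simp

lemma co_binary_dom [simp]: "co CMin \<in> dom (N \<rightarrow> N \<rightarrow> N)" "co CMax \<in> dom (N \<rightarrow> N \<rightarrow> N)" "co CA0 \<in> dom (N \<rightarrow> N \<rightarrow> N)"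
   "co CA1 \<in> dom (N \<rightarrow> N \<rightarrow> N)" "co CA2 \<in> dom (N \<rightarrow> N \<rightarrow> N)" "co CA3 \<in> dom (N \<rightarrow> N \<rightarrow> N)"
  using co_dom[of CMin] co_dom[of CMax] co_dom[of CA0] co_dom[of CA1] co_dom[of CA2] co_dom[of CA3] by simp_all

lemma sc_D [simp]: "a \<in> D \<Longrightarrow> sc a \<in> D" using ap_dom co_suc_dom by blast

lemma bin_D [simp]: "f \<in> dom (N \<rightarrow> N \<rightarrow> N) \<Longrightarrow> a \<in> D \<Longrightarrow> b \<in> D \<Longrightarrow> f \<bullet> a \<bullet> b \<in> D"
  using ap_dom by blast

lemma T1_D [simp]: "f \<in> dom T1 \<Longrightarrow> a \<in> D \<Longrightarrow> f \<bullet> a \<in> D"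
  using ap_dom by blast

lemma T2_D [simp]: "Y \<in> dom T2 \<Longrightarrow> f \<in> dom T1 \<Longrightarrow> Y \<bullet> f \<in> D"
  using ap_dom by blast

lemma suc_ne: "a \<in> D \<Longrightarrow> sc a \<noteq> z"
  using axiom_valid[OF E_EFA.suc_nonzero[of v0], of "e0((0, N) := a)"] by simp

lemma suc_inj: "a \<in> D \<Longrightarrow> b \<in> D \<Longrightarrow> sc a = sc b \<Longrightarrow> a = b"
  using axiom_valid[OF E_EFA.suc_inj[of v0 v1], of "e0((0, N) := a, (1, N) := b)"] by simp

lemma le_z: "a \<in> D \<Longrightarrow> le a z \<longleftrightarrow> a = z"
  using axiom_valid[OF E_EFA.le_zero[of v0], of "e0((0, N) := a)"] by simp

lemma le_s: "a \<in> D \<Longrightarrow> b \<in> D \<Longrightarrow> le a (sc b) \<longleftrightarrow> le a b \<or> a = sc b"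
  using axiom_valid[OF E_EFA.le_suc[of v0 v1], of "e0((0, N) := a, (1, N) := b)"] by simp

lemma min_eq_left: "a \<in> D \<Longrightarrow> b \<in> D \<Longrightarrow> le a b \<Longrightarrow> mi a b = a"
  using axiom_valid[OF E_EFA.min1[of v0 v1], of "e0((0, N) := a, (1, N) := b)"] by simp

lemma max_eq_right: "a \<in> D \<Longrightarrow> b \<in> D \<Longrightarrow> le a b \<Longrightarrow> mx a b = b"
  using axiom_valid[OF E_EFA.max1[of v0 v1], of "e0((0, N) := a, (1, N) := b)"] by simp

lemma max_eq_left: "a \<in> D \<Longrightarrow> b \<in> D \<Longrightarrow> le b a \<Longrightarrow> mx a b = a"
  using axiom_valid[OF E_EFA.max2[of v1 v0], of "e0((0, N) := a, (1, N) := b)"] by simp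

lemma A0: "a \<in> D \<Longrightarrow> b \<in> D \<Longrightarrow> co CA0 \<bullet> a \<bullet> b = sc b"
  using axiom_valid[OF E_EFA.A0[of v0 v1], of "e0((0, N) := a, (1, N) := b)"] by simp

lemma pl_z [simp]: "a \<in> D \<Longrightarrow> pl a z = a"
  using axiom_valid[OF E_EFA.A1_zero[of v0], of "e0((0, N) := a)"] by simp

lemma pl_s [simp]: "a \<in> D \<Longrightarrow> b \<in> D \<Longrightarrow> pl a (sc b) = sc (pl a b)"
  using axiom_valid[OF E_EFA.A1_suc[of v0 v1], of "e0((0, N) := a, (1, N) := b)"] by (simp add: A0)

lemma ml_z [simp]: "a \<in> D \<Longrightarrow> ml a z = z"
  using axiom_valid[OF E_EFA.A2_zero[of v0], of "e0((0, N) := a)"] by simp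

lemma ml_s [simp]: "a \<in> D \<Longrightarrow> b \<in> D \<Longrightarrow> ml a (sc b) = pl a (ml a b)"
  using axiom_valid[OF E_EFA.A2_suc[of v0 v1], of "e0((0, N) := a, (1, N) := b)"] by simp

lemma pw_z [simp]: "a \<in> D \<Longrightarrow> pw a z = sc z"
  using axiom_valid[OF E_EFA.A3_zero[of v0], of "e0((0, N) := a)"] by simp

lemma pw_s [simp]: "a \<in> D \<Longrightarrow> b \<in> D \<Longrightarrow> pw a (sc b) = ml a (pw a b)"
  using axiom_valid[OF E_EFA.A3_suc[of v0 v1], of "e0((0, N) := a, (1, N) := b)"] by simp

text \<open>The induction scheme of the theory, adapted to a semantic predicate: \<open>A\<close> is
  a quantifier-free formula expressing \<open>P\<close> of the variable with index 0, and the
  environment \<open>e\<close> holds the parameters. Each use names such a formula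
  explicitly.\<close>

lemma ind:
  assumes A: "qfree_internal A" "wf_fm A" "fmub A \<le> 100" "tenv e"
    and P: "\<And>n. n \<in> D \<Longrightarrow> P n \<longleftrightarrow> sat A (e((0, N) := n))"
    and "P z" and s: "\<And>n. n \<in> D \<Longrightarrow> P n \<Longrightarrow> P (sc n)" and n: "n \<in> D"
  shows "P n"
proof -
  let ?x = "(0 :: nat, N)"
  have w: "wf_fm (fsubst ?x Zr A)" "wf_fm (fsubst ?x (Sc (V ?x)) A)"
    by (rule wf_fsubst; use A in simp)+
  have u: "fmub (fsubst ?x Zr A) \<le> 100" "fmub (fsubst ?x (Sc (V ?x)) A) \<le> 100"
    using fmub_fsubst[of ?x Zr A] fmub_fsubst[of ?x "Sc (V ?x)" A] A(3) by simp_all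
  have "sat (fsubst ?x Zr A \<^bold>\<longrightarrow> All ?x (A \<^bold>\<longrightarrow> fsubst ?x (Sc (V ?x)) A) \<^bold>\<longrightarrow> All ?x A) e"
    by (rule axiom_valid[OF E_EFA.qf_ind]) (use A w u in simp_all)
  then have "sat A (e(?x := z)) \<longrightarrow> (\<forall>n\<in>D. sat A (e(?x := n)) \<longrightarrow> sat A (e(?x := sc n))) \<longrightarrow> (\<forall>n\<in>D. sat A (e(?x := n)))"
    by (simp add: sat_fsubst free_for_qfree[OF A(1)])
  then show ?thesis using P assms(6) s n by simp
qed

lemma le_refl: "a \<in> D \<Longrightarrow> le a a"
  by (rule ind[of "v0 \<^bold>\<le> v0" e0 "\<lambda>x. le x x"]) (simp_all add: le_z le_s)

lemma le_trans: "le a b \<Longrightarrow> le b c \<Longrightarrow> a \<in> D \<Longrightarrow> b \<in> D \<Longrightarrow> c \<in> D \<Longrightarrow> le a c"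
proof -
  assume a: "a \<in> D" "b \<in> D" "c \<in> D" "le a b" "le b c"
  have "le b c \<longrightarrow> le a c"
    by (rule ind[of "v1 \<^bold>\<le> v0 \<^bold>\<longrightarrow> v2 \<^bold>\<le> v0" "e0((1, N) := b, (2, N) := a)" "\<lambda>x. le b x \<longrightarrow> le a x" c])
      (use a in \<open>auto simp: le_z le_s\<close>)
  then show ?thesis using a by blast
qed

lemma z_le: "a \<in> D \<Longrightarrow> le z a"
  by (rule ind[of "Zr \<^bold>\<le> v0" e0 "\<lambda>x. le z x"]) (simp_all add: le_z le_s)

lemma le_suc_self: "a \<in> D \<Longrightarrow> le a (sc a)"
  by (simp add: le_s le_refl)

lemma suc_mono: "le a b \<Longrightarrow> a \<in> D \<Longrightarrow> b \<in> D \<Longrightarrow> le (sc a) (sc b)"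
proof -
  assume a: "a \<in> D" "b \<in> D" "le a b"
  have "le a b \<longrightarrow> le (sc a) (sc b)"
    by (rule ind[of "v1 \<^bold>\<le> v0 \<^bold>\<longrightarrow> Sc v1 \<^bold>\<le> Sc v0" "e0((1, N) := a)" "\<lambda>x. le a x \<longrightarrow> le (sc a) (sc x)" b])
      (use a in \<open>auto simp: le_z le_s\<close>)
  then show ?thesis using a by blast
qed

definition idF :: 'a where "idF = val (lam (0, N) v0) e0"

lemma val_closed: "tvars t = {} \<Longrightarrow> val t e = val t e0"
  by (rule val_cong) simp

lemma val_idT [simp]: "val (lam (0, N) v0) e = idF"
  unfolding idF_def by (rule val_closed) simp

lemma idF [simp]: "idF \<in> dom T1" "b \<in> D \<Longrightarrow> idF \<bullet> b = b"
  using val_in[OF tenv_e0, of "lam (0, N) v0" T1] val_lam[of v0 e0 b "(0, N)"] by simp_all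

definition pd :: "'a \<Rightarrow> 'a" where
  "pd a = co (CRec N) \<bullet> a \<bullet> z \<bullet> (co (CPi T1 N) \<bullet> idF) \<bullet> idF"

lemma val_pdT [simp]: "val (pdT t) e = pd (val t e)"
  by (simp add: pdT_def pd_def)

lemma pd_D [simp]: "a \<in> D \<Longrightarrow> pd a \<in> D"
  using val_in[of "e0((0, N) := a)" "pdT v0" N] by simp

lemma pd_z [simp]: "pd z = z"
  using axiom_valid[OF E_EFA.rec_zero[of N Zr "Cn (CPi T1 N) \<cdot> lam (0, N) (V (0, N))" "lam (0, N) (V (0, N))" "[]"], of e0]
  by (simp add: apps_def pd_def)

lemma pd_s [simp]: "b \<in> D \<Longrightarrow> pd (sc b) = b"
  using axiom_valid[OF E_EFA.rec_suc[of N v0 Zr "Cn (CPi T1 N) \<cdot> lam (0, N) (V (0, N))" "lam (0, N) (V (0, N))" "[]"],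
      of "e0((0, N) := b)"] pd_D[of b]
  by (simp add: apps_def pd_def K[of idF T1 _ N] min_eq_left le_refl)

lemma zero_or_suc: "a \<in> D \<Longrightarrow> a = z \<or> (\<exists>b\<in>D. a = sc b)"
proof -
  assume a: "a \<in> D"
  have "a = z \<or> sc (pd a) = a"
    by (rule ind[of "v0 \<^bold>= Zr \<^bold>\<or> Sc (pdT v0) \<^bold>= v0" e0 "\<lambda>a. a = z \<or> sc (pd a) = a"]) (use a in auto)
  then show ?thesis using a pd_D by metis
qed

lemma le_cases: "a \<in> D \<Longrightarrow> b \<in> D \<Longrightarrow> le a b \<Longrightarrow> a = b \<or> le (sc a) b"
proof -
  assume a: "a \<in> D" "b \<in> D" "le a b"
  have "le a b \<longrightarrow> a = b \<or> le (sc a) b"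
    by (rule ind[of "v1 \<^bold>\<le> v0 \<^bold>\<longrightarrow> v1 \<^bold>= v0 \<^bold>\<or> Sc v1 \<^bold>\<le> v0" "e0((1, N) := a)" "\<lambda>x. le a x \<longrightarrow> a = x \<or> le (sc a) x" b])
      (use a in \<open>auto simp: le_z le_s le_refl\<close>)
  then show ?thesis using a by blast
qed

lemma le_total: "a \<in> D \<Longrightarrow> b \<in> D \<Longrightarrow> le a b \<or> le (sc b) a"
proof -
  assume a: "a \<in> D" "b \<in> D"
  show ?thesis
  proof (rule ind[of "v1 \<^bold>\<le> v0 \<^bold>\<or> Sc v0 \<^bold>\<le> v1" "e0((1, N) := a)" "\<lambda>x. le a x \<or> le (sc x) a" b])
    show "le a z \<or> le (sc z) a" using zero_or_suc[of a] a suc_mono[OF z_le] by (auto simp: le_z)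
  next
    fix n assume n: "n \<in> D" "le a n \<or> le (sc n) a"
    then show "le a (sc n) \<or> le (sc (sc n)) a"
      using a le_cases[of "sc n" a] by (auto simp: le_s)
  qed (use a in auto)
qed

lemma not_suc_le: "a \<in> D \<Longrightarrow> \<not> le (sc a) a"
proof -
  assume a: "a \<in> D"
  show ?thesis
  proof (rule ind[of "Neg (Sc v0 \<^bold>\<le> v0)" e0 "\<lambda>x. \<not> le (sc x) x" a])
    show "\<not> le (sc z) z" using suc_ne by (simp add: le_z)
  next
    fix n assume n: "n \<in> D" "\<not> le (sc n) n"
    show "\<not> le (sc (sc n)) (sc n)"
    proof
      assume "le (sc (sc n)) (sc n)"
      then have "le (sc (sc n)) n \<or> sc (sc n) = sc n" using n by (simp add: le_s)
      then show False
        using n le_trans[of "sc n" "sc (sc n)" n] suc_inj[of "sc n" n] le_suc_self le_refl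
        by (metis sc_D)
    qed
  qed (use a in auto)
qed

lemma le_antisym: "le a b \<Longrightarrow> le b a \<Longrightarrow> a \<in> D \<Longrightarrow> b \<in> D \<Longrightarrow> a = b"
  using le_cases[of a b] le_trans[of "sc a" b a] not_suc_le[of a] by auto

lemma suc_le_cancel: "a \<in> D \<Longrightarrow> b \<in> D \<Longrightarrow> le (sc a) (sc b) \<longleftrightarrow> le a b"
  using suc_mono le_s[of "sc a" b] suc_inj le_trans[of a "sc a" b] le_suc_self le_refl by (metis sc_D)

lemma z_pl [simp]: "a \<in> D \<Longrightarrow> pl z a = a"
  by (rule ind[of "Cn CA1 \<cdot> Zr \<cdot> v0 \<^bold>= v0" e0 "\<lambda>x. pl z x = x"]) simp_all

lemma s_pl [simp]: "a \<in> D \<Longrightarrow> b \<in> D \<Longrightarrow> pl (sc a) b = sc (pl a b)"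
  by (rule ind[of "Cn CA1 \<cdot> Sc v1 \<cdot> v0 \<^bold>= Sc (Cn CA1 \<cdot> v1 \<cdot> v0)" "e0((1, N) := a)" "\<lambda>x. pl (sc a) x = sc (pl a x)"]) simp_all

lemma pl_comm: "a \<in> D \<Longrightarrow> b \<in> D \<Longrightarrow> pl a b = pl b a"
  by (rule ind[of "Cn CA1 \<cdot> v1 \<cdot> v0 \<^bold>= Cn CA1 \<cdot> v0 \<cdot> v1" "e0((1, N) := a)" "\<lambda>x. pl a x = pl x a"]) simp_all

lemma le_pl1: "a \<in> D \<Longrightarrow> b \<in> D \<Longrightarrow> le a (pl a b)"
  by (rule ind[of "v1 \<^bold>\<le> Cn CA1 \<cdot> v1 \<cdot> v0" "e0((1, N) := a)" "\<lambda>x. le a (pl a x)"])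
    (simp_all add: le_refl le_s)

lemma le_pl2: "a \<in> D \<Longrightarrow> b \<in> D \<Longrightarrow> le b (pl a b)"
  using le_pl1 pl_comm by metis

lemma pl_mono: "a \<in> D \<Longrightarrow> b \<in> D \<Longrightarrow> c \<in> D \<Longrightarrow> le (pl a b) (pl a c) \<longleftrightarrow> le b c"
proof -
  assume a: "a \<in> D" "b \<in> D" "c \<in> D"
  have "le (pl a b) (pl a c) \<longrightarrow> le b c"
    by (rule ind[of "Cn CA1 \<cdot> v0 \<cdot> v1 \<^bold>\<le> Cn CA1 \<cdot> v0 \<cdot> v2 \<^bold>\<longrightarrow> v1 \<^bold>\<le> v2" "e0((1, N) := b, (2, N) := c)"
        "\<lambda>x. le (pl x b) (pl x c) \<longrightarrow> le b c"]) (use a in \<open>simp_all add: suc_le_cancel\<close>)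
  moreover have "le b c \<longrightarrow> le (pl a b) (pl a c)"
    by (rule ind[of "v1 \<^bold>\<le> v2 \<^bold>\<longrightarrow> Cn CA1 \<cdot> v0 \<cdot> v1 \<^bold>\<le> Cn CA1 \<cdot> v0 \<cdot> v2" "e0((1, N) := b, (2, N) := c)"
        "\<lambda>x. le b c \<longrightarrow> le (pl x b) (pl x c)"]) (use a in \<open>simp_all add: suc_le_cancel\<close>)
  ultimately show ?thesis by blast
qed

lemma pl_cancel: "pl a b = pl a c \<Longrightarrow> a \<in> D \<Longrightarrow> b \<in> D \<Longrightarrow> c \<in> D \<Longrightarrow> b = c"
  using pl_mono[of a b c] pl_mono[of a c b] le_refl[of "pl a b"] le_antisym by simp

lemma pl_mono2: "le a b \<Longrightarrow> le c d \<Longrightarrow> a \<in> D \<Longrightarrow> b \<in> D \<Longrightarrow> c \<in> D \<Longrightarrow> d \<in> D \<Longrightarrow> le (pl a c) (pl b d)"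
  using le_trans[of "pl a c" "pl a d" "pl b d"] pl_mono[of a c d] pl_mono[of d a b] pl_comm by simp

lemma ml_mono_left: "le a b \<Longrightarrow> a \<in> D \<Longrightarrow> b \<in> D \<Longrightarrow> c \<in> D \<Longrightarrow> le (ml a c) (ml b c)"
proof (rule ind[of "Cn CA2 \<cdot> v1 \<cdot> v0 \<^bold>\<le> Cn CA2 \<cdot> v2 \<cdot> v0" "e0((1, N) := a, (2, N) := b)" "\<lambda>x. le (ml a x) (ml b x)" c])
qed (simp_all add: le_refl pl_mono2)

lemma ml_mono_right: "le a b \<Longrightarrow> a \<in> D \<Longrightarrow> b \<in> D \<Longrightarrow> c \<in> D \<Longrightarrow> le (ml c a) (ml c b)"
proof -
  assume a: "le a b" "a \<in> D" "b \<in> D" "c \<in> D"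
  have "le a b \<longrightarrow> le (ml c a) (ml c b)"
  proof (rule ind[of "v1 \<^bold>\<le> v0 \<^bold>\<longrightarrow> Cn CA2 \<cdot> v2 \<cdot> v1 \<^bold>\<le> Cn CA2 \<cdot> v2 \<cdot> v0" "e0((1, N) := a, (2, N) := c)" "\<lambda>x. le a x \<longrightarrow> le (ml c a) (ml c x)" b])
    fix n assume n: "n \<in> D" "le a n \<longrightarrow> le (ml c a) (ml c n)"
    have "le (ml c n) (ml c (sc n))" using n a by (simp add: le_pl2)
    then show "le a (sc n) \<longrightarrow> le (ml c a) (ml c (sc n))"
      using n a le_trans[of "ml c a" "ml c n" "ml c (sc n)"] by (auto simp: le_s le_refl)
  qed (use a in \<open>auto simp: le_z le_refl\<close>)
  then show ?thesis using a by blast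
qed

text \<open>Codes of sequences are sums of powers of 2; by this inequality they dominate the values
  that they code.\<close>

lemma self_le_pw: "a \<in> D \<Longrightarrow> le (sc a) (pw (sc (sc z)) a)"
proof (rule ind[of "Sc v0 \<^bold>\<le> Cn CA3 \<cdot> Sc (Sc Zr) \<cdot> v0" e0 "\<lambda>a. le (sc a) (pw (sc (sc z)) a)"])
  have dbl: "le b (ml (sc (sc z)) b)" if "b \<in> D" for b
  proof (rule ind[of "v0 \<^bold>\<le> Cn CA2 \<cdot> Sc (Sc Zr) \<cdot> v0" e0 "\<lambda>b. le b (ml (sc (sc z)) b)"])
    fix n assume "n \<in> D" "le n (ml (sc (sc z)) n)"
    then have "le n (sc (ml (sc (sc z)) n))" by (simp add: le_s)
    then show "le (sc n) (ml (sc (sc z)) (sc n))" using \<open>n \<in> D\<close> by (simp add: suc_le_cancel)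
  qed (use that in \<open>auto simp: le_refl\<close>)
  fix n assume n: "n \<in> D" "le (sc n) (pw (sc (sc z)) n)"
  let ?y = "pw (sc (sc z)) n"
  have y: "?y \<in> D" using n by simp
  have "?y \<noteq> z" using n suc_ne le_z[of "sc n"] by auto
  then obtain b where b: "b \<in> D" "?y = sc b" using zero_or_suc[OF y] by auto
  have "le (sc ?y) (ml (sc (sc z)) ?y)" unfolding b(2) using b(1) dbl by (simp add: suc_le_cancel)
  then show "le (sc (sc n)) (pw (sc (sc z)) (sc n))"
    using n le_trans[of "sc (sc n)" "sc ?y"] suc_mono by simp
qed (auto simp: le_refl)

abbreviation sq :: "'a \<Rightarrow> 'a" where "sq a \<equiv> ml a a"

text \<open>From (a + 1)^2 = a^2 + 2 a + 1: adding at most a to a^2 does not reach the next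
  square.\<close>

lemma sq_gap: "le (sc a) b \<Longrightarrow> a \<in> D \<Longrightarrow> b \<in> D \<Longrightarrow> le n a \<Longrightarrow> n \<in> D \<Longrightarrow> le (sc (pl (sq a) n)) (sq b)"
proof -
  assume a: "le (sc a) b" "a \<in> D" "b \<in> D" "le n a" "n \<in> D"
  have "le (sq a) (ml (sc a) a)" using a by (intro ml_mono_left) (auto simp: le_suc_self)
  then have "le (pl n (sq a)) (pl a (ml (sc a) a))" using a by (intro pl_mono2) auto
  then have "le (sc (pl (sq a) n)) (ml (sc a) (sc a))" using a pl_comm by (simp add: suc_le_cancel)
  moreover have "le (ml (sc a) (sc a)) (ml b (sc a))" using a by (intro ml_mono_left) auto
  moreover have "le (ml b (sc a)) (sq b)" using a by (intro ml_mono_right) auto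
  ultimately show ?thesis using a le_trans by (meson bin_D co_binary_dom sc_D)
qed

abbreviation pr :: "'a \<Rightarrow> 'a \<Rightarrow> 'a" where "pr n m \<equiv> pl (sq (pl n m)) n"

text \<open>The pairing is (n + m)^2 + n, which avoids division. By \<open>sq_gap\<close> values
  with different sums n + m are separated by a square, so the sum is determined, and n and m follow
  by cancellation.\<close>

lemma pr_inj:
  assumes "pr n m = pr n' m'" and D: "n \<in> D" "m \<in> D" "n' \<in> D" "m' \<in> D"
  shows "n = n' \<and> m = m'"
proof -
  let ?a = "pl n m" and ?b = "pl n' m'"
  have *: False if "le (sc (pl n m)) (pl n' m')" "n \<in> D" "m \<in> D" "n' \<in> D" "m' \<in> D" "pr n m = pr n' m'" for n m n' m'
  proof -
    have "le (sc (pr n m)) (sq (pl n' m'))" using that by (intro sq_gap) (auto simp: le_pl1)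
    moreover have "le (sq (pl n' m')) (pr n' m')" using that by (intro le_pl1) auto
    ultimately have "le (sc (pr n m)) (pr n' m')"
      by (rule le_trans) (use that in simp_all)
    then show False unfolding that(6)[symmetric] using not_suc_le[of "pr n m"] that by simp
  qed
  have "?a = ?b"
    using le_total[of ?a ?b] le_cases[of ?a ?b] *[of n m n' m'] *[of n' m' n m] assms by auto
  then have "n = n'" using pl_cancel[of "sq ?a" n n'] assms by simp
  then show ?thesis using \<open>?a = ?b\<close> pl_cancel D by blast
qed

end

section \<open>Subtraction, bounded search, standardness and codes in models of
  \<open>B0\<close>\<close>

context b0
begin

lemma co_Phi_dom [simp]: "co CPhi1 \<in> dom (T1 \<rightarrow> N \<rightarrow> N)" "co CPhi2 \<in> dom (T1 \<rightarrow> N \<rightarrow> N)"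
  "co CMu \<in> dom ((N \<rightarrow> N \<rightarrow> N) \<rightarrow> N \<rightarrow> N)"
  using co_dom[of CPhi1] co_dom[of CPhi2] co_dom[of CMu] by simp_all

lemma K_D [simp]: "a \<in> dom \<sigma> \<Longrightarrow> co (CPi \<sigma> \<tau>) \<bullet> a \<in> dom (\<tau> \<rightarrow> \<sigma>)"
  using co_dom[of "CPi \<sigma> \<tau>"] ap_dom by fastforce

definition cd :: "'a \<Rightarrow> 'a \<Rightarrow> 'a \<Rightarrow> 'a" where
  "cd a b c = co (CRec N) \<bullet> a \<bullet> b \<bullet> (co (CPi T1 N) \<bullet> (co (CPi N N) \<bullet> c)) \<bullet> (co (CPi N N) \<bullet> c)"

lemma val_cndT [simp]: "val (cndT a b c) e = cd (val a e) (val b e) (val c e)"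
  by (simp add: cndT_def cd_def)

lemma cd_D [simp]: "a \<in> D \<Longrightarrow> b \<in> D \<Longrightarrow> c \<in> D \<Longrightarrow> cd a b c \<in> D"
  using val_in[of "e0((0, N) := a, (1, N) := b, (2, N) := c)" "cndT v0 v1 v2" N] by simp

lemma cd [simp]: assumes "a \<in> D" "b \<in> D" "c \<in> D" shows "cd a b c = (if a = z then b else c)"
proof (cases "a = z")
  case True
  then show ?thesis
    using axiom_valid[OF E_EFA.rec_zero[of N v1 "Cn (CPi T1 N) \<cdot> (Cn (CPi N N) \<cdot> v2)" "Cn (CPi N N) \<cdot> v2" "[]"],
        of "e0((1, N) := b, (2, N) := c)"] assms by (simp add: apps_def cd_def)
next
  case False
  then obtain m where m: "m \<in> D" "a = sc m" using zero_or_suc assms by blast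
  have "cd m b c \<in> D" using m assms by simp
  then have r: "co (CRec N) \<bullet> m \<bullet> b \<bullet> (co (CPi T1 N) \<bullet> (co (CPi N N) \<bullet> c)) \<bullet> (co (CPi N N) \<bullet> c) \<in> D"
    by (simp add: cd_def)
  show ?thesis
    using axiom_valid[OF E_EFA.rec_suc[of N v0 v1 "Cn (CPi T1 N) \<cdot> (Cn (CPi N N) \<cdot> v2)" "Cn (CPi N N) \<cdot> v2" "[]"],
        of "e0((0, N) := m, (1, N) := b, (2, N) := c)"] assms m r False
    by (simp add: apps_def cd_def K[of "co (CPi N N) \<bullet> c" T1 _ N] K[of c N _ N] min_eq_left le_refl)
qed

definition pdF :: 'a where "pdF = val (lams [(0, N), (1, N)] (pdT v0)) e0"

lemma val_pdF [simp]: "val (lams [(0, N), (Suc 0, N)] (pdT v0)) e = pdF"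
  unfolding pdF_def One_nat_def by (rule val_closed) simp

lemma pdF [simp]: "pdF \<in> dom (N \<rightarrow> N \<rightarrow> N)" "a \<in> D \<Longrightarrow> b \<in> D \<Longrightarrow> pdF \<bullet> a \<bullet> b = pd a"
proof -
  show "pdF \<in> dom (N \<rightarrow> N \<rightarrow> N)"
    using val_in[OF tenv_e0, of "lams [(0, N), (1, N)] (pdT v0)" "N \<rightarrow> N \<rightarrow> N"] by simp
  assume "a \<in> D" "b \<in> D"
  then show "pdF \<bullet> a \<bullet> b = pd a" unfolding pdF_def by (simp del: val_pdF)
qed

definition mn :: "'a \<Rightarrow> 'a \<Rightarrow> 'a" where
  "mn a b = co (CRec N) \<bullet> b \<bullet> a \<bullet> pdF \<bullet> (co (CPi N N) \<bullet> a)"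

lemma val_mnT [simp]: "val (mnT a b) e = mn (val a e) (val b e)"
  by (simp add: mnT_def mn_def)

lemma mn_D [simp]: "a \<in> D \<Longrightarrow> b \<in> D \<Longrightarrow> mn a b \<in> D"
  using val_in[of "e0((0, N) := a, (1, N) := b)" "mnT v0 v1" N] by simp

lemma mn_z: "a \<in> D \<Longrightarrow> mn a z = a"
  using axiom_valid[OF E_EFA.rec_zero[of N v1 "lams [(0, N), (1, N)] (pdT v0)" "Cn (CPi N N) \<cdot> v1" "[]"], of "e0((1, N) := a)"]
  by (simp add: apps_def mn_def ub_closed)

lemma mn_s: "a \<in> D \<Longrightarrow> b \<in> D \<Longrightarrow> mn a (sc b) = mi (pd (mn a b)) a"
  using axiom_valid[OF E_EFA.rec_suc[of N v0 v1 "lams [(0, N), (1, N)] (pdT v0)" "Cn (CPi N N) \<cdot> v1" "[]"],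
      of "e0((0, N) := b, (1, N) := a)"] mn_D[of a b]
  by (simp add: apps_def mn_def ub_closed K[of a N _ N])

text \<open>The recursion for subtraction comes with a minimum that has to be removed. An equation
  with the maximum is quantifier free and suits induction on \<open>b\<close>; the link to the
  order, \<open>mn_eq_z\<close>, follows from it by cancellation.\<close>

lemma mn_mx: "a \<in> D \<Longrightarrow> b \<in> D \<Longrightarrow> mx a b = pl (mn a b) b"
proof (rule ind[of "Cn CMax \<cdot> v1 \<cdot> v0 \<^bold>= Cn CA1 \<cdot> mnT v1 v0 \<cdot> v0" "e0((1, N) := a)" "\<lambda>b. mx a b = pl (mn a b) b"])
  assume a: "a \<in> D"
  show "mx a z = pl (mn a z) z" using a by (simp add: max_eq_left z_le mn_z)
  fix n assume n: "n \<in> D" "mx a n = pl (mn a n) n"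
  show "mx a (sc n) = pl (mn a (sc n)) (sc n)"
  proof (cases "mn a n = z")
    case True
    have "le a n"
    proof (rule ccontr)
      assume "\<not> le a n"
      then have s: "le (sc n) a" using le_total a n by blast
      then have "le n a" using le_trans[of n "sc n" a] le_suc_self a n by simp
      then have "a = n" using n True a by (simp add: max_eq_left)
      then show False using s not_suc_le a by blast
    qed
    then have "le a (sc n)" using a n by (simp add: le_s)
    then show ?thesis using True a n by (simp add: mn_s max_eq_right min_eq_left z_le)
  next
    case False
    then obtain m where m: "m \<in> D" "mn a n = sc m" using zero_or_suc[of "mn a n"] a n by auto
    have "le (sc n) a"
    proof (rule ccontr)
      assume "\<not> le (sc n) a"
      then have "mx a n = n" using le_total a n max_eq_right by blast
      then have "sc (pl m n) = n" using n m by simp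
      then have "le (sc n) n" using le_pl2[of m n] suc_mono[of n "pl m n"] m n by simp
      then show False using not_suc_le n by blast
    qed
    moreover have "le n a" using le_trans[of n "sc n" a] le_suc_self calculation a n by simp
    ultimately have a': "a = sc (pl m n)" "mx a (sc n) = a" using n m a max_eq_left[of a n] max_eq_left[of a "sc n"] by simp_all
    have "le m a" unfolding a' using m n le_pl1[of m n] by (simp add: le_s)
    then show ?thesis using a' m n a by (simp add: mn_s min_eq_left)
  qed
qed auto

lemma mn_eq_z [simp]: "a \<in> D \<Longrightarrow> b \<in> D \<Longrightarrow> mn a b = z \<longleftrightarrow> le a b"
proof
  assume a: "a \<in> D" "b \<in> D"
  { assume "mn a b = z"
    then have m: "mx a b = b" using mn_mx a by simp
    show "le a b"
    proof (rule ccontr)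
      assume "\<not> le a b"
      then have s: "le (sc b) a" using le_total a by blast
      then have "le b a" using le_trans[of b "sc b" a] le_suc_self a by simp
      then show False using m max_eq_left s not_suc_le a by simp
    qed }
  { assume "le a b"
    then have "pl b (mn a b) = pl b z" using mn_mx[of a b] max_eq_right[of a b] a pl_comm[of b "mn a b"] by simp
    then show "mn a b = z" using pl_cancel a by (meson mn_D z_D) }
qed

definition eqt :: "'a \<Rightarrow> 'a \<Rightarrow> 'a" where "eqt a b = pl (mn a b) (mn b a)"

lemma val_eqT [simp]: "val (eqT a b) e = eqt (val a e) (val b e)"
  by (simp add: eqT_def eqt_def)

lemma eqt_D [simp]: "a \<in> D \<Longrightarrow> b \<in> D \<Longrightarrow> eqt a b \<in> D"
  by (simp add: eqt_def)

lemma eqt [simp]: "a \<in> D \<Longrightarrow> b \<in> D \<Longrightarrow> eqt a b = z \<longleftrightarrow> a = b"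
proof
  assume a: "a \<in> D" "b \<in> D" "eqt a b = z"
  then have "le (mn a b) z" "le (mn b a) z"
    using le_pl1[of "mn a b" "mn b a"] le_pl2[of "mn a b" "mn b a"] by (simp_all add: eqt_def)
  then show "a = b" using a le_antisym by (simp add: le_z)
qed (simp add: eqt_def mn_eq_z[THEN iffD2] le_refl)

lemma Phi1_z: "f \<in> dom T1 \<Longrightarrow> co CPhi1 \<bullet> f \<bullet> z = f \<bullet> z"
  using axiom_valid[OF E_EFA.Phi1_zero[of "V (0, T1)"], of "e0((0, T1) := f)"] by simp

lemma Phi1_s: "f \<in> dom T1 \<Longrightarrow> a \<in> D \<Longrightarrow> co CPhi1 \<bullet> f \<bullet> sc a = mx (f \<bullet> sc a) (co CPhi1 \<bullet> f \<bullet> a)"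
  using axiom_valid[OF E_EFA.Phi1_suc[of "V (0, T1)" v0], of "e0((0, T1) := f, (0, N) := a)"] by simp

lemma Phi2_z: "f \<in> dom T1 \<Longrightarrow> co CPhi2 \<bullet> f \<bullet> z = f \<bullet> z"
  using axiom_valid[OF E_EFA.Phi2_zero[of "V (0, T1)"], of "e0((0, T1) := f)"] by simp

lemma Phi2_s: "f \<in> dom T1 \<Longrightarrow> a \<in> D \<Longrightarrow> co CPhi2 \<bullet> f \<bullet> sc a = pl (f \<bullet> sc a) (co CPhi2 \<bullet> f \<bullet> a)"
  using axiom_valid[OF E_EFA.Phi2_suc[of "V (0, T1)" v0], of "e0((0, T1) := f, (0, N) := a)"] by simp

lemma Phi_D [simp]: "f \<in> dom T1 \<Longrightarrow> co CPhi1 \<bullet> f \<in> dom T1" "f \<in> dom T1 \<Longrightarrow> co CPhi2 \<bullet> f \<in> dom T1"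
  using ap_dom co_Phi_dom by blast+

lemma le_mx: "a \<in> D \<Longrightarrow> b \<in> D \<Longrightarrow> le a (mx a b) \<and> le b (mx a b)"
  using le_total[of a b] le_trans[of b "sc b" a] le_suc_self[of b] le_refl max_eq_right max_eq_left by (metis sc_D)

lemma Phi1_ge:
  assumes "f \<in> dom T1" "i \<in> D" "k \<in> D" "le i k" shows "le (f \<bullet> i) (co CPhi1 \<bullet> f \<bullet> k)"
proof -
  have "le i k \<longrightarrow> le (f \<bullet> i) (co CPhi1 \<bullet> f \<bullet> k)"
  proof (rule ind[of "v1 \<^bold>\<le> v0 \<^bold>\<longrightarrow> V (0, T1) \<cdot> v1 \<^bold>\<le> Cn CPhi1 \<cdot> V (0, T1) \<cdot> v0" "e0((1, N) := i, (0, T1) := f)"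
        "\<lambda>k. le i k \<longrightarrow> le (f \<bullet> i) (co CPhi1 \<bullet> f \<bullet> k)"])
    show "le i z \<longrightarrow> le (f \<bullet> i) (co CPhi1 \<bullet> f \<bullet> z)" using assms by (auto simp: le_z Phi1_z le_refl)
    fix n assume n: "n \<in> D" "le i n \<longrightarrow> le (f \<bullet> i) (co CPhi1 \<bullet> f \<bullet> n)"
    let ?a = "f \<bullet> sc n" and ?b = "co CPhi1 \<bullet> f \<bullet> n"
    have d: "?a \<in> D" "?b \<in> D" using assms n by simp_all
    show "le i (sc n) \<longrightarrow> le (f \<bullet> i) (co CPhi1 \<bullet> f \<bullet> sc n)"
      using n assms le_mx[OF d] le_trans[of "f \<bullet> i" ?b "mx ?a ?b"] d by (auto simp: le_s Phi1_s)
  qed (use assms in auto)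
  then show ?thesis using assms by blast
qed

lemma Phi2_ge: "f \<in> dom T1 \<Longrightarrow> k \<in> D \<Longrightarrow> le (f \<bullet> k) (co CPhi2 \<bullet> f \<bullet> k)"
  using zero_or_suc[of k] by (auto simp: Phi2_z Phi2_s le_refl le_pl1)

definition mu :: "'a \<Rightarrow> 'a \<Rightarrow> 'a" where "mu f x = co CMu \<bullet> f \<bullet> x"

lemma mu_D [simp]: "f \<in> dom (N \<rightarrow> N \<rightarrow> N) \<Longrightarrow> x \<in> D \<Longrightarrow> mu f x \<in> D"
  unfolding mu_def using ap_dom[of "co CMu" "N \<rightarrow> N \<rightarrow> N" T1 f] by simp

lemma mu_found: "f \<in> dom (N \<rightarrow> N \<rightarrow> N) \<Longrightarrow> x \<in> D \<Longrightarrow> y \<in> D \<Longrightarrow> le y x \<Longrightarrow> f \<bullet> x \<bullet> y = z \<Longrightarrow> f \<bullet> x \<bullet> mu f x = z"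
  using axiom_valid[OF E_EFA.mu_found[of v1 v0 "V (0, N \<rightarrow> N \<rightarrow> N)"], of "e0((0, N \<rightarrow> N \<rightarrow> N) := f, (0, N) := x, (1, N) := y)"]
  by (simp add: mu_def)

lemma mu_least: "f \<in> dom (N \<rightarrow> N \<rightarrow> N) \<Longrightarrow> x \<in> D \<Longrightarrow> y \<in> D \<Longrightarrow> le (sc y) (mu f x) \<Longrightarrow> f \<bullet> x \<bullet> y \<noteq> z"
  using axiom_valid[OF E_EFA.mu_least[of v1 "V (0, N \<rightarrow> N \<rightarrow> N)" v0], of "e0((0, N \<rightarrow> N \<rightarrow> N) := f, (0, N) := x, (1, N) := y)"]
  by (simp add: mu_def)

lemma mu_le: "f \<in> dom (N \<rightarrow> N \<rightarrow> N) \<Longrightarrow> x \<in> D \<Longrightarrow> le (mu f x) x"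
  using axiom_valid[OF E_EFA.mu_default[of "V (0, N \<rightarrow> N \<rightarrow> N)" v0], of "e0((0, N \<rightarrow> N \<rightarrow> N) := f, (0, N) := x)"]
  by (auto simp: mu_def z_le)

text \<open>\<open>CMu\<close> applied to a binary functional and x searches up to x and also passes
  x to the functional. Making the functional ignore it yields the search for a zero of a function of
  one argument up to a bound.\<close>

definition kf :: "'a \<Rightarrow> 'a" where "kf f = co (CPi T1 N) \<bullet> f"

lemma kf [simp]: "f \<in> dom T1 \<Longrightarrow> kf f \<in> dom (N \<rightarrow> N \<rightarrow> N)" "f \<in> dom T1 \<Longrightarrow> x \<in> D \<Longrightarrow> kf f \<bullet> x = f"
  by (simp_all add: kf_def K)

lemma axiom_st_valid: "A \<in> B0 \<Longrightarrow> wf_fm A \<Longrightarrow> fmub A \<le> 100 \<Longrightarrow> tenv e \<Longrightarrow> sat A e"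
  by (rule valid) auto

lemma st_ap: "f \<in> dom (\<sigma> \<rightarrow> \<tau>) \<Longrightarrow> x \<in> dom \<sigma> \<Longrightarrow> stp f \<Longrightarrow> stp x \<Longrightarrow> stp (f \<bullet> x)"
  using axiom_st_valid[of "St (V (0, \<sigma> \<rightarrow> \<tau>)) \<^bold>\<and> St (V (1, \<sigma>)) \<^bold>\<longrightarrow> St (V (0, \<sigma> \<rightarrow> \<tau>) \<cdot> V (1, \<sigma>))"
      "e0((0, \<sigma> \<rightarrow> \<tau>) := f, (1, \<sigma>) := x)"] T_st.intros(3)
  by (simp add: B0_def B0_minus_def E_EFA_st_def)

lemma st_co: "stp (co c)"
  using axiom_st_valid[of "St (Cn c)" e0] T_st.intros(2)[of "Cn c"] by (simp add: B0_def B0_minus_def E_EFA_st_def)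

lemma st_le: "stp a \<Longrightarrow> le b a \<Longrightarrow> a \<in> D \<Longrightarrow> b \<in> D \<Longrightarrow> stp b"
  using axiom_st_valid[of "St v0 \<^bold>\<and> v1 \<^bold>\<le> v0 \<^bold>\<longrightarrow> St v1" "e0((0, N) := a, (1, N) := b)"] T_st.intros(4)[of v0 v1]
  by (simp add: B0_def B0_minus_def E_EFA_st_def)

lemma st_val: "wt t \<Longrightarrow> tenv e \<Longrightarrow> (\<And>x. x \<in> tvars t \<Longrightarrow> stp (e x)) \<Longrightarrow> stp (val t e)"
proof (induction t)
  case (App s t)
  then obtain \<sigma> \<tau> where "ty_of s = \<sigma> \<rightarrow> \<tau>" "ty_of t = \<sigma>" "wt s" "wt t"
    by (auto split: ty.splits)
  then show ?case using App st_ap[of "val s e" \<sigma> \<tau> "val t e"] by simp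
qed (auto simp: st_co)

text \<open>The contrapositive of \<open>PF_TP_all\<close> for the negated matrix. No parameters may
  occur, and this is met by the sentences asserting that \<mu> and \<kappa> exist.\<close>

lemma transfer_ex:
  assumes "internal A" "fvars A \<subseteq> {x}" "wf_fm A" "fmub (Ex x A) \<le> 100" "tenv e" "sat (Ex x A) e"
  shows "\<exists>a\<in>dom (snd x). stp a \<and> sat A (e(x := a))"
proof -
  have "(foldr AllSt [x] (Neg A) \<^bold>\<longrightarrow> foldr All [x] (Neg A)) \<in> B0"
    unfolding B0_def using assms by (intro UnI2 PF_TP_all.intros) auto
  then have "sat (foldr AllSt [x] (Neg A) \<^bold>\<longrightarrow> foldr All [x] (Neg A)) e"
    by (rule axiom_st_valid) (use assms in auto)
  then show ?thesis using assms by auto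
qed

definition codeF :: 'a where "codeF = val code_tm e0"

lemma val_code [simp]: "val code_tm e = codeF"
  unfolding codeF_def by (rule val_closed) simp

lemma codeF_D [simp]: "codeF \<in> dom (T1 \<rightarrow> N \<rightarrow> N)" "g \<in> dom T1 \<Longrightarrow> codeF \<bullet> g \<in> dom T1"
proof -
  show *: "codeF \<in> dom (T1 \<rightarrow> N \<rightarrow> N)"
    using val_in[OF tenv_e0, of code_tm "T1 \<rightarrow> N \<rightarrow> N"] by simp
  show "g \<in> dom T1 \<Longrightarrow> codeF \<bullet> g \<in> dom T1" using * ap_dom by blast
qed

lemma psum:
  assumes h: "h \<in> dom T1" and e: "tenv e"
  shows "val psum_tm e \<bullet> h \<bullet> z = z"
    and "x \<in> D \<Longrightarrow> le (h \<bullet> x) (val psum_tm e \<bullet> h \<bullet> sc x)"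
proof -
  let ?Z = "lams [(1, N), (2, N)] (V (0, T1) \<cdot> n2)" and ?V = "lam (2, N) (V (0, T1) \<cdot> n2)"
  let ?t = "lam (0, N) (Cn (CRec N) \<cdot> n0 \<cdot> Zr \<cdot> ?Z \<cdot> ?V)"
  let ?e = "e((0, T1) := h)"
  let ?h = "val ?t ?e"
  have eq: "val psum_tm e \<bullet> h = co CPhi2 \<bullet> ?h" using h e by (simp add: psum_tm_def)
  have hD: "?h \<in> dom T1" using h e by simp
  have u: "ub ?Z = 1" "ub ?V = 1" by (simp_all add: lams_def lam.simps)
  have c: "val ?Z (?e((0, N) := y)) = val ?Z ?e" "val ?V (?e((0, N) := y)) = val ?V ?e" for y
    by (rule val_cong; simp)+
  have h0: "?h \<bullet> z = z"
    using axiom_valid[OF E_EFA.rec_zero[of N Zr ?Z ?V "[]"], of ?e] h e u c by (simp add: apps_def)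
  have hs: "?h \<bullet> sc x = h \<bullet> x" if x: "x \<in> D" for x
  proof -
    have r: "val (Cn (CRec N) \<cdot> n0 \<cdot> Zr \<cdot> ?Z \<cdot> ?V) (?e((0, N) := x)) \<in> D"
      using h e x by (intro val_in) simp_all
    show ?thesis
      using axiom_valid[OF E_EFA.rec_suc[of N n0 Zr ?Z ?V "[]"], of "?e((0, N) := x)"] h e u x r c
      by (simp add: apps_def min_eq_left le_refl)
  qed
  show "val psum_tm e \<bullet> h \<bullet> z = z" unfolding eq using hD h0 by (simp add: Phi2_z)
  show "le (h \<bullet> x) (val psum_tm e \<bullet> h \<bullet> sc x)" if "x \<in> D"
    unfolding eq using Phi2_ge[OF hD, of "sc x"] hs that by simp
qed

text \<open>What the argument takes from the coding: the empty segment has code 0, and the code of a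
  nonempty segment exceeds its last value, because the summand for that value is a power of 2 with
  an exponent at least as large.\<close>

lemma code:
  assumes g: "g \<in> dom T1"
  shows "codeF \<bullet> g \<bullet> z = z" and "x \<in> D \<Longrightarrow> le (sc (g \<bullet> x)) (codeF \<bullet> g \<bullet> sc x)"
proof -
  let ?t = "lam (0, N) (pow2 (Cn CA1 \<cdot> n0 \<cdot> (Cn CPhi2 \<cdot> V (0, T1) \<cdot> n0)))"
  let ?e = "e0((0, T1) := g)"
  let ?h = "val ?t ?e"
  have hD: "?h \<in> dom T1" using g by simp
  have eq: "codeF \<bullet> g = val psum_tm ?e \<bullet> ?h" using g unfolding codeF_def by (simp add: code_tm_def del: val_code)
  show "codeF \<bullet> g \<bullet> z = z" unfolding eq using psum(1)[OF hD] g by simp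
  assume x: "x \<in> D"
  let ?p = "pl x (co CPhi2 \<bullet> g \<bullet> x)"
  have hx: "?h \<bullet> x = pw (sc (sc z)) ?p" using g x by (simp add: pow2_def)
  have "le (sc (g \<bullet> x)) (sc ?p)"
    using suc_mono[OF le_trans[OF Phi2_ge[OF g x] le_pl2[of x]]] g x by simp
  then have "le (sc (g \<bullet> x)) (?h \<bullet> x)"
    unfolding hx using le_trans[of "sc (g \<bullet> x)" "sc ?p" "pw (sc (sc z)) ?p"] self_le_pw[of ?p] g x by simp
  then show "le (sc (g \<bullet> x)) (codeF \<bullet> g \<bullet> sc x)"
    unfolding eq using le_trans[OF _ psum(2)[OF hD]] g x hD
      val_in[of ?e "psum_tm \<cdot> ?t" T1] by simp
qed

end

section \<open>Closed terms for Grilliot's trick and for the search for paths\<close>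

definition TRT :: tm where
  "TRT = lams [(0, N), (0, T1), (1, N)] (cndT (mnT (Sc (V (1, N))) (V (0, N))) (Sc Zr) (V (0, T1) \<cdot> V (1, N)))"

definition oneT :: tm where "oneT = Cn (CPi N N) \<cdot> Sc Zr"

text \<open>\<open>TRT\<close> overwrites the first n values of a function with 1. A zero of the
  present functional is a function that Y still separates from the constant 1 after this change;
  among the binary functions \<kappa> can look for one.\<close>

definition WT :: tm where
  "WT = lams [(0, T2), (0, N), (0, T1)]
     (cndT (eqT (V (0, T2) \<cdot> (TRT \<cdot> V (0, N) \<cdot> V (0, T1))) (V (0, T2) \<cdot> oneT)) (Sc Zr) Zr)"

text \<open>A sequence of functions converging to the constant 1: the n-th member is 1 below n, and
  \<kappa> chooses the rest so that Y takes another value than at the limit, if this is possible at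
  all.\<close>

definition GT :: tm where
  "GT = lams [(0, T2), (0, T2 \<rightarrow> T1), (0, N)]
     (TRT \<cdot> V (0, N) \<cdot> (V (0, T2 \<rightarrow> T1) \<cdot> (WT \<cdot> V (0, T2) \<cdot> V (0, N))))"

text \<open>Grilliot's function. If f has a least zero m, it is the m-th member of the sequence
  \<open>GT\<close>, otherwise the constant 1. Since these agree below m, the argument itself can
  serve as the bound of the search for m, and no unbounded search enters the definition.\<close>

definition HT :: tm where
  "HT = (let m = Cn CMu \<cdot> (Cn (CPi T1 N) \<cdot> V (0, T1)) \<cdot> V (0, N) in
     lams [(0, T2), (0, T2 \<rightarrow> T1), (0, T1), (0, N)]
       (cndT (V (0, T1) \<cdot> m) (GT \<cdot> V (0, T2) \<cdot> V (0, T2 \<rightarrow> T1) \<cdot> m \<cdot> V (0, N)) (Sc Zr)))"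

definition ET :: tm where
  "ET = lams [(0, T2), (0, T2 \<rightarrow> T1), (0, T1)]
     (cndT (eqT (V (0, T2) \<cdot> (HT \<cdot> V (0, T2) \<cdot> V (0, T2 \<rightarrow> T1) \<cdot> V (0, T1))) (V (0, T2) \<cdot> oneT)) (Sc Zr) Zr)"

definition prT :: "tm \<Rightarrow> tm \<Rightarrow> tm" where
  "prT n m = Cn CA1 \<cdot> (Cn CA2 \<cdot> (Cn CA1 \<cdot> n \<cdot> m) \<cdot> (Cn CA1 \<cdot> n \<cdot> m)) \<cdot> n"

text \<open>A function is represented by the binary characteristic function of its graph, with 0 for
  membership. The search functional recovers its value at n from the graph.\<close>

definition decT :: tm where
  "decT = lams [(0, T2), (0, T1), (0, N)] (V (0, T2) \<cdot> lam (1, N) (V (0, T1) \<cdot> prT (V (0, N)) (V (1, N))))"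

text \<open>The number quantifier is asked for a place at which the path condition fails. Both case
  distinctions therefore exchange 0 and 1, so that 0 again means truth.\<close>

definition PT :: tm where
  "PT = lams [(0, T2), (1, T2), (0, T1), (1, T1)]
     (cndT (V (0, T2) \<cdot> lam (0, N)
        (cndT (V (0, T1) \<cdot> (code_tm \<cdot> (decT \<cdot> V (1, T2) \<cdot> V (1, T1)) \<cdot> V (0, N))) (Sc Zr) Zr)) (Sc Zr) Zr)"

definition muT :: tm where
  "muT = lams [(0, T2), (1, T2), (0, T2 \<rightarrow> T1), (0, T1)]
     (decT \<cdot> V (1, T2) \<cdot> (V (0, T2 \<rightarrow> T1) \<cdot> (PT \<cdot> V (0, T2) \<cdot> V (1, T2) \<cdot> V (0, T1))))"

lemma tvars_fun_terms [simp]: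
  "tvars TRT = {}" "tvars oneT = {}" "tvars WT = {}" "tvars GT = {}" "tvars HT = {}" "tvars ET = {}"
  "tvars (prT n m) = tvars n \<union> tvars m" "tvars decT = {}" "tvars PT = {}" "tvars muT = {}"
proof -
  show a: "tvars TRT = {}" "tvars oneT = {}" by (auto simp: TRT_def oneT_def)
  show b: "tvars WT = {}" by (auto simp: WT_def a)
  show c: "tvars GT = {}" by (auto simp: GT_def a b)
  show d: "tvars HT = {}" by (auto simp: HT_def Let_def c)
  show "tvars ET = {}" by (auto simp: ET_def a d)
  show p: "tvars (prT n m) = tvars n \<union> tvars m" for n m by (auto simp: prT_def)
  show e: "tvars decT = {}" by (auto simp: decT_def p)
  show f: "tvars PT = {}" by (auto simp: PT_def e)
  show "tvars muT = {}" by (auto simp: muT_def e f)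
qed

context b0
begin

lemma fun_terms_typed [simp]:
  "wt TRT" "ty_of TRT = N \<rightarrow> T1 \<rightarrow> T1" "wt oneT" "ty_of oneT = T1" "wt WT" "ty_of WT = T2 \<rightarrow> N \<rightarrow> T2"
  "wt GT" "ty_of GT = T2 \<rightarrow> (T2 \<rightarrow> T1) \<rightarrow> N \<rightarrow> T1"
  "wt HT" "ty_of HT = T2 \<rightarrow> (T2 \<rightarrow> T1) \<rightarrow> T1 \<rightarrow> T1" "wt ET" "ty_of ET = T2 \<rightarrow> (T2 \<rightarrow> T1) \<rightarrow> T2"
  "wt decT" "ty_of decT = T2 \<rightarrow> T1 \<rightarrow> T1" "wt PT" "ty_of PT = T2 \<rightarrow> T2 \<rightarrow> T1 \<rightarrow> T2"
  "wt muT" "ty_of muT = T2 \<rightarrow> T2 \<rightarrow> (T2 \<rightarrow> T1) \<rightarrow> T1 \<rightarrow> T1"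
proof -
  show a: "wt TRT" "ty_of TRT = N \<rightarrow> T1 \<rightarrow> T1" "wt oneT" "ty_of oneT = T1" by (simp_all add: TRT_def oneT_def)
  show b: "wt WT" "ty_of WT = T2 \<rightarrow> N \<rightarrow> T2" by (simp_all add: WT_def a)
  show c: "wt GT" "ty_of GT = T2 \<rightarrow> (T2 \<rightarrow> T1) \<rightarrow> N \<rightarrow> T1" by (simp_all add: GT_def a b)
  show d: "wt HT" "ty_of HT = T2 \<rightarrow> (T2 \<rightarrow> T1) \<rightarrow> T1 \<rightarrow> T1" by (simp_all add: HT_def Let_def c)
  show "wt ET" "ty_of ET = T2 \<rightarrow> (T2 \<rightarrow> T1) \<rightarrow> T2" by (simp_all add: ET_def a d)
  show e: "wt decT" "ty_of decT = T2 \<rightarrow> T1 \<rightarrow> T1" by (simp_all add: decT_def prT_def)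
  show f: "wt PT" "ty_of PT = T2 \<rightarrow> T2 \<rightarrow> T1 \<rightarrow> T2" by (simp_all add: PT_def e)
  show "wt muT" "ty_of muT = T2 \<rightarrow> T2 \<rightarrow> (T2 \<rightarrow> T1) \<rightarrow> T1 \<rightarrow> T1" by (simp_all add: muT_def e f)
qed

definition tr where "tr = val TRT e0"
definition oneF where "oneF = val oneT e0"
definition wF where "wF = val WT e0"
definition gF where "gF = val GT e0"
definition hF where "hF = val HT e0"
definition eF where "eF = val ET e0"
definition decF where "decF = val decT e0"
definition pF where "pF = val PT e0"
definition muF where "muF = val muT e0"

lemma val_fun_terms [simp]:
  "val TRT e = tr" "val oneT e = oneF" "val WT e = wF" "val GT e = gF" "val HT e = hF" "val ET e = eF"
  "val decT e = decF" "val PT e = pF" "val muT e = muF"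
  unfolding tr_def oneF_def wF_def gF_def hF_def eF_def decF_def pF_def muF_def
  by (rule val_closed, simp)+

lemma fun_dom:
  "tr \<in> dom (N \<rightarrow> T1 \<rightarrow> T1)" "oneF \<in> dom T1" "wF \<in> dom (T2 \<rightarrow> N \<rightarrow> T2)" "gF \<in> dom (T2 \<rightarrow> (T2 \<rightarrow> T1) \<rightarrow> N \<rightarrow> T1)"
  "hF \<in> dom (T2 \<rightarrow> (T2 \<rightarrow> T1) \<rightarrow> T1 \<rightarrow> T1)" "eF \<in> dom (T2 \<rightarrow> (T2 \<rightarrow> T1) \<rightarrow> T2)" "decF \<in> dom (T2 \<rightarrow> T1 \<rightarrow> T1)"
  "pF \<in> dom (T2 \<rightarrow> T2 \<rightarrow> T1 \<rightarrow> T2)" "muF \<in> dom (T2 \<rightarrow> T2 \<rightarrow> (T2 \<rightarrow> T1) \<rightarrow> T1 \<rightarrow> T1)"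
  unfolding tr_def oneF_def wF_def gF_def hF_def eF_def decF_def pF_def muF_def
  by (rule val_in; simp del: val_fun_terms)+

lemma kap_D [simp]: "k \<in> dom (T2 \<rightarrow> T1) \<Longrightarrow> Y \<in> dom T2 \<Longrightarrow> k \<bullet> Y \<in> dom T1"
  using ap_dom by blast

lemma fun_app_dom [simp]:
  "n \<in> D \<Longrightarrow> g \<in> dom T1 \<Longrightarrow> tr \<bullet> n \<bullet> g \<in> dom T1" "oneF \<in> dom T1"
  "Y \<in> dom T2 \<Longrightarrow> n \<in> D \<Longrightarrow> wF \<bullet> Y \<bullet> n \<in> dom T2"
  "Y \<in> dom T2 \<Longrightarrow> k \<in> dom (T2 \<rightarrow> T1) \<Longrightarrow> n \<in> D \<Longrightarrow> gF \<bullet> Y \<bullet> k \<bullet> n \<in> dom T1"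
  "Y \<in> dom T2 \<Longrightarrow> k \<in> dom (T2 \<rightarrow> T1) \<Longrightarrow> f \<in> dom T1 \<Longrightarrow> hF \<bullet> Y \<bullet> k \<bullet> f \<in> dom T1"
  "Y \<in> dom T2 \<Longrightarrow> k \<in> dom (T2 \<rightarrow> T1) \<Longrightarrow> eF \<bullet> Y \<bullet> k \<in> dom T2"
  "Y \<in> dom T2 \<Longrightarrow> f \<in> dom T1 \<Longrightarrow> decF \<bullet> Y \<bullet> f \<in> dom T1"
  "X \<in> dom T2 \<Longrightarrow> Y \<in> dom T2 \<Longrightarrow> f \<in> dom T1 \<Longrightarrow> pF \<bullet> X \<bullet> Y \<bullet> f \<in> dom T2"
  "X \<in> dom T2 \<Longrightarrow> Y \<in> dom T2 \<Longrightarrow> k \<in> dom (T2 \<rightarrow> T1) \<Longrightarrow> muF \<bullet> X \<bullet> Y \<bullet> k \<in> dom (T1 \<rightarrow> T1)"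
  using fun_dom by (meson ap_dom)+

lemma oneF [simp]: "n \<in> D \<Longrightarrow> oneF \<bullet> n = sc z"
  unfolding oneF_def by (simp add: oneT_def K del: val_fun_terms)

lemma tr [simp]: "n \<in> D \<Longrightarrow> g \<in> dom T1 \<Longrightarrow> m \<in> D \<Longrightarrow> tr \<bullet> n \<bullet> g \<bullet> m = (if le (sc m) n then sc z else g \<bullet> m)"
  unfolding tr_def by (simp add: TRT_def del: val_fun_terms)

lemma wF [simp]: "Y \<in> dom T2 \<Longrightarrow> n \<in> D \<Longrightarrow> g \<in> dom T1
  \<Longrightarrow> wF \<bullet> Y \<bullet> n \<bullet> g = (if Y \<bullet> (tr \<bullet> n \<bullet> g) = Y \<bullet> oneF then sc z else z)"
  unfolding wF_def by (simp add: WT_def del: val_fun_terms(3))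

lemma gF [simp]: "Y \<in> dom T2 \<Longrightarrow> k \<in> dom (T2 \<rightarrow> T1) \<Longrightarrow> n \<in> D \<Longrightarrow> gF \<bullet> Y \<bullet> k \<bullet> n = tr \<bullet> n \<bullet> (k \<bullet> (wF \<bullet> Y \<bullet> n))"
  unfolding gF_def by (simp add: GT_def del: val_fun_terms(4))

lemma hF [simp]: "Y \<in> dom T2 \<Longrightarrow> k \<in> dom (T2 \<rightarrow> T1) \<Longrightarrow> f \<in> dom T1 \<Longrightarrow> n \<in> D \<Longrightarrow>
   hF \<bullet> Y \<bullet> k \<bullet> f \<bullet> n = (if f \<bullet> mu (kf f) n = z then gF \<bullet> Y \<bullet> k \<bullet> mu (kf f) n \<bullet> n else sc z)"
  unfolding hF_def using mu_D[of "kf f" n]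
  by (simp add: HT_def Let_def kf_def[symmetric] mu_def[symmetric] del: val_fun_terms(5) gF)

lemma eF [simp]: "Y \<in> dom T2 \<Longrightarrow> k \<in> dom (T2 \<rightarrow> T1) \<Longrightarrow> f \<in> dom T1 \<Longrightarrow>
   eF \<bullet> Y \<bullet> k \<bullet> f = (if Y \<bullet> (hF \<bullet> Y \<bullet> k \<bullet> f) = Y \<bullet> oneF then sc z else z)"
  unfolding eF_def by (simp add: ET_def del: val_fun_terms(6))

lemma one_neq_zero [simp]: "sc z \<noteq> z" using suc_ne by simp

lemma fun_st: "stp tr" "stp oneF" "stp wF"
  unfolding tr_def oneF_def wF_def by (rule st_val; simp del: val_fun_terms)+

definition bin :: "'a \<Rightarrow> bool" where "bin f \<longleftrightarrow> (\<forall>n\<in>D. le (f \<bullet> n) (sc z))"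

definition is_kappa :: "'a \<Rightarrow> bool" where
  "is_kappa k \<longleftrightarrow> (\<forall>Y\<in>dom T2. (\<exists>f\<in>dom T1. bin f \<and> Y \<bullet> f = z) \<longrightarrow> Y \<bullet> (k \<bullet> Y) = z \<and> bin (k \<bullet> Y))"

lemma sat_binary: "tenv e \<Longrightarrow> wt f \<Longrightarrow> ty_of f = T1 \<Longrightarrow> sat (binary f) e \<longleftrightarrow> bin (val f e)"
proof -
  have "(ub f, N) \<notin> tvars f" using tvars_ub by fastforce
  then show "tenv e \<Longrightarrow> wt f \<Longrightarrow> ty_of f = T1 \<Longrightarrow> ?thesis"
    by (simp add: binary_def bin_def val_upd_fresh Let_def)
qed

lemma kappa_st: assumes e: "tenv e" shows "\<exists>k\<in>dom (T2 \<rightarrow> T1). stp k \<and> is_kappa k"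
proof -
  let ?B = "All (0, T2) (Ex (0, T1) (binary (V (0, T1)) \<^bold>\<and> V (0, T2) \<cdot> V (0, T1) \<^bold>= Zr) \<^bold>\<longrightarrow>
        V (0, T2) \<cdot> (V (0, T2 \<rightarrow> T1) \<cdot> V (0, T2)) \<^bold>= Zr \<^bold>\<and> binary (V (0, T2 \<rightarrow> T1) \<cdot> V (0, T2)))"
  have k: "kappa3 = Ex (0, T2 \<rightarrow> T1) ?B" by (simp add: kappa3_def Let_def)
  have w: "wf_fm ?B" "fmub (Ex (0, T2 \<rightarrow> T1) ?B) \<le> 100" "fvars ?B \<subseteq> {(0, T2 \<rightarrow> T1)}" "internal ?B"
    by (auto simp: binary_def Let_def)
  have "sat (Ex (0, T2 \<rightarrow> T1) ?B) e" unfolding k[symmetric]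
    by (rule valid) (use e w in \<open>auto simp only: k Un_iff insert_iff wf_fm_connectives\<close>)
  from transfer_ex[OF w(4,3,1,2) e this] obtain k where
    k: "k \<in> dom (T2 \<rightarrow> T1)" "stp k" "sat ?B (e((0, T2 \<rightarrow> T1) := k))" by auto
  have "is_kappa k" unfolding is_kappa_def
    using k e by (simp add: sat_binary)
  then show ?thesis using k by blast
qed

section \<open>From transfer for paths to the number quantifier, search and \<mu>\<close>

definition path :: "'a \<Rightarrow> 'a \<Rightarrow> bool" where
  "path f g \<longleftrightarrow> (\<forall>x\<in>D. f \<bullet> (codeF \<bullet> g \<bullet> x) = z)"

lemma sat_mu1: "tenv e \<Longrightarrow> sat mu1 e \<longleftrightarrow>
  (\<exists>\<mu>\<in>dom (T1 \<rightarrow> T1). \<forall>f\<in>dom T1. (\<exists>g\<in>dom T1. path f g) \<longrightarrow> path f (\<mu> \<bullet> f))"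
  by (simp add: mu1_def Let_def path_def)

lemma sat_TRANS: "tenv e \<Longrightarrow> sat Pi11_TRANS e \<longleftrightarrow>
  (\<forall>f\<in>dom T1. stp f \<longrightarrow> (\<exists>g\<in>dom T1. path f g) \<longrightarrow> (\<exists>g\<in>dom T1. stp g \<and> path f g))"
  by (simp add: Pi11_TRANS_def Let_def path_def)

lemma mu1_imp_TRANS:
  assumes e: "tenv e" and m: "sat mu1 e" shows "sat Pi11_TRANS e"
proof -
  let ?A = "All (0, T1) (Ex (1, T1) (All (0, N) (V (0, T1) \<cdot> (code_tm \<cdot> V (1, T1) \<cdot> V (0, N)) \<^bold>= Zr)) \<^bold>\<longrightarrow>
        All (0, N) (V (0, T1) \<cdot> (code_tm \<cdot> (V (0, T1 \<rightarrow> T1) \<cdot> V (0, T1)) \<cdot> V (0, N)) \<^bold>= Zr))"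
  have m1: "mu1 = Ex (0, T1 \<rightarrow> T1) ?A" by (simp add: mu1_def Let_def)
  have "\<exists>\<mu>\<in>dom (snd (0 :: nat, T1 \<rightarrow> T1)). stp \<mu> \<and> sat ?A (e((0, T1 \<rightarrow> T1) := \<mu>))"
    by (rule transfer_ex) (use e m[unfolded m1] in auto)
  then obtain \<mu> where \<mu>: "\<mu> \<in> dom (T1 \<rightarrow> T1)" "stp \<mu>"
    "\<forall>f\<in>dom T1. (\<exists>g\<in>dom T1. path f g) \<longrightarrow> path f (\<mu> \<bullet> f)"
    using e by (auto simp: path_def)
  then have "f \<in> dom T1 \<Longrightarrow> stp f \<Longrightarrow> \<mu> \<bullet> f \<in> dom T1 \<and> stp (\<mu> \<bullet> f)" for f
    using ap_dom st_ap by blast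
  then show ?thesis unfolding sat_TRANS[OF e] using \<mu> by blast
qed

text \<open>The tree F accepts the empty sequence and every code s such that f has a zero up to s.
  The function with constant value n is a path, as the codes of its nonempty segments exceed n. A
  standard path has a standard segment of length 1, whose code bounds a zero of f, and numbers below
  a standard number are standard.\<close>

lemma TRANS_Pi01:
  assumes e: "tenv e" and t: "sat Pi11_TRANS e" and f: "f \<in> dom T1" "stp f" and n: "n \<in> D" "f \<bullet> n = z"
  shows "\<exists>n\<in>D. stp n \<and> f \<bullet> n = z"
proof -
  let ?t = "lam (0, N) (cndT (V (0, N)) Zr (V (0, T1) \<cdot> (Cn CMu \<cdot> (Cn (CPi T1 N) \<cdot> V (0, T1)) \<cdot> V (0, N))))"
  define F where "F = val ?t (e0((0, T1) := f))"
  have F: "F \<in> dom T1" unfolding F_def using f by simp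
  have Fs: "stp F" unfolding F_def by (rule st_val) (use f in auto)
  have Fa: "F \<bullet> s = (if s = z then z else f \<bullet> mu (kf f) s)" if "s \<in> D" for s
    using that f mu_D[of "kf f" s] unfolding F_def
    by (simp add: kf_def[symmetric] mu_def[symmetric])
  have Fz: "F \<bullet> s = z" if s: "s \<in> D" "m \<in> D" "le m s" "f \<bullet> m = z" for s m
    using Fa[OF s(1)] mu_found[of "kf f" s m] s f by simp
  let ?g = "co (CPi N N) \<bullet> n"
  have g: "?g \<in> dom T1" using n by simp
  have "F \<bullet> (codeF \<bullet> ?g \<bullet> x) = z" if x: "x \<in> D" for x
  proof -
    consider "x = z" | y where "y \<in> D" "x = sc y" using zero_or_suc x by blast
    then show ?thesis
    proof cases
      case 1
      then show ?thesis using code(1)[OF g] Fa by simp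
    next
      case 2
      then have "le n (codeF \<bullet> ?g \<bullet> x)"
        using code(2)[OF g, of y] K[of n N y N] le_trans[of n "sc n" "codeF \<bullet> ?g \<bullet> x"] le_suc_self n g by simp
      then show ?thesis using Fz[of _ n] n g x by simp
    qed
  qed
  then have "path F ?g" by (simp add: path_def)
  then obtain g where g: "g \<in> dom T1" "stp g" "path F g"
    using t F Fs \<open>?g \<in> dom T1\<close> unfolding sat_TRANS[OF e] by blast
  \<comment> \<open>The segment must be nonempty: at the empty one F is 0 regardless of f.\<close>
  let ?s = "codeF \<bullet> g \<bullet> sc z"
  have "stp codeF" unfolding codeF_def by (rule st_val) (auto simp del: val_code)
  then have s: "?s \<in> D" "stp ?s"
    using g st_ap[of codeF T1 T1 g] st_ap[of "codeF \<bullet> g" N N "sc z"] st_ap[of "co CSuc" N N z] by (simp_all add: st_co)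
  have s0: "F \<bullet> ?s = z" using g by (simp add: path_def)
  have "?s \<noteq> z"
    using code(2)[OF g(1), of z] le_z[of "sc (g \<bullet> z)"] suc_ne[of "g \<bullet> z"] g by auto
  then have "f \<bullet> mu (kf f) ?s = z" using s0 Fa s by simp
  moreover have "mu (kf f) ?s \<in> D" "le (mu (kf f) ?s) ?s" using mu_D mu_le f s by simp_all
  ultimately show ?thesis using st_le s by blast
qed

definition lenF where "lenF = val (len_tm N) e0"
definition compF where "compF = val (comp_tm N) e0"
definition imgF where "imgF = val (img_tm T1 N) e0"

lemma val_seq [simp]: "val (len_tm N) e = lenF" "val (comp_tm N) e = compF" "val (img_tm T1 N) e = imgF"
  unfolding lenF_def compF_def imgF_def by (rule val_closed, simp)+

text \<open>For each standard f the choice axiom yields a finite sequence that contains a zero. The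
  maximum of its components, computed by \<open>CPhi1\<close>, is a single number bounding that
  zero, and it depends on f through a standard functional.\<close>

lemma zero_bound:
  assumes e: "tenv e" and t: "sat Pi11_TRANS e"
  shows "\<exists>Z\<in>dom T2. stp Z \<and> (\<forall>f\<in>dom T1. stp f \<longrightarrow> (\<exists>n\<in>D. f \<bullet> n = z) \<longrightarrow> (\<exists>n\<in>D. le n (Z \<bullet> f) \<and> f \<bullet> n = z))"
proof -
  \<comment> \<open>The premise of \<open>HAC_int\<close> speaks of every standard f, so the formula
    is made to hold trivially for functions without a zero.\<close>
  let ?A = "Ex (1, N) (V (0, T1) \<cdot> V (1, N) \<^bold>= Zr) \<^bold>\<longrightarrow> V (0, T1) \<cdot> V (0, N) \<^bold>= Zr"
  let ?H = "AllSt (0, T1) (ExSt (0, N) ?A) \<^bold>\<longrightarrow>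
    ExSt (0, T2) (AllSt (0, T1) (Ex (0, N) (Mem N (V (0, N)) (img_tm T1 N \<cdot> V (0, T2) \<cdot> V (0, T1)) \<^bold>\<and> ?A)))"
  have "?H \<in> B0"
    using HAC_int.intros[of ?A "(0, T2)" "(0, T1)" "(0, N)"] by (simp add: B0_def B0_minus_def)
  then have "sat ?H e" by (rule axiom_st_valid) (use e in \<open>simp_all add: Mem_def Let_def\<close>)
  moreover have "\<exists>n\<in>D. stp n \<and> ((\<exists>m\<in>D. f \<bullet> m = z) \<longrightarrow> f \<bullet> n = z)" if "f \<in> dom T1" "stp f" for f
    using TRANS_Pi01[OF e t that] st_co z_D by blast
  ultimately obtain Y where Y: "Y \<in> dom T2" "stp Y" and
    *: "\<And>f. f \<in> dom T1 \<Longrightarrow> stp f \<Longrightarrow> \<exists>n\<in>D. (\<exists>i\<in>D. le (sc i) (lenF \<bullet> (imgF \<bullet> Y \<bullet> f)) \<and>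
          n = compF \<bullet> (imgF \<bullet> Y \<bullet> f) \<bullet> i) \<and> ((\<exists>m\<in>D. f \<bullet> m = z) \<longrightarrow> f \<bullet> n = z)"
    using e by (auto simp: Mem_def Let_def)
  let ?t = "lam (0, T1) (Cn CPhi1 \<cdot>
      lam (0, N) (comp_tm N \<cdot> (img_tm T1 N \<cdot> V (0, T2) \<cdot> V (0, T1)) \<cdot> V (0, N))
      \<cdot> (len_tm N \<cdot> (img_tm T1 N \<cdot> V (0, T2) \<cdot> V (0, T1))))"
  define Z where "Z = val ?t (e0((0, T2) := Y))"
  have Z: "Z \<in> dom T2" "stp Z" unfolding Z_def using Y by (auto intro!: st_val)
  have "\<exists>n\<in>D. le n (Z \<bullet> f) \<and> f \<bullet> n = z" if f: "f \<in> dom T1" "stp f" "\<exists>n\<in>D. f \<bullet> n = z" for f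
  proof -
    let ?e = "e0((0, T2) := Y, (0, T1) := f)"
    let ?s = "imgF \<bullet> Y \<bullet> f"
    let ?F = "val (lam (0, N) (comp_tm N \<cdot> (img_tm T1 N \<cdot> V (0, T2) \<cdot> V (0, T1)) \<cdot> V (0, N))) ?e"
    let ?l = "lenF \<bullet> ?s"
    obtain n i where n: "n \<in> D" "f \<bullet> n = z" "i \<in> D" "le (sc i) ?l" "n = compF \<bullet> ?s \<bullet> i"
      using *[OF f(1,2)] f(3) by blast
    have F: "?F \<in> dom T1" using f Y by simp
    have l: "?l \<in> D" using val_in[of ?e "len_tm N \<cdot> (img_tm T1 N \<cdot> V (0, T2) \<cdot> V (0, T1))" N] f Y by simp
    have "Z \<bullet> f = co CPhi1 \<bullet> ?F \<bullet> ?l" unfolding Z_def using f Y by simp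
    moreover have "?F \<bullet> i = n" using n f Y by simp
    moreover have "le i ?l" using n l le_trans[of i "sc i" ?l] le_suc_self by simp
    ultimately have "le n (Z \<bullet> f)" using Phi1_ge[OF F n(3) l] by simp
    then show ?thesis using n by blast
  qed
  then show ?thesis using Z by blast
qed

lemma number_quantifier:
  assumes e: "tenv e" and t: "sat Pi11_TRANS e"
  shows "\<exists>E\<in>dom T2. \<forall>f\<in>dom T1. E \<bullet> f = z \<longleftrightarrow> (\<exists>n\<in>D. f \<bullet> n = z)"
proof -
  obtain Z where Z: "Z \<in> dom T2" "stp Z" and Zb: "\<And>f. f \<in> dom T1 \<Longrightarrow> stp f \<Longrightarrow> \<exists>n\<in>D. f \<bullet> n = z \<Longrightarrow>
      \<exists>n\<in>D. le n (Z \<bullet> f) \<and> f \<bullet> n = z" using zero_bound[OF e t] by blast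
  obtain k where k: "k \<in> dom (T2 \<rightarrow> T1)" "stp k" "is_kappa k" using kappa_st[OF e] by blast
  let ?one = "sc z"
  let ?G = "\<lambda>n. gF \<bullet> Z \<bullet> k \<bullet> n"
  let ?W = "\<lambda>n. wF \<bullet> Z \<bullet> n"
  let ?b = "\<lambda>n. ?W n \<bullet> (k \<bullet> ?W n)"
  have trtr: "tr \<bullet> n \<bullet> (tr \<bullet> m \<bullet> g) = tr \<bullet> m \<bullet> g" if "n \<in> D" "m \<in> D" "g \<in> dom T1" "le n m" for n m g
  proof (rule ext[of _ N N])
    fix x assume x: "x \<in> D"
    then show "tr \<bullet> n \<bullet> (tr \<bullet> m \<bullet> g) \<bullet> x = tr \<bullet> m \<bullet> g \<bullet> x"
      using that le_trans[of "sc x" n m] by simp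
  qed (use that in auto)
  \<comment> \<open>For every n, nonstandard ones included, \<kappa> finds a binary function that Z
    separates from the constant 1 although its first n values are overwritten with 1. The numbers
    for which this fails are the zeros of a standard function, so if there is one, there is a
    standard one.\<close>
  have all: "?b n = z" if n: "n \<in> D" for n
  proof (rule ccontr)
    assume nb: "?b n \<noteq> z"
    let ?t = "lam (0, N) (cndT (WT \<cdot> V (0, T2) \<cdot> V (0, N) \<cdot> (V (0, T2 \<rightarrow> T1) \<cdot> (WT \<cdot> V (0, T2) \<cdot> V (0, N)))) (Sc Zr) Zr)"
    define b where "b = val ?t (e0((0, T2) := Z, (0, T2 \<rightarrow> T1) := k))"
    have b: "b \<in> dom T1" "stp b" unfolding b_def using Z k by (auto intro!: st_val)
    have bv: "b \<bullet> m = cd (?b m) ?one z" if "m \<in> D" for m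
      unfolding b_def using Z k that by (simp del: wF cd)
    have bz: "b \<bullet> m = z \<longleftrightarrow> ?b m \<noteq> z" if "m \<in> D" for m
    proof -
      have "?b m \<in> D" using Z k that by (simp del: wF)
      then show ?thesis using bv[OF that] cd[of "?b m" ?one z] by simp
    qed
    obtain m where m: "m \<in> D" "stp m" "?b m \<noteq> z"
      using TRANS_Pi01[OF e t b n] bz nb n by blast
    have all: "Z \<bullet> (tr \<bullet> m \<bullet> g) = Z \<bullet> oneF" if "g \<in> dom T1" "bin g" for g
    proof (rule ccontr)
      assume "Z \<bullet> (tr \<bullet> m \<bullet> g) \<noteq> Z \<bullet> oneF"
      then have "?W m \<bullet> g = z" using Z m that by simp
      then have "?b m = z" using k(3) Z m that unfolding is_kappa_def by (metis fun_app_dom(3))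
      then show False using m by simp
    qed
    \<comment> \<open>After a failure at m, Z ignores the values of binary functions from m on, once
      they are 1 below m. The standard function that is 1 below K and 0 from K on is then sent to l,
      its value at the constant 1; but l would have to bound one of its zeros, and K exceeds
      l.\<close>
    let ?l = "Z \<bullet> oneF"
    let ?K = "mx m (sc ?l)"
    let ?zf = "co (CPi N N) \<bullet> z"
    let ?g = "tr \<bullet> ?K \<bullet> ?zf"
    have l: "?l \<in> D" using Z by simp
    have KD: "?K \<in> D" "le m ?K" "le (sc ?l) ?K" using le_mx[of m "sc ?l"] l m by simp_all
    have zf: "?zf \<in> dom T1" "\<And>x. x \<in> D \<Longrightarrow> ?zf \<bullet> x = z" by (simp_all add: K[of z N _ N])
    have g: "?g \<in> dom T1" using KD zf by simp
    have "bin ?g" unfolding bin_def using KD zf by (simp add: le_refl z_le)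
    then have Zg: "Z \<bullet> ?g = ?l" using all[OF g] trtr[of m ?K ?zf] KD zf m by simp
    have "stp ?l" using Z fun_st st_ap[of Z T1 N oneF] by simp
    then have "stp (sc ?l)" using st_ap[of "co CSuc" N N ?l] st_co l by simp
    then have "stp ?K" using m l st_ap[of "co CMax" N "N \<rightarrow> N" m] st_ap[of "co CMax \<bullet> m" N N "sc ?l"] st_co
      ap_dom[of "co CMax" N "N \<rightarrow> N" m] by simp
    moreover have "stp ?zf" using st_ap[of "co (CPi N N)" N "N \<rightarrow> N" z] co_dom[of "CPi N N"] st_co by simp
    ultimately have "stp ?g"
      using KD zf fun_st fun_dom(1) st_ap[of tr N "T1 \<rightarrow> T1" ?K] st_ap[of "tr \<bullet> ?K" T1 T1 ?zf]
        ap_dom[of tr N "T1 \<rightarrow> T1" ?K] by simp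
    moreover have "?g \<bullet> ?K = z" using KD zf not_suc_le by simp
    ultimately obtain x where x: "x \<in> D" "le x ?l" "?g \<bullet> x = z" using Zb[OF g] KD Zg by metis
    then have "le (sc x) ?K" using le_trans[of "sc x" "sc ?l" ?K] suc_mono[of x ?l] l KD by simp
    then show False using x KD zf by simp
  qed
  \<comment> \<open>The point of discontinuity: the functions \<open>?G n\<close> converge to the
    constant 1, and Z never takes its value at the limit on them.\<close>
  have G: "?G n \<in> dom T1" "Z \<bullet> (?G n) \<noteq> Z \<bullet> oneF" if "n \<in> D" for n
    using all[OF that] Z k that by (auto split: if_splits)
  have G1: "?G n \<bullet> x = ?one" if "n \<in> D" "x \<in> D" "le (sc x) n" for n x
    using that Z k by simp
  let ?E = "eF \<bullet> Z \<bullet> k"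
  have "?E \<bullet> f = z \<longleftrightarrow> (\<exists>n\<in>D. f \<bullet> n = z)" if f: "f \<in> dom T1" for f
  proof -
    let ?h = "hF \<bullet> Z \<bullet> k \<bullet> f"
    have h: "?h \<in> dom T1" using Z k f by simp
    have hn: "?h \<bullet> n = (if f \<bullet> mu (kf f) n = z then ?G (mu (kf f) n) \<bullet> n else ?one)" if "n \<in> D" for n
      by (rule hF) (use Z k f that in auto)
    have "Z \<bullet> ?h \<noteq> Z \<bullet> oneF \<longleftrightarrow> (\<exists>n\<in>D. f \<bullet> n = z)"
    proof
      assume ne: "Z \<bullet> ?h \<noteq> Z \<bullet> oneF"
      show "\<exists>n\<in>D. f \<bullet> n = z"
      proof (rule ccontr)
        assume "\<not> (\<exists>n\<in>D. f \<bullet> n = z)"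
        then have "?h = oneF"
          using hn f mu_D[of "kf f"] by (intro ext[OF h]) (auto simp del: hF)
        then show False using ne by simp
      qed
    next
      assume "\<exists>n\<in>D. f \<bullet> n = z"
      then obtain n where n: "n \<in> D" "f \<bullet> n = z" by blast
      define m where "m = mu (kf f) n"
      have m: "m \<in> D" "f \<bullet> m = z" "le m n"
        using mu_D[of "kf f" n] mu_found[of "kf f" n n] mu_le[of "kf f" n] le_refl n f by (auto simp: m_def)
      have least: "f \<bullet> y \<noteq> z" if "y \<in> D" "le (sc y) m" for y
        using mu_least[of "kf f" n y] that n f by (simp add: m_def)
      \<comment> \<open>A successful search with a bound beyond m returns the least zero,
        independently of the bound.\<close>
      have uniq: "mu (kf f) x = m" if x: "x \<in> D" "f \<bullet> mu (kf f) x = z" "le m x" for x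
      proof -
        let ?y = "mu (kf f) x"
        have y: "?y \<in> D" using f x by simp
        have "le m ?y" using le_total[of m ?y] least[of ?y] m x y by blast
        moreover have "le ?y m" using le_total[of ?y m] mu_least[of "kf f" x m] m x y f by auto
        ultimately show ?thesis using le_antisym m y by blast
      qed
      have "?h = ?G m"
      proof (rule ext[OF h G(1)[OF m(1)]])
        fix x assume x: "x \<in> D"
        let ?y = "mu (kf f) x"
        have y: "?y \<in> D" "le ?y x" using f x mu_le by simp_all
        show "?h \<bullet> x = ?G m \<bullet> x"
        proof (cases "le m x")
          case True
          then have "f \<bullet> ?y = z" using mu_found[of "kf f" x m] m x f by simp
          then show ?thesis using hn[OF x] uniq[OF x _ True] by simp
        next
          case False
          then have s: "le (sc x) m" using le_total m x by blast
          have "f \<bullet> ?y \<noteq> z" using least[of ?y] le_trans[of "sc ?y" "sc x" m] suc_mono y x s m by simp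
          then show ?thesis using hn[OF x] G1[OF m(1) x s] by simp
        qed
      qed
      then show "Z \<bullet> ?h \<noteq> Z \<bullet> oneF" using G(2)[OF m(1)] by simp
    qed
    moreover have "?E \<bullet> f = z \<longleftrightarrow> Z \<bullet> ?h \<noteq> Z \<bullet> oneF" using eF[OF Z(1) k(1) f] by simp
    ultimately show ?thesis by blast
  qed
  moreover have "?E \<in> dom T2" using Z k by simp
  ultimately show ?thesis by blast
qed

text \<open>With \<open>E\<close> as a parameter the existence of a zero becomes an equation, so the
  formula expressing that n is a zero if there is one is quantifier free, and
  \<open>QF_AC_10\<close> applies.\<close>

lemma search:
  assumes e: "tenv e" and E: "E \<in> dom T2" "\<forall>f\<in>dom T1. E \<bullet> f = z \<longleftrightarrow> (\<exists>n\<in>D. f \<bullet> n = z)"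
  shows "\<exists>M\<in>dom T2. \<forall>f\<in>dom T1. (\<exists>n\<in>D. f \<bullet> n = z) \<longrightarrow> f \<bullet> (M \<bullet> f) = z"
proof -
  let ?A = "V (1, T2) \<cdot> V (0, T1) \<^bold>= Zr \<^bold>\<longrightarrow> V (0, T1) \<cdot> V (0, N) \<^bold>= Zr"
  let ?H = "All (0, T1) (Ex (0, N) ?A) \<^bold>\<longrightarrow>
    Ex (0, T2) (All (0, T1) (fsubst (0, N) (V (0, T2) \<cdot> V (0, T1)) ?A))"
  have "?H \<in> B0"
    using QF_AC_10.intros[of ?A "(0, T1)" "(0, N)" "(0, T2)"] by (simp add: B0_def B0_minus_def)
  then have "sat ?H (e((1, T2) := E))" by (rule axiom_st_valid) (use e E in simp_all)
  moreover have "\<exists>n\<in>D. E \<bullet> f = z \<longrightarrow> f \<bullet> n = z" if "f \<in> dom T1" for f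
    using E(2) that z_D by blast
  ultimately show ?thesis using e E by auto
qed

lemma TRANS_imp_mu1:
  assumes e: "tenv e" and t: "sat Pi11_TRANS e" shows "sat mu1 e"
proof -
  obtain E where E: "E \<in> dom T2" "\<forall>f\<in>dom T1. E \<bullet> f = z \<longleftrightarrow> (\<exists>n\<in>D. f \<bullet> n = z)"
    using number_quantifier[OF e t] by blast
  obtain M where M: "M \<in> dom T2" "\<And>f. f \<in> dom T1 \<Longrightarrow> \<exists>n\<in>D. f \<bullet> n = z \<Longrightarrow> f \<bullet> (M \<bullet> f) = z"
    using search[OF e E] by blast
  obtain k where k: "k \<in> dom (T2 \<rightarrow> T1)" "is_kappa k" using kappa_st[OF e] by blast
  let ?dec = "\<lambda>h. decF \<bullet> M \<bullet> h"
  let ?P = "\<lambda>f. pF \<bullet> E \<bullet> M \<bullet> f"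
  let ?\<mu> = "muF \<bullet> E \<bullet> M \<bullet> k"
  have P: "?P f \<bullet> h = z \<longleftrightarrow> path f (?dec h)" if f: "f \<in> dom T1" and h: "h \<in> dom T1" for f h
  proof -
    let ?e = "e0((0, T2) := E, (1, T2) := M, (0, T1) := f, (1, T1) := h)"
    let ?q = "val (lam (0, N) (cndT (V (0, T1) \<cdot> (code_tm \<cdot> (decT \<cdot> V (1, T2) \<cdot> V (1, T1)) \<cdot> V (0, N))) (Sc Zr) Zr)) ?e"
    have q: "?q \<in> dom T1" using f h E M by simp
    have qx: "?q \<bullet> x = (if f \<bullet> (codeF \<bullet> ?dec h \<bullet> x) = z then sc z else z)" if "x \<in> D" for x
      using f h E M that by simp
    have "?P f \<bullet> h = (if E \<bullet> ?q = z then sc z else z)"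
      unfolding pF_def using f h E M q by (simp add: PT_def del: val_fun_terms(8))
    then have "?P f \<bullet> h = z \<longleftrightarrow> E \<bullet> ?q \<noteq> z" by simp
    also have "\<dots> \<longleftrightarrow> path f (?dec h)" using E(2) q qx by (auto simp: path_def)
    finally show ?thesis .
  qed
  \<comment> \<open>The binary code h of g is 0 exactly at the pairs of n and g n. Whether s is such
    a pair is decided by a search bounded by s, since a pair is at least as large as its component
    n.\<close>
  have dec: "\<exists>h\<in>dom T1. bin h \<and> ?dec h = g" if g: "g \<in> dom T1" for g
  proof -
    let ?q = "lams [(1, N), (2, N)] (eqT (V (1, N)) (prT (V (2, N)) (V (0, T1) \<cdot> V (2, N))))"
    let ?t = "lam (0, N) (cndT (?q \<cdot> V (0, N) \<cdot> (Cn CMu \<cdot> ?q \<cdot> V (0, N))) Zr (Sc Zr))"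
    let ?e = "e0((0, T1) := g)"
    define Q where "Q = val ?q ?e"
    have pw: "wt (prT (V (2, N)) (V (0, T1) \<cdot> V (2, N)))" "ty_of (prT (V (2, N)) (V (0, T1) \<cdot> V (2, N))) = N"
      by (simp_all add: prT_def)
    have Q: "Q \<in> dom (N \<rightarrow> N \<rightarrow> N)" unfolding Q_def using g pw by simp
    have Qe: "val ?q (?e((0, N) := x)) = Q" for x unfolding Q_def by (rule val_cong) auto
    have Qx: "Q \<bullet> s \<bullet> n = z \<longleftrightarrow> s = pr n (g \<bullet> n)" if "s \<in> D" "n \<in> D" for s n
      unfolding Q_def using that g pw by (simp add: prT_def)
    define h where "h = val ?t ?e"
    have h: "h \<in> dom T1" unfolding h_def using g pw by simp
    have hs: "h \<bullet> s = (if Q \<bullet> s \<bullet> mu Q s = z then z else sc z)" if "s \<in> D" for s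
      using mu_D[OF Q that] that g pw Qe Q unfolding h_def
      by (simp add: mu_def[symmetric] del: val_lams_Cons)
    have b: "bin h" unfolding bin_def using hs by (simp add: z_le le_refl)
    have hp: "h \<bullet> pr n m = z \<longleftrightarrow> g \<bullet> n = m" if D: "n \<in> D" "m \<in> D" for n m
    proof
      let ?s = "pr n m"
      have s: "?s \<in> D" using D by simp
      have y: "mu Q ?s \<in> D" using Q s by simp
      { assume "h \<bullet> ?s = z"
        then have "?s = pr (mu Q ?s) (g \<bullet> mu Q ?s)" using hs[OF s] Qx[OF s y] by (simp split: if_splits)
        then show "g \<bullet> n = m" using pr_inj[of n m "mu Q ?s" "g \<bullet> mu Q ?s"] D y g by simp }
      { assume "g \<bullet> n = m"
        then have "Q \<bullet> ?s \<bullet> n = z" using Qx[OF s] D by simp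
        moreover have "le n ?s" using D by (simp add: le_pl2)
        ultimately show "h \<bullet> ?s = z" using hs[OF s] mu_found[OF Q s] D by simp }
    qed
    have "?dec h = g"
    proof (rule ext[of _ N N])
      fix n assume n: "n \<in> D"
      let ?r = "val (lam (1, N) (V (0, T1) \<cdot> prT (V (0, N)) (V (1, N)))) (e0((0, T2) := M, (0, T1) := h, (0, N) := n))"
      have r: "?r \<in> dom T1" using n h M by (simp add: prT_def)
      have rm: "?r \<bullet> m = h \<bullet> pr n m" if "m \<in> D" for m
        using n h M that by (simp add: prT_def)
      have "?r \<bullet> (g \<bullet> n) = z" using rm hp n g by simp
      then have "?r \<bullet> (M \<bullet> ?r) = z" using M(2)[OF r] n g by (metis T1_D)
      then have "g \<bullet> n = M \<bullet> ?r" using rm hp n M(1) r by simp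
      moreover have "?dec h \<bullet> n = M \<bullet> ?r"
        unfolding decF_def using n h M by (simp add: decT_def prT_def del: val_fun_terms(7))
      ultimately show "?dec h \<bullet> n = g \<bullet> n" by simp
    qed (use g h M in auto)
    then show ?thesis using h b by blast
  qed
  have mu: "?\<mu> \<bullet> f = ?dec (k \<bullet> ?P f)" if "f \<in> dom T1" for f
    unfolding muF_def using that E M k by (simp add: muT_def del: val_fun_terms(9))
  have "path f (?\<mu> \<bullet> f)" if f: "f \<in> dom T1" and p: "\<exists>g\<in>dom T1. path f g" for f
  proof -
    obtain g where g: "g \<in> dom T1" "path f g" using p by blast
    obtain h where h: "h \<in> dom T1" "bin h" "?dec h = g" using dec[OF g(1)] by blast
    have Pf: "?P f \<in> dom T2" using f E M by simp
    have "?P f \<bullet> h = z" using P[OF f h(1)] h g by simp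
    then have "?P f \<bullet> (k \<bullet> ?P f) = z" using k Pf h unfolding is_kappa_def by blast
    then show ?thesis using P[OF f, of "k \<bullet> ?P f"] mu[OF f] k Pf by simp
  qed
  moreover have "?\<mu> \<in> dom (T1 \<rightarrow> T1)" using E M k by simp
  ultimately show ?thesis unfolding sat_mu1[OF e] by blast
qed

end

lemma mu1_TRANS_wf: "wf_fm (mu1 \<^bold>\<longleftrightarrow> Pi11_TRANS)" "fmub (mu1 \<^bold>\<longleftrightarrow> Pi11_TRANS) \<le> 100" "fvars (mu1 \<^bold>\<longleftrightarrow> Pi11_TRANS) = {}"
  by (auto simp: mu1_def Pi11_TRANS_def Let_def)

theorem equivalence: "B0 \<union> {kappa3} \<^bold>\<turnstile> (mu1 \<^bold>\<longleftrightarrow> Pi11_TRANS)"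
proof (rule completeness)
  show "E_EFA_st \<subseteq> B0 \<union> {kappa3}" by (auto simp: B0_def B0_minus_def)
next
  fix dom :: "ty \<Rightarrow> (ty \<times> tm) set" and ap co le stp e
  assume f: "ftm dom ap co" and v: "\<And>B e. derives (B0 \<union> {kappa3}) {} B \<Longrightarrow> fmub B \<le> 100 \<Longrightarrow> fts.tenv dom e
      \<Longrightarrow> ftm.sat dom ap co le stp B e" and e: "fts.tenv dom e"
  interpret ftm dom ap co le stp by (rule f)
  interpret b0 dom ap co le stp
    by unfold_locales (use v derives.ax in blast)
  show "sat (mu1 \<^bold>\<longleftrightarrow> Pi11_TRANS) e" using mu1_imp_TRANS[OF e] TRANS_imp_mu1[OF e] by auto
qed (rule mu1_TRANS_wf)+

section \<open>A type structure over the standard numbers\<close>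

text \<open>The constants are grouped by the way in which they are evaluated, so that a single
  evaluation rule and a single computability lemma cover each group.\<close>

fun bop :: "cst \<Rightarrow> (nat \<Rightarrow> nat \<Rightarrow> nat) option" where
  "bop CMin = Some min" | "bop CMax = Some max" | "bop CA0 = Some (\<lambda>m n. Suc n)"
| "bop CA1 = Some (+)" | "bop CA2 = Some (*)" | "bop CA3 = Some (^)" | "bop c = None"

fun phi :: "cst \<Rightarrow> ((nat \<Rightarrow> nat) \<Rightarrow> nat \<Rightarrow> nat) option" where
  "phi CPhi1 = Some (\<lambda>g n. Max (g ` {..n}))" | "phi CPhi2 = Some (\<lambda>g n. sum g {..n})"
| "phi CPhi3 = Some (\<lambda>g n. prod g {..n})" | "phi c = None"

definition mun :: "(nat \<Rightarrow> nat) \<Rightarrow> nat \<Rightarrow> nat" where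
  "mun g n = (if \<exists>y\<le>n. g y = 0 then LEAST y. g y = 0 else 0)"

text \<open>Numbers are standard and the constants have their intended meaning. Fullness is asked
  for at type 1 and at the types of the functionals in \<open>QF_AC_10\<close>, \<open>mu1\<close>
  and \<open>kappa3\<close>. For \<open>full21\<close> an argument of type 2 is described by the
  functional that it induces on set-theoretic functions.\<close>

locale std = fts dom ap co
  for dom :: "ty \<Rightarrow> 'a set" and ap :: "'a \<Rightarrow> 'a \<Rightarrow> 'a" (infixl "\<bullet>" 100) and co :: "cst \<Rightarrow> 'a" +
  fixes nm :: "nat \<Rightarrow> 'a"
  assumes nm_inj [simp]: "nm m = nm n \<longleftrightarrow> m = n"
    and dom_N: "dom N = range nm"
    and co_zero [simp]: "co CZero = nm 0"
    and co_suc [simp]: "co CSuc \<bullet> nm n = nm (Suc n)"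
    and co_bop: "bop c \<noteq> None \<Longrightarrow> co c \<bullet> nm m \<bullet> nm n = nm (the (bop c) m n)"
    and co_phi: "phi c \<noteq> None \<Longrightarrow> f \<in> dom T1 \<Longrightarrow> (\<And>k. f \<bullet> nm k = nm (g k)) \<Longrightarrow> co c \<bullet> f \<bullet> nm n = nm (the (phi c) g n)"
    and co_mu: "f \<in> dom (N \<rightarrow> N \<rightarrow> N) \<Longrightarrow> (\<And>k. f \<bullet> nm n \<bullet> nm k = nm (g k)) \<Longrightarrow> co CMu \<bullet> f \<bullet> nm n = nm (mun g n)"
    and co_rec0: "y \<in> dom \<rho> \<Longrightarrow> r \<in> dom (N \<rightarrow> N \<rightarrow> \<rho>) \<Longrightarrow> v \<in> dom (N \<rightarrow> \<rho>) \<Longrightarrow>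
      list_all2 (\<lambda>w \<sigma>. w \<in> dom \<sigma>) ws (arg_tys \<rho>) \<Longrightarrow>
      foldl (\<bullet>) (co (CRec \<rho>) \<bullet> nm 0 \<bullet> y \<bullet> r \<bullet> v) ws = foldl (\<bullet>) y ws"
    and co_recS: "y \<in> dom \<rho> \<Longrightarrow> r \<in> dom (N \<rightarrow> N \<rightarrow> \<rho>) \<Longrightarrow> v \<in> dom (N \<rightarrow> \<rho>) \<Longrightarrow>
      list_all2 (\<lambda>w \<sigma>. w \<in> dom \<sigma>) ws (arg_tys \<rho>) \<Longrightarrow>
      foldl (\<bullet>) (co (CRec \<rho>) \<bullet> nm (Suc n) \<bullet> y \<bullet> r \<bullet> v) ws =
        co CMin \<bullet> foldl (\<bullet>) (r \<bullet> foldl (\<bullet>) (co (CRec \<rho>) \<bullet> nm n \<bullet> y \<bullet> r \<bullet> v) ws \<bullet> nm n) ws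
          \<bullet> foldl (\<bullet>) (v \<bullet> nm n) ws"
    and full1: "\<exists>F\<in>dom T1. \<forall>k. F \<bullet> nm k = nm (g k)"
    and full2: "\<exists>G\<in>dom T2. \<forall>F\<in>dom T1. \<forall>f. (\<forall>k. F \<bullet> nm k = nm (f k)) \<longrightarrow> G \<bullet> F = nm (Y f)"
    and full11: "\<exists>G\<in>dom (T1 \<rightarrow> T1). \<forall>F\<in>dom T1. \<forall>f k. (\<forall>k. F \<bullet> nm k = nm (f k)) \<longrightarrow> G \<bullet> F \<bullet> nm k = nm (M f k)"
    and full21: "\<exists>G\<in>dom (T2 \<rightarrow> T1). \<forall>Q\<in>dom T2. \<forall>Y k. (\<forall>F\<in>dom T1. \<forall>f. (\<forall>k. F \<bullet> nm k = nm (f k)) \<longrightarrow> Q \<bullet> F = nm (Y f))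
       \<longrightarrow> G \<bullet> Q \<bullet> nm k = nm (\<kappa> Y k)"

text \<open>Tait's computability method: types are interpreted by partial equivalence relations on applicative
  terms whose heads are the constants and arbitrary set-theoretic functionals of the types needed.\<close>

datatype head =
    HC cst | HNum nat | HF1 "nat \<Rightarrow> nat" | HF2 "(nat \<Rightarrow> nat) \<Rightarrow> nat" | HF11 "(nat \<Rightarrow> nat) \<Rightarrow> nat \<Rightarrow> nat"
  | HF21 "((nat \<Rightarrow> nat) \<Rightarrow> nat) \<Rightarrow> nat \<Rightarrow> nat"

text \<open>Terms are kept in spine form, a head with its list of arguments, so that the evaluation
  rules can match a head together with all the arguments it needs.\<close>

datatype u = U head "u list"

fun appl :: "u \<Rightarrow> u list \<Rightarrow> u" where "appl (U h xs) ys = U h (xs @ ys)"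

abbreviation uapp :: "u \<Rightarrow> u \<Rightarrow> u" where "uapp s t \<equiv> appl s [t]"
abbreviation num :: "nat \<Rightarrow> u" where "num n \<equiv> U (HNum n) []"

lemma appl_appl [simp]: "appl (appl s xs) ys = appl s (xs @ ys)"
  by (cases s) simp

lemma appl_Nil [simp]: "appl s [] = s"
  by (cases s) simp

text \<open>\<open>ev t n\<close>: the applicative term \<open>t\<close> of type 0 evaluates to \<open>n\<close>. The rules for the set-theoretic
  functionals \<open>HF2\<close>, \<open>HF11\<close> and \<open>HF21\<close> have infinitely many premises.\<close>

inductive ev :: "u \<Rightarrow> nat \<Rightarrow> bool" where
  num: "ev (num n) n"
| F1: "ev a m \<Longrightarrow> i = f m \<Longrightarrow> ev (U (HF1 f) [a]) i"
| F2: "(\<forall>k. ev (uapp a (num k)) (g k)) \<Longrightarrow> i = Y g \<Longrightarrow> ev (U (HF2 Y) [a]) i"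
| F11: "(\<forall>k. ev (uapp a (num k)) (g k)) \<Longrightarrow> ev b m \<Longrightarrow> i = M g m \<Longrightarrow> ev (U (HF11 M) [a, b]) i"
| F21: "(\<forall>f. ev (uapp a (U (HF1 f) [])) (Y f)) \<Longrightarrow> ev b m \<Longrightarrow> i = \<kappa> Y m \<Longrightarrow> ev (U (HF21 \<kappa>) [a, b]) i"
| Pi: "ev (appl a ws) n \<Longrightarrow> ev (U (HC (CPi \<rho> \<tau>)) (a # b # ws)) n"
| Sigma: "ev (appl a (c # uapp b c # ws)) n \<Longrightarrow> ev (U (HC (CSigma \<delta> \<rho> \<tau>)) (a # b # c # ws)) n"
| Zero: "ev (U (HC CZero) []) 0"
| Suc: "ev a m \<Longrightarrow> ev (U (HC CSuc) [a]) (Suc m)"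
| bop: "ev a m \<Longrightarrow> ev b n \<Longrightarrow> bop c \<noteq> None \<Longrightarrow> i = the (bop c) m n \<Longrightarrow> ev (U (HC c) [a, b]) i"
| phi: "(\<forall>k. ev (uapp a (num k)) (g k)) \<Longrightarrow> ev b n \<Longrightarrow> phi c \<noteq> None \<Longrightarrow> i = the (phi c) g n \<Longrightarrow> ev (U (HC c) [a, b]) i"
| mu: "(\<forall>k. ev (appl a [b, num k]) (g k)) \<Longrightarrow> ev b n \<Longrightarrow> i = mun g n \<Longrightarrow> ev (U (HC CMu) [a, b]) i"
| rec0: "ev x 0 \<Longrightarrow> ev (appl y ws) n \<Longrightarrow> ev (U (HC (CRec \<rho>)) (x # y # r # v # ws)) n"
| recS: "ev x (Suc n) \<Longrightarrow> ev (appl r (U (HC (CRec \<rho>)) (num n # y # r # v # ws) # num n # ws)) p \<Longrightarrow>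
    ev (appl v (num n # ws)) q \<Longrightarrow> i = min p q \<Longrightarrow> ev (U (HC (CRec \<rho>)) (x # y # r # v # ws)) i"

inductive_cases ev_numE: "ev (num n) m"
inductive_cases ev_F1E: "ev (U (HF1 f) as) m"
inductive_cases ev_F2E: "ev (U (HF2 f) as) m"
inductive_cases ev_F11E: "ev (U (HF11 f) as) m"
inductive_cases ev_F21E: "ev (U (HF21 f) as) m"
inductive_cases ev_CE: "ev (U (HC c) as) m"

lemma fun_det: "\<forall>k. ev (t k) (g k) \<and> (\<forall>m. ev (t k) m \<longrightarrow> g k = m) \<Longrightarrow> \<forall>k. ev (t k) (g' k) \<Longrightarrow> g = g'"
  by (rule HOL.ext) blast

text \<open>The head determines the rule, except for the recursor, where the value of the recursion
  argument decides. Rules with infinitely many premises determine a whole function of values, which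
  is unique by extensionality of the metatheory.\<close>

lemma ev_det: "ev t n \<Longrightarrow> ev t m \<Longrightarrow> n = m"
proof (induction arbitrary: m rule: ev.induct)
  case (F2 a g i Y)
  from F2.prems obtain g' where *: "m = Y g'" "\<forall>k. ev (uapp a (num k)) (g' k)" by (auto elim: ev_F2E)
  have "g = g'" by (rule fun_det[OF F2.IH *(2)])
  then show ?case using F2.hyps *(1) by simp
next
  case (F11 a g b k i M)
  from F11.prems obtain g' k' where *: "m = M g' k'" "\<forall>k. ev (uapp a (num k)) (g' k)" "ev b k'" by (auto elim: ev_F11E)
  have "g = g'" by (rule fun_det[OF F11.IH(1) *(2)])
  moreover have "k = k'" using F11.IH(2) *(3) by blast
  ultimately show ?case using F11.hyps *(1) by simp
next
  case (F21 a Y b k i \<kappa>)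
  from F21.prems obtain g' k' where *: "m = \<kappa> g' k'" "\<forall>f. ev (uapp a (U (HF1 f) [])) (g' f)" "ev b k'" by (auto elim: ev_F21E)
  have "Y = g'" by (rule fun_det[OF F21.IH(1) *(2)])
  moreover have "k = k'" using F21.IH(2) *(3) by blast
  ultimately show ?case using F21.hyps *(1) by simp
next
  case (bop a k b l c i)
  have "phi c = None" using bop.hyps(3) by (cases c) auto
  with bop.prems bop.hyps(3) obtain k' l' where *: "m = the (bop c) k' l'" "ev a k'" "ev b l'"
    by (elim ev_CE) auto
  then have "k = k'" "l = l'" using bop.IH by auto
  then show ?case using bop.hyps(4) *(1) by simp
next
  case (phi a g b n c i)
  have "bop c = None" using phi.hyps(2) by (cases c) auto
  with phi.prems phi.hyps(2) obtain g' n' where *: "m = the (phi c) g' n'" "\<forall>k. ev (uapp a (num k)) (g' k)" "ev b n'"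
    by (elim ev_CE) auto
  have "g = g'" by (rule fun_det[OF phi.IH(1) *(2)])
  moreover have "n = n'" using phi.IH(2) *(3) by blast
  ultimately show ?case using phi.hyps(3) *(1) by simp
next
  case (mu a b g n i)
  from mu.prems obtain g' n' where *: "m = mun g' n'" "\<forall>k. ev (appl a [b, num k]) (g' k)" "ev b n'"
    by (elim ev_CE) auto
  have "g = g'" by (rule fun_det[OF mu.IH(1) *(2)])
  moreover have "n = n'" using mu.IH(2) *(3) by blast
  ultimately show ?case using mu.hyps *(1) by simp
next
  case (rec0 x y ws n \<rho> r v)
  from rec0.prems consider "ev (appl y ws) m" | k where "ev x (Suc k)"
    by (elim ev_CE) auto
  then show ?case using rec0.IH by cases auto
next
  case (recS x n r \<rho> y v ws p q i)
  from recS.prems consider "ev x 0" | k p' q' where "ev x (Suc k)" "m = min p' q'"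
     "ev (appl r (U (HC (CRec \<rho>)) (num k # y # r # v # ws) # num k # ws)) p'" "ev (appl v (num k # ws)) q'"
    by (elim ev_CE) auto
  then show ?case
  proof cases
    case (2 k p' q')
    then have "k = n" using recS.IH(1) by auto
    then show ?thesis using 2 recS.IH(2,3) recS.hyps by blast
  qed (use recS.IH(1) in auto)
next
  case (F1 a m f i)
  from F1.prems show ?case by (elim ev_F1E) (use F1 in auto)
next
  case (Pi a ws n \<rho> \<tau> b)
  from Pi.prems have "ev (appl a ws) m" by (elim ev_CE) simp_all
  then show ?case by (rule Pi.IH)
next
  case (Sigma a c b ws n \<delta> \<rho> \<tau>)
  from Sigma.prems have "ev (appl a (c # uapp b c # ws)) m" by (elim ev_CE) simp_all
  then show ?case by (rule Sigma.IH)
next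
  case (Suc a n)
  from Suc.prems obtain k where "ev a k" "m = Suc k" by (elim ev_CE) simp_all
  then show ?case using Suc.IH by simp
next
  case (num n)
  then show ?case by (elim ev_numE) simp
next
  case Zero
  then show ?case by (elim ev_CE) simp_all
qed

fun R :: "ty \<Rightarrow> u \<Rightarrow> u \<Rightarrow> bool" where
  "R N s t \<longleftrightarrow> (\<exists>n. ev s n \<and> ev t n)"
| "R (\<sigma> \<rightarrow> \<tau>) s t \<longleftrightarrow> (\<forall>a b. R \<sigma> a b \<longrightarrow> R \<tau> (uapp s a) (uapp t b))"

fun Rl :: "ty list \<Rightarrow> u list \<Rightarrow> u list \<Rightarrow> bool" where
  "Rl [] as bs \<longleftrightarrow> as = [] \<and> bs = []"
| "Rl (\<sigma> # \<sigma>s) as bs \<longleftrightarrow> (\<exists>a b as' bs'. as = a # as' \<and> bs = b # bs' \<and> R \<sigma> a b \<and> Rl \<sigma>s as' bs')"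

text \<open>Evaluation happens at type 0, when all arguments are present. Feeding related argument
  lists reduces relatedness at any type to a common value, the form in which the rules for the
  combinators and the recursor apply.\<close>

lemma R_spine: "R \<sigma> s t \<longleftrightarrow> (\<forall>as bs. Rl (arg_tys \<sigma>) as bs \<longrightarrow> (\<exists>n. ev (appl s as) n \<and> ev (appl t bs) n))"
proof (induction \<sigma> arbitrary: s t)
  case (Fn \<sigma> \<tau>)
  have "R (\<sigma> \<rightarrow> \<tau>) s t \<longleftrightarrow> (\<forall>a b. R \<sigma> a b \<longrightarrow>
      (\<forall>as bs. Rl (arg_tys \<tau>) as bs \<longrightarrow> (\<exists>n. ev (appl s (a # as)) n \<and> ev (appl t (b # bs)) n)))"
    by (simp add: Fn.IH(2))
  then show ?case by (simp; blast)
qed auto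

lemma R_sym_trans: "(R \<sigma> x y \<longrightarrow> R \<sigma> y x) \<and> (R \<sigma> x y \<longrightarrow> R \<sigma> y w \<longrightarrow> R \<sigma> x w)"
proof (induction \<sigma> arbitrary: x y w)
  case N
  show ?case unfolding R.simps by (metis ev_det)
next
  case (Fn \<sigma> \<tau>)
  have s: "R \<sigma> a b \<Longrightarrow> R \<sigma> b a" "R \<sigma> a b \<Longrightarrow> R \<sigma> a a" for a b using Fn.IH(1) by blast+
  have t: "R \<tau> a b \<Longrightarrow> R \<tau> b a" "R \<tau> a b \<Longrightarrow> R \<tau> b c \<Longrightarrow> R \<tau> a c" for a b c using Fn.IH(2) by blast+
  have tr: "R (\<sigma> \<rightarrow> \<tau>) x w" if "R (\<sigma> \<rightarrow> \<tau>) x y" "R (\<sigma> \<rightarrow> \<tau>) y w"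
    unfolding R.simps
  proof (intro HOL.allI HOL.impI)
    fix a b assume ab: "R \<sigma> a b"
    have "R \<tau> (uapp x a) (uapp y a)" using that(1) s(2)[OF ab] by simp
    moreover have "R \<tau> (uapp y a) (uapp w b)" using that(2) ab by simp
    ultimately show "R \<tau> (uapp x a) (uapp w b)" by (rule t(2))
  qed
  have sy: "R (\<sigma> \<rightarrow> \<tau>) y x" if "R (\<sigma> \<rightarrow> \<tau>) x y"
    unfolding R.simps using that s(1) t(1) by (simp; blast)
  show ?case using tr sy by blast
qed

lemma R_num [simp]: "R N (num n) (num n)" by (auto intro: ev.num)

lemma R_T1: assumes "R T1 a b" shows "\<exists>g. \<forall>k. ev (uapp a (num k)) (g k) \<and> ev (uapp b (num k)) (g k)"
proof -
  have "\<exists>n. ev (uapp a (num k)) n \<and> ev (uapp b (num k)) n" for k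
    using assms R_num[of k] unfolding R.simps by blast
  then show ?thesis by metis
qed

lemma R_F1: "R T1 (U (HF1 f) []) (U (HF1 f) [])"
  by (auto intro: ev.F1)

text \<open>Every constant \<open>HF1 f\<close> is related to itself, so related objects of type 2
  have a common value at each set-theoretic function. This family of values is what the rule for
  \<open>HF21\<close> takes as its premise.\<close>

lemma R_T2: assumes "R T2 a b"
  shows "\<exists>Y. \<forall>f. ev (uapp a (U (HF1 f) [])) (Y f) \<and> ev (uapp b (U (HF1 f) [])) (Y f)"
proof -
  have "\<exists>n. ev (uapp a (U (HF1 f) [])) n \<and> ev (uapp b (U (HF1 f) [])) n" for f
    using assms R_F1[of f] unfolding R.simps(2)[of T1 N] R.simps(1) by blast
  then show ?thesis by metis
qed

lemma R_F2: "R T2 (U (HF2 Y) []) (U (HF2 Y) [])"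
  unfolding R.simps(2)[of T1 N] R.simps(1)
proof (intro HOL.allI HOL.impI)
  fix a b assume "R T1 a b"
  then obtain g where "\<forall>k. ev (uapp a (num k)) (g k) \<and> ev (uapp b (num k)) (g k)" using R_T1 by blast
  then show "\<exists>n. ev (uapp (U (HF2 Y) []) a) n \<and> ev (uapp (U (HF2 Y) []) b) n"
    by (auto intro!: exI[of _ "Y g"] ev.F2[of _ g])
qed

lemma R_F11: "R (T1 \<rightarrow> T1) (U (HF11 M) []) (U (HF11 M) [])"
  unfolding R.simps(2)[of T1 T1] R.simps(2)[of N N] R.simps(1)
proof (intro HOL.allI HOL.impI)
  fix a b x y assume "\<forall>a' b'. (\<exists>n. ev a' n \<and> ev b' n) \<longrightarrow> (\<exists>n. ev (uapp a a') n \<and> ev (uapp b b') n)" "\<exists>n. ev x n \<and> ev y n"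
  then obtain g n where "\<forall>k. ev (uapp a (num k)) (g k) \<and> ev (uapp b (num k)) (g k)" "ev x n" "ev y n"
    using R_T1[of a b] unfolding R.simps by blast
  then show "\<exists>n. ev (uapp (uapp (U (HF11 M) []) a) x) n \<and> ev (uapp (uapp (U (HF11 M) []) b) y) n"
    by (auto intro!: exI[of _ "M g n"] ev.F11[of _ g _ n])
qed

lemma R_F21: "R (T2 \<rightarrow> T1) (U (HF21 \<kappa>) []) (U (HF21 \<kappa>) [])"
  unfolding R.simps(2)[of T2 T1]
proof (intro HOL.allI HOL.impI)
  fix a b assume "R T2 a b"
  then obtain Y where Y: "\<forall>f. ev (uapp a (U (HF1 f) [])) (Y f) \<and> ev (uapp b (U (HF1 f) [])) (Y f)" using R_T2 by blast
  show "R T1 (uapp (U (HF21 \<kappa>) []) a) (uapp (U (HF21 \<kappa>) []) b)"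
    unfolding R.simps
  proof (intro HOL.allI HOL.impI)
    fix x y assume "\<exists>n. ev x n \<and> ev y n"
    then obtain n where "ev x n" "ev y n" by blast
    then show "\<exists>n. ev (uapp (uapp (U (HF21 \<kappa>) []) a) x) n \<and> ev (uapp (uapp (U (HF21 \<kappa>) []) b) y) n"
      using Y by (auto intro!: exI[of _ "\<kappa> Y n"] ev.F21[of _ Y _ n])
  qed
qed

lemma R_bop: "bop c = Some p \<Longrightarrow> R (N \<rightarrow> N \<rightarrow> N) (U (HC c) []) (U (HC c) [])"
  unfolding R.simps
proof (intro HOL.allI HOL.impI)
  fix a b x y assume "bop c = Some p" "\<exists>n. ev a n \<and> ev b n" "\<exists>n. ev x n \<and> ev y n"
  then obtain m n where "ev a m" "ev b m" "ev x n" "ev y n" by blast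
  then show "\<exists>n. ev (uapp (uapp (U (HC c) []) a) x) n \<and> ev (uapp (uapp (U (HC c) []) b) y) n"
    using \<open>bop c = Some p\<close> ev.bop[of a m x n c "p m n"] ev.bop[of b m y n c "p m n"] by auto
qed

lemma R_phi: "phi c = Some F \<Longrightarrow> R (T1 \<rightarrow> N \<rightarrow> N) (U (HC c) []) (U (HC c) [])"
  unfolding R.simps(2)[of T1 "N \<rightarrow> N"]
proof (intro HOL.allI HOL.impI)
  fix a b assume F: "phi c = Some F" and "R T1 a b"
  then obtain g where g: "\<forall>k. ev (uapp a (num k)) (g k) \<and> ev (uapp b (num k)) (g k)" using R_T1 by blast
  show "R T1 (uapp (U (HC c) []) a) (uapp (U (HC c) []) b)"
    unfolding R.simps
  proof (intro HOL.allI HOL.impI)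
    fix x y assume "\<exists>n. ev x n \<and> ev y n"
    then obtain n where "ev x n" "ev y n" by blast
    then show "\<exists>n. ev (uapp (uapp (U (HC c) []) a) x) n \<and> ev (uapp (uapp (U (HC c) []) b) y) n"
      using g F ev.phi[of a g x n c "F g n"] ev.phi[of b g y n c "F g n"] by auto
  qed
qed

lemma R_mu: "R ((N \<rightarrow> N \<rightarrow> N) \<rightarrow> N \<rightarrow> N) (U (HC CMu) []) (U (HC CMu) [])"
  unfolding R.simps(2)[of "N \<rightarrow> N \<rightarrow> N" "N \<rightarrow> N"]
proof (intro HOL.allI HOL.impI)
  fix a b assume ab: "R (N \<rightarrow> N \<rightarrow> N) a b"
  show "R T1 (uapp (U (HC CMu) []) a) (uapp (U (HC CMu) []) b)"
    unfolding R.simps(2)[of N N]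
  proof (intro HOL.allI HOL.impI)
    fix x y assume xy: "R N x y"
    then obtain n where n: "ev x n" "ev y n" by auto
    have "R T1 (uapp a x) (uapp b y)" using ab xy unfolding R.simps(2)[of N T1] by blast
    then obtain g where "\<forall>k. ev (uapp (uapp a x) (num k)) (g k) \<and> ev (uapp (uapp b y) (num k)) (g k)" using R_T1 by blast
    then show "R N (uapp (uapp (U (HC CMu) []) a) x) (uapp (uapp (U (HC CMu) []) b) y)"
      using n by (auto intro!: exI[of _ "mun g n"] ev.mu[of _ _ g n])
  qed
qed

lemma R_Pi: "R (\<rho> \<rightarrow> \<tau> \<rightarrow> \<rho>) (U (HC (CPi \<rho> \<tau>)) []) (U (HC (CPi \<rho> \<tau>)) [])"
proof -
  have "\<exists>n. ev (U (HC (CPi \<rho> \<tau>)) (a # x # ws)) n \<and> ev (U (HC (CPi \<rho> \<tau>)) (b # y # vs)) n"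
    if "R \<rho> a b" "Rl (arg_tys \<rho>) ws vs" for a b x y ws vs
    using that unfolding R_spine[of \<rho>] by (meson ev.Pi)
  then show ?thesis unfolding R_spine[of "\<rho> \<rightarrow> \<tau> \<rightarrow> \<rho>"] by auto
qed

lemma R_Sigma: "R ((\<delta> \<rightarrow> \<rho> \<rightarrow> \<tau>) \<rightarrow> (\<delta> \<rightarrow> \<rho>) \<rightarrow> \<delta> \<rightarrow> \<tau>) (U (HC (CSigma \<delta> \<rho> \<tau>)) []) (U (HC (CSigma \<delta> \<rho> \<tau>)) [])"
proof -
  let ?S = "CSigma \<delta> \<rho> \<tau>"
  have "\<exists>n. ev (U (HC ?S) (a # b # c # ws)) n \<and> ev (U (HC ?S) (a' # b' # c' # vs)) n"
    if h: "R (\<delta> \<rightarrow> \<rho> \<rightarrow> \<tau>) a a'" "R (\<delta> \<rightarrow> \<rho>) b b'" "R \<delta> c c'" "Rl (arg_tys \<tau>) ws vs" for a a' b b' c c' ws vs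
  proof -
    have "R \<tau> (uapp (uapp a c) (uapp b c)) (uapp (uapp a' c') (uapp b' c'))"
      using that unfolding R.simps by blast
    then obtain n where "ev (appl (uapp (uapp a c) (uapp b c)) ws) n" "ev (appl (uapp (uapp a' c') (uapp b' c')) vs) n"
      using h(4) unfolding R_spine[of \<tau>] by blast
    then show ?thesis using ev.Sigma[of a c b ws n \<delta> \<rho> \<tau>] ev.Sigma[of a' c' b' vs n \<delta> \<rho> \<tau>] by auto
  qed
  then show ?thesis unfolding R_spine[of "(\<delta> \<rightarrow> \<rho> \<rightarrow> \<tau>) \<rightarrow> (\<delta> \<rightarrow> \<rho>) \<rightarrow> \<delta> \<rightarrow> \<tau>"] by (auto simp del: R.simps)
qed

text \<open>Induction on the value of the recursion argument. The successor rule evaluates the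
  previous stage at a numeral, so the induction hypothesis is used for numerals, whatever terms the
  given arguments are.\<close>

lemma Rec_eval:
  assumes "R \<rho> y y'" "R (N \<rightarrow> N \<rightarrow> \<rho>) r r'" "R (N \<rightarrow> \<rho>) v v'" "Rl (arg_tys \<rho>) ws ws'"
  shows "ev x n \<Longrightarrow> ev x' n \<Longrightarrow>
    \<exists>i. ev (U (HC (CRec \<rho>)) (x # y # r # v # ws)) i \<and> ev (U (HC (CRec \<rho>)) (x' # y' # r' # v' # ws')) i"
proof (induction n arbitrary: x x')
  case 0
  then show ?case using assms(1,4) unfolding R_spine[of \<rho>] by (meson ev.rec0)
next
  case (Suc n)
  have "R N (U (HC (CRec \<rho>)) (num n # y # r # v # ws)) (U (HC (CRec \<rho>)) (num n # y' # r' # v' # ws'))" (is "R N ?a ?b")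
    using Suc.IH[OF ev.num ev.num] by simp
  then have "R \<rho> (uapp (uapp r ?a) (num n)) (uapp (uapp r' ?b) (num n))" "R \<rho> (uapp v (num n)) (uapp v' (num n))"
    using assms(2,3) R_num unfolding R.simps(2) by blast+
  then obtain p q where "ev (appl (uapp (uapp r ?a) (num n)) ws) p" "ev (appl (uapp (uapp r' ?b) (num n)) ws') p"
    "ev (appl (uapp v (num n)) ws) q" "ev (appl (uapp v' (num n)) ws') q"
    using assms(4) unfolding R_spine[of \<rho>] by blast
  then show ?case using Suc.prems by (intro exI[of _ "min p q"]) (auto intro: ev.recS)
qed

lemma R_Rec: "R (N \<rightarrow> \<rho> \<rightarrow> (N \<rightarrow> N \<rightarrow> \<rho>) \<rightarrow> (N \<rightarrow> \<rho>) \<rightarrow> \<rho>) (U (HC (CRec \<rho>)) []) (U (HC (CRec \<rho>)) [])"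
proof -
  have "\<exists>i. ev (U (HC (CRec \<rho>)) (x # y # r # v # ws)) i \<and> ev (U (HC (CRec \<rho>)) (x' # y' # r' # v' # ws')) i"
    if "R N x x'" "R \<rho> y y'" "R (N \<rightarrow> N \<rightarrow> \<rho>) r r'" "R (N \<rightarrow> \<rho>) v v'" "Rl (arg_tys \<rho>) ws ws'" for x x' y y' r r' v v' ws ws'
    using Rec_eval[OF that(2-5)] that(1) unfolding R.simps(1) by blast
  then show ?thesis unfolding R_spine[of "N \<rightarrow> \<rho> \<rightarrow> (N \<rightarrow> N \<rightarrow> \<rho>) \<rightarrow> (N \<rightarrow> \<rho>) \<rightarrow> \<rho>"] by (auto simp del: R.simps)
qed

lemma R_const: "R (cst_ty c) (U (HC c) []) (U (HC c) [])"
proof (cases c)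
  case CZero
  then show ?thesis by (auto intro: ev.Zero)
next
  case CSuc
  then show ?thesis by (auto intro: ev.Suc)
qed (simp_all only: cst_ty.simps R_Pi R_Sigma R_Rec R_mu R_bop[OF bop.simps(1)] R_bop[OF bop.simps(2)]
    R_bop[OF bop.simps(3)] R_bop[OF bop.simps(4)] R_bop[OF bop.simps(5)] R_bop[OF bop.simps(6)]
    R_phi[OF phi.simps(1)] R_phi[OF phi.simps(2)] R_phi[OF phi.simps(3)])

interpretation S: per R uapp "\<lambda>c. U (HC c) []"
proof
  fix \<sigma> x y w
  show "R \<sigma> x y \<Longrightarrow> R \<sigma> y x" "R \<sigma> x y \<Longrightarrow> R \<sigma> y w \<Longrightarrow> R \<sigma> x w" using R_sym_trans by blast+
next
  fix \<sigma> \<tau> f g x y assume "R (\<sigma> \<rightarrow> \<tau>) f g" "R \<sigma> x y"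
  then show "R \<tau> (uapp f x) (uapp g y)" by simp
next
  fix \<sigma> \<tau> f g assume a: "R (\<sigma> \<rightarrow> \<tau>) f f" "R (\<sigma> \<rightarrow> \<tau>) g g" "\<And>x. R \<sigma> x x \<Longrightarrow> R \<tau> (uapp f x) (uapp g x)"
  have "R \<tau> (uapp f x) (uapp g y)" if "R \<sigma> x y" for x y
  proof -
    have "R \<sigma> x x" using that R_sym_trans by blast
    then have "R \<tau> (uapp f x) (uapp g x)" "R \<tau> (uapp g x) (uapp g y)" using a that by auto
    then show ?thesis using R_sym_trans by blast
  qed
  then show "R (\<sigma> \<rightarrow> \<tau>) f g" by simp
next
  fix c show "R (cst_ty c) (U (HC c) []) (U (HC c) [])" by (rule R_const)
next
  fix \<rho> \<tau> x y assume "R \<rho> x x"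
  have "\<exists>n. ev (appl (uapp (uapp (U (HC (CPi \<rho> \<tau>)) []) x) y) ws) n \<and> ev (appl x vs) n" if h: "Rl (arg_tys \<rho>) ws vs" for ws vs
  proof -
    obtain n where "ev (appl x ws) n" "ev (appl x vs) n"
      using \<open>R \<rho> x x\<close> h unfolding R_spine[of \<rho>] by blast
    then show ?thesis using ev.Pi[of x ws n \<rho> \<tau> y] by auto
  qed
  then show "R \<rho> (uapp (uapp (U (HC (CPi \<rho> \<tau>)) []) x) y) x" unfolding R_spine[of \<rho>] by blast
next
  fix \<delta> \<rho> \<tau> x y w assume "R (\<delta> \<rightarrow> \<rho> \<rightarrow> \<tau>) x x" "R (\<delta> \<rightarrow> \<rho>) y y" "R \<delta> w w"
  then have r: "R \<tau> (uapp (uapp x w) (uapp y w)) (uapp (uapp x w) (uapp y w))" by simp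
  have "\<exists>n. ev (appl (uapp (uapp (uapp (U (HC (CSigma \<delta> \<rho> \<tau>)) []) x) y) w) ws) n \<and> ev (appl (uapp (uapp x w) (uapp y w)) vs) n"
    if h: "Rl (arg_tys \<tau>) ws vs" for ws vs
  proof -
    obtain n where "ev (appl (uapp (uapp x w) (uapp y w)) ws) n" "ev (appl (uapp (uapp x w) (uapp y w)) vs) n"
      using r h unfolding R_spine[of \<tau>] by blast
    then show ?thesis using ev.Sigma[of x w y ws n \<delta> \<rho> \<tau>] by auto
  qed
  then show "R \<tau> (uapp (uapp (uapp (U (HC (CSigma \<delta> \<rho> \<tau>)) []) x) y) w) (uapp (uapp x w) (uapp y w))"
    unfolding R_spine[of \<tau>] by blast
qed

abbreviation Snm :: "nat \<Rightarrow> ty \<times> u" where "Snm n \<equiv> S.cl N (num n)"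

lemma Snm_ev: "ev t n \<Longrightarrow> S.cl N t = Snm n"
  by (rule S.cl_eqI) (auto intro: ev.num)

lemma Rl_refl_ex: "list_all2 (\<lambda>w \<sigma>. w \<in> S.qdom \<sigma>) ws \<sigma>s \<Longrightarrow> \<exists>us. Rl \<sigma>s us us \<and> ws = map2 S.cl \<sigma>s us"
proof (induction rule: list_all2_induct)
  case (Cons w ws \<sigma> \<sigma>s)
  then obtain us t where "Rl \<sigma>s us us" "ws = map2 S.cl \<sigma>s us" "R \<sigma> t t" "w = S.cl \<sigma> t"
    unfolding S.qdom_def by blast
  then show ?case by (intro exI[of _ "t # us"]) simp
qed simp

lemma foldl_qap: "R \<sigma> t t \<Longrightarrow> Rl (arg_tys \<sigma>) us us \<Longrightarrow> foldl S.qap (S.cl \<sigma> t) (map2 S.cl (arg_tys \<sigma>) us) = S.cl N (appl t us)"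
proof (induction \<sigma> arbitrary: t us)
  case (Fn \<sigma> \<tau>)
  then obtain w vs where "us = w # vs" "R \<sigma> w w" "Rl (arg_tys \<tau>) vs vs" by auto
  then show ?case using Fn.IH(2)[of "uapp t w" vs] Fn.prems(1) by (simp add: S.qap_cl del: R.simps) simp
qed simp

lemma qdomE: "f \<in> S.qdom \<sigma> \<Longrightarrow> (\<And>t. f = S.cl \<sigma> t \<Longrightarrow> R \<sigma> t t \<Longrightarrow> P) \<Longrightarrow> P"
  unfolding S.qdom_def by blast

lemma R_uapp: "R (\<sigma> \<rightarrow> \<tau>) t t \<Longrightarrow> R \<sigma> x x \<Longrightarrow> R \<tau> (uapp t x) (uapp t x)" by simp

lemma cl_num_eq: "R N t t \<Longrightarrow> S.cl N t = Snm n \<Longrightarrow> ev t n"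
proof -
  assume "R N t t" "S.cl N t = Snm n"
  then have "R N t (num n)" using S.cl_eq[of N t "num n"] R_num by blast
  then obtain k where "ev t k" "ev (num n) k" by auto
  then show "ev t n" using ev_det ev.num by blast
qed

lemma T1_cl: "R T1 t t \<Longrightarrow> \<forall>k. S.qap (S.cl T1 t) (Snm k) = Snm (g k) \<Longrightarrow> \<forall>k. ev (uapp t (num k)) (g k)"
  using cl_num_eq R_uapp[of N N t] R_num S.qap_cl[of N N t] by metis

lemma S_std: "std S.qdom S.qap S.qco Snm"
proof -
  interpret F: fts S.qdom S.qap S.qco by (rule S.fts_quotient)
  show ?thesis
  proof
    fix m n show "Snm m = Snm n \<longleftrightarrow> m = n"
      using cl_num_eq[OF R_num, of m n] ev_det ev.num by blast
  next
    show "S.qdom N = range Snm" unfolding S.qdom_def using Snm_ev R_num by auto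
  next
    show "S.qco CZero = Snm 0" unfolding S.qco_def by (simp add: Snm_ev ev.Zero)
  next
    fix n show "S.qap (S.qco CSuc) (Snm n) = Snm (Suc n)"
      using S.qap_cl[of N N "U (HC CSuc) []" "num n"] R_const[of CSuc] R_num[of n]
      by (simp add: S.qco_def Snm_ev ev.num ev.Suc)
  next
    fix c m n assume "bop c \<noteq> None"
    then obtain p where p: "bop c = Some p" by blast
    have c: "cst_ty c = N \<rightarrow> N \<rightarrow> N" using p by (cases c) auto
    note r = R_bop[OF p] R_uapp[OF R_bop[OF p] R_num[of m]]
    have e: "ev (U (HC c) [num m, num n]) (p m n)" by (rule ev.bop[OF ev.num ev.num]) (simp_all add: p)
    show "S.qap (S.qap (S.qco c) (Snm m)) (Snm n) = Snm (the (bop c) m n)"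
      unfolding S.qco_def c S.qap_cl[OF r(1) R_num] S.qap_cl[OF r(2) R_num]
      by (rule Snm_ev) (simp add: e p)
  next
    fix c f g n assume "phi c \<noteq> None" and F': "f \<in> S.qdom T1" "\<And>k. S.qap f (Snm k) = Snm (g k)"
    then obtain G where F: "phi c = Some G" by blast
    obtain t where t: "f = S.cl T1 t" "R T1 t t" using qdomE[OF F'(1)] by blast
    have c: "cst_ty c = T1 \<rightarrow> N \<rightarrow> N" using F by (cases c) auto
    have g: "\<forall>k. ev (uapp t (num k)) (g k)" using T1_cl t F'(2) by blast
    note r = R_phi[OF F] R_uapp[OF R_phi[OF F] t(2)]
    have e: "ev (U (HC c) [t, num n]) (G g n)" by (rule ev.phi[OF g ev.num]) (simp_all add: F)
    show "S.qap (S.qap (S.qco c) f) (Snm n) = Snm (the (phi c) g n)"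
      unfolding S.qco_def c t(1) S.qap_cl[OF r(1) t(2)] S.qap_cl[OF r(2) R_num]
      by (rule Snm_ev) (simp add: e F)
  next
    fix f g n assume F: "f \<in> S.qdom (N \<rightarrow> N \<rightarrow> N)" "\<And>k. S.qap (S.qap f (Snm n)) (Snm k) = Snm (g k)"
    obtain t where t: "f = S.cl (N \<rightarrow> N \<rightarrow> N) t" "R (N \<rightarrow> N \<rightarrow> N) t t" using qdomE[OF F(1)] by blast
    have tn: "R T1 (uapp t (num n)) (uapp t (num n))" using R_uapp[OF t(2) R_num] .
    have "\<forall>k. S.qap (S.cl T1 (uapp t (num n))) (Snm k) = Snm (g k)"
      using F(2) unfolding t(1) S.qap_cl[OF t(2) R_num] by blast
    then have g: "\<forall>k. ev (appl t [num n, num k]) (g k)" using T1_cl[OF tn] by simp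
    note r = R_mu R_uapp[OF R_mu t(2)]
    show "S.qap (S.qap (S.qco CMu) f) (Snm n) = Snm (mun g n)"
      unfolding S.qco_def cst_ty.simps t(1) S.qap_cl[OF r(1) t(2)] S.qap_cl[OF r(2) R_num]
      by (rule Snm_ev) (simp add: ev.mu[OF g ev.num refl])
  next
    fix \<rho> y r v ws assume a: "y \<in> S.qdom \<rho>" "r \<in> S.qdom (N \<rightarrow> N \<rightarrow> \<rho>)" "v \<in> S.qdom (N \<rightarrow> \<rho>)"
      "list_all2 (\<lambda>w \<sigma>. w \<in> S.qdom \<sigma>) ws (arg_tys \<rho>)"
    obtain y' r' v' us where y: "y = S.cl \<rho> y'" "R \<rho> y' y'" and r: "r = S.cl (N \<rightarrow> N \<rightarrow> \<rho>) r'" "R (N \<rightarrow> N \<rightarrow> \<rho>) r' r'"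
      and v: "v = S.cl (N \<rightarrow> \<rho>) v'" "R (N \<rightarrow> \<rho>) v' v'" and us: "Rl (arg_tys \<rho>) us us" "ws = map2 S.cl (arg_tys \<rho>) us"
      using qdomE[OF a(1)] qdomE[OF a(2)] qdomE[OF a(3)] Rl_refl_ex[OF a(4)] by metis
    let ?C = "U (HC (CRec \<rho>)) []"
    have rec: "S.qap (S.qap (S.qap (S.qap (S.qco (CRec \<rho>)) (Snm n)) y) r) v
        = S.cl \<rho> (U (HC (CRec \<rho>)) [num n, y', r', v']) \<and> R \<rho> (U (HC (CRec \<rho>)) [num n, y', r', v']) (U (HC (CRec \<rho>)) [num n, y', r', v'])" for n
    proof -
      note c1 = R_uapp[OF R_Rec R_num[of n]] note c2 = R_uapp[OF c1 y(2)] note c3 = R_uapp[OF c2 r(2)]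
      show ?thesis unfolding S.qco_def cst_ty.simps y(1) r(1) v(1)
        S.qap_cl[OF R_Rec R_num] S.qap_cl[OF c1 y(2)] S.qap_cl[OF c2 r(2)] S.qap_cl[OF c3 v(2)]
        using R_uapp[OF c3 v(2)] by (simp del: R.simps)
    qed
    have f: "foldl S.qap (S.qap (S.qap (S.qap (S.qap (S.qco (CRec \<rho>)) (Snm n)) y) r) v) ws
        = S.cl N (U (HC (CRec \<rho>)) (num n # y' # r' # v' # us))" for n
      using foldl_qap[OF conjunct2[OF rec[of n]] us(1)] unfolding conjunct1[OF rec[of n]] us(2) by simp
    { obtain n where "ev (appl y' us) n" using y(2) us(1) unfolding R_spine[of \<rho>] by blast
      then have "ev (U (HC (CRec \<rho>)) (num 0 # y' # r' # v' # us)) n" "ev (appl y' us) n"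
        by (auto intro: ev.rec0 ev.num)
      then show "foldl S.qap (S.qap (S.qap (S.qap (S.qap (S.qco (CRec \<rho>)) (Snm 0)) y) r) v) ws = foldl S.qap y ws"
        unfolding f unfolding y(1) us(2) foldl_qap[OF y(2) us(1)] by (simp add: Snm_ev) }
    { fix n
      let ?b = "U (HC (CRec \<rho>)) (num n # y' # r' # v' # us)"
      obtain i where "ev ?b i" using Rec_eval[OF y(2) r(2) v(2) us(1) ev.num ev.num] by blast
      then have b: "R N ?b ?b" by auto
      note r1 = R_uapp[OF r(2) b] note r2 = R_uapp[OF r1 R_num[of n]] note v2 = R_uapp[OF v(2) R_num[of n]]
      obtain p where p: "ev (appl (uapp (uapp r' ?b) (num n)) us) p" using r2 us(1) unfolding R_spine[of \<rho>] by blast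
      obtain q where q: "ev (appl (uapp v' (num n)) us) q" using v2 us(1) unfolding R_spine[of \<rho>] by blast
      have "ev (U (HC (CRec \<rho>)) (num (Suc n) # y' # r' # v' # us)) (min p q)"
        using p q by (auto intro: ev.recS ev.num)
      moreover have mn: "bop CMin = Some min" by simp
      note m = R_bop[OF mn] R_uapp[OF R_bop[OF mn] R_num[of p]]
      have e: "ev (U (HC CMin) [num p, num q]) (min p q)" by (rule ev.bop[OF ev.num ev.num]) simp_all
      have "S.qap (S.qap (S.qco CMin) (Snm p)) (Snm q) = Snm (min p q)"
        unfolding S.qco_def cst_ty.simps S.qap_cl[OF m(1) R_num] S.qap_cl[OF m(2) R_num]
        by (rule Snm_ev) (simp add: e)
      ultimately show "foldl S.qap (S.qap (S.qap (S.qap (S.qap (S.qco (CRec \<rho>)) (Snm (Suc n))) y) r) v) ws =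
         S.qap (S.qap (S.qco CMin) (foldl S.qap (S.qap (S.qap r (foldl S.qap (S.qap (S.qap (S.qap (S.qap (S.qco (CRec \<rho>)) (Snm n)) y) r) v) ws)) (Snm n)) ws))
          (foldl S.qap (S.qap v (Snm n)) ws)"
        unfolding f unfolding r(1) v(1) S.qap_cl[OF r(2) b] S.qap_cl[OF r1 R_num] S.qap_cl[OF v(2) R_num] us(2)
          foldl_qap[OF r2 us(1)] foldl_qap[OF v2 us(1)] Snm_ev[OF p] Snm_ev[OF q] by (simp add: Snm_ev) }
  next
    fix g :: "nat \<Rightarrow> nat"
    have "S.qap (S.cl T1 (U (HF1 g) [])) (Snm k) = Snm (g k)" for k
      unfolding S.qap_cl[OF R_F1 R_num] by (rule Snm_ev) (simp add: ev.F1[OF ev.num])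
    then show "\<exists>F\<in>S.qdom T1. \<forall>k. S.qap F (Snm k) = Snm (g k)" using S.qdomI[OF R_F1] by blast
  next
    fix Y :: "(nat \<Rightarrow> nat) \<Rightarrow> nat"
    have "S.qap (S.cl T2 (U (HF2 Y) [])) F = Snm (Y f)" if F: "F \<in> S.qdom T1" "\<forall>k. S.qap F (Snm k) = Snm (f k)" for F f
    proof -
      obtain t where t: "F = S.cl T1 t" "R T1 t t" using qdomE[OF F(1)] by blast
      have "\<forall>k. ev (uapp t (num k)) (f k)" using T1_cl[OF t(2)] F(2) t(1) by blast
      then have e: "ev (U (HF2 Y) [t]) (Y f)" by (rule ev.F2[OF _ refl])
      show ?thesis unfolding t(1) S.qap_cl[OF R_F2 t(2)] by (intro Snm_ev) (simp add: e)
    qed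
    then show "\<exists>G\<in>S.qdom T2. \<forall>F\<in>S.qdom T1. \<forall>f. (\<forall>k. S.qap F (Snm k) = Snm (f k)) \<longrightarrow> S.qap G F = Snm (Y f)"
      using S.qdomI[OF R_F2] by blast
  next
    fix M :: "(nat \<Rightarrow> nat) \<Rightarrow> nat \<Rightarrow> nat"
    have "S.qap (S.qap (S.cl (T1 \<rightarrow> T1) (U (HF11 M) [])) F) (Snm k) = Snm (M f k)"
      if F: "F \<in> S.qdom T1" "\<forall>k. S.qap F (Snm k) = Snm (f k)" for F f k
    proof -
      obtain t where t: "F = S.cl T1 t" "R T1 t t" using qdomE[OF F(1)] by blast
      have "\<forall>k. ev (uapp t (num k)) (f k)" using T1_cl[OF t(2)] F(2) t(1) by blast
      then have "ev (U (HF11 M) [t, num k]) (M f k)" by (rule ev.F11[OF _ ev.num refl])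
      then show ?thesis unfolding t(1) S.qap_cl[OF R_F11 t(2)] S.qap_cl[OF R_uapp[OF R_F11 t(2)] R_num]
        by (intro Snm_ev) simp
    qed
    then show "\<exists>G\<in>S.qdom (T1 \<rightarrow> T1). \<forall>F\<in>S.qdom T1. \<forall>f k. (\<forall>k. S.qap F (Snm k) = Snm (f k)) \<longrightarrow> S.qap (S.qap G F) (Snm k) = Snm (M f k)"
      using S.qdomI[OF R_F11] by blast
  next
    fix \<kappa> :: "((nat \<Rightarrow> nat) \<Rightarrow> nat) \<Rightarrow> nat \<Rightarrow> nat"
    have "S.qap (S.qap (S.cl (T2 \<rightarrow> T1) (U (HF21 \<kappa>) [])) Q) (Snm k) = Snm (\<kappa> Y k)"
      if Q: "Q \<in> S.qdom T2" "\<forall>F\<in>S.qdom T1. \<forall>f. (\<forall>k. S.qap F (Snm k) = Snm (f k)) \<longrightarrow> S.qap Q F = Snm (Y f)" for Q Y k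
    proof -
      obtain t where t: "Q = S.cl T2 t" "R T2 t t" using qdomE[OF Q(1)] by blast
      have "ev (uapp t (U (HF1 f) [])) (Y f)" for f
      proof -
        have "S.qap (S.cl T1 (U (HF1 f) [])) (Snm k) = Snm (f k)" for k
          unfolding S.qap_cl[OF R_F1 R_num] by (rule Snm_ev) (simp add: ev.F1[OF ev.num])
        then have "S.qap Q (S.cl T1 (U (HF1 f) [])) = Snm (Y f)" using Q(2) S.qdomI[OF R_F1] by blast
        then show ?thesis unfolding t(1) S.qap_cl[OF t(2) R_F1] using cl_num_eq R_uapp[OF t(2) R_F1] by blast
      qed
      then have "ev (U (HF21 \<kappa>) [t, num k]) (\<kappa> Y k)" by (intro ev.F21[OF _ ev.num refl]) blast
      then show ?thesis unfolding t(1) S.qap_cl[OF R_F21 t(2)] S.qap_cl[OF R_uapp[OF R_F21 t(2)] R_num]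
        by (intro Snm_ev) simp
    qed
    then show "\<exists>G\<in>S.qdom (T2 \<rightarrow> T1). \<forall>Q\<in>S.qdom T2. \<forall>Y k. (\<forall>F\<in>S.qdom T1. \<forall>f. (\<forall>k. S.qap F (Snm k) = Snm (f k)) \<longrightarrow> S.qap Q F = Snm (Y f))
       \<longrightarrow> S.qap (S.qap G Q) (Snm k) = Snm (\<kappa> Y k)"
      using S.qdomI[OF R_F21] by blast
  qed
qed

section \<open>Coding of sequences over the standard numbers\<close>

text \<open>Written with the same search as \<open>hd_tm\<close>, so that \<open>co_mu\<close> gives
  the value of that term at once; that it is the exponent of 2 is shown in
  \<open>hdn_code\<close>.\<close>

definition hdn :: "nat \<Rightarrow> nat" where
  "hdn n = mun (\<lambda>p. Suc (n div 2 ^ Suc p * 2 ^ Suc p) - n) n"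

definition tln :: "nat \<Rightarrow> nat" where "tln n = n div 2 ^ Suc (hdn n)"

definition codn :: "(nat \<Rightarrow> nat) \<Rightarrow> nat \<Rightarrow> nat" where
  "codn g k = (\<Sum>j<k. 2 ^ (j + sum g {..j}))"

lemma mun_eqI: "g m = 0 \<Longrightarrow> m \<le> n \<Longrightarrow> (\<And>y. g y = 0 \<Longrightarrow> m \<le> y) \<Longrightarrow> mun g n = m"
  unfolding mun_def by (auto intro: Least_equality)

lemma hdn_code: "hdn (2 ^ a * (2 * b + 1)) = a"
proof -
  let ?n = "2 ^ a * (2 * b + 1) :: nat"
  \<comment> \<open>The tested difference is 0 exactly for non-divisors, so the search returns the
    least p such that the power of 2 with exponent p + 1 does not divide.\<close>
  have z: "Suc (m div d * d) - m = 0 \<longleftrightarrow> \<not> d dvd m" for m d :: nat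
  proof
    assume "\<not> d dvd m"
    then have "m mod d \<noteq> 0" by (simp add: dvd_eq_mod_eq_0)
    moreover have "m div d * d + m mod d = m" by simp
    ultimately show "Suc (m div d * d) - m = 0" by linarith
  qed (auto simp: dvd_div_mult_self)
  have "2 ^ Suc a dvd ?n \<longleftrightarrow> 2 dvd 2 * b + 1"
    unfolding power_Suc2 by (rule nat_mult_dvd_cancel1) simp
  then have n: "\<not> 2 ^ Suc a dvd ?n" by simp
  show ?thesis unfolding hdn_def
  proof (rule mun_eqI)
    show "Suc (?n div 2 ^ Suc a * 2 ^ Suc a) - ?n = 0" using n z by blast
    have "a < 2 ^ a" by (rule less_exp)
    also have "(2::nat) ^ a \<le> ?n" by simp
    finally show "a \<le> ?n" by simp
    fix y assume "Suc (?n div 2 ^ Suc y * 2 ^ Suc y) - ?n = 0"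
    then have "\<not> 2 ^ Suc y dvd ?n" using z by blast
    then show "a \<le> y"
      by (metis dvd_mult2 le_imp_power_dvd not_less_eq_eq)
  qed
qed

lemma tln_code: "tln (2 ^ a * (2 * b + 1)) = b"
proof -
  have "2 ^ a * (2 * b + 1) div 2 ^ Suc a = (2 * b + 1) div (2 :: nat)"
    by (metis div_mult_mult1 power_Suc2 power_not_zero zero_neq_numeral)
  then show ?thesis unfolding tln_def hdn_code by simp
qed

lemma tln_le: "tln n \<le> n" unfolding tln_def by simp

lemma tln_pow_le: "(tln ^^ i) n \<le> n"
  by (induction i) (auto intro: order_trans[OF tln_le])

lemma tln_0 [simp]: "tln 0 = 0" by (simp add: tln_def)

text \<open>Splitting off the summand for j = 0 turns the closed sum into the recursion for putting
  a head in front: all other exponents contain g 0 + 1.\<close>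

lemma codn_Suc: "codn g (Suc k) = 2 ^ g 0 * (2 * codn (\<lambda>j. g (Suc j)) k + 1)"
proof -
  have s: "sum g {..Suc j} = g 0 + sum (\<lambda>j. g (Suc j)) {..j}" for j
    by (rule sum.atMost_Suc_shift)
  have "codn g (Suc k) = 2 ^ g 0 + (\<Sum>j<k. 2 ^ (Suc j + sum g {..Suc j}))"
    unfolding codn_def by (subst sum.lessThan_Suc_shift) simp
  also have "(\<Sum>j<k. 2 ^ (Suc j + sum g {..Suc j})) = (\<Sum>j<k. 2 ^ g 0 * (2 * (2 ^ (j + sum (\<lambda>j. g (Suc j)) {..j}) :: nat)))"
    by (rule sum.cong) (simp_all only: s add_Suc power_Suc power_add mult_ac)
  also have "\<dots> = 2 ^ g 0 * (2 * codn (\<lambda>j. g (Suc j)) k)"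
    unfolding codn_def by (simp add: sum_distrib_left)
  finally show ?thesis by (simp add: algebra_simps)
qed

lemma codn_0 [simp]: "codn g 0 = 0" by (simp add: codn_def)

lemma codn_drop: "i \<le> k \<Longrightarrow> (tln ^^ i) (codn g k) = codn (\<lambda>j. g (i + j)) (k - i)"
proof (induction i)
  case (Suc i)
  then have "k - i = Suc (k - Suc i)" by simp
  then have "(tln ^^ Suc i) (codn g k) = tln (codn (\<lambda>j. g (i + j)) (Suc (k - Suc i)))" using Suc by simp
  also have "\<dots> = codn (\<lambda>j. g (i + Suc j)) (k - Suc i)" by (simp only: codn_Suc tln_code)
  finally show ?case by simp
qed simp

lemma codn_nth: "i < k \<Longrightarrow> hdn ((tln ^^ i) (codn g k)) = g i"
proof -
  assume "i < k"
  define m where "m = k - Suc i"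
  have "k - i = Suc m" using \<open>i < k\<close> by (simp add: m_def)
  then have "hdn ((tln ^^ i) (codn g k)) = hdn (codn (\<lambda>j. g (i + j)) (Suc m))"
    using \<open>i < k\<close> codn_drop[of i k g] by simp
  also have "\<dots> = g (i + 0)" by (simp only: codn_Suc hdn_code)
  finally show ?thesis by simp
qed

text \<open>The search for the length is bounded by the code, so the code has to be at least as
  large as the length.\<close>

lemma codn_ge: "k \<le> codn g k"
proof (induction k arbitrary: g)
  case (Suc k)
  have "Suc k \<le> 2 * codn (\<lambda>j. g (Suc j)) k + 1" using Suc[of "\<lambda>j. g (Suc j)"] by simp
  also have "\<dots> = 1 * (2 * codn (\<lambda>j. g (Suc j)) k + 1)" by simp
  also have "\<dots> \<le> 2 ^ g 0 * (2 * codn (\<lambda>j. g (Suc j)) k + 1)" by (rule mult_le_mono1) simp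
  finally show ?case by (simp only: codn_Suc)
qed simp

definition lhn :: "nat \<Rightarrow> nat" where "lhn n = mun (\<lambda>i. (tln ^^ i) n) n"

lemma lhn_codn: "lhn (codn g k) = k"
  unfolding lhn_def
proof (rule mun_eqI)
  show "(tln ^^ k) (codn g k) = 0" by (simp add: codn_drop)
  show "k \<le> codn g k" by (rule codn_ge)
  fix y assume y: "(tln ^^ y) (codn g k) = 0"
  show "k \<le> y"
  proof (rule ccontr)
    assume "\<not> k \<le> y"
    then have "codn (\<lambda>j. g (y + j)) (k - y) = 0" "k - y > 0" using y by (simp_all add: codn_drop)
    then show False using codn_ge[of "k - y" "\<lambda>j. g (y + j)"] by simp
  qed
qed

section \<open>Argument tuples and the values of the coding terms\<close>

context fts
begin

definition upds :: "(var \<Rightarrow> 'a) \<Rightarrow> var list \<Rightarrow> 'a list \<Rightarrow> var \<Rightarrow> 'a" where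
  "upds e xs ws = fold (\<lambda>(x, w) e. e(x := w)) (zip xs ws) e"

lemma upds_simps [simp]: "upds e [] ws = e" "upds e (x # xs) (w # ws) = upds (e(x := w)) xs ws"
  by (simp_all add: upds_def)

lemma upds_other: "length xs = length ws \<Longrightarrow> x \<notin> set xs \<Longrightarrow> upds e xs ws x = e x"
  by (induction xs ws arbitrary: e rule: list_induct2) auto

lemma upds_tenv: "list_all2 (\<lambda>x w. w \<in> dom (snd x)) xs ws \<Longrightarrow> tenv e \<Longrightarrow> tenv (upds e xs ws)"
  by (induction xs ws arbitrary: e rule: list_all2_induct) auto

lemma upds_map: "length xs = length ws \<Longrightarrow> distinct xs \<Longrightarrow> map (upds e xs ws) xs = ws"
  by (induction xs ws arbitrary: e rule: list_induct2) (auto simp: upds_other)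

lemma val_lams_spine:
  "list_all2 (\<lambda>x w. w \<in> dom (snd x)) xs ws \<Longrightarrow> wt t \<Longrightarrow> tenv e \<Longrightarrow>
   foldl (\<bullet>) (val (lams xs t) e) ws = val t (upds e xs ws)"
  by (induction xs ws arbitrary: e rule: list_all2_induct) auto

lemma val_apps: "val (apps t us) e = foldl (\<bullet>) (val t e) (map (\<lambda>u. val u e) us)"
  unfolding apps_def by (induction us arbitrary: t) auto

definition args :: "ty \<Rightarrow> 'a list \<Rightarrow> bool" where
  "args \<sigma> ws \<longleftrightarrow> list_all2 (\<lambda>w \<tau>. w \<in> dom \<tau>) ws (arg_tys \<sigma>)"

lemma args_Fn: "args (\<sigma> \<rightarrow> \<tau>) ws \<longleftrightarrow> (\<exists>w vs. ws = w # vs \<and> w \<in> dom \<sigma> \<and> args \<tau> vs)"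
  unfolding args_def by (cases ws) auto

text \<open>Sequences of objects of higher type are coded argument by argument, so identities
  between them are checked at full argument tuples, where they are statements about numbers.\<close>

lemma ext_args: "F \<in> dom \<sigma> \<Longrightarrow> G \<in> dom \<sigma> \<Longrightarrow> (\<And>ws. args \<sigma> ws \<Longrightarrow> foldl (\<bullet>) F ws = foldl (\<bullet>) G ws) \<Longrightarrow> F = G"
proof (induction \<sigma> arbitrary: F G)
  case N
  then show ?case by (force simp: args_def)
next
  case (Fn \<sigma> \<tau>)
  have "F \<bullet> x = G \<bullet> x" if x: "x \<in> dom \<sigma>" for x
  proof (rule Fn.IH(2))
    fix ws assume "args \<tau> ws"
    then show "foldl (\<bullet>) (F \<bullet> x) ws = foldl (\<bullet>) (G \<bullet> x) ws"
      using Fn.prems(3)[of "x # ws"] x by (simp add: args_Fn)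
  qed (use Fn.prems x ap_dom in auto)
  then show ?case using Fn.prems ext by blast
qed

lemma foldl_dom: "F \<in> dom \<sigma> \<Longrightarrow> args \<sigma> ws \<Longrightarrow> foldl (\<bullet>) F ws \<in> dom N"
proof (induction \<sigma> arbitrary: F ws)
  case (Fn \<sigma> \<tau>)
  then show ?case using ap_dom by (fastforce simp: args_Fn)
qed (simp add: args_def)

lemma args_arg_vars: "args \<sigma> ws \<Longrightarrow> list_all2 (\<lambda>x w. w \<in> dom (snd x)) (arg_vars \<sigma>) ws"
  unfolding args_def arg_vars_def by (auto simp: list_all2_conv_all_nth)

lemma distinct_arg_vars: "distinct (arg_vars \<sigma>)"
  unfolding arg_vars_def by (simp add: distinct_zipI1)

text \<open>The coding terms use indices below 10 for everything else, so the argument variables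
  never interfere.\<close>

lemma fst_arg_vars: "x \<in> set (arg_vars \<sigma>) \<Longrightarrow> 10 \<le> fst x"
  by (cases x) (auto simp: arg_vars_def dest: set_zip_leftD)

lemma upds_arg_vars:
  assumes "args \<sigma> ws"
  shows "map (\<lambda>u. val u (upds e (arg_vars \<sigma>) ws)) (map V (arg_vars \<sigma>)) = ws"
    and "fst x < 10 \<Longrightarrow> upds e (arg_vars \<sigma>) ws x = e x"
proof -
  have l: "length (arg_vars \<sigma>) = length ws"
    using args_arg_vars[OF assms] list_all2_lengthD by blast
  show "map (\<lambda>u. val u (upds e (arg_vars \<sigma>) ws)) (map V (arg_vars \<sigma>)) = ws"
    using upds_map[OF l distinct_arg_vars] by (simp add: comp_def)
  show "fst x < 10 \<Longrightarrow> upds e (arg_vars \<sigma>) ws x = e x"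
    using fst_arg_vars[of x \<sigma>] by (intro upds_other[OF l]) auto
qed

lemma zero_args: "args \<sigma> (map (\<lambda>t. val t e) (map zero_tm (arg_tys \<sigma>)))" if "tenv e"
  unfolding args_def using that by (auto simp: list_all2_conv_all_nth)

end

text \<open>The converse of \<open>len_tm\<close> and \<open>comp_tm\<close>: an object coding y 0,
  ..., y (k - 1), obtained by coding the values at each argument tuple as a number sequence.\<close>

definition seq_tm :: "ty \<Rightarrow> tm" where
  "seq_tm \<sigma> = lams ((0, N \<rightarrow> \<sigma>) # (1, N) # arg_vars \<sigma>)
     (code_tm \<cdot> lam (2, N) (apps (V (0, N \<rightarrow> \<sigma>) \<cdot> V (2, N)) (map V (arg_vars \<sigma>))) \<cdot> V (1, N))"

lemma seq_tm_typed [simp]: "wt (seq_tm \<sigma>)" "ty_of (seq_tm \<sigma>) = (N \<rightarrow> \<sigma>) \<rightarrow> N \<rightarrow> \<sigma>" "tvars (seq_tm \<sigma>) = {}"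
  unfolding seq_tm_def by (auto simp: ty_of_lams)

context std
begin

lemma nm_dom [simp]: "nm n \<in> dom N" using dom_N by simp

lemma domN_E: "a \<in> dom N \<Longrightarrow> \<exists>n. a = nm n" using dom_N by auto

lemma T1_nm: "F \<in> dom T1 \<Longrightarrow> \<exists>g. \<forall>k. F \<bullet> nm k = nm (g k)"
proof -
  assume "F \<in> dom T1"
  then have "\<exists>n. F \<bullet> nm k = nm n" for k using ap_dom[of F N N "nm k"] domN_E by simp
  then show ?thesis by metis
qed

lemma bop_simps [simp]:
  "co CMin \<bullet> nm m \<bullet> nm n = nm (min m n)" "co CMax \<bullet> nm m \<bullet> nm n = nm (max m n)" "co CA0 \<bullet> nm m \<bullet> nm n = nm (Suc n)"
  "co CA1 \<bullet> nm m \<bullet> nm n = nm (m + n)" "co CA2 \<bullet> nm m \<bullet> nm n = nm (m * n)" "co CA3 \<bullet> nm m \<bullet> nm n = nm (m ^ n)"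
  using co_bop[of CMin m n] co_bop[of CMax m n] co_bop[of CA0 m n] co_bop[of CA1 m n] co_bop[of CA2 m n] co_bop[of CA3 m n]
  by simp_all

fun recf :: "nat \<Rightarrow> (nat \<Rightarrow> nat \<Rightarrow> nat) \<Rightarrow> (nat \<Rightarrow> nat) \<Rightarrow> nat \<Rightarrow> nat" where
  "recf y h b 0 = y"
| "recf y h b (Suc n) = min (h (recf y h b n) n) (b n)"

lemma rec_N:
  assumes "r \<in> dom (N \<rightarrow> N \<rightarrow> N)" "v \<in> dom T1" "\<And>a n. r \<bullet> nm a \<bullet> nm n = nm (h a n)" "\<And>n. v \<bullet> nm n = nm (b n)"
  shows "co (CRec N) \<bullet> nm n \<bullet> nm y \<bullet> r \<bullet> v = nm (recf y h b n)"
proof (induction n)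
  case 0
  then show ?case using co_rec0[of "nm y" N r v "[]"] assms by simp
next
  case (Suc n)
  then show ?case using co_recS[of "nm y" N r v "[]" n] assms by simp
qed

lemma pred_nm [simp]: assumes e: "tenv e" shows "val pred_tm e \<bullet> nm n = nm (n - 1)"
proof -
  have "val pred_tm e \<bullet> nm n = nm (recf 0 (\<lambda>a n. n) (\<lambda>n. n) n)"
    using e unfolding pred_tm_def by (simp del: lam.simps, intro rec_N) simp_all
  also have "recf 0 (\<lambda>a n. n) (\<lambda>n. n) n = n - 1" by (cases n) auto
  finally show ?thesis .
qed

lemma monus_nm [simp]: assumes e: "tenv e" shows "val monus_tm e \<bullet> nm a \<bullet> nm b = nm (a - b)"
proof -
  have "val monus_tm e \<bullet> nm a \<bullet> nm b = nm (recf a (\<lambda>x n. x - 1) (\<lambda>n. a) b)"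
    using e unfolding monus_tm_def by (simp, intro rec_N) simp_all
  also have "recf a (\<lambda>x n. x - 1) (\<lambda>n. a) b = a - b" by (induction b) auto
  finally show ?thesis .
qed

lemma pow2_val [simp]: "val (pow2 t) e = co CA3 \<bullet> nm 2 \<bullet> val t e"
  by (simp add: pow2_def numeral_2_eq_2)

lemma shift_nm [simp]: assumes e: "tenv e" shows "val shift_tm e \<bullet> nm n \<bullet> nm p = nm (n div 2 ^ p)"
proof -
  have "val shift_tm e \<bullet> nm n \<bullet> nm p = nm (mun (\<lambda>q. Suc n - Suc q * 2 ^ p) n)"
    using e unfolding shift_tm_def by (simp, intro co_mu) simp_all
  also have "mun (\<lambda>q. Suc n - Suc q * 2 ^ p) n = n div 2 ^ p"
  proof (rule mun_eqI)
    have "n < Suc (n div 2 ^ p) * 2 ^ p"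
      using dividend_less_div_times[of "2 ^ p" n] by simp
    then show "Suc n - Suc (n div 2 ^ p) * 2 ^ p = 0" by simp
    fix y assume "Suc n - Suc y * 2 ^ p = 0"
    then have "n < Suc y * 2 ^ p" by simp
    then have "n div 2 ^ p < Suc y" by (simp add: less_mult_imp_div_less)
    then show "n div 2 ^ p \<le> y" by simp
  qed simp
  finally show ?thesis .
qed

lemma hd_nm [simp]: assumes e: "tenv e" shows "val hd_tm e \<bullet> nm n = nm (hdn n)"
  unfolding hdn_def using e unfolding hd_tm_def by (simp, intro co_mu) simp_all

lemma tl_nm [simp]: assumes e: "tenv e" shows "val tl_tm e \<bullet> nm n = nm (tln n)"
  unfolding tln_def using e unfolding tl_tm_def by simp

lemma drop_nm [simp]: assumes e: "tenv e" shows "val drop_tm e \<bullet> nm n \<bullet> nm i = nm ((tln ^^ i) n)"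
proof -
  have "val drop_tm e \<bullet> nm n \<bullet> nm i = nm (recf n (\<lambda>x k. tln x) (\<lambda>k. n) i)"
    using e unfolding drop_tm_def by (simp, intro rec_N) simp_all
  \<comment> \<open>The cut-off n of the bounded recursion never becomes active, because tails do
    not exceed the code.\<close>
  also have "recf n (\<lambda>x k. tln x) (\<lambda>k. n) i = (tln ^^ i) n"
  proof (induction i)
    case (Suc i)
    then show ?case using tln_pow_le[of "Suc i" n] by simp
  qed simp
  finally show ?thesis .
qed

lemma nth_nm [simp]: assumes e: "tenv e" shows "val nth_tm e \<bullet> nm n \<bullet> nm i = nm (hdn ((tln ^^ i) n))"
  using e unfolding nth_tm_def by simp

lemma lh_nm [simp]: assumes e: "tenv e" shows "val lh_tm e \<bullet> nm n = nm (lhn n)"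
  unfolding lhn_def using e unfolding lh_tm_def by (simp, intro co_mu) simp_all

lemma Phi_nm:
  assumes "f \<in> dom T1" "\<And>k. f \<bullet> nm k = nm (g k)"
  shows "co CPhi1 \<bullet> f \<bullet> nm n = nm (Max (g ` {..n}))" "co CPhi2 \<bullet> f \<bullet> nm n = nm (sum g {..n})"
    "co CPhi3 \<bullet> f \<bullet> nm n = nm (prod g {..n})"
  using co_phi[of CPhi1 f g n] co_phi[of CPhi2 f g n] co_phi[of CPhi3 f g n] assms by simp_all

lemma psum_nm: assumes e: "tenv e" and h: "h \<in> dom T1" "\<And>k. h \<bullet> nm k = nm (g k)"
  shows "val psum_tm e \<bullet> h \<bullet> nm k = nm (\<Sum>j<k. g j)"
proof -
  have "val psum_tm e \<bullet> h \<bullet> nm k = nm (sum (recf 0 (\<lambda>x n. g n) g) {..k})"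
    using e h unfolding psum_tm_def by (simp, intro Phi_nm(2)) (simp_all, intro rec_N, simp_all)
  also have "sum (recf 0 (\<lambda>x n. g n) g) {..k} = (\<Sum>j<k. g j)"
  proof (cases k)
    case (Suc m)
    then show ?thesis by (simp only: sum.atMost_Suc_shift lessThan_Suc_atMost) simp
  qed simp
  finally show ?thesis .
qed

lemma code_nm: assumes e: "tenv e" and h: "h \<in> dom T1" "\<And>k. h \<bullet> nm k = nm (g k)"
  shows "val code_tm e \<bullet> h \<bullet> nm k = nm (codn g k)"
  unfolding codn_def using e h unfolding code_tm_def
  by (simp, intro psum_nm) (simp_all add: Phi_nm(2)[OF h])

lemma len_args: "tenv e \<Longrightarrow> y \<in> dom \<sigma> \<Longrightarrow> val (len_tm \<sigma>) e \<bullet> y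
    = val lh_tm e \<bullet> foldl (\<bullet>) y (map (\<lambda>t. val t e) (map zero_tm (arg_tys \<sigma>)))"
proof -
  assume e: "tenv e" and y: "y \<in> dom \<sigma>"
  have c: "val t (e(x := a)) = val t e" if "tvars t = {}" for t x a
    by (rule val_cong) (use that in simp)
  show ?thesis unfolding len_tm_def using e y by (simp add: val_apps c comp_def)
qed

lemma comp_args: "tenv e \<Longrightarrow> y \<in> dom \<sigma> \<Longrightarrow> args \<sigma> ws \<Longrightarrow>
  foldl (\<bullet>) (val (comp_tm \<sigma>) e \<bullet> y \<bullet> nm i) ws = val nth_tm e \<bullet> foldl (\<bullet>) y ws \<bullet> nm i"
proof -
  assume e: "tenv e" and y: "y \<in> dom \<sigma>" and w: "args \<sigma> ws"
  let ?e = "e((0, \<sigma>) := y, (1, N) := nm i)"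
  let ?b = "nth_tm \<cdot> apps (V (0, \<sigma>)) (map V (arg_vars \<sigma>)) \<cdot> V (1, N)"
  have te: "tenv ?e" using e y by simp
  have "val (comp_tm \<sigma>) e \<bullet> y \<bullet> nm i = val (lams (arg_vars \<sigma>) ?b) ?e"
    unfolding comp_tm_def using e y by simp
  then have "foldl (\<bullet>) (val (comp_tm \<sigma>) e \<bullet> y \<bullet> nm i) ws = val ?b (upds ?e (arg_vars \<sigma>) ws)"
    using val_lams_spine[OF args_arg_vars[OF w] _ te, of ?b] by simp
  also have "\<dots> = val nth_tm (upds ?e (arg_vars \<sigma>) ws) \<bullet> foldl (\<bullet>) y ws \<bullet> nm i"
    by (simp add: val_apps upds_arg_vars[OF w] del: map_map)
  also have "val nth_tm (upds ?e (arg_vars \<sigma>) ws) = val nth_tm e" by (rule val_cong) simp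
  finally show ?thesis .
qed

lemma seq_args: "tenv e \<Longrightarrow> y \<in> dom (N \<rightarrow> \<sigma>) \<Longrightarrow> args \<sigma> ws \<Longrightarrow> (\<And>j. foldl (\<bullet>) (y \<bullet> nm j) ws = nm (g j)) \<Longrightarrow>
  foldl (\<bullet>) (val (seq_tm \<sigma>) e \<bullet> y \<bullet> nm k) ws = nm (codn g k)"
proof -
  assume e: "tenv e" and y: "y \<in> dom (N \<rightarrow> \<sigma>)" and w: "args \<sigma> ws" and g: "\<And>j. foldl (\<bullet>) (y \<bullet> nm j) ws = nm (g j)"
  let ?e = "e((0, N \<rightarrow> \<sigma>) := y, (1, N) := nm k)"
  let ?l = "lam (2, N) (apps (V (0, N \<rightarrow> \<sigma>) \<cdot> V (2, N)) (map V (arg_vars \<sigma>)))"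
  let ?b = "code_tm \<cdot> ?l \<cdot> V (1, N)"
  let ?u = "upds ?e (arg_vars \<sigma>) ws"
  have te: "tenv ?e" using e y by simp
  have tu: "tenv ?u" using upds_tenv[OF args_arg_vars[OF w] te] .
  have "val (seq_tm \<sigma>) e \<bullet> y \<bullet> nm k = val (lams (arg_vars \<sigma>) ?b) ?e"
    unfolding seq_tm_def using e y by simp
  then have "foldl (\<bullet>) (val (seq_tm \<sigma>) e \<bullet> y \<bullet> nm k) ws = val ?b ?u"
    using val_lams_spine[OF args_arg_vars[OF w] _ te, of ?b] by simp
  also have "\<dots> = val code_tm ?u \<bullet> val ?l ?u \<bullet> nm k"
    by (simp add: upds_arg_vars(2)[OF w])
  also have "\<dots> = nm (codn g k)"
  proof (rule code_nm[OF tu])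
    show "val ?l ?u \<in> dom T1" using tu by simp
    fix j
    have "(2, N) \<notin> set (arg_vars \<sigma>)" using fst_arg_vars by fastforce
    then have "map (\<lambda>x. (?u((2, N) := nm j)) x) (arg_vars \<sigma>) = map ?u (arg_vars \<sigma>)" by auto
    also have "\<dots> = ws" using upds_arg_vars(1)[OF w, of ?e] by (simp add: comp_def)
    finally have m: "map (\<lambda>x. (?u((2, N) := nm j)) x) (arg_vars \<sigma>) = ws" .
    have "val ?l ?u \<bullet> nm j = foldl (\<bullet>) (y \<bullet> nm j) (map (\<lambda>x. (?u((2, N) := nm j)) x) (arg_vars \<sigma>))"
      using tu by (simp add: val_apps comp_def upds_arg_vars(2)[OF w])
    then show "val ?l ?u \<bullet> nm j = nm (g j)" unfolding m g .
  qed
  finally show ?thesis .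
qed

lemma args_nm: "y \<in> dom (N \<rightarrow> \<sigma>) \<Longrightarrow> args \<sigma> ws \<Longrightarrow> \<exists>g. \<forall>j. foldl (\<bullet>) (y \<bullet> nm j) ws = nm (g j)"
proof -
  assume "y \<in> dom (N \<rightarrow> \<sigma>)" "args \<sigma> ws"
  then have "\<exists>n. foldl (\<bullet>) (y \<bullet> nm j) ws = nm n" for j
    using foldl_dom[of "y \<bullet> nm j" \<sigma> ws] ap_dom[of y N \<sigma> "nm j"] domN_E by simp
  then show ?thesis by metis
qed

lemma seq_dom: "tenv e \<Longrightarrow> y \<in> dom (N \<rightarrow> \<sigma>) \<Longrightarrow> val (seq_tm \<sigma>) e \<bullet> y \<bullet> nm k \<in> dom \<sigma>"
  using val_in[of e "seq_tm \<sigma>" "(N \<rightarrow> \<sigma>) \<rightarrow> N \<rightarrow> \<sigma>"] ap_dom[of "val (seq_tm \<sigma>) e" "N \<rightarrow> \<sigma>" "N \<rightarrow> \<sigma>" y]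
    ap_dom[of "val (seq_tm \<sigma>) e \<bullet> y" N \<sigma> "nm k"] by simp

lemma comp_dom: "tenv e \<Longrightarrow> y \<in> dom \<sigma> \<Longrightarrow> val (comp_tm \<sigma>) e \<bullet> y \<bullet> nm i \<in> dom \<sigma>"
  using val_in[of e "comp_tm \<sigma>" "\<sigma> \<rightarrow> N \<rightarrow> \<sigma>"] ap_dom[of "val (comp_tm \<sigma>) e" \<sigma> "N \<rightarrow> \<sigma>" y]
    ap_dom[of "val (comp_tm \<sigma>) e \<bullet> y" N \<sigma> "nm i"] by simp

lemma len_seq: assumes e: "tenv e" and y: "y \<in> dom (N \<rightarrow> \<sigma>)"
  shows "val (len_tm \<sigma>) e \<bullet> (val (seq_tm \<sigma>) e \<bullet> y \<bullet> nm k) = nm k"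
proof -
  obtain g where "\<forall>j. foldl (\<bullet>) (y \<bullet> nm j) (map (\<lambda>t. val t e) (map zero_tm (arg_tys \<sigma>))) = nm (g j)"
    using args_nm[OF y zero_args[OF e]] by blast
  then show ?thesis
    using seq_args[OF e y zero_args[OF e], of g k] e by (simp add: len_args seq_dom y lhn_codn del: map_map)
qed

lemma comp_seq: assumes e: "tenv e" and y: "y \<in> dom (N \<rightarrow> \<sigma>)" and i: "i < k"
  shows "val (comp_tm \<sigma>) e \<bullet> (val (seq_tm \<sigma>) e \<bullet> y \<bullet> nm k) \<bullet> nm i = y \<bullet> nm i"
proof (rule ext_args[of _ \<sigma>])
  fix ws assume w: "args \<sigma> ws"
  obtain g where g: "\<forall>j. foldl (\<bullet>) (y \<bullet> nm j) ws = nm (g j)" using args_nm[OF y w] by blast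
  show "foldl (\<bullet>) (val (comp_tm \<sigma>) e \<bullet> (val (seq_tm \<sigma>) e \<bullet> y \<bullet> nm k) \<bullet> nm i) ws = foldl (\<bullet>) (y \<bullet> nm i) ws"
    using comp_args[OF e seq_dom[OF e y] w] seq_args[OF e y w, of g k] g e i by (simp add: codn_nth)
qed (use e y comp_dom seq_dom ap_dom in auto)

text \<open>The case of a single block, which is the one that arises for the witnesses of
  \<open>HAC_int\<close>. Every position below m lies in block 0, so the search for the block index
  returns 0; beyond m the coded function is irrelevant, hence the auxiliary
  \<open>h\<close>.\<close>

lemma flat_one:
  assumes e: "tenv e" and l: "l \<in> dom T1" "l \<bullet> nm 0 = nm m" and q: "q \<in> dom (N \<rightarrow> N \<rightarrow> N)" "\<And>j. q \<bullet> nm 0 \<bullet> nm j = nm (g j)"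
  shows "\<exists>h. (\<forall>j<m. h j = g j) \<and> val flat_tm e \<bullet> l \<bullet> q \<bullet> nm 1 = nm (codn h m)"
proof -
  obtain l' where l': "\<And>k. l \<bullet> nm k = nm (l' k)" using T1_nm[OF l(1)] by blast
  have l0: "l' 0 = m" using l(2) l'[of 0] by simp
  let ?e = "e((0, T1) := l, (0, N \<rightarrow> N \<rightarrow> N) := q, (0, N) := nm 1)"
  have te: "tenv ?e" using e l q by simp
  have tj: "tenv (?e((1, N) := nm j))" for j using te by simp
  let ?M = "Cn CMu \<cdot> lams [(3, N), (2, N)] (monus_tm \<cdot> Sc (V (1, N)) \<cdot> (psum_tm \<cdot> V (0, T1) \<cdot> Sc (V (2, N)))) \<cdot> V (0, N)"
  let ?L = "lam (1, N) (V (0, N \<rightarrow> N \<rightarrow> N) \<cdot> ?M \<cdot> (monus_tm \<cdot> V (1, N) \<cdot> (psum_tm \<cdot> V (0, T1) \<cdot> ?M)))"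
  have eq: "val flat_tm e \<bullet> l \<bullet> q \<bullet> nm 1 = val code_tm ?e \<bullet> val ?L ?e \<bullet> (val psum_tm ?e \<bullet> l \<bullet> nm 1)"
    using e l q unfolding flat_tm_def Let_def by simp
  have L: "val ?L ?e \<in> dom T1" using te by simp
  obtain h where h: "\<And>k. val ?L ?e \<bullet> nm k = nm (h k)" using T1_nm[OF L] by blast
  have "h j = g j" if j: "j < m" for j
  proof -
    let ?f = "\<lambda>i. Suc j - (\<Sum>i'<Suc i. l' i')"
    have "val ?M (?e((1, N) := nm j)) = nm (mun ?f 1)"
      using te e l q by (simp, intro co_mu) (simp_all add: psum_nm[OF _ l(1) l'])
    moreover have "mun ?f 1 = 0"
      by (rule mun_eqI) (use j l0 in auto)
    ultimately have M: "val ?M (?e((1, N) := nm j)) = nm 0" by simp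
    have "val ?L ?e \<bullet> nm j = val (V (0, N \<rightarrow> N \<rightarrow> N) \<cdot> ?M \<cdot> (monus_tm \<cdot> V (1, N) \<cdot> (psum_tm \<cdot> V (0, T1) \<cdot> ?M))) (?e((1, N) := nm j))"
      by (rule val_lam) (use te in simp_all)
    also have "\<dots> = (?e((1, N) := nm j)) (0, N \<rightarrow> N \<rightarrow> N) \<bullet> val ?M (?e((1, N) := nm j))
        \<bullet> (val monus_tm (?e((1, N) := nm j)) \<bullet> (?e((1, N) := nm j)) (1, N)
          \<bullet> (val psum_tm (?e((1, N) := nm j)) \<bullet> (?e((1, N) := nm j)) (0, T1) \<bullet> val ?M (?e((1, N) := nm j))))"
      by (simp only: val.simps)
    also have "\<dots> = q \<bullet> nm 0 \<bullet> (val monus_tm (?e((1, N) := nm j)) \<bullet> nm j \<bullet> (val psum_tm (?e((1, N) := nm j)) \<bullet> l \<bullet> nm 0))"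
      unfolding M by simp
    also have "\<dots> = q \<bullet> nm 0 \<bullet> nm j"
      using psum_nm[OF tj l(1) l', of j 0] monus_nm[OF tj, of j j 0] by simp
    finally show ?thesis using h q(2) by simp
  qed
  moreover have "val flat_tm e \<bullet> l \<bullet> q \<bullet> nm 1 = nm (codn h m)"
    unfolding eq using psum_nm[OF te l(1) l', of 1] code_nm[OF te L h] l0 by simp
  ultimately show ?thesis by blast
qed

text \<open>The sequence with f as its only component, built from any \<open>ff\<close> with value f
  at 0, has as its image at x the sequence coded by f x. Evaluation at argument tuples reduces this
  to \<open>flat_one\<close>.\<close>

lemma img_seq:
  assumes e: "tenv e" and x: "x \<in> dom \<sigma>" and f: "f \<in> dom (\<sigma> \<rightarrow> \<tau>)" and ff: "ff \<in> dom (N \<rightarrow> \<sigma> \<rightarrow> \<tau>)" "ff \<bullet> nm 0 = f"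
    and m: "val (len_tm \<tau>) e \<bullet> (f \<bullet> x) = nm m"
  defines "Z \<equiv> val (img_tm \<sigma> \<tau>) e \<bullet> (val (seq_tm (\<sigma> \<rightarrow> \<tau>)) e \<bullet> ff \<bullet> nm 1) \<bullet> x"
  shows "val (len_tm \<tau>) e \<bullet> Z = nm m" "j < m \<Longrightarrow> val (comp_tm \<tau>) e \<bullet> Z \<bullet> nm j = val (comp_tm \<tau>) e \<bullet> (f \<bullet> x) \<bullet> nm j"
proof -
  let ?Y = "val (seq_tm (\<sigma> \<rightarrow> \<tau>)) e \<bullet> ff \<bullet> nm 1"
  have Y: "?Y \<in> dom (\<sigma> \<rightarrow> \<tau>)" using seq_dom[OF e ff(1)] .
  have fx: "f \<bullet> x \<in> dom \<tau>" using f x ap_dom by blast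
  have Y0: "val (comp_tm (\<sigma> \<rightarrow> \<tau>)) e \<bullet> ?Y \<bullet> nm 0 = f" using comp_seq[OF e ff(1), of 0 1] ff by simp
  have Yl: "val (len_tm (\<sigma> \<rightarrow> \<tau>)) e \<bullet> ?Y = nm 1" using len_seq[OF e ff(1)] .
  have Z: "Z \<in> dom \<tau>" unfolding Z_def
    using val_in[of e "img_tm \<sigma> \<tau>" "(\<sigma> \<rightarrow> \<tau>) \<rightarrow> \<sigma> \<rightarrow> \<tau>"] ap_dom[of "val (img_tm \<sigma> \<tau>) e" "\<sigma> \<rightarrow> \<tau>" "\<sigma> \<rightarrow> \<tau>" ?Y]
      ap_dom[of "val (img_tm \<sigma> \<tau>) e \<bullet> ?Y" \<sigma> \<tau> x] e Y x by simp
  have main: "\<exists>h. (\<forall>j<m. nm (h j) = foldl (\<bullet>) (val (comp_tm \<tau>) e \<bullet> (f \<bullet> x) \<bullet> nm j) ws) \<and> foldl (\<bullet>) Z ws = nm (codn h m)"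
    if w: "args \<tau> ws" for ws
  proof -
    let ?FX = "comp_tm (\<sigma> \<rightarrow> \<tau>) \<cdot> V (0, \<sigma> \<rightarrow> \<tau>) \<cdot> V (2, N) \<cdot> V (1, \<sigma>)"
    let ?l = "lam (2, N) (len_tm \<tau> \<cdot> ?FX)"
    let ?in = "apps (comp_tm \<tau> \<cdot> ?FX \<cdot> V (3, N)) (map V (arg_vars \<tau>))"
    let ?q = "lams [(2, N), (3, N)] ?in"
    let ?b = "flat_tm \<cdot> ?l \<cdot> ?q \<cdot> (len_tm (\<sigma> \<rightarrow> \<tau>) \<cdot> V (0, \<sigma> \<rightarrow> \<tau>))"
    let ?e = "e((0, \<sigma> \<rightarrow> \<tau>) := ?Y, (1, \<sigma>) := x)"
    define U where "U = upds ?e (arg_vars \<tau>) ws"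
    have te: "tenv ?e" using e Y x by simp
    have tu: "tenv U" unfolding U_def using upds_tenv[OF args_arg_vars[OF w] te] .
    have cl: "val t U = val t e" "val t (U(y := a)) = val t e" "val t (U(y := a, y' := a')) = val t e"
      if "tvars t = {}" for t y a y' a' by (rule val_cong, use that in simp)+
    have u: "U (0, \<sigma> \<rightarrow> \<tau>) = ?Y" "U (Suc 0, \<sigma>) = x"
      unfolding U_def using upds_arg_vars(2)[OF w, of _ ?e] by simp_all
    have "val (img_tm \<sigma> \<tau>) e \<bullet> ?Y \<bullet> x = val (lams (arg_vars \<tau>) ?b) ?e"
      unfolding img_tm_def Let_def using e Y x by simp
    then have "foldl (\<bullet>) Z ws = val ?b U"
      unfolding Z_def U_def using val_lams_spine[OF args_arg_vars[OF w] _ te, of ?b] by simp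
    also have "\<dots> = val flat_tm U \<bullet> val ?l U \<bullet> val ?q U \<bullet> nm 1"
      by (simp add: u cl Yl[unfolded One_nat_def] del: val_lams_Cons)
    finally have eq: "foldl (\<bullet>) Z ws = val flat_tm U \<bullet> val ?l U \<bullet> val ?q U \<bullet> nm 1" .
    have l: "val ?l U \<in> dom T1" "val ?l U \<bullet> nm 0 = nm m"
      using tu by (simp_all add: u cl Y0[unfolded One_nat_def] m)
    have q: "val ?q U \<in> dom (N \<rightarrow> N \<rightarrow> N)" using tu by simp
    have qj: "val ?q U \<bullet> nm 0 \<bullet> nm j = foldl (\<bullet>) (val (comp_tm \<tau>) e \<bullet> (f \<bullet> x) \<bullet> nm j) ws" for j
    proof -
      let ?v = "U((2, N) := nm 0, (3, N) := nm j)"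
      have "y \<in> set (arg_vars \<tau>) \<Longrightarrow> ?v y = U y" for y using fst_arg_vars[of y \<tau>] by auto
      then have "map ?v (arg_vars \<tau>) = map U (arg_vars \<tau>)" by simp
      also have "\<dots> = ws" unfolding U_def using upds_arg_vars(1)[OF w, of ?e] by (simp add: comp_def)
      finally have mv: "map ?v (arg_vars \<tau>) = ws" .
      have "val ?q U \<bullet> nm 0 \<bullet> nm j = val ?in ?v" using tu by simp
      also have "\<dots> = foldl (\<bullet>) (val (comp_tm \<tau> \<cdot> ?FX \<cdot> V (3, N)) ?v) (map ?v (arg_vars \<tau>))"
        by (simp only: val_apps map_map comp_def val.simps)
      also have "val (comp_tm \<tau> \<cdot> ?FX \<cdot> V (3, N)) ?v = val (comp_tm \<tau>) e \<bullet> (f \<bullet> x) \<bullet> nm j"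
        by (simp add: u cl Y0[unfolded One_nat_def])
      finally show ?thesis unfolding mv .
    qed
    obtain g where g: "\<And>j. val ?q U \<bullet> nm 0 \<bullet> nm j = nm (g j)"
      using T1_nm[OF ap_dom[OF q nm_dom[of 0]]] by blast
    obtain h where "\<forall>j<m. h j = g j" "val flat_tm U \<bullet> val ?l U \<bullet> val ?q U \<bullet> nm 1 = nm (codn h m)"
      using flat_one[OF tu l q g] by blast
    then show ?thesis using eq g qj by (intro exI[of _ h]) metis
  qed
  show "val (len_tm \<tau>) e \<bullet> Z = nm m"
    using main[OF zero_args[OF e]] e by (auto simp: len_args Z lhn_codn simp del: map_map)
  show "val (comp_tm \<tau>) e \<bullet> Z \<bullet> nm j = val (comp_tm \<tau>) e \<bullet> (f \<bullet> x) \<bullet> nm j" if j: "j < m"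
  proof (rule ext_args[of _ \<tau>])
    fix ws assume w: "args \<tau> ws"
    obtain h where h: "\<forall>j<m. nm (h j) = foldl (\<bullet>) (val (comp_tm \<tau>) e \<bullet> (f \<bullet> x) \<bullet> nm j) ws" "foldl (\<bullet>) Z ws = nm (codn h m)"
      using main[OF w] by blast
    show "foldl (\<bullet>) (val (comp_tm \<tau>) e \<bullet> Z \<bullet> nm j) ws = foldl (\<bullet>) (val (comp_tm \<tau>) e \<bullet> (f \<bullet> x) \<bullet> nm j) ws"
      unfolding comp_args[OF e Z w] h(2) using e h(1) j by (simp add: codn_nth)
  qed (use e Z fx comp_dom in auto)
qed

end

section \<open>Truth of the internal axioms in the ground structure, and uniform boundedness\<close>

context std
begin

definition lenm :: "'a \<Rightarrow> 'a \<Rightarrow> bool" where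
  "lenm a b \<longleftrightarrow> (\<exists>m n. a = nm m \<and> b = nm n \<and> m \<le> n)"

lemma lenm_nm [simp]: "lenm (nm m) (nm n) \<longleftrightarrow> m \<le> n"
  by (auto simp: lenm_def)

end

text \<open>Standardness is a placeholder here: the ground structure evaluates internal formulas,
  and forcing gives standardness its meaning.\<close>

sublocale std \<subseteq> ftm dom ap co lenm "\<lambda>_. True"
  by unfold_locales

context std
begin

lemma val_N: "tenv e \<Longrightarrow> wt t \<Longrightarrow> ty_of t = N \<Longrightarrow> \<exists>n. val t e = nm n"
  using val_in domN_E by blast

lemma mun_props:
  "y \<le> n \<Longrightarrow> g y = 0 \<Longrightarrow> g (mun g n) = 0" "y < mun g n \<Longrightarrow> g y \<noteq> 0"
  "mun g n = 0 \<or> g (mun g n) = 0 \<and> mun g n \<le> n"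
proof -
  have *: "g (LEAST y. g y = 0) = 0 \<and> (LEAST y. g y = 0) \<le> y" if "g y = 0" for y
    using that LeastI[of "\<lambda>y. g y = 0" y] Least_le[of "\<lambda>y. g y = 0" y] by blast
  show "y \<le> n \<Longrightarrow> g y = 0 \<Longrightarrow> g (mun g n) = 0" unfolding mun_def using * by auto
  show "y < mun g n \<Longrightarrow> g y \<noteq> 0" unfolding mun_def using * by (auto split: if_splits dest: leD)
  show "mun g n = 0 \<or> g (mun g n) = 0 \<and> mun g n \<le> n"
    unfolding mun_def using * order_trans by (auto split: if_splits)
qed

lemma list_all_apps: "wt (apps t ws) \<Longrightarrow> ty_of (apps t ws) = N \<Longrightarrow> wt t \<and> list_all2 (\<lambda>w \<sigma>. wt w \<and> ty_of w = \<sigma>) ws (arg_tys (ty_of t))"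
proof (induction ws arbitrary: t)
  case (Cons w ws)
  have "wt (apps (t \<cdot> w) ws)" "ty_of (apps (t \<cdot> w) ws) = N" using Cons.prems by (simp_all add: apps_def)
  then have *: "wt (t \<cdot> w)" "list_all2 (\<lambda>w \<sigma>. wt w \<and> ty_of w = \<sigma>) ws (arg_tys (ty_of (t \<cdot> w)))"
    using Cons.IH by blast+
  then obtain \<sigma> \<tau> where "ty_of t = \<sigma> \<rightarrow> \<tau>" "ty_of w = \<sigma>" by (auto split: ty.splits)
  then show ?case using * by simp
qed (simp add: apps_def)

lemma apps_vals: assumes "wt (apps t ws)" "ty_of (apps t ws) = N" "tenv e"
  shows "list_all2 (\<lambda>w \<sigma>. w \<in> dom \<sigma>) (map (\<lambda>w. val w e) ws) (arg_tys (ty_of t))"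
  using list_all_apps[OF assms(1,2)] assms(3) by (auto simp: list_all2_conv_all_nth)

lemma sat_E_EFA: "A \<in> E_EFA \<Longrightarrow> wf_fm A \<Longrightarrow> tenv e \<Longrightarrow> sat A e"
proof (induction rule: E_EFA.induct)
  case (ext \<rho> x y \<tau> z)
  then show ?case by (simp add: sat_eq wf_fm_eq)
next
  case (le_cong x x' y y')
  then show ?case by simp
next
  case (suc_nonzero x)
  then show ?case using val_N[of e x] by auto
next
  case (suc_inj x y)
  then show ?case using val_N[of e x] val_N[of e y] by auto
next
  case (le_zero x)
  then show ?case using val_N[of e x] by auto
next
  case (le_suc x y)
  then show ?case using val_N[of e x] val_N[of e y] by auto
next
  case (min1 x y)
  then show ?case using val_N[of e x] val_N[of e y] by auto
next
  case (min2 x y)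
  then show ?case using val_N[of e x] val_N[of e y] by auto
next
  case (max1 x y)
  then show ?case using val_N[of e x] val_N[of e y] by auto
next
  case (max2 x y)
  then show ?case using val_N[of e x] val_N[of e y] by auto
next
  case (qf_ind A x)
  show ?case
  proof (simp add: sat_fsubst free_for_qfree[OF qf_ind(1)] qf_ind(2), intro HOL.impI ballI)
    fix a assume z: "sat A (e(x := nm 0))" and s: "\<forall>a\<in>dom N. sat A (e(x := a)) \<longrightarrow> sat A (e(x := co CSuc \<bullet> a))"
      and a: "a \<in> dom N"
    have "sat A (e(x := nm n))" for n
      by (induction n) (use z s co_suc nm_dom in metis)+
    then show "sat A (e(x := a))" using domN_E[OF a] by auto
  qed
next
  case (pi \<rho> \<tau> x y)
  then have "wt x" "wt y" "ty_of x = \<rho>" "ty_of y = \<tau>" by (auto simp: wf_fm_eq)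
  then show ?case using pi by (simp add: sat_eq K[OF val_in val_in])
next
  case (sigma \<tau> \<delta> \<rho> x y z)
  then have w: "wt x" "wt y" "ty_of x = \<delta> \<rightarrow> \<rho> \<rightarrow> \<tau>" "ty_of y = \<delta> \<rightarrow> \<rho>" "wt z" "ty_of z = \<delta>"
    by (auto simp: wf_fm_eq)
  then show ?case using sigma by (simp add: sat_eq S[OF val_in val_in val_in])
next
  case (A0 x y)
  then show ?case using val_N[of e x] val_N[of e y] by auto
next
  case (A1_zero x)
  then show ?case using val_N[of e x] by auto
next
  case (A1_suc x y)
  then show ?case using val_N[of e x] val_N[of e y] by auto
next
  case (A2_zero x)
  then show ?case using val_N[of e x] by auto
next
  case (A2_suc x y)
  then show ?case using val_N[of e x] val_N[of e y] by auto
next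
  case (A3_zero x)
  then show ?case using val_N[of e x] by auto
next
  case (A3_suc x y)
  then show ?case using val_N[of e x] val_N[of e y] by auto
next
  case (Phi1_zero f)
  then have f: "val f e \<in> dom T1" by simp
  then obtain g where g: "\<And>k. val f e \<bullet> nm k = nm (g k)" using T1_nm by blast
  show ?case using Phi_nm[OF f g, of 0] g by simp
next
  case (Phi1_suc f x)
  then have f: "val f e \<in> dom T1" by simp
  then obtain g where g: "\<And>k. val f e \<bullet> nm k = nm (g k)" using T1_nm by blast
  obtain n where n: "val x e = nm n" using val_N[of e x] Phi1_suc by auto
  have "Max (g ` {..Suc n}) = max (g (Suc n)) (Max (g ` {..n}))"
    by (simp add: atMost_Suc)
  then show ?case using Phi_nm(1)[OF f g] g n by simp
next
  case (Phi2_zero f)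
  then have f: "val f e \<in> dom T1" by simp
  then obtain g where g: "\<And>k. val f e \<bullet> nm k = nm (g k)" using T1_nm by blast
  show ?case using Phi_nm[OF f g, of 0] g by simp
next
  case (Phi2_suc f x)
  then have f: "val f e \<in> dom T1" by simp
  then obtain g where g: "\<And>k. val f e \<bullet> nm k = nm (g k)" using T1_nm by blast
  obtain n where n: "val x e = nm n" using val_N[of e x] Phi2_suc by auto
  show ?case using Phi_nm(2)[OF f g] g n by simp
next
  case (Phi3_zero f)
  then have f: "val f e \<in> dom T1" by simp
  then obtain g where g: "\<And>k. val f e \<bullet> nm k = nm (g k)" using T1_nm by blast
  show ?case using Phi_nm[OF f g, of 0] g by simp
next
  case (Phi3_suc f x)
  then have f: "val f e \<in> dom T1" by simp
  then obtain g where g: "\<And>k. val f e \<bullet> nm k = nm (g k)" using T1_nm by blast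
  obtain n where n: "val x e = nm n" using val_N[of e x] Phi3_suc by auto
  show ?case using Phi_nm(3)[OF f g] g n by simp
next
  case (mu_found y x f)
  then have w: "wt y" "ty_of y = N" "wt x" "ty_of x = N" "wt f" "ty_of f = N \<rightarrow> N \<rightarrow> N" by (auto split: ty.splits)
  obtain m n where mn: "val x e = nm n" "val y e = nm m" using val_N w mu_found.prems by metis
  have f: "val f e \<in> dom (N \<rightarrow> N \<rightarrow> N)" using w mu_found.prems by simp
  obtain g where g: "\<And>k. val f e \<bullet> nm n \<bullet> nm k = nm (g k)" using T1_nm[OF ap_dom[OF f nm_dom]] by blast
  show ?case using mn g co_mu[OF f g] mun_props(1)[of m n g] by simp
next
  case (mu_least y f x)
  then have w: "wt y" "ty_of y = N" "wt x" "ty_of x = N" "wt f" "ty_of f = N \<rightarrow> N \<rightarrow> N" by (auto split: ty.splits)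
  obtain m n where mn: "val x e = nm n" "val y e = nm m" using val_N w mu_least.prems by metis
  have f: "val f e \<in> dom (N \<rightarrow> N \<rightarrow> N)" using w mu_least.prems by simp
  obtain g where g: "\<And>k. val f e \<bullet> nm n \<bullet> nm k = nm (g k)" using T1_nm[OF ap_dom[OF f nm_dom]] by blast
  show ?case using mn g co_mu[OF f g] mun_props(2)[of m g n] by simp
next
  case (mu_default f x)
  then have w: "wt x" "ty_of x = N" "wt f" "ty_of f = N \<rightarrow> N \<rightarrow> N" by (auto split: ty.splits)
  obtain n where mn: "val x e = nm n" using val_N w mu_default.prems by metis
  have f: "val f e \<in> dom (N \<rightarrow> N \<rightarrow> N)" using w mu_default.prems by simp
  obtain g where g: "\<And>k. val f e \<bullet> nm n \<bullet> nm k = nm (g k)" using T1_nm[OF ap_dom[OF f nm_dom]] by blast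
  show ?case using mn g co_mu[OF f g] mun_props(3)[of g n] by auto
next
  case (rec_zero \<rho> y z v ws)
  let ?t = "Cn (CRec \<rho>) \<cdot> Zr \<cdot> y \<cdot> z \<cdot> v"
  have a: "wt (apps ?t ws)" "ty_of (apps ?t ws) = N" using rec_zero by simp_all
  have w: "wt y" "ty_of y = \<rho>" "wt z" "ty_of z = N \<rightarrow> N \<rightarrow> \<rho>" "wt v" "ty_of v = N \<rightarrow> \<rho>"
    using list_all_apps[OF a] by (auto split: ty.splits)
  have "list_all2 (\<lambda>w \<sigma>. w \<in> dom \<sigma>) (map (\<lambda>w. val w e) ws) (arg_tys \<rho>)"
    using apps_vals[OF a rec_zero(2)] w by simp
  then show ?case using w rec_zero(2) by (simp add: val_apps co_rec0)
next
  case (rec_suc \<rho> x y z v ws)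
  let ?t = "Cn (CRec \<rho>) \<cdot> Sc x \<cdot> y \<cdot> z \<cdot> v"
  have a: "wt (apps ?t ws)" "ty_of (apps ?t ws) = N" using rec_suc by simp_all
  have w: "wt y" "ty_of y = \<rho>" "wt z" "ty_of z = N \<rightarrow> N \<rightarrow> \<rho>" "wt v" "ty_of v = N \<rightarrow> \<rho>" "wt x" "ty_of x = N"
    using list_all_apps[OF a] by (auto split: ty.splits)
  obtain n where n: "val x e = nm n" using val_N w rec_suc by metis
  have "list_all2 (\<lambda>w \<sigma>. w \<in> dom \<sigma>) (map (\<lambda>w. val w e) ws) (arg_tys \<rho>)"
    using apps_vals[OF a rec_suc(2)] w by simp
  then show ?case using w rec_suc(2) n by (simp add: val_apps co_recS)
qed simp_all

lemma T1_ext: "F \<in> dom T1 \<Longrightarrow> G \<in> dom T1 \<Longrightarrow> (\<And>k. F \<bullet> nm k = G \<bullet> nm k) \<Longrightarrow> F = G"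
proof (rule ext[of _ N N])
  fix a assume h: "\<And>k. F \<bullet> nm k = G \<bullet> nm k" "a \<in> dom N"
  obtain n where "a = nm n" using domN_E h(2) by blast
  then show "F \<bullet> a = G \<bullet> a" using h(1) by simp
qed

text \<open>Choice in the metatheory gives a functional on set-theoretic functions, which
  \<open>full2\<close> realises; objects of type 1 and functions on numbers determine each
  other.\<close>

lemma sat_QF_AC: "A \<in> QF_AC_10 \<Longrightarrow> wf_fm A \<Longrightarrow> tenv e \<Longrightarrow> sat A e"
proof (induction rule: QF_AC_10.induct)
  case (1 A x y Y)
  have xy: "x \<noteq> y" "Y \<noteq> x" "Y \<noteq> y" using 1 by auto
  define G where "G f = (SOME n. sat A (e(x := f, y := nm n)))" for f
  define to1 where "to1 h = (SOME F. F \<in> dom T1 \<and> (\<forall>k. F \<bullet> nm k = nm (h k)))" for h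
  have to1: "to1 h \<in> dom T1 \<and> (\<forall>k. to1 h \<bullet> nm k = nm (h k))" for h
    unfolding to1_def using full1[of h] by (intro someI_ex[of "\<lambda>F. F \<in> dom T1 \<and> (\<forall>k. F \<bullet> nm k = nm (h k))"]) blast
  obtain Q where Q: "Q \<in> dom T2" "\<forall>F\<in>dom T1. \<forall>f. (\<forall>k. F \<bullet> nm k = nm (f k)) \<longrightarrow> Q \<bullet> F = nm (G (to1 f))"
    using full2[of "\<lambda>f. G (to1 f)"] by blast
  have QF: "Q \<bullet> F = nm (G F)" if F: "F \<in> dom T1" for F
  proof -
    obtain g where g: "\<forall>k. F \<bullet> nm k = nm (g k)" using T1_nm[OF F] by blast
    have "to1 g = F"
      by (rule T1_ext) (use to1 F g in auto)
    then show ?thesis using Q F g by auto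
  qed
  show ?case
  proof (simp add: 1 sat_fsubst free_for_qfree[OF 1(1)] xy, intro HOL.impI bexI[of _ Q] ballI)
    fix f assume a: "\<forall>a\<in>dom T1. \<exists>b\<in>dom N. sat A (e(x := a, y := b))" and f: "f \<in> dom T1"
    then have "\<exists>n. sat A (e(x := f, y := nm n))" using domN_E by blast
    then have "sat A (e(x := f, y := nm (G f)))" unfolding G_def by (rule someI_ex)
    moreover have "sat A (e(Y := Q, x := f, y := Q \<bullet> f)) = sat A (e(x := f, y := nm (G f)))"
      by (rule sat_cong) (use 1 QF[OF f] in auto)
    ultimately show "sat A (e(Y := Q, x := f, y := Q \<bullet> f))" by simp
  qed (use Q in auto)
qed

lemma T1_full: "\<exists>F. F \<in> dom T1 \<and> (\<forall>k. F \<bullet> nm k = nm (h k))"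
  using full1[of h] by blast

definition to1 :: "(nat \<Rightarrow> nat) \<Rightarrow> 'a" where
  "to1 h = (SOME F. F \<in> dom T1 \<and> (\<forall>k. F \<bullet> nm k = nm (h k)))"

lemma to1: "to1 h \<in> dom T1" "to1 h \<bullet> nm k = nm (h k)"
  unfolding to1_def using someI_ex[OF T1_full[of h]] by blast+

lemma to1_eq: "F \<in> dom T1 \<Longrightarrow> (\<And>k. F \<bullet> nm k = nm (g k)) \<Longrightarrow> F = to1 g"
  by (rule T1_ext) (simp_all add: to1)

lemma T1_to1: "F \<in> dom T1 \<Longrightarrow> \<exists>g. F = to1 g"
  using T1_nm to1_eq by blast

text \<open>The choice operator of the metatheory picks a path for every tree that has one, and
  \<open>full11\<close> realises this choice. For \<open>kappa3\<close> the same is done with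
  \<open>full21\<close>.\<close>

lemma sat_mu1: assumes "tenv e" shows "sat mu1 e"
proof -
  define P where "P f g \<longleftrightarrow> (\<forall>n. f (codn g n) = 0)" for f g :: "nat \<Rightarrow> nat"
  obtain G where G: "G \<in> dom (T1 \<rightarrow> T1)" "\<forall>F\<in>dom T1. \<forall>f k. (\<forall>k. F \<bullet> nm k = nm (f k)) \<longrightarrow> G \<bullet> F \<bullet> nm k = nm ((SOME g. P f g) k)"
    using full11[of "\<lambda>f. SOME g. P f g"] by blast
  have "G \<bullet> to1 f = to1 (SOME g. P f g)" for f
    by (rule to1_eq) (use G to1 ap_dom in \<open>auto\<close>)
  moreover have path: "(\<forall>x\<in>dom N. to1 f \<bullet> (val code_tm e' \<bullet> to1 g \<bullet> x) = nm 0) \<longleftrightarrow> P f g" if "tenv e'" for f g e'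
  proof -
    have "to1 f \<bullet> (val code_tm e' \<bullet> to1 g \<bullet> nm n) = nm (f (codn g n))" for n
      using code_nm[OF that to1(1), of g g n] to1 by simp
    then show ?thesis unfolding P_def dom_N by simp
  qed
  have "sat mu1 e \<longleftrightarrow> (\<exists>\<mu>\<in>dom (T1 \<rightarrow> T1). \<forall>f\<in>dom T1. (\<exists>g\<in>dom T1. \<forall>x\<in>dom N. f \<bullet> (val code_tm e \<bullet> g \<bullet> x) = nm 0)
      \<longrightarrow> (\<forall>x\<in>dom N. f \<bullet> (val code_tm e \<bullet> (\<mu> \<bullet> f) \<bullet> x) = nm 0))"
    by (simp add: mu1_def Let_def val_upd_fresh)
  moreover have "\<forall>f\<in>dom T1. (\<exists>g\<in>dom T1. \<forall>x\<in>dom N. f \<bullet> (val code_tm e \<bullet> g \<bullet> x) = nm 0)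
      \<longrightarrow> (\<forall>x\<in>dom N. f \<bullet> (val code_tm e \<bullet> (G \<bullet> f) \<bullet> x) = nm 0)"
  proof (intro ballI HOL.impI, elim bexE)
    fix f g x assume f: "f \<in> dom T1" and g: "g \<in> dom T1" "\<forall>x\<in>dom N. f \<bullet> (val code_tm e \<bullet> g \<bullet> x) = nm 0" and x: "x \<in> dom N"
    obtain f' g' where fg: "f = to1 f'" "g = to1 g'" using f g T1_to1 by metis
    then have "P f' (SOME g. P f' g)" using g path[OF assms] someI[of "P f'" g'] by simp
    then show "f \<bullet> (val code_tm e \<bullet> (G \<bullet> f) \<bullet> x) = nm 0"
      using path[OF assms, of f' "SOME g. P f' g"] x fg calculation by simp
  qed
  ultimately show ?thesis using G(1) by blast
qed

lemma sat_kappa3: assumes "tenv e" shows "sat kappa3 e"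
proof -
  define P where "P Y f \<longleftrightarrow> (\<forall>n. f n \<le> (1::nat)) \<and> Y f = (0::nat)" for Y and f :: "nat \<Rightarrow> nat"
  obtain G where G: "G \<in> dom (T2 \<rightarrow> T1)" "\<forall>Q\<in>dom T2. \<forall>Y k. (\<forall>F\<in>dom T1. \<forall>f. (\<forall>k. F \<bullet> nm k = nm (f k)) \<longrightarrow> Q \<bullet> F = nm (Y f))
       \<longrightarrow> G \<bullet> Q \<bullet> nm k = nm ((SOME f. P Y f) k)"
    using full21[of "\<lambda>Y. SOME f. P Y f"] by blast
  have b: "sat (binary f) e' \<longleftrightarrow> (\<forall>n\<in>dom N. lenm (val f e' \<bullet> n) (nm 1))" if "tenv e'" for f e'
  proof -
    have "(ub f, N) \<notin> tvars f" using tvars_ub by fastforce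
    then show ?thesis by (simp add: binary_def Let_def val_upd_fresh)
  qed
  have main: "Q \<bullet> (G \<bullet> Q) = nm 0 \<and> (\<forall>n\<in>dom N. lenm (G \<bullet> Q \<bullet> n) (nm 1))"
    if Q: "Q \<in> dom T2" and f: "f \<in> dom T1" "\<forall>n\<in>dom N. lenm (f \<bullet> n) (nm 1)" "Q \<bullet> f = nm 0" for Q f
  proof -
    have "\<exists>n. Q \<bullet> to1 h = nm n" for h using ap_dom[OF Q to1(1)] domN_E by blast
    then obtain Y where Y: "\<And>h. Q \<bullet> to1 h = nm (Y h)" by metis
    have "G \<bullet> Q \<bullet> nm k = nm ((SOME f. P Y f) k)" for k
      using G(2) Q Y to1_eq by metis
    then have GQ: "G \<bullet> Q = to1 (SOME f. P Y f)" using G Q ap_dom by (intro to1_eq) auto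
    obtain f' where f': "f = to1 f'" using f T1_to1 by blast
    have "P Y f'" unfolding P_def using f Y unfolding f' dom_N by (simp add: to1)
    then have "P Y (SOME f. P Y f)" using someI[of "P Y" f'] by simp
    then show ?thesis unfolding GQ P_def dom_N using Y by (simp add: to1)
  qed
  have "sat kappa3 e \<longleftrightarrow> (\<exists>k\<in>dom (T2 \<rightarrow> T1). \<forall>Q\<in>dom T2. (\<exists>f\<in>dom T1. (\<forall>n\<in>dom N. lenm (f \<bullet> n) (nm 1)) \<and> Q \<bullet> f = nm 0)
     \<longrightarrow> Q \<bullet> (k \<bullet> Q) = nm 0 \<and> (\<forall>n\<in>dom N. lenm (k \<bullet> Q \<bullet> n) (nm 1)))"
    using assms by (simp add: kappa3_def Let_def b)
  then show ?thesis using G(1) main by blast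
qed

text \<open>The logical relation of uniform boundedness for families of objects indexed by \<open>m\<close>.\<close>

fun Bd :: "ty \<Rightarrow> (nat \<Rightarrow> 'a) \<Rightarrow> bool" where
  "Bd N x \<longleftrightarrow> (\<exists>B. \<forall>m. \<exists>k\<le>B. x m = nm k)"
| "Bd (\<sigma> \<rightarrow> \<tau>) x \<longleftrightarrow> (\<forall>m. x m \<in> dom (\<sigma> \<rightarrow> \<tau>)) \<and> (\<forall>y. Bd \<sigma> y \<longrightarrow> Bd \<tau> (\<lambda>m. x m \<bullet> y m))"

lemma Bd_dom: "Bd \<sigma> x \<Longrightarrow> x m \<in> dom \<sigma>"
  by (cases \<sigma>) (auto simp: dom_N)

lemma Bd_app: "Bd (\<sigma> \<rightarrow> \<tau>) x \<Longrightarrow> Bd \<sigma> y \<Longrightarrow> Bd \<tau> (\<lambda>m. x m \<bullet> y m)"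
  by simp

lemma Bd_nm [simp]: "Bd N (\<lambda>m. nm k)" by auto

lemma Bd_NI: "(\<And>m. x m = nm (g m)) \<Longrightarrow> (\<And>m. g m \<le> B) \<Longrightarrow> Bd N x"
  by auto

lemma Bd_NE: "Bd N x \<Longrightarrow> \<exists>g B. (\<forall>m. x m = nm (g m)) \<and> (\<forall>m. g m \<le> B)"
proof -
  assume "Bd N x"
  then obtain B where "\<forall>m. \<exists>k. k \<le> B \<and> x m = nm k" by auto
  then show ?thesis by metis
qed

fun Bl :: "ty list \<Rightarrow> (nat \<Rightarrow> 'a) list \<Rightarrow> bool" where
  "Bl [] ws \<longleftrightarrow> ws = []"
| "Bl (\<sigma> # \<sigma>s) ws \<longleftrightarrow> (\<exists>w vs. ws = w # vs \<and> Bd \<sigma> w \<and> Bl \<sigma>s vs)"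

text \<open>Serves the recursor, whose equations are available at full argument lists only.\<close>

lemma Bd_spine: "(\<forall>m. x m \<in> dom \<sigma>) \<Longrightarrow>
  Bd \<sigma> x \<longleftrightarrow> (\<forall>ws. Bl (arg_tys \<sigma>) ws \<longrightarrow> Bd N (\<lambda>m. foldl (\<bullet>) (x m) (map (\<lambda>w. w m) ws)))"
proof (induction \<sigma> arbitrary: x)
  case (Fn \<sigma> \<tau>)
  have "Bd \<tau> (\<lambda>m. x m \<bullet> y m) \<longleftrightarrow> (\<forall>ws. Bl (arg_tys \<tau>) ws \<longrightarrow> Bd N (\<lambda>m. foldl (\<bullet>) (x m \<bullet> y m) (map (\<lambda>w. w m) ws)))"
    if "Bd \<sigma> y" for y
    by (rule Fn.IH(2)) (use Fn.prems Bd_dom[OF that] ap_dom in blast)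
  then have "Bd (\<sigma> \<rightarrow> \<tau>) x \<longleftrightarrow> (\<forall>y. Bd \<sigma> y \<longrightarrow> (\<forall>ws. Bl (arg_tys \<tau>) ws \<longrightarrow>
      Bd N (\<lambda>m. foldl (\<bullet>) (x m) (map (\<lambda>w. w m) (y # ws)))))" using Fn.prems by simp
  also have "\<dots> \<longleftrightarrow> (\<forall>ws. Bl (arg_tys (\<sigma> \<rightarrow> \<tau>)) ws \<longrightarrow> Bd N (\<lambda>m. foldl (\<bullet>) (x m) (map (\<lambda>w. w m) ws)))"
    unfolding arg_tys.simps Bl.simps by blast
  finally show ?case .
qed simp

lemma Bl_args: "Bl (arg_tys \<sigma>) ws \<Longrightarrow> args \<sigma> (map (\<lambda>w. w m) ws)"
proof (induction \<sigma> arbitrary: ws)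
  case (Fn \<sigma> \<tau>)
  then show ?case using Bd_dom by (auto simp: args_Fn)
qed (simp add: args_def)

text \<open>\<open>H\<close> bounds the operation on all arguments below the given ones; the
  operation itself may fail to be monotone.\<close>

lemma Bd_bop: assumes b: "bop c \<noteq> None" and m: "\<And>a b a' b'. a \<le> a' \<Longrightarrow> b \<le> b' \<Longrightarrow> the (bop c) a b \<le> H a' b'"
  shows "Bd (N \<rightarrow> N \<rightarrow> N) (\<lambda>m. co c)"
proof -
  have "cst_ty c = N \<rightarrow> N \<rightarrow> N" using b by (cases c) auto
  then have d: "co c \<in> dom (N \<rightarrow> N \<rightarrow> N)" using co_dom[of c] by simp
  have "Bd N (\<lambda>m. co c \<bullet> x m \<bullet> y m)" if xy: "Bd N x" "Bd N y" for x y
  proof -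
    obtain g B g' B' where "\<forall>m. x m = nm (g m)" "\<forall>m. g m \<le> B" "\<forall>m. y m = nm (g' m)" "\<forall>m. g' m \<le> B'"
      using Bd_NE xy by metis
    then show ?thesis using co_bop[OF b] m by (intro Bd_NI[of _ "\<lambda>m. the (bop c) (g m) (g' m)" "H B B'"]) auto
  qed
  moreover have "co c \<bullet> x m \<in> dom T1" if "Bd N x" for x m using ap_dom[OF d Bd_dom[OF that]] .
  ultimately show ?thesis using d by (simp del: Bd.simps(1))
qed

lemma Bd_phi: assumes b: "phi c \<noteq> None"
    and m: "\<And>g h n B. (\<And>k. g k \<le> h k) \<Longrightarrow> n \<le> B \<Longrightarrow> the (phi c) g n \<le> H h B"
  shows "Bd (T1 \<rightarrow> N \<rightarrow> N) (\<lambda>m. co c)"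
proof -
  have "cst_ty c = T1 \<rightarrow> N \<rightarrow> N" using b by (cases c) auto
  then have d: "co c \<in> dom (T1 \<rightarrow> N \<rightarrow> N)" using co_dom[of c] by simp
  have "Bd N (\<lambda>m. co c \<bullet> x m \<bullet> y m)" if xy: "Bd T1 x" "Bd N y" for x y
  proof -
    obtain g' B' where y: "\<forall>m. y m = nm (g' m)" "\<forall>m. g' m \<le> B'" using Bd_NE xy by metis
    have "\<exists>g B. (\<forall>m. x m \<bullet> nm k = nm (g m)) \<and> (\<forall>m. g m \<le> B)" for k
      using Bd_NE[OF Bd_app[OF xy(1) Bd_nm]] .
    then obtain g h where g: "\<And>k m. x m \<bullet> nm k = nm (g k m)" "\<And>k m. g k m \<le> h k" by metis
    have "co c \<bullet> x m \<bullet> y m = nm (the (phi c) (\<lambda>k. g k m) (g' m))" for m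
      using co_phi[OF b Bd_dom[OF xy(1)], of m "\<lambda>k. g k m"] g y by simp
    moreover have "the (phi c) (\<lambda>k. g k m') (g' m') \<le> H h B'" for m' using g y by (intro m) auto
    ultimately show ?thesis by (rule Bd_NI)
  qed
  moreover have "co c \<bullet> x m \<in> dom T1" if "Bd T1 x" for x m using ap_dom[OF d Bd_dom[OF that]] .
  ultimately show ?thesis using d by (simp del: Bd.simps(1))
qed

lemma mun_le: "mun g n \<le> n" using mun_props(3)[of g n] by auto

lemma Bd_co: "Bd (cst_ty c) (\<lambda>m. co c)"
proof (cases c)
  case CZero
  then show ?thesis by (auto intro: exI[of _ 0])
next
  case CSuc
  have "Bd N (\<lambda>m. co CSuc \<bullet> y m)" if h: "Bd N y" for y
  proof -
    obtain g B where "\<forall>m. y m = nm (g m)" "\<forall>m. g m \<le> B" using Bd_NE[OF h] by blast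
    then show ?thesis by (intro Bd_NI[of _ "\<lambda>m. Suc (g m)" "Suc B"]) simp_all
  qed
  then show ?thesis using CSuc co_dom[of CSuc] by (simp del: Bd.simps(1))
next
  case CMin
  then show ?thesis using Bd_bop[of CMin "\<lambda>a b. a"] by (simp del: Bd.simps)
next
  case CMax
  then show ?thesis using Bd_bop[of CMax max] by (force simp del: Bd.simps)
next
  case CA0
  then show ?thesis using Bd_bop[of CA0 "\<lambda>a b. Suc b"] by (simp del: Bd.simps)
next
  case CA1
  then show ?thesis using Bd_bop[of CA1 "(+)"] by (simp del: Bd.simps)
next
  case CA2
  then show ?thesis using Bd_bop[of CA2 "(*)"] by (simp del: Bd.simps add: mult_le_mono)
next
  case CA3
  \<comment> \<open>As 0 ^ 0 = 1 exceeds 0 ^ 1, powers are not monotone in the exponent at base 0;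
    raising the base by one repairs this.\<close>
  have "a ^ b \<le> Suc a' ^ b'" if "a \<le> a'" "b \<le> b'" for a b a' b' :: nat
    using power_mono[of a "Suc a'" b] power_increasing[of b b' "Suc a'"] that by simp
  then show ?thesis using CA3 Bd_bop[of CA3 "\<lambda>a b. Suc a ^ b"] by (simp del: Bd.simps)
next
  case CPhi1
  have "Max (g ` {..n}) \<le> sum h {..B}" if "\<And>k. g k \<le> h k" "n \<le> B" for g h :: "nat \<Rightarrow> nat" and n B
  proof -
    have "g k \<le> sum h {..B}" if "k \<le> n" for k
      by (rule order_trans[OF \<open>\<And>k. g k \<le> h k\<close>[of k] member_le_sum[of k "{..B}" h]]) (use \<open>n \<le> B\<close> that in auto)
    then show ?thesis by auto
  qed
  then show ?thesis using CPhi1 Bd_phi[of CPhi1 "\<lambda>h B. sum h {..B}"] by (simp del: Bd.simps)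
next
  case CPhi2
  have "sum g {..n} \<le> sum h {..B}" if "\<And>k. g k \<le> h k" "n \<le> B" for g h :: "nat \<Rightarrow> nat" and n B
    by (rule order_trans[OF sum_mono[of "{..n}" g h] sum_mono2]) (use that in auto)
  then show ?thesis using CPhi2 Bd_phi[of CPhi2 "\<lambda>h B. sum h {..B}"] by (simp del: Bd.simps)
next
  case CPhi3
  \<comment> \<open>A factor 0 could make a longer product smaller, hence the successors in the
    bounding product.\<close>
  have "prod g {..n} \<le> prod (\<lambda>k. Suc (h k)) {..B}" if *: "\<And>k. g k \<le> h k" "n \<le> B" for g h :: "nat \<Rightarrow> nat" and n B
  proof -
    have "prod g {..n} \<le> prod (\<lambda>k. Suc (h k)) {..n}" using *(1) by (intro prod_mono) (auto intro: le_SucI)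
    also have "\<dots> \<le> prod (\<lambda>k. Suc (h k)) {..B}" using *(2) by (intro dvd_imp_le prod_dvd_prod_subset prod_pos) auto
    finally show ?thesis .
  qed
  then show ?thesis using CPhi3 Bd_phi[of CPhi3 "\<lambda>h B. prod (\<lambda>k. Suc (h k)) {..B}"] by (simp del: Bd.simps)
next
  case CMu
  let ?F = "N \<rightarrow> N \<rightarrow> N"
  have d: "co CMu \<in> dom (?F \<rightarrow> N \<rightarrow> N)" using co_dom[of CMu] by simp
  have "Bd N (\<lambda>m. co CMu \<bullet> x m \<bullet> y m)" if xy: "Bd ?F x" "Bd N y" for x y
  proof -
    obtain g' B' where y: "\<forall>m. y m = nm (g' m)" "\<forall>m. g' m \<le> B'" using Bd_NE xy by metis
    have x: "x m \<in> dom ?F" for m using Bd_dom[OF xy(1)] .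
    have "\<exists>g. \<forall>k. x m \<bullet> nm (g' m) \<bullet> nm k = nm (g k)" for m using T1_nm[OF ap_dom[OF x nm_dom]] .
    then obtain g where g: "\<And>m k. x m \<bullet> nm (g' m) \<bullet> nm k = nm (g m k)" by metis
    have "co CMu \<bullet> x m \<bullet> y m = nm (mun (g m) (g' m))" for m using co_mu[OF x g] y by simp
    moreover have "mun (g m) (g' m) \<le> B'" for m using mun_le[of "g m" "g' m"] y order_trans by blast
    ultimately show ?thesis by (rule Bd_NI)
  qed
  moreover have "co CMu \<bullet> x m \<in> dom T1" if "Bd ?F x" for x m using ap_dom[OF d Bd_dom[OF that]] .
  ultimately show ?thesis using d CMu by (simp only: cst_ty.simps Bd.simps(2)[of "N \<rightarrow> N \<rightarrow> N" "N \<rightarrow> N"] Bd.simps(2)[of N N], blast)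
next
  case (CPi \<rho> \<tau>)
  have d: "co (CPi \<rho> \<tau>) \<in> dom (\<rho> \<rightarrow> \<tau> \<rightarrow> \<rho>)" using co_dom[of "CPi \<rho> \<tau>"] by simp
  have "(\<lambda>m. co (CPi \<rho> \<tau>) \<bullet> x m \<bullet> y m) = x" if "Bd \<rho> x" "Bd \<tau> y" for x y
    by (rule HOL.ext) (use K[OF Bd_dom[OF that(1)] Bd_dom[OF that(2)]] in simp)
  then have "Bd \<rho> (\<lambda>m. co (CPi \<rho> \<tau>) \<bullet> x m \<bullet> y m)" if "Bd \<rho> x" "Bd \<tau> y" for x y using that by simp
  moreover have "co (CPi \<rho> \<tau>) \<bullet> x m \<in> dom (\<tau> \<rightarrow> \<rho>)" if "Bd \<rho> x" for x m using ap_dom[OF d Bd_dom[OF that]] .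
  ultimately show ?thesis using d CPi by simp
next
  case (CSigma \<delta> \<rho> \<tau>)
  let ?S = "co (CSigma \<delta> \<rho> \<tau>)"
  have d: "?S \<in> dom ((\<delta> \<rightarrow> \<rho> \<rightarrow> \<tau>) \<rightarrow> (\<delta> \<rightarrow> \<rho>) \<rightarrow> \<delta> \<rightarrow> \<tau>)" using co_dom[of "CSigma \<delta> \<rho> \<tau>"] by simp
  have "Bd \<tau> (\<lambda>m. ?S \<bullet> x m \<bullet> y m \<bullet> w m)" if b: "Bd (\<delta> \<rightarrow> \<rho> \<rightarrow> \<tau>) x" "Bd (\<delta> \<rightarrow> \<rho>) y" "Bd \<delta> w" for x y w
  proof -
    have "(\<lambda>m. ?S \<bullet> x m \<bullet> y m \<bullet> w m) = (\<lambda>m. x m \<bullet> w m \<bullet> (y m \<bullet> w m))"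
      by (rule HOL.ext) (use S[OF Bd_dom[OF b(1)] Bd_dom[OF b(2)] Bd_dom[OF b(3)]] in simp)
    then show ?thesis using Bd_app[OF Bd_app[OF b(1,3)] Bd_app[OF b(2,3)]] by simp
  qed
  moreover have d1: "?S \<bullet> x m \<in> dom ((\<delta> \<rightarrow> \<rho>) \<rightarrow> \<delta> \<rightarrow> \<tau>)" if "Bd (\<delta> \<rightarrow> \<rho> \<rightarrow> \<tau>) x" for x m using ap_dom[OF d Bd_dom[OF that]] .
  moreover have "?S \<bullet> x m \<bullet> y m \<in> dom (\<delta> \<rightarrow> \<tau>)" if "Bd (\<delta> \<rightarrow> \<rho> \<rightarrow> \<tau>) x" "Bd (\<delta> \<rightarrow> \<rho>) y" for x y m
    using ap_dom[OF d1[OF that(1)] Bd_dom[OF that(2)]] .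
  ultimately show ?thesis unfolding CSigma cst_ty.simps Bd.simps(2)[of "\<delta> \<rightarrow> \<rho> \<rightarrow> \<tau>" "(\<delta> \<rightarrow> \<rho>) \<rightarrow> \<delta> \<rightarrow> \<tau>"]
      Bd.simps(2)[of "\<delta> \<rightarrow> \<rho>" "\<delta> \<rightarrow> \<tau>"] Bd.simps(2)[of \<delta> \<tau>] using d by blast
next
  case (CRec \<rho>)
  let ?\<sigma> = "N \<rightarrow> \<rho> \<rightarrow> (N \<rightarrow> N \<rightarrow> \<rho>) \<rightarrow> (N \<rightarrow> \<rho>) \<rightarrow> \<rho>"
  let ?R = "co (CRec \<rho>)"
  have d: "?R \<in> dom ?\<sigma>" using co_dom[of "CRec \<rho>"] by simp
  have "Bd N (\<lambda>m. foldl (\<bullet>) (?R \<bullet> n m \<bullet> y m \<bullet> r m \<bullet> v m) (map (\<lambda>w. w m) ws))"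
    if b: "Bd N n" "Bd \<rho> y" "Bd (N \<rightarrow> N \<rightarrow> \<rho>) r" "Bd (N \<rightarrow> \<rho>) v" "Bl (arg_tys \<rho>) ws" for n y r v ws
  proof -
    obtain g B where n: "\<And>m. n m = nm (g m)" "\<And>m. g m \<le> B" using Bd_NE[OF b(1)] by blast
    note D = Bd_dom[OF b(2)] Bd_dom[OF b(3)] Bd_dom[OF b(4)]
    have a: "list_all2 (\<lambda>w \<sigma>. w \<in> dom \<sigma>) (map (\<lambda>w. w m) ws) (arg_tys \<rho>)" for m
      using Bl_args[OF b(5)] unfolding args_def .
    have fd: "foldl (\<bullet>) x (map (\<lambda>w. w m) ws) \<in> dom N" if "x \<in> dom \<rho>" for x m
      using foldl_dom[OF that Bl_args[OF b(5)]] .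
    have "Bd N (\<lambda>m. foldl (\<bullet>) (y m) (map (\<lambda>w. w m) ws))"
      using b(2,5) Bd_spine[of y \<rho>] D(1) by blast
    from Bd_NE[OF this] obtain y' Y where y: "\<And>m. foldl (\<bullet>) (y m) (map (\<lambda>w. w m) ws) = nm (y' m)" "\<And>m. y' m \<le> Y" by blast
    have vB: "Bd N (\<lambda>m. foldl (\<bullet>) (v m \<bullet> nm k) (map (\<lambda>w. w m) ws))" for k
      using Bd_app[OF b(4) Bd_nm[of k]] b(5) Bd_spine[of "\<lambda>m. v m \<bullet> nm k" \<rho>] ap_dom[OF D(3) nm_dom] by blast
    have "\<exists>v' V. (\<forall>m. foldl (\<bullet>) (v m \<bullet> nm k) (map (\<lambda>w. w m) ws) = nm (v' m)) \<and> (\<forall>m. v' m \<le> V)" for k using Bd_NE[OF vB] .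
    then obtain v' V where v: "\<And>m k. foldl (\<bullet>) (v m \<bullet> nm k) (map (\<lambda>w. w m) ws) = nm (v' k m)" "\<And>m k. v' k m \<le> V k" by metis
    have R: "?R \<bullet> nm k \<bullet> y m \<bullet> r m \<bullet> v m \<in> dom \<rho>" for k m
      using ap_dom[OF ap_dom[OF ap_dom[OF ap_dom[OF d nm_dom[of k]] D(1)] D(2)] D(3)] .
    \<comment> \<open>Each step of the recursion is cut off by the value of v at the predecessor. So
      the result is at most the start value or one of finitely many values of v, and the bound
      arises without an induction along the recursion.\<close>
    have "\<exists>i\<le>Y + sum V {..B}. foldl (\<bullet>) (?R \<bullet> n m \<bullet> y m \<bullet> r m \<bullet> v m) (map (\<lambda>w. w m) ws) = nm i" for m
    proof (cases "g m")
      case 0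
      then show ?thesis using n(1)[of m] co_rec0[of "y m" \<rho> "r m" "v m" "map (\<lambda>w. w m) ws", OF D a] y by (auto intro!: exI[of _ "y' m"] trans_le_add1)
    next
      case (Suc k)
      let ?w = "map (\<lambda>w. w m) ws"
      let ?p = "foldl (\<bullet>) (?R \<bullet> nm k \<bullet> y m \<bullet> r m \<bullet> v m) ?w"
      have "?p \<in> dom N" using fd[OF R] .
      then have "foldl (\<bullet>) (r m \<bullet> ?p \<bullet> nm k) ?w \<in> dom N" using ap_dom[OF ap_dom[OF D(2)] nm_dom] fd by blast
      then obtain q where q: "foldl (\<bullet>) (r m \<bullet> ?p \<bullet> nm k) ?w = nm q" using domN_E by blast
      have "foldl (\<bullet>) (?R \<bullet> n m \<bullet> y m \<bullet> r m \<bullet> v m) ?w = nm (min q (v' k m))"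
        using n(1)[of m] Suc co_recS[of "y m" \<rho> "r m" "v m" ?w k, OF D a] q v by simp
      moreover have "min q (v' k m) \<le> Y + sum V {..B}"
      proof -
        have "k \<in> {..B}" using Suc n(2)[of m] by simp
        then have "V k \<le> sum V {..B}" by (intro member_le_sum) auto
        then show ?thesis using v(2)[of k m] by linarith
      qed
      ultimately show ?thesis by blast
    qed
    then show ?thesis by auto
  qed
  then have "Bd N (\<lambda>m. foldl (\<bullet>) ?R (map (\<lambda>w. w m) ws))" if "Bl (arg_tys ?\<sigma>) ws" for ws
    using that by (auto simp del: Bd.simps)
  then show ?thesis unfolding CRec cst_ty.simps using Bd_spine[of "\<lambda>m. ?R" ?\<sigma>] d by blast
qed

end

section \<open>Forcing a small standardness predicate\<close>

text \<open>Head and tail of a nonzero code act as the projections of a pairing. It is monotone in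
  both arguments, so a pair of bounds bounds all pairs below.\<close>

definition prn :: "nat \<Rightarrow> nat \<Rightarrow> nat" where "prn a b = 2 ^ a * (2 * b + 1)"

lemma prn [simp]: "hdn (prn a b) = a" "tln (prn a b) = b"
  unfolding prn_def by (rule hdn_code, rule tln_code)

lemma prn_mono: "a \<le> a' \<Longrightarrow> b \<le> b' \<Longrightarrow> prn a b \<le> prn a' b'"
  unfolding prn_def by (intro mult_le_mono power_increasing) auto

definition pair_tm :: tm where
  "pair_tm = lams [(0, N), (1, N)] (Cn CA2 \<cdot> pow2 (V (0, N)) \<cdot> Sc (Cn CA2 \<cdot> Sc (Sc Zr) \<cdot> V (1, N)))"

text \<open>All applications of a member of one sequence to a member of another, enumerated by pairs
  of indices.\<close>

definition spread_tm :: "ty \<Rightarrow> ty \<Rightarrow> tm" where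
  "spread_tm \<sigma> \<tau> = lams [(0, N \<rightarrow> \<sigma> \<rightarrow> \<tau>), (1, N \<rightarrow> \<sigma>), (2, N)]
     (V (0, N \<rightarrow> \<sigma> \<rightarrow> \<tau>) \<cdot> (hd_tm \<cdot> V (2, N)) \<cdot> (V (1, N \<rightarrow> \<sigma>) \<cdot> (tl_tm \<cdot> V (2, N))))"

lemma pair_spread_typed [simp]:
  "wt pair_tm" "ty_of pair_tm = N \<rightarrow> N \<rightarrow> N" "tvars pair_tm = {}"
  "wt (spread_tm \<sigma> \<tau>)" "ty_of (spread_tm \<sigma> \<tau>) = (N \<rightarrow> \<sigma> \<rightarrow> \<tau>) \<rightarrow> (N \<rightarrow> \<sigma>) \<rightarrow> N \<rightarrow> \<tau>" "tvars (spread_tm \<sigma> \<tau>) = {}"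
  by (auto simp: pair_tm_def spread_tm_def)

text \<open>Objects of the extension are named by functions of an assignment \<open>i\<close> of objects to the variables, which
  depend on finitely many variables only; an unused variable is a generic object. A condition consists of
  the set of typed names declared standard and of a promise \<open>\<Theta> i \<sigma> a\<close> that the standard objects \<open>a\<close> of
  type \<open>\<sigma>\<close> have to keep.\<close>

type_synonym 'b cnd = "(ty \<times> ((var \<Rightarrow> 'b) \<Rightarrow> 'b)) set \<times> ((var \<Rightarrow> 'b) \<Rightarrow> ty \<Rightarrow> 'b \<Rightarrow> bool)"

context std
begin

lemma pair_nm [simp]: "tenv e \<Longrightarrow> val pair_tm e \<bullet> nm a \<bullet> nm b = nm (prn a b)"
  by (simp add: pair_tm_def prn_def numeral_2_eq_2)

lemma spread_nm: "tenv e \<Longrightarrow> t \<in> dom (N \<rightarrow> \<sigma> \<rightarrow> \<tau>) \<Longrightarrow> s \<in> dom (N \<rightarrow> \<sigma>) \<Longrightarrow>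
   val (spread_tm \<sigma> \<tau>) e \<bullet> t \<bullet> s \<bullet> nm m = t \<bullet> nm (hdn m) \<bullet> (s \<bullet> nm (tln m))"
  by (simp add: spread_tm_def)

text \<open>Indices are counted regardless of types, so the variables of index n, of whatever type,
  are generic for everything with support n.\<close>

definition supp :: "nat \<Rightarrow> ((var \<Rightarrow> 'a) \<Rightarrow> 'b) \<Rightarrow> bool" where
  "supp n u \<longleftrightarrow> (\<forall>i i'. tenv i \<longrightarrow> tenv i' \<longrightarrow> (\<forall>x. fst x < n \<longrightarrow> i x = i' x) \<longrightarrow> u i = u i')"

lemma suppD: "supp n u \<Longrightarrow> tenv i \<Longrightarrow> tenv i' \<Longrightarrow> (\<And>x. fst x < n \<Longrightarrow> i x = i' x) \<Longrightarrow> u i = u i'"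
  unfolding supp_def by blast

lemma supp_mono: "supp n u \<Longrightarrow> n \<le> m \<Longrightarrow> supp m u"
  unfolding supp_def by (meson less_le_trans)

definition nam :: "ty \<Rightarrow> ((var \<Rightarrow> 'a) \<Rightarrow> 'a) \<Rightarrow> bool" where
  "nam \<sigma> u \<longleftrightarrow> (\<forall>i. tenv i \<longrightarrow> u i \<in> dom \<sigma>) \<and> (\<exists>n. supp n u)"

text \<open>The values of closed terms with the names in D as further constants. There are no
  variables to abstract; abstraction from a name is supplied by \<open>Gen_abs\<close>.\<close>

inductive Gen :: "(ty \<times> ((var \<Rightarrow> 'a) \<Rightarrow> 'a)) set \<Rightarrow> ty \<Rightarrow> ((var \<Rightarrow> 'a) \<Rightarrow> 'a) \<Rightarrow> bool" for D where
  Gen_base: "(\<sigma>, u) \<in> D \<Longrightarrow> Gen D \<sigma> u"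
| Gen_co: "Gen D (cst_ty c) (\<lambda>i. co c)"
| Gen_app: "Gen D (\<sigma> \<rightarrow> \<tau>) u \<Longrightarrow> Gen D \<sigma> v \<Longrightarrow> Gen D \<tau> (\<lambda>i. u i \<bullet> v i)"

lemma Gen_mono: "Gen D \<sigma> u \<Longrightarrow> D \<subseteq> D' \<Longrightarrow> Gen D' \<sigma> u"
  by (induction rule: Gen.induct) (auto intro: Gen.intros)

lemma Gen_closed: "wt t \<Longrightarrow> tvars t = {} \<Longrightarrow> Gen D (ty_of t) (\<lambda>i. val t i)"
proof (induction t)
  case (Cn c)
  show ?case unfolding val.simps ty_of.simps by (rule Gen_co)
next
  case (App s t)
  then obtain \<sigma> \<tau> where t: "ty_of s = \<sigma> \<rightarrow> \<tau>" "ty_of t = \<sigma>" "wt s" "wt t"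
    by (auto split: ty.splits)
  then have "Gen D (\<sigma> \<rightarrow> \<tau>) (\<lambda>i. val s i)" "Gen D \<sigma> (\<lambda>i. val t i)" using App by auto
  from Gen_app[OF this] show ?case unfolding val.simps using t by simp
qed simp

lemma Gen_closed': "wt t \<Longrightarrow> tvars t = {} \<Longrightarrow> ty_of t = \<sigma> \<Longrightarrow> Gen D \<sigma> (\<lambda>i. val t i)"
  using Gen_closed by blast

lemma Gen_nm: "Gen D N (\<lambda>i. nm k)"
proof (induction k)
  case 0
  then show ?case using Gen_co[of D CZero] by simp
next
  case (Suc k)
  have "Gen D (N \<rightarrow> N) (\<lambda>i. co CSuc)" using Gen_co[of D CSuc] by simp
  from Gen_app[OF this Suc] show ?case by simp
qed

text \<open>A condition forces \<open>X\<close> if \<open>X i\<close> holds for all assignments at which finitely many generated sequences, up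
  to a generated bound, keep the promise. It is consistent if it does not force falsity.\<close>

definition ok :: "'a cnd \<Rightarrow> (ty \<times> ((var \<Rightarrow> 'a) \<Rightarrow> 'a)) set \<Rightarrow> ((var \<Rightarrow> 'a) \<Rightarrow> 'a) \<Rightarrow> (var \<Rightarrow> 'a) \<Rightarrow> bool" where
  "ok p F b i \<longleftrightarrow> (\<forall>w\<in>F. \<forall>k. lenm (nm k) (b i) \<longrightarrow> snd p i (fst w) (snd w i \<bullet> nm k))"

definition gens :: "'a cnd \<Rightarrow> (ty \<times> ((var \<Rightarrow> 'a) \<Rightarrow> 'a)) set \<Rightarrow> ((var \<Rightarrow> 'a) \<Rightarrow> 'a) \<Rightarrow> bool" where
  "gens p F b \<longleftrightarrow> finite F \<and> (\<forall>w\<in>F. Gen (fst p) (N \<rightarrow> fst w) (snd w)) \<and> Gen (fst p) N b"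

definition frc :: "'a cnd \<Rightarrow> ((var \<Rightarrow> 'a) \<Rightarrow> bool) \<Rightarrow> bool" where
  "frc p X \<longleftrightarrow> (\<exists>F b. gens p F b \<and> (\<forall>i. tenv i \<longrightarrow> ok p F b i \<longrightarrow> X i))"

definition bnd :: "nat \<Rightarrow> 'a cnd \<Rightarrow> bool" where
  "bnd n p \<longleftrightarrow> (\<forall>w\<in>fst p. (\<forall>i. tenv i \<longrightarrow> snd w i \<in> dom (fst w)) \<and> supp n (snd w)) \<and> supp n (snd p)"

definition cond :: "'a cnd \<Rightarrow> bool" where
  "cond p \<longleftrightarrow> \<not> frc p (\<lambda>i. False) \<and> (\<exists>n. bnd n p)"

definition below :: "'a cnd \<Rightarrow> 'a cnd \<Rightarrow> bool" (infix "\<preceq>" 50) where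
  "q \<preceq> p \<longleftrightarrow> fst p \<subseteq> fst q \<and> (\<forall>i \<sigma> a. snd q i \<sigma> a \<longrightarrow> snd p i \<sigma> a)"

lemma below_refl [simp]: "p \<preceq> p" by (simp add: below_def)

lemma below_trans: "r \<preceq> q \<Longrightarrow> q \<preceq> p \<Longrightarrow> r \<preceq> p" unfolding below_def by blast

lemma Gen_bnd: "Gen (fst p) \<sigma> u \<Longrightarrow> bnd n p \<Longrightarrow> (\<forall>i. tenv i \<longrightarrow> u i \<in> dom \<sigma>) \<and> supp n u"
proof (induction rule: Gen.induct)
  case (Gen_base \<sigma> u)
  then show ?case unfolding bnd_def by fastforce
next
  case (Gen_app \<sigma> \<tau> u v)
  then show ?case unfolding supp_def using ap_dom by metis
qed (simp add: co_dom supp_def)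

lemma Gen_dom: "Gen (fst p) \<sigma> u \<Longrightarrow> cond p \<Longrightarrow> tenv i \<Longrightarrow> u i \<in> dom \<sigma>"
  using Gen_bnd unfolding cond_def by blast

lemma Gen_nam: "Gen (fst p) \<sigma> u \<Longrightarrow> cond p \<Longrightarrow> nam \<sigma> u"
  using Gen_bnd unfolding cond_def nam_def by blast

lemma frc_mono: "frc p X \<Longrightarrow> (\<And>i. tenv i \<Longrightarrow> X i \<Longrightarrow> Y i) \<Longrightarrow> frc p Y"
  unfolding frc_def by blast

lemma frc_all: "(\<And>i. tenv i \<Longrightarrow> X i) \<Longrightarrow> frc p X"
  unfolding frc_def gens_def by (intro exI[of _ "{}"] exI[of _ "\<lambda>i. nm 0"]) (auto intro: Gen_nm)

lemma frc_below: "frc p X \<Longrightarrow> q \<preceq> p \<Longrightarrow> frc q X"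
proof -
  assume "frc p X" and q: "q \<preceq> p"
  then obtain F b where F: "gens p F b" "\<And>i. tenv i \<Longrightarrow> ok p F b i \<Longrightarrow> X i" unfolding frc_def by blast
  have "gens q F b" using F(1) q Gen_mono unfolding gens_def below_def by blast
  moreover have "ok q F b i \<Longrightarrow> ok p F b i" for i using q unfolding ok_def below_def by blast
  ultimately show ?thesis using F(2) unfolding frc_def by blast
qed

lemma Gen_max: "Gen D N b \<Longrightarrow> Gen D N b' \<Longrightarrow> Gen D N (\<lambda>i. co CMax \<bullet> b i \<bullet> b' i)"
  using Gen_app[OF Gen_app[of D N "N \<rightarrow> N" "\<lambda>i. co CMax" b], of b'] Gen_co[of D CMax] by simp

lemma frc_conj: assumes "frc p X" "frc p Y" "cond p" shows "frc p (\<lambda>i. X i \<and> Y i)"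
proof -
  obtain F b where F: "gens p F b" "\<And>i. tenv i \<Longrightarrow> ok p F b i \<Longrightarrow> X i" using assms unfolding frc_def by blast
  obtain F' b' where F': "gens p F' b'" "\<And>i. tenv i \<Longrightarrow> ok p F' b' i \<Longrightarrow> Y i" using assms unfolding frc_def by blast
  let ?b = "\<lambda>i. co CMax \<bullet> b i \<bullet> b' i"
  have g: "gens p (F \<union> F') ?b" using F(1) F'(1) Gen_max unfolding gens_def by blast
  have "X i \<and> Y i" if i: "tenv i" "ok p (F \<union> F') ?b i" for i
  proof -
    have "b i \<in> dom N" "b' i \<in> dom N" using Gen_dom assms(3) i(1) F(1) F'(1) unfolding gens_def by blast+
    then obtain m m' where m: "b i = nm m" "b' i = nm m'" using domN_E by blast
    then have "ok p F b i" "ok p F' b' i" using i(2) unfolding ok_def by auto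
    then show ?thesis using F(2) F'(2) i(1) by blast
  qed
  then show ?thesis using g unfolding frc_def by blast
qed

lemma frc_False: "cond p \<Longrightarrow> frc p X \<Longrightarrow> frc p (\<lambda>i. \<not> X i) \<Longrightarrow> False"
  using frc_mono[OF frc_conj[of p X "\<lambda>i. \<not> X i"], of "\<lambda>i. False"] unfolding cond_def by blast

lemma frc_promise: "Gen (fst p) (N \<rightarrow> \<rho>) t \<Longrightarrow> Gen (fst p) N b \<Longrightarrow>
  frc p (\<lambda>i. \<forall>k. lenm (nm k) (b i) \<longrightarrow> snd p i \<rho> (t i \<bullet> nm k))"
  unfolding frc_def gens_def ok_def by (intro exI[of _ "{(\<rho>, t)}"] exI[of _ b]) auto

text \<open>A promise may contain requirements that do not concern the standard object, such as
  those added in \<open>frc_split\<close>. Since some object is standard in any case, they are in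
  force.\<close>

lemma frc_any: "frc p (\<lambda>i. \<exists>\<rho> a. snd p i \<rho> a)"
proof -
  have "Gen (fst p) (N \<rightarrow> N) (\<lambda>i. co CSuc)" using Gen_co[of "fst p" CSuc] by simp
  from frc_promise[OF this Gen_nm[of _ 0]] show ?thesis
    by (rule frc_mono) (metis lenm_nm order_refl)
qed

text \<open>Put the negation of X into the promise. Finitely many generated sequences that refuted
  the new condition would establish X from p, because the new promise is kept wherever the old one
  is kept and X fails.\<close>

lemma frc_split: assumes "cond p" "supp n X" "\<not> frc p X" shows "\<exists>q. cond q \<and> q \<preceq> p \<and> frc q (\<lambda>i. \<not> X i)"
proof -
  let ?q = "(fst p, \<lambda>i \<sigma> a. snd p i \<sigma> a \<and> \<not> X i)"
  have b: "?q \<preceq> p" by (simp add: below_def)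
  have "\<not> frc ?q (\<lambda>i. False)"
  proof
    assume "frc ?q (\<lambda>i. False)"
    then obtain F b where F: "gens ?q F b" "\<And>i. tenv i \<Longrightarrow> \<not> ok ?q F b i" unfolding frc_def by blast
    have "X i" if "tenv i" "ok p F b i" for i
      using F(2)[OF that(1)] that(2) unfolding ok_def by auto
    moreover have "gens p F b" using F(1) unfolding gens_def by simp
    ultimately show False using assms(3) unfolding frc_def by blast
  qed
  moreover obtain m where m: "bnd m p" using assms unfolding cond_def by blast
  have "bnd (max n m) ?q"
  proof -
    have s: "supp (max n m) X" "supp (max n m) (snd p)"
      using supp_mono[OF assms(2)] m supp_mono[of m "snd p" "max n m"] unfolding bnd_def by simp_all
    have "supp (max n m) (\<lambda>i \<sigma> a. snd p i \<sigma> a \<and> \<not> X i)"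
      unfolding supp_def
    proof (intro HOL.allI HOL.impI)
      fix i i' assume "tenv i" "tenv i'" "\<forall>x. fst x < max n m \<longrightarrow> i x = i' x"
      then have "X i = X i'" "snd p i = snd p i'" using suppD[OF s(1)] suppD[OF s(2)] by blast+
      then show "(\<lambda>\<sigma> a. snd p i \<sigma> a \<and> \<not> X i) = (\<lambda>\<sigma> a. snd p i' \<sigma> a \<and> \<not> X i')" by simp
    qed
    moreover have "(\<forall>i. tenv i \<longrightarrow> snd w i \<in> dom (fst w)) \<and> supp (max n m) (snd w)" if "w \<in> fst p" for w
      using m supp_mono[of m "snd w" "max n m"] that unfolding bnd_def by simp
    ultimately show ?thesis unfolding bnd_def by simp
  qed
  ultimately have "cond ?q" unfolding cond_def by blast
  moreover have "frc ?q (\<lambda>i. \<not> X i)" by (rule frc_mono[OF frc_any]) auto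
  ultimately show ?thesis using b by blast
qed

section \<open>Standardness and the forcing relation\<close>

definition generated :: "'a cnd \<Rightarrow> ty \<Rightarrow> ((var \<Rightarrow> 'a) \<Rightarrow> 'a) \<Rightarrow> bool" where
  "generated p \<sigma> u \<longleftrightarrow> (\<exists>t b. Gen (fst p) (N \<rightarrow> \<sigma>) t \<and> Gen (fst p) N b \<and>
     frc p (\<lambda>i. \<exists>k. lenm (nm k) (b i) \<and> u i = t i \<bullet> nm k))"

text \<open>A stronger condition may declare more names standard, so being generated is only
  required densely below p. This also makes the notion stable under double negation.\<close>

definition st_forced :: "'a cnd \<Rightarrow> ty \<Rightarrow> ((var \<Rightarrow> 'a) \<Rightarrow> 'a) \<Rightarrow> bool" where
  "st_forced p \<sigma> u \<longleftrightarrow> (\<forall>q. cond q \<longrightarrow> q \<preceq> p \<longrightarrow> (\<exists>r. cond r \<and> r \<preceq> q \<and> generated r \<sigma> u))"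

lemma generated_below: "generated p \<sigma> u \<Longrightarrow> q \<preceq> p \<Longrightarrow> generated q \<sigma> u"
  unfolding generated_def using frc_below Gen_mono below_def by meson

lemma st_forced_below: "st_forced p \<sigma> u \<Longrightarrow> q \<preceq> p \<Longrightarrow> st_forced q \<sigma> u"
  unfolding st_forced_def using below_trans by blast

lemma generated_st_forced: "generated p \<sigma> u \<Longrightarrow> st_forced p \<sigma> u"
  unfolding st_forced_def using generated_below below_refl by blast

text \<open>A generated object is a member of the constant sequence with its value.\<close>

lemma Gen_generated: assumes "Gen (fst p) \<sigma> u" "cond p" shows "generated p \<sigma> u"
proof -
  have "Gen (fst p) (\<sigma> \<rightarrow> N \<rightarrow> \<sigma>) (\<lambda>i. co (CPi \<sigma> N))" using Gen_co[of "fst p" "CPi \<sigma> N"] by simp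
  then have "Gen (fst p) (N \<rightarrow> \<sigma>) (\<lambda>i. co (CPi \<sigma> N) \<bullet> u i)" using Gen_app assms(1) by blast
  moreover have "frc p (\<lambda>i. \<exists>k. lenm (nm k) (nm 0) \<and> u i = co (CPi \<sigma> N) \<bullet> u i \<bullet> nm k)"
    by (rule frc_all) (use K[OF Gen_dom[OF assms], of _ "nm 0" N] in auto)
  ultimately show ?thesis unfolding generated_def using Gen_nm[of "fst p" 0] by blast
qed

definition at :: "(var \<Rightarrow> (var \<Rightarrow> 'a) \<Rightarrow> 'a) \<Rightarrow> (var \<Rightarrow> 'a) \<Rightarrow> var \<Rightarrow> 'a" where
  "at \<eta> i x = \<eta> x i"

definition nenv :: "(var \<Rightarrow> (var \<Rightarrow> 'a) \<Rightarrow> 'a) \<Rightarrow> bool" where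
  "nenv \<eta> \<longleftrightarrow> (\<forall>x. nam (snd x) (\<eta> x))"

lemma at_upd: "at (\<eta>(x := u)) i = (at \<eta> i)(x := u i)"
  by (rule HOL.ext) (simp add: at_def)

lemma nenv_upd: "nenv \<eta> \<Longrightarrow> nam (snd x) u \<Longrightarrow> nenv (\<eta>(x := u))"
  unfolding nenv_def by simp

lemma at_tenv: "nenv \<eta> \<Longrightarrow> tenv i \<Longrightarrow> tenv (at \<eta> i)"
  unfolding nenv_def nam_def tenv_def at_def by blast

text \<open>Every formula is built from implication, falsity and universal quantifiers, for which
  the clauses need no density condition; density is hidden in the atoms. The clause for
  \<open>All\<close> stays at the same condition, since forcing passes to stronger ones by
  \<open>forces_below\<close>.\<close>

fun forces :: "fm \<Rightarrow> 'a cnd \<Rightarrow> (var \<Rightarrow> (var \<Rightarrow> 'a) \<Rightarrow> 'a) \<Rightarrow> bool" where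
  "forces (s \<^bold>= t) p \<eta> \<longleftrightarrow> frc p (\<lambda>i. val s (at \<eta> i) = val t (at \<eta> i))"
| "forces (s \<^bold>\<le> t) p \<eta> \<longleftrightarrow> frc p (\<lambda>i. lenm (val s (at \<eta> i)) (val t (at \<eta> i)))"
| "forces (St t) p \<eta> \<longleftrightarrow> st_forced p (ty_of t) (\<lambda>i. val t (at \<eta> i))"
| "forces Bot p \<eta> \<longleftrightarrow> False"
| "forces (A \<^bold>\<longrightarrow> B) p \<eta> \<longleftrightarrow> (\<forall>q. cond q \<longrightarrow> q \<preceq> p \<longrightarrow> forces A q \<eta> \<longrightarrow> forces B q \<eta>)"
| "forces (All x A) p \<eta> \<longleftrightarrow> (\<forall>u. nam (snd x) u \<longrightarrow> forces A p (\<eta>(x := u)))"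
| "forces (AllSt x A) p \<eta> \<longleftrightarrow> (\<forall>u. nam (snd x) u \<longrightarrow>
     (\<forall>q. cond q \<longrightarrow> q \<preceq> p \<longrightarrow> st_forced q (snd x) u \<longrightarrow> forces A q (\<eta>(x := u))))"

lemma forces_below: "forces A p \<eta> \<Longrightarrow> q \<preceq> p \<Longrightarrow> forces A q \<eta>"
proof (induction A arbitrary: \<eta>)
  case (Eq s t)
  then show ?case using frc_below by simp
next
  case (Le s t)
  then show ?case using frc_below by simp
next
  case (St t)
  then show ?case using st_forced_below by simp
next
  case (Imp A B)
  then show ?case using below_trans unfolding forces.simps by blast
next
  case (AllSt x A)
  then show ?case using below_trans unfolding forces.simps by blast
qed auto

lemma fin_supp: "finite X \<Longrightarrow> nenv \<eta> \<Longrightarrow> \<exists>n. \<forall>x\<in>X. supp n (\<eta> x)"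
proof (induction rule: finite_induct)
  case (insert x X)
  then obtain n m where "\<forall>x\<in>X. supp n (\<eta> x)" "supp m (\<eta> x)" unfolding nenv_def nam_def by blast
  then have "\<forall>y\<in>insert x X. supp (max n m) (\<eta> y)"
    using supp_mono max.cobounded1 max.cobounded2 unfolding ball_simps by blast
  then show ?case by blast
qed simp

lemma at_agree: "\<forall>x\<in>X. supp n (\<eta> x) \<Longrightarrow> tenv i \<Longrightarrow> tenv i' \<Longrightarrow> (\<And>x. fst x < n \<Longrightarrow> i x = i' x) \<Longrightarrow> x \<in> X
   \<Longrightarrow> at \<eta> i x = at \<eta> i' x"
  unfolding at_def using suppD by blast

lemma supp_val: assumes "\<forall>x\<in>tvars t. supp n (\<eta> x)" shows "supp n (\<lambda>i. val t (at \<eta> i))"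
  unfolding supp_def by (intro HOL.allI HOL.impI val_cong, rule at_agree[OF assms]) auto

lemma supp_sat: assumes "\<forall>x\<in>fvars A. supp n (\<eta> x)" shows "supp n (\<lambda>i. sat A (at \<eta> i))"
  unfolding supp_def by (intro HOL.allI HOL.impI sat_cong, rule at_agree[OF assms]) auto

lemma nam_val: assumes "nenv \<eta>" "wt t" shows "nam (ty_of t) (\<lambda>i. val t (at \<eta> i))"
proof -
  obtain n where "\<forall>x\<in>tvars t. supp n (\<eta> x)" using fin_supp[OF finite_tvars assms(1)] by blast
  then show ?thesis unfolding nam_def using supp_val at_tenv[OF assms(1)] val_dom assms(2) by blast
qed

lemma frc_stable:
  assumes "cond p" "supp n X" "\<And>q. cond q \<Longrightarrow> q \<preceq> p \<Longrightarrow> \<exists>r. cond r \<and> r \<preceq> q \<and> frc r X" shows "frc p X"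
proof (rule ccontr)
  assume "\<not> frc p X"
  then obtain q where q: "cond q" "q \<preceq> p" "frc q (\<lambda>i. \<not> X i)" using frc_split assms by blast
  then obtain r where "cond r" "r \<preceq> q" "frc r X" using assms(3) by blast
  then show False using frc_False frc_below q by blast
qed

text \<open>What is forced densely is forced, as classical logic demands. For equations and
  inequalities this rests on \<open>frc_split\<close>, for standardness on its definition.\<close>

lemma forces_stable:
  "cond p \<Longrightarrow> nenv \<eta> \<Longrightarrow> (\<And>q. cond q \<Longrightarrow> q \<preceq> p \<Longrightarrow> \<exists>r. cond r \<and> r \<preceq> q \<and> forces A r \<eta>) \<Longrightarrow> forces A p \<eta>"
proof (induction A arbitrary: p \<eta>)
  case (Eq s t)
  obtain n where n: "\<forall>x\<in>fvars (s \<^bold>= t). supp n (\<eta> x)" using fin_supp[OF finite_fvars Eq.prems(2)] by blast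
  show ?case unfolding forces.simps
    by (rule frc_stable[OF Eq.prems(1) supp_sat[OF n, unfolded sat.simps]]) (use Eq.prems(3) in simp)
next
  case (Le s t)
  obtain n where n: "\<forall>x\<in>fvars (s \<^bold>\<le> t). supp n (\<eta> x)" using fin_supp[OF finite_fvars Le.prems(2)] by blast
  show ?case unfolding forces.simps
    by (rule frc_stable[OF Le.prems(1) supp_sat[OF n, unfolded sat.simps]]) (use Le.prems(3) in simp)
next
  case (St t)
  show ?case unfolding forces.simps st_forced_def
  proof (intro HOL.allI HOL.impI)
    fix q assume "cond q" "q \<preceq> p"
    then obtain r where r: "cond r" "r \<preceq> q" "st_forced r (ty_of t) (\<lambda>i. val t (at \<eta> i))" using St.prems(3) by fastforce
    then obtain r' where "cond r'" "r' \<preceq> r" "generated r' (ty_of t) (\<lambda>i. val t (at \<eta> i))" unfolding st_forced_def using below_refl by blast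
    then show "\<exists>r. cond r \<and> r \<preceq> q \<and> generated r (ty_of t) (\<lambda>i. val t (at \<eta> i))" using r below_trans by blast
  qed
next
  case Bot
  then show ?case using Bot.prems(3)[OF Bot.prems(1) below_refl] by simp
next
  case (Imp A B)
  show ?case unfolding forces.simps
  proof (intro HOL.allI HOL.impI)
    fix q assume q: "cond q" "q \<preceq> p" "forces A q \<eta>"
    show "forces B q \<eta>"
    proof (rule Imp.IH(2)[OF q(1) Imp.prems(2)])
      fix q' assume q': "cond q'" "q' \<preceq> q"
      then obtain r where r: "cond r" "r \<preceq> q'" "forces (A \<^bold>\<longrightarrow> B) r \<eta>" using Imp.prems(3) below_trans q by meson
      have "forces A r \<eta>" using forces_below[OF q(3)] below_trans r q' by blast
      then show "\<exists>r. cond r \<and> r \<preceq> q' \<and> forces B r \<eta>" using r below_refl unfolding forces.simps by blast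
    qed
  qed
next
  case (All x A)
  show ?case unfolding forces.simps
  proof (intro HOL.allI HOL.impI)
    fix u assume u: "nam (snd x) u"
    show "forces A p (\<eta>(x := u))"
    proof (rule All.IH[OF All.prems(1) nenv_upd[OF All.prems(2) u]])
      fix q assume "cond q" "q \<preceq> p"
      then obtain r where "cond r" "r \<preceq> q" "forces (All x A) r \<eta>" using All.prems(3) by meson
      then show "\<exists>r. cond r \<and> r \<preceq> q \<and> forces A r (\<eta>(x := u))" using u unfolding forces.simps by blast
    qed
  qed
next
  case (AllSt x A)
  show ?case unfolding forces.simps
  proof (intro HOL.allI HOL.impI)
    fix u q assume u: "nam (snd x) u" and q: "cond q" "q \<preceq> p" "st_forced q (snd x) u"
    show "forces A q (\<eta>(x := u))"
    proof (rule AllSt.IH[OF q(1) nenv_upd[OF AllSt.prems(2) u]])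
      fix q' assume q': "cond q'" "q' \<preceq> q"
      then obtain r where r: "cond r" "r \<preceq> q'" "forces (AllSt x A) r \<eta>" using AllSt.prems(3) below_trans q by meson
      have "st_forced r (snd x) u" using st_forced_below[OF q(3)] below_trans r q' by blast
      then show "\<exists>r. cond r \<and> r \<preceq> q' \<and> forces A r (\<eta>(x := u))" using r u below_refl unfolding forces.simps by blast
    qed
  qed
qed

text \<open>The counterpart of the theorem of Los. A condition that does not validate an implication
  pointwise can be strengthened so that the implication fails at all assignments in question; for a
  universal quantifier, counterexamples are collected into a name.\<close>

lemma forces_internal:
  "internal A \<Longrightarrow> cond p \<Longrightarrow> nenv \<eta> \<Longrightarrow> forces A p \<eta> \<longleftrightarrow> frc p (\<lambda>i. sat A (at \<eta> i))"
proof (induction A arbitrary: p \<eta>)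
  case Bot
  then show ?case by (simp add: cond_def)
next
  case (Imp A B)
  have IH: "forces A q \<eta> \<longleftrightarrow> frc q (\<lambda>i. sat A (at \<eta> i))" "forces B q \<eta> \<longleftrightarrow> frc q (\<lambda>i. sat B (at \<eta> i))" if "cond q" for q
    using Imp that by auto
  show ?case
  proof
    assume a: "forces (A \<^bold>\<longrightarrow> B) p \<eta>"
    show "frc p (\<lambda>i. sat (A \<^bold>\<longrightarrow> B) (at \<eta> i))"
    proof (rule ccontr)
      obtain n where n: "\<forall>x\<in>fvars (A \<^bold>\<longrightarrow> B). supp n (\<eta> x)" using fin_supp[OF finite_fvars Imp.prems(3)] by blast
      assume "\<not> frc p (\<lambda>i. sat (A \<^bold>\<longrightarrow> B) (at \<eta> i))"
      then obtain q where q: "cond q" "q \<preceq> p" "frc q (\<lambda>i. \<not> sat (A \<^bold>\<longrightarrow> B) (at \<eta> i))"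
        using frc_split[OF Imp.prems(2) supp_sat[OF n]] by blast
      have "frc q (\<lambda>i. sat A (at \<eta> i))" "frc q (\<lambda>i. \<not> sat B (at \<eta> i))" by (rule frc_mono[OF q(3)]; simp)+
      moreover have "frc q (\<lambda>i. sat B (at \<eta> i))" using a q IH[OF q(1)] calculation(1) unfolding forces.simps by blast
      ultimately show False using frc_False q(1) by blast
    qed
  next
    assume a: "frc p (\<lambda>i. sat (A \<^bold>\<longrightarrow> B) (at \<eta> i))"
    show "forces (A \<^bold>\<longrightarrow> B) p \<eta>" unfolding forces.simps
    proof (intro HOL.allI HOL.impI)
      fix q assume q: "cond q" "q \<preceq> p" "forces A q \<eta>"
      have "frc q (\<lambda>i. sat (A \<^bold>\<longrightarrow> B) (at \<eta> i) \<and> sat A (at \<eta> i))"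
        using frc_conj[OF frc_below[OF a q(2)]] q IH by blast
      then have "frc q (\<lambda>i. sat B (at \<eta> i))" by (rule frc_mono) simp
      then show "forces B q \<eta>" using IH q by blast
    qed
  qed
next
  case (All x A)
  have IH: "forces A p (\<eta>(x := u)) \<longleftrightarrow> frc p (\<lambda>i. sat A ((at \<eta> i)(x := u i)))" if "nam (snd x) u" for u
    using All.IH[of p "\<eta>(x := u)", unfolded at_upd, OF _ All.prems(2) nenv_upd[OF All.prems(3) that]] All.prems(1)
    unfolding internal.simps by blast
  show ?case
  proof
    assume a: "forces (All x A) p \<eta>"
    obtain d where d: "d \<in> dom (snd x)" using dom_ex by blast
    obtain n where n: "\<forall>y\<in>fvars A. supp n (\<eta> y)" using fin_supp[OF finite_fvars All.prems(3)] by blast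
    define P where "P i b \<longleftrightarrow> b \<in> dom (snd x) \<and> \<not> sat A ((at \<eta> i)(x := b))" for i b
    \<comment> \<open>The collected counterexample has to be a name, hence of finite support. It
      depends on i only through the set of counterexamples at i, and this set depends on the support
      of the free variables only.\<close>
    define u where "u i = (if \<exists>b. P i b then SOME b. P i b else d)" for i
    have PP: "P i = P i'" if "tenv i" "tenv i'" "\<And>x. fst x < n \<Longrightarrow> i x = i' x" for i i'
    proof (rule HOL.ext)
      fix b
      have "sat A ((at \<eta> i)(x := b)) = sat A ((at \<eta> i')(x := b))"
        by (rule sat_cong) (use at_agree[OF n that] in auto)
      then show "P i b = P i' b" by (simp add: P_def)
    qed
    have s: "supp n u" unfolding supp_def
    proof (intro HOL.allI HOL.impI)
      fix i i' assume "tenv i" "tenv i'" "\<forall>x. fst x < n \<longrightarrow> i x = i' x"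
      then have "P i = P i'" by (intro PP) blast+
      then show "u i = u i'" unfolding u_def by (simp only:)
    qed
    have Pu: "\<exists>b. P i b \<Longrightarrow> P i (u i)" for i unfolding u_def by (simp add: someI_ex)
    have "u i \<in> dom (snd x)" for i using Pu[of i] d unfolding u_def P_def by (auto split: if_splits)
    then have "nam (snd x) u" using s unfolding nam_def by blast
    then have "frc p (\<lambda>i. sat A ((at \<eta> i)(x := u i)))" using a IH unfolding forces.simps by blast
    then show "frc p (\<lambda>i. sat (All x A) (at \<eta> i))"
    proof (rule frc_mono)
      fix i assume "sat A ((at \<eta> i)(x := u i))"
      then have "\<not> P i (u i)" by (simp add: P_def)
      then show "sat (All x A) (at \<eta> i)" using Pu[of i] unfolding P_def sat.simps by blast
    qed
  next
    assume a: "frc p (\<lambda>i. sat (All x A) (at \<eta> i))"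
    have "frc p (\<lambda>i. sat A ((at \<eta> i)(x := u i)))" if "nam (snd x) u" for u
      by (rule frc_mono[OF a]) (use that in \<open>auto simp: nam_def\<close>)
    then show "forces (All x A) p \<eta>" using IH unfolding forces.simps by blast
  qed
qed auto

lemma forces_cong: "(\<And>x. x \<in> fvars A \<Longrightarrow> \<eta> x = \<eta>' x) \<Longrightarrow> forces A p \<eta> \<longleftrightarrow> forces A p \<eta>'"
proof (induction A arbitrary: p \<eta> \<eta>')
  case (Eq s t)
  have "val s (at \<eta> i) = val s (at \<eta>' i)" "val t (at \<eta> i) = val t (at \<eta>' i)" for i
    by (rule val_cong; use Eq in \<open>simp add: at_def\<close>)+
  then show ?case by simp
next
  case (Le s t)
  have "val s (at \<eta> i) = val s (at \<eta>' i)" "val t (at \<eta> i) = val t (at \<eta>' i)" for i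
    by (rule val_cong; use Le in \<open>simp add: at_def\<close>)+
  then show ?case by simp
next
  case (St t)
  have "val t (at \<eta> i) = val t (at \<eta>' i)" for i
    by (rule val_cong; use St in \<open>simp add: at_def\<close>)
  then show ?case by simp
next
  case (Imp A B)
  have "forces A q \<eta> \<longleftrightarrow> forces A q \<eta>'" "forces B q \<eta> \<longleftrightarrow> forces B q \<eta>'" for q
    by (rule Imp.IH; use Imp.prems in simp)+
  then show ?case by simp
next
  case (All x A)
  have "forces A q (\<eta>(x := u)) \<longleftrightarrow> forces A q (\<eta>'(x := u))" for q u
    by (rule All.IH) (use All.prems in auto)
  then show ?case by (simp only: forces.simps)
next
  case (AllSt x A)
  have "forces A q (\<eta>(x := u)) \<longleftrightarrow> forces A q (\<eta>'(x := u))" for q u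
    by (rule AllSt.IH) (use AllSt.prems in auto)
  then show ?case by (simp only: forces.simps)
qed simp

lemma forces_fsubst_binder:
  assumes IH: "\<And>p \<eta>. wf_fm A \<Longrightarrow> free_for u x A \<Longrightarrow> forces (fsubst x u A) p \<eta> = forces A p (\<eta>(x := \<lambda>i. val u (at \<eta> i)))"
    and w: "wf_fm A" and f: "x \<notin> fvars A - {y} \<or> y \<notin> tvars u \<and> free_for u x A"
  shows "forces (if x = y then A else fsubst x u A) p (\<eta>(y := v)) = forces A p (\<eta>(x := \<lambda>i. val u (at \<eta> i), y := v))"
proof (cases "x \<in> fvars A - {y}")
  case True
  then have *: "x \<noteq> y" "y \<notin> tvars u" "free_for u x A" using f by auto
  have vu: "(\<lambda>i. val u (at (\<eta>(y := v)) i)) = (\<lambda>i. val u (at \<eta> i))"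
    by (rule HOL.ext, rule val_cong) (use * in \<open>auto simp: at_def\<close>)
  have "forces (fsubst x u A) p (\<eta>(y := v)) = forces A p (\<eta>(y := v, x := \<lambda>i. val u (at \<eta> i)))"
    unfolding IH[OF w *(3)] vu ..
  moreover have "\<eta>(y := v, x := \<lambda>i. val u (at \<eta> i)) = \<eta>(x := \<lambda>i. val u (at \<eta> i), y := v)"
    by (rule fun_upd_twist) (use * in auto)
  ultimately show ?thesis using * by (simp only: if_False)
next
  case False
  have "forces A p (\<eta>(y := v)) = forces A p (\<eta>(x := \<lambda>i. val u (at \<eta> i), y := v))"
    by (rule forces_cong) (use False in auto)
  moreover have "(if x = y then A else fsubst x u A) = A" using False by (auto simp: fsubst_fresh)
  ultimately show ?thesis by (simp only:)
qed

lemma forces_fsubst: "wt u \<Longrightarrow> ty_of u = snd x \<Longrightarrow> wf_fm A \<Longrightarrow> free_for u x A \<Longrightarrow>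
  forces (fsubst x u A) p \<eta> = forces A p (\<eta>(x := \<lambda>i. val u (at \<eta> i)))"
proof (induction A arbitrary: p \<eta>)
  case (Eq s t)
  show ?case by (simp only: fsubst.simps forces.simps val_tsubst at_upd)
next
  case (Le s t)
  show ?case by (simp only: fsubst.simps forces.simps val_tsubst at_upd)
next
  case (St t)
  then have "ty_of (tsubst x u t) = ty_of t" using tsubst_typed[of t u x] by simp
  then show ?case by (simp only: fsubst.simps forces.simps val_tsubst at_upd)
next
  case (Imp A B)
  have "forces (fsubst x u A) q \<eta> = forces A q (\<eta>(x := \<lambda>i. val u (at \<eta> i)))"
    "forces (fsubst x u B) q \<eta> = forces B q (\<eta>(x := \<lambda>i. val u (at \<eta> i)))" for q
    by (rule Imp.IH; use Imp.prems in simp)+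
  then show ?case by (simp only: fsubst.simps forces.simps)
next
  case (All y A)
  show ?case unfolding fsubst.simps forces.simps
    by (subst forces_fsubst_binder[OF All.IH]) (use All.prems in auto)
next
  case (AllSt y A)
  show ?case unfolding fsubst.simps forces.simps
    by (subst forces_fsubst_binder[OF AllSt.IH]) (use AllSt.prems in auto)
qed simp

text \<open>Classical reasoning enters through \<open>forces_stable\<close>: if no stronger
  condition forced A, the negation of A would be forced and the premise of \<open>raa\<close> would
  force falsity.\<close>

theorem forces_sound:
  assumes T: "\<And>B p \<eta>. B \<in> T \<Longrightarrow> wf_fm B \<Longrightarrow> cond p \<Longrightarrow> nenv \<eta> \<Longrightarrow> forces B p \<eta>"
  shows "derives T \<Gamma> A \<Longrightarrow> cond p \<Longrightarrow> nenv \<eta> \<Longrightarrow> (\<And>B. B \<in> \<Gamma> \<Longrightarrow> forces B p \<eta>) \<Longrightarrow> forces A p \<eta>"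
proof (induction arbitrary: p \<eta> rule: derives.induct)
  case (ax A \<Gamma>)
  show ?case by (rule T[OF ax.hyps ax.prems(1,2)])
next
  case (hyp A \<Gamma>)
  show ?case by (rule hyp.prems(3)[OF hyp.hyps(1)])
next
  case (impI A \<Gamma> B)
  show ?case unfolding forces.simps
  proof (intro HOL.allI HOL.impI)
    fix q assume q: "cond q" "q \<preceq> p" "forces A q \<eta>"
    show "forces B q \<eta>"
      by (rule impI.IH[OF q(1) impI.prems(2)]) (use q impI.prems(3) forces_below in blast)
  qed
next
  case (impE \<Gamma> A B)
  have "forces (A \<^bold>\<longrightarrow> B) p \<eta>" "forces A p \<eta>"
    by (rule impE.IH[OF impE.prems], assumption)+
  then show ?case using below_refl impE.prems(1) unfolding forces.simps by blast
next
  case (raa A \<Gamma>)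
  show ?case
  proof (rule forces_stable[OF raa.prems(1,2)])
    fix q assume q: "cond q" "q \<preceq> p"
    show "\<exists>r. cond r \<and> r \<preceq> q \<and> forces A r \<eta>"
    proof (rule ccontr)
      assume n: "\<not> (\<exists>r. cond r \<and> r \<preceq> q \<and> forces A r \<eta>)"
      have "forces Bot q \<eta>"
      proof (rule raa.IH[OF q(1) raa.prems(2)])
        fix B assume "B \<in> insert (Neg A) \<Gamma>"
        then consider "B = Neg A" | "B \<in> \<Gamma>" by blast
        then show "forces B q \<eta>"
        proof cases
          case 1
          show ?thesis unfolding 1 Neg_def forces.simps using n by blast
        next
          case 2
          show ?thesis by (rule forces_below[OF raa.prems(3)[OF 2] q(2)])
        qed
      qed
      then show False by simp
    qed
  qed
next
  case (allI \<Gamma> A x)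
  show ?case unfolding forces.simps
  proof (intro HOL.allI HOL.impI)
    fix u assume u: "nam (snd x) u"
    show "forces A p (\<eta>(x := u))"
    proof (rule allI.IH[OF allI.prems(1) nenv_upd[OF allI.prems(2) u]])
      fix B assume B: "B \<in> \<Gamma>"
      have "forces B p (\<eta>(x := u)) = forces B p \<eta>" by (rule forces_cong) (use allI.hyps(2) B in auto)
      then show "forces B p (\<eta>(x := u))" using allI.prems(3) B by simp
    qed
  qed
next
  case (allE \<Gamma> x A u)
  have "wf_fm A" using derives_wf[OF allE.hyps(1)] by simp
  note e = forces_fsubst[OF allE.hyps(2,3) this allE.hyps(4), of p \<eta>]
  have "forces (All x A) p \<eta>" by (rule allE.IH[OF allE.prems])
  then show ?case unfolding e forces.simps
    using nam_val[OF allE.prems(2) allE.hyps(2)] unfolding allE.hyps(3) by blast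
qed

lemma forces_Neg: "forces (Neg A) p \<eta> \<longleftrightarrow> (\<forall>q. cond q \<longrightarrow> q \<preceq> p \<longrightarrow> \<not> forces A q \<eta>)"
  by (simp add: Neg_def)

lemma forces_And: assumes "cond p" "nenv \<eta>" shows "forces (A \<^bold>\<and> B) p \<eta> \<longleftrightarrow> forces A p \<eta> \<and> forces B p \<eta>"
proof
  assume a: "forces (A \<^bold>\<and> B) p \<eta>"
  have "\<exists>r. cond r \<and> r \<preceq> q \<and> forces A r \<eta>" "\<exists>r. cond r \<and> r \<preceq> q \<and> forces B r \<eta>" if q: "cond q" "q \<preceq> p" for q
  proof -
    have "\<not> forces (A \<^bold>\<longrightarrow> Neg B) q \<eta>" using a q unfolding And_def forces_Neg by blast
    then obtain r where r: "cond r" "r \<preceq> q" "forces A r \<eta>" "\<not> forces (Neg B) r \<eta>" unfolding forces.simps by blast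
    then show "\<exists>r. cond r \<and> r \<preceq> q \<and> forces A r \<eta>" "\<exists>r. cond r \<and> r \<preceq> q \<and> forces B r \<eta>"
      unfolding forces_Neg using below_trans by blast+
  qed
  then show "forces A p \<eta> \<and> forces B p \<eta>" using forces_stable assms by blast
next
  assume a: "forces A p \<eta> \<and> forces B p \<eta>"
  show "forces (A \<^bold>\<and> B) p \<eta>"
    unfolding And_def forces_Neg forces.simps(5)
  proof (intro HOL.allI HOL.impI notI)
    fix q assume q: "cond q" "q \<preceq> p" "\<forall>r. cond r \<longrightarrow> r \<preceq> q \<longrightarrow> forces A r \<eta> \<longrightarrow> (\<forall>s. cond s \<longrightarrow> s \<preceq> r \<longrightarrow> \<not> forces B s \<eta>)"
    have "forces A q \<eta>" "forces B q \<eta>" using a forces_below[OF _ q(2)] by blast+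
    then show False using q(1,3) below_refl by blast
  qed
qed

lemma forces_IffI: assumes "cond p" "nenv \<eta>" "\<And>q. cond q \<Longrightarrow> q \<preceq> p \<Longrightarrow> forces A q \<eta> \<longleftrightarrow> forces B q \<eta>"
  shows "forces (A \<^bold>\<longleftrightarrow> B) p \<eta>"
  unfolding Iff_def forces_And[OF assms(1,2)] forces.simps using assms(3) by blast

lemma forces_IffD: assumes "cond p" "nenv \<eta>" "forces (A \<^bold>\<longleftrightarrow> B) p \<eta>" "forces A p \<eta>" shows "forces B p \<eta>"
  using assms(3,4) below_refl unfolding Iff_def forces_And[OF assms(1,2)] forces.simps using assms(1) by blast

lemma forces_ExI: assumes "\<And>q. cond q \<Longrightarrow> q \<preceq> p \<Longrightarrow> \<exists>r u. cond r \<and> r \<preceq> q \<and> nam (snd x) u \<and> forces A r (\<eta>(x := u))"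
  shows "forces (Ex x A) p \<eta>"
  unfolding Ex_def forces_Neg
proof (intro HOL.allI HOL.impI notI)
  fix q assume q: "cond q" "q \<preceq> p" "forces (All x (Neg A)) q \<eta>"
  then obtain r u where "cond r" "r \<preceq> q" "nam (snd x) u" "forces A r (\<eta>(x := u))" using assms by blast
  then show False using q(3) unfolding forces.simps(6) forces_Neg by blast
qed

lemma forces_ExStI: assumes "\<And>q. cond q \<Longrightarrow> q \<preceq> p \<Longrightarrow> \<exists>r u. cond r \<and> r \<preceq> q \<and> nam (snd x) u \<and> st_forced r (snd x) u \<and> forces A r (\<eta>(x := u))"
  shows "forces (ExSt x A) p \<eta>"
  unfolding ExSt_def forces_Neg
proof (intro HOL.allI HOL.impI notI)
  fix q assume q: "cond q" "q \<preceq> p" "forces (AllSt x (Neg A)) q \<eta>"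
  then obtain r u where "cond r" "r \<preceq> q" "nam (snd x) u" "st_forced r (snd x) u" "forces A r (\<eta>(x := u))" using assms by blast
  then show False using q(3) below_refl unfolding forces.simps(7) forces_Neg by blast
qed

lemma forces_ExStD: assumes "forces (ExSt x A) p \<eta>" "cond p"
  shows "\<exists>r u. cond r \<and> r \<preceq> p \<and> nam (snd x) u \<and> st_forced r (snd x) u \<and> forces A r (\<eta>(x := u))"
proof (rule ccontr)
  assume n: "\<not> ?thesis"
  have "forces (AllSt x (Neg A)) p \<eta>"
    unfolding forces.simps(7) forces_Neg using n below_trans st_forced_below by blast
  then show False using assms below_refl unfolding ExSt_def forces_Neg by blast
qed

section \<open>Forcing the axioms on standardness\<close>

lemma forces_valid: "internal A \<Longrightarrow> cond p \<Longrightarrow> nenv \<eta> \<Longrightarrow> (\<And>e. tenv e \<Longrightarrow> sat A e) \<Longrightarrow> forces A p \<eta>"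
  unfolding forces_internal by (rule frc_all) (use at_tenv in blast)

lemma forces_EQ: "A \<in> EQ \<Longrightarrow> wf_fm A \<Longrightarrow> cond p \<Longrightarrow> nenv \<eta> \<Longrightarrow> forces A p \<eta>"
proof (induction rule: EQ.induct)
  case (1 x A)
  have v: "(\<lambda>i. val (V x) (at (\<eta>(x := u)) i)) = u" for u by (rule HOL.ext) (simp add: at_def)
  show ?case by (rule forces_IffI[OF 1(2,3)]) (simp only: forces.simps v ty_of.simps)
next
  case (2 x A)
  have v: "(\<lambda>i. val (V x) (at (\<eta>(x := u)) i)) = u" for u by (rule HOL.ext) (simp add: at_def)
  show ?case
  proof (rule forces_IffI[OF 2(2,3)])
    fix q assume q: "cond q" "q \<preceq> p"
    show "forces (ExSt x A) q \<eta> \<longleftrightarrow> forces (Ex x (St (V x) \<^bold>\<and> A)) q \<eta>"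
    proof
      assume a: "forces (ExSt x A) q \<eta>"
      show "forces (Ex x (St (V x) \<^bold>\<and> A)) q \<eta>"
      proof (rule forces_ExI)
        fix q' assume q': "cond q'" "q' \<preceq> q"
        obtain r u where r: "cond r" "r \<preceq> q'" "nam (snd x) u" "st_forced r (snd x) u" "forces A r (\<eta>(x := u))"
          using forces_ExStD[OF forces_below[OF a q'(2)] q'(1)] by blast
        then have "forces (St (V x) \<^bold>\<and> A) r (\<eta>(x := u))"
          unfolding forces_And[OF r(1) nenv_upd[OF 2(3) r(3)]] forces.simps v by simp
        then show "\<exists>r u. cond r \<and> r \<preceq> q' \<and> nam (snd x) u \<and> forces (St (V x) \<^bold>\<and> A) r (\<eta>(x := u))" using r by blast
      qed
    next
      assume a: "forces (Ex x (St (V x) \<^bold>\<and> A)) q \<eta>"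
      show "forces (ExSt x A) q \<eta>"
      proof (rule forces_ExStI)
        fix q' assume q': "cond q'" "q' \<preceq> q"
        then have "\<not> forces (All x (Neg (St (V x) \<^bold>\<and> A))) q' \<eta>" using a unfolding Ex_def forces_Neg by blast
        then obtain u r where r: "nam (snd x) u" "cond r" "r \<preceq> q'" "forces (St (V x) \<^bold>\<and> A) r (\<eta>(x := u))"
          unfolding forces.simps(6) forces_Neg by blast
        then have "st_forced r (snd x) u" "forces A r (\<eta>(x := u))"
          unfolding forces_And[OF r(2) nenv_upd[OF 2(3) r(1)]] forces.simps v by simp_all
        then show "\<exists>r u. cond r \<and> r \<preceq> q' \<and> nam (snd x) u \<and> st_forced r (snd x) u \<and> forces A r (\<eta>(x := u))" using r by blast
      qed
    qed
  qed
qed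

text \<open>The member of the spread sequence at the pair of k and l is the application of t k to s
  l, and by monotonicity this index lies below the pair of the two bounds.\<close>

lemma generated_app:
  assumes p: "cond p" and f: "generated p (\<sigma> \<rightarrow> \<tau>) f" and x: "generated p \<sigma> x" shows "generated p \<tau> (\<lambda>i. f i \<bullet> x i)"
proof -
  obtain t b where t: "Gen (fst p) (N \<rightarrow> \<sigma> \<rightarrow> \<tau>) t" "Gen (fst p) N b" "frc p (\<lambda>i. \<exists>k. lenm (nm k) (b i) \<and> f i = t i \<bullet> nm k)"
    using f unfolding generated_def by blast
  obtain s c where s: "Gen (fst p) (N \<rightarrow> \<sigma>) s" "Gen (fst p) N c" "frc p (\<lambda>i. \<exists>k. lenm (nm k) (c i) \<and> x i = s i \<bullet> nm k)"
    using x unfolding generated_def by blast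
  let ?t = "\<lambda>i. val (spread_tm \<sigma> \<tau>) i \<bullet> t i \<bullet> s i" and ?b = "\<lambda>i. val pair_tm i \<bullet> b i \<bullet> c i"
  have g: "Gen (fst p) (N \<rightarrow> \<tau>) ?t" "Gen (fst p) N ?b"
    using Gen_app[OF Gen_app[OF Gen_closed'[of "spread_tm \<sigma> \<tau>"] t(1)] s(1)] Gen_app[OF Gen_app[OF Gen_closed'[of pair_tm] t(2)] s(2)]
    by simp_all
  have "frc p (\<lambda>i. \<exists>k. lenm (nm k) (?b i) \<and> f i \<bullet> x i = ?t i \<bullet> nm k)"
  proof (rule frc_mono[OF frc_conj[OF t(3) s(3) p]])
    fix i assume i: "tenv i" "(\<exists>k. lenm (nm k) (b i) \<and> f i = t i \<bullet> nm k) \<and> (\<exists>k. lenm (nm k) (c i) \<and> x i = s i \<bullet> nm k)"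
    then obtain k l where k: "lenm (nm k) (b i)" "f i = t i \<bullet> nm k" "lenm (nm l) (c i)" "x i = s i \<bullet> nm l" by blast
    obtain b' c' where b: "b i = nm b'" "c i = nm c'" using Gen_dom[OF t(2) p i(1)] Gen_dom[OF s(2) p i(1)] domN_E by blast
    have "lenm (nm (prn k l)) (?b i)" using k b i prn_mono by simp
    moreover have "f i \<bullet> x i = ?t i \<bullet> nm (prn k l)"
      using spread_nm[OF i(1) Gen_dom[OF t(1) p i(1)] Gen_dom[OF s(1) p i(1)], of "prn k l"] k by simp
    ultimately show "\<exists>k. lenm (nm k) (?b i) \<and> f i \<bullet> x i = ?t i \<bullet> nm k" by blast
  qed
  then show ?thesis using g unfolding generated_def by blast
qed

lemma Phi1_bound: assumes "f \<in> dom T1" "k \<le> n" "f \<bullet> nm k = nm a" shows "lenm (nm a) (co CPhi1 \<bullet> f \<bullet> nm n)"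
proof -
  obtain g where g: "\<And>k. f \<bullet> nm k = nm (g k)" using T1_nm[OF assms(1)] by blast
  have "g k \<le> Max (g ` {..n})" using assms(2) by simp
  then show ?thesis using Phi_nm(1)[OF assms(1) g] g[of k] assms(3) by simp
qed

text \<open>A number below t k with k \<le> b is at most the maximum of t up to b. It is therefore a
  member of the identity sequence below this bound, which \<open>CPhi1\<close> generates.\<close>

lemma generated_le:
  assumes p: "cond p" and x: "generated p N x" and y: "frc p (\<lambda>i. lenm (y i) (x i))" shows "generated p N y"
proof -
  obtain t b where t: "Gen (fst p) (N \<rightarrow> N) t" "Gen (fst p) N b" "frc p (\<lambda>i. \<exists>k. lenm (nm k) (b i) \<and> x i = t i \<bullet> nm k)"
    using x unfolding generated_def by blast
  let ?t = "\<lambda>i. val (lam (0, N) (V (0, N))) i" and ?b = "\<lambda>i. co CPhi1 \<bullet> t i \<bullet> b i"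
  have g: "Gen (fst p) (N \<rightarrow> N) ?t" by (rule Gen_closed') simp_all
  have "Gen (fst p) (T1 \<rightarrow> N \<rightarrow> N) (\<lambda>i. co CPhi1)" using Gen_co[of "fst p" CPhi1] by simp
  then have b: "Gen (fst p) N ?b" using Gen_app[OF Gen_app[OF _ t(1)] t(2)] by blast
  have "frc p (\<lambda>i. \<exists>k. lenm (nm k) (?b i) \<and> y i = ?t i \<bullet> nm k)"
  proof (rule frc_mono[OF frc_conj[OF t(3) y p]])
    fix i assume i: "tenv i" "(\<exists>k. lenm (nm k) (b i) \<and> x i = t i \<bullet> nm k) \<and> lenm (y i) (x i)"
    obtain b' where b': "b i = nm b'" using Gen_dom[OF t(2) p i(1)] domN_E by blast
    obtain k m n where k: "k \<le> b'" "x i = t i \<bullet> nm k" "y i = nm m" "x i = nm n" "m \<le> n"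
      using i(2) b' unfolding lenm_def by auto
    have "lenm (nm n) (?b i)" using Phi1_bound[OF Gen_dom[OF t(1) p i(1)] k(1), of n] k b' by simp
    then have "lenm (nm m) (?b i)" using k(5) unfolding lenm_def by (metis nm_inj order_trans)
    then show "\<exists>k. lenm (nm k) (?b i) \<and> y i = ?t i \<bullet> nm k" using k i by (intro exI[of _ m]) simp
  qed
  then show ?thesis using g b unfolding generated_def by blast
qed

lemma st_forcedI: "(\<And>q. cond q \<Longrightarrow> q \<preceq> p \<Longrightarrow> \<exists>r. cond r \<and> r \<preceq> q \<and> generated r \<sigma> u) \<Longrightarrow> st_forced p \<sigma> u"
  unfolding st_forced_def by blast

lemma st_forcedD: "st_forced p \<sigma> u \<Longrightarrow> cond q \<Longrightarrow> q \<preceq> p \<Longrightarrow> \<exists>r. cond r \<and> r \<preceq> q \<and> generated r \<sigma> u"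
  unfolding st_forced_def by blast

lemma forces_T_st: "A \<in> T_st \<Longrightarrow> wf_fm A \<Longrightarrow> cond p \<Longrightarrow> nenv \<eta> \<Longrightarrow> forces A p \<eta>"
proof (induction rule: T_st.induct)
  case (1 x \<sigma> y)
  then have w: "wt x" "wt y" "ty_of x = \<sigma>" "ty_of y = \<sigma>" by (auto simp: wf_fm_eq)
  show ?case unfolding forces.simps(5)
  proof (intro HOL.allI HOL.impI)
    fix q assume q: "cond q" "q \<preceq> p" "forces (St x \<^bold>\<and> eq \<sigma> x y) q \<eta>"
    then have a: "st_forced q \<sigma> (\<lambda>i. val x (at \<eta> i))" "frc q (\<lambda>i. sat (eq \<sigma> x y) (at \<eta> i))"
      using forces_And[OF q(1) 1(3)] forces_internal[OF internal_eq q(1) 1(3)] w by auto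
    have e: "frc q (\<lambda>i. val x (at \<eta> i) = val y (at \<eta> i))"
      by (rule frc_mono[OF a(2)]) (simp add: sat_eq at_tenv[OF 1(3)] w)
    have "st_forced q \<sigma> (\<lambda>i. val y (at \<eta> i))"
    proof (rule st_forcedI)
      fix q' assume "cond q'" "q' \<preceq> q"
      then obtain r where r: "cond r" "r \<preceq> q'" "generated r \<sigma> (\<lambda>i. val x (at \<eta> i))" "r \<preceq> q" using st_forcedD[OF a(1)] below_trans by meson
      obtain t b where t: "Gen (fst r) (N \<rightarrow> \<sigma>) t" "Gen (fst r) N b"
        "frc r (\<lambda>i. \<exists>k. lenm (nm k) (b i) \<and> val x (at \<eta> i) = t i \<bullet> nm k)" using r(3) unfolding generated_def by blast
      have "frc r (\<lambda>i. \<exists>k. lenm (nm k) (b i) \<and> val y (at \<eta> i) = t i \<bullet> nm k)"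
        by (rule frc_mono[OF frc_conj[OF t(3) frc_below[OF e r(4)] r(1)]]) (elim conjE, simp only:)
      then have "generated r \<sigma> (\<lambda>i. val y (at \<eta> i))" using t unfolding generated_def by blast
      then show "\<exists>r. cond r \<and> r \<preceq> q' \<and> generated r \<sigma> (\<lambda>i. val y (at \<eta> i))" using r by blast
    qed
    then show "forces (St y) q \<eta>" using w by simp
  qed
next
  case (2 t)
  have "(\<lambda>i. val t (at \<eta> i)) = (\<lambda>i. val t i)" by (rule HOL.ext, rule val_cong) (use 2 in simp)
  then show ?case using Gen_closed[of t "fst p"] 2 Gen_generated generated_st_forced by simp
next
  case (3 f x)
  then obtain \<sigma> \<tau> where w: "wt f" "wt x" "ty_of f = \<sigma> \<rightarrow> \<tau>" "ty_of x = \<sigma>" by (auto split: ty.splits)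
  show ?case unfolding forces.simps(5)
  proof (intro HOL.allI HOL.impI)
    fix q assume q: "cond q" "q \<preceq> p" "forces (St f \<^bold>\<and> St x) q \<eta>"
    then have a: "st_forced q (\<sigma> \<rightarrow> \<tau>) (\<lambda>i. val f (at \<eta> i))" "st_forced q \<sigma> (\<lambda>i. val x (at \<eta> i))"
      using forces_And[OF q(1) 3(3)] w by auto
    have "st_forced q \<tau> (\<lambda>i. val f (at \<eta> i) \<bullet> val x (at \<eta> i))"
    proof (rule st_forcedI)
      fix q' assume q': "cond q'" "q' \<preceq> q"
      then obtain r where r: "cond r" "r \<preceq> q'" "generated r (\<sigma> \<rightarrow> \<tau>) (\<lambda>i. val f (at \<eta> i))" "r \<preceq> q" using st_forcedD[OF a(1)] below_trans by meson
      then obtain r' where r': "cond r'" "r' \<preceq> r" "generated r' \<sigma> (\<lambda>i. val x (at \<eta> i))" using st_forcedD[OF a(2)] by meson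
      then have "generated r' \<tau> (\<lambda>i. val f (at \<eta> i) \<bullet> val x (at \<eta> i))" using generated_app generated_below r by blast
      then show "\<exists>r. cond r \<and> r \<preceq> q' \<and> generated r \<tau> (\<lambda>i. val f (at \<eta> i) \<bullet> val x (at \<eta> i))" using r r' below_trans by blast
    qed
    then show "forces (St (f \<cdot> x)) q \<eta>" using w by simp
  qed
next
  case (4 x y)
  then have w: "wt x" "wt y" "ty_of x = N" "ty_of y = N" by auto
  show ?case unfolding forces.simps(5)
  proof (intro HOL.allI HOL.impI)
    fix q assume q: "cond q" "q \<preceq> p" "forces (St x \<^bold>\<and> y \<^bold>\<le> x) q \<eta>"
    then have a: "st_forced q N (\<lambda>i. val x (at \<eta> i))" "frc q (\<lambda>i. lenm (val y (at \<eta> i)) (val x (at \<eta> i)))"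
      using forces_And[OF q(1) 4(3)] w by auto
    have "st_forced q N (\<lambda>i. val y (at \<eta> i))"
    proof (rule st_forcedI)
      fix q' assume "cond q'" "q' \<preceq> q"
      then obtain r where r: "cond r" "r \<preceq> q'" "generated r N (\<lambda>i. val x (at \<eta> i))" "r \<preceq> q" using st_forcedD[OF a(1)] below_trans by meson
      then show "\<exists>r. cond r \<and> r \<preceq> q' \<and> generated r N (\<lambda>i. val y (at \<eta> i))"
        using generated_le[OF r(1,3) frc_below[OF a(2) r(4)]] by blast
    qed
    then show "forces (St y) q \<eta>" using w by simp
  qed
qed

end

section \<open>Merging generated sequences and abstracting a name from them\<close>

definition join_tm :: "ty \<Rightarrow> tm" where
  "join_tm \<tau> = (let z = V (0, N \<rightarrow> \<tau>) \<cdot> (tl_tm \<cdot> V (2, N)) in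
     lams [(0, N \<rightarrow> \<tau>), (1, N \<rightarrow> \<tau>), (2, N)]
       (Cn (CRec \<tau>) \<cdot> (hd_tm \<cdot> V (2, N)) \<cdot> (V (1, N \<rightarrow> \<tau>) \<cdot> (tl_tm \<cdot> V (2, N)))
         \<cdot> (Cn (CPi (N \<rightarrow> \<tau>) N) \<cdot> (Cn (CPi \<tau> N) \<cdot> z)) \<cdot> (Cn (CPi \<tau> N) \<cdot> z)))"

definition comps_tm :: "ty \<Rightarrow> tm" where
  "comps_tm \<sigma> = lams [(0, \<sigma> \<rightarrow> N), (1, N \<rightarrow> \<sigma>), (2, N)] (V (0, \<sigma> \<rightarrow> N) \<cdot> (V (1, N \<rightarrow> \<sigma>) \<cdot> V (2, N)))"

text \<open>The members of all the sequences t (s k) in one enumeration, indexed by pairs of k and a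
  position.\<close>

definition unpair_tm :: "ty \<Rightarrow> ty \<Rightarrow> tm" where
  "unpair_tm \<sigma> \<tau> = lams [(0, \<sigma> \<rightarrow> N \<rightarrow> \<tau>), (1, N \<rightarrow> \<sigma>), (2, N)]
     (V (0, \<sigma> \<rightarrow> N \<rightarrow> \<tau>) \<cdot> (V (1, N \<rightarrow> \<sigma>) \<cdot> (hd_tm \<cdot> V (2, N))) \<cdot> (tl_tm \<cdot> V (2, N)))"

text \<open>To each x the finite sequence t x 0, ..., t x (s x); the successor is there because the
  bound s x is itself an admissible index.\<close>

definition fam_tm :: "ty \<Rightarrow> ty \<Rightarrow> tm" where
  "fam_tm \<sigma> \<tau> = lams [(0, \<sigma> \<rightarrow> N \<rightarrow> \<tau>), (1, \<sigma> \<rightarrow> N), (2, \<sigma>)]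
     (seq_tm \<tau> \<cdot> (V (0, \<sigma> \<rightarrow> N \<rightarrow> \<tau>) \<cdot> V (2, \<sigma>)) \<cdot> Sc (V (1, \<sigma> \<rightarrow> N) \<cdot> V (2, \<sigma>)))"

lemma join_fam_typed [simp]:
  "wt (join_tm \<tau>)" "ty_of (join_tm \<tau>) = (N \<rightarrow> \<tau>) \<rightarrow> (N \<rightarrow> \<tau>) \<rightarrow> N \<rightarrow> \<tau>" "tvars (join_tm \<tau>) = {}"
  "wt (comps_tm \<sigma>)" "ty_of (comps_tm \<sigma>) = (\<sigma> \<rightarrow> N) \<rightarrow> (N \<rightarrow> \<sigma>) \<rightarrow> N \<rightarrow> N" "tvars (comps_tm \<sigma>) = {}"
  "wt (unpair_tm \<sigma> \<tau>)" "ty_of (unpair_tm \<sigma> \<tau>) = (\<sigma> \<rightarrow> N \<rightarrow> \<tau>) \<rightarrow> (N \<rightarrow> \<sigma>) \<rightarrow> N \<rightarrow> \<tau>" "tvars (unpair_tm \<sigma> \<tau>) = {}"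
  "wt (fam_tm \<sigma> \<tau>)" "ty_of (fam_tm \<sigma> \<tau>) = (\<sigma> \<rightarrow> N \<rightarrow> \<tau>) \<rightarrow> (\<sigma> \<rightarrow> N) \<rightarrow> \<sigma> \<rightarrow> \<tau>" "tvars (fam_tm \<sigma> \<tau>) = {}"
  by (auto simp: join_tm_def comps_tm_def unpair_tm_def fam_tm_def Let_def)

context std
begin

text \<open>Case distinction at every type out of the bounded recursor: step function and bound have
  the same constant value c, so at each argument tuple the minimum is that of a number with
  itself.\<close>

lemma rec_cases:
  assumes a: "a \<in> dom \<tau>" and c: "c \<in> dom \<tau>"
  shows "co (CRec \<tau>) \<bullet> nm n \<bullet> a \<bullet> (co (CPi (N \<rightarrow> \<tau>) N) \<bullet> (co (CPi \<tau> N) \<bullet> c)) \<bullet> (co (CPi \<tau> N) \<bullet> c) = (if n = 0 then a else c)"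
proof -
  let ?v = "co (CPi \<tau> N) \<bullet> c"
  let ?r = "co (CPi (N \<rightarrow> \<tau>) N) \<bullet> ?v"
  have v: "?v \<in> dom (N \<rightarrow> \<tau>)" using ap_dom[of "co (CPi \<tau> N)" \<tau> "N \<rightarrow> \<tau>" c] co_dom[of "CPi \<tau> N"] c by simp
  then have r: "?r \<in> dom (N \<rightarrow> N \<rightarrow> \<tau>)"
    using ap_dom[of "co (CPi (N \<rightarrow> \<tau>) N)" "N \<rightarrow> \<tau>" "N \<rightarrow> N \<rightarrow> \<tau>" ?v] co_dom[of "CPi (N \<rightarrow> \<tau>) N"] by simp
  have "co (CRec \<tau>) \<in> dom (N \<rightarrow> \<tau> \<rightarrow> (N \<rightarrow> N \<rightarrow> \<tau>) \<rightarrow> (N \<rightarrow> \<tau>) \<rightarrow> \<tau>)" using co_dom[of "CRec \<tau>"] by simp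
  then have R: "co (CRec \<tau>) \<bullet> nm n \<bullet> a \<bullet> ?r \<bullet> ?v \<in> dom \<tau>" for n
    using ap_dom[OF ap_dom[OF ap_dom[OF ap_dom[OF _ nm_dom] a] r] v] by blast
  have vn: "?v \<bullet> nm k = c" for k using K[OF c nm_dom] .
  have rn: "?r \<bullet> x \<bullet> nm k = c" if "x \<in> dom N" for x k using K[OF v that] vn by simp
  show ?thesis
  proof (rule ext_args[OF R])
    fix ws assume w: "args \<tau> ws"
    then have w': "list_all2 (\<lambda>w \<sigma>. w \<in> dom \<sigma>) ws (arg_tys \<tau>)" unfolding args_def .
    obtain j where j: "foldl (\<bullet>) c ws = nm j" using domN_E[OF foldl_dom[OF c w]] by blast
    show "foldl (\<bullet>) (co (CRec \<tau>) \<bullet> nm n \<bullet> a \<bullet> ?r \<bullet> ?v) ws = foldl (\<bullet>) (if n = 0 then a else c) ws"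
    proof (cases n)
      case 0
      then show ?thesis using co_rec0[OF a r v w'] by simp
    next
      case (Suc m)
      then show ?thesis using co_recS[OF a r v w', of m] rn[OF foldl_dom[OF R[of m] w]] vn j by simp
    qed
  qed (use a c in simp)
qed

lemma join_nm: assumes "tenv e" "t \<in> dom (N \<rightarrow> \<tau>)" "s \<in> dom (N \<rightarrow> \<tau>)"
  shows "val (join_tm \<tau>) e \<bullet> t \<bullet> s \<bullet> nm m = (if hdn m = 0 then s \<bullet> nm (tln m) else t \<bullet> nm (tln m))"
  unfolding join_tm_def Let_def
  using assms rec_cases[OF ap_dom[OF assms(3) nm_dom] ap_dom[OF assms(2) nm_dom], of "hdn m" "tln m" "tln m"] by simp

lemma comps_nm: "tenv e \<Longrightarrow> t \<in> dom (\<sigma> \<rightarrow> N) \<Longrightarrow> s \<in> dom (N \<rightarrow> \<sigma>) \<Longrightarrow>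
   val (comps_tm \<sigma>) e \<bullet> t \<bullet> s \<bullet> nm m = t \<bullet> (s \<bullet> nm m)"
  by (simp add: comps_tm_def)

lemma unpair_nm: "tenv e \<Longrightarrow> t \<in> dom (\<sigma> \<rightarrow> N \<rightarrow> \<tau>) \<Longrightarrow> s \<in> dom (N \<rightarrow> \<sigma>) \<Longrightarrow>
   val (unpair_tm \<sigma> \<tau>) e \<bullet> t \<bullet> s \<bullet> nm m = t \<bullet> (s \<bullet> nm (hdn m)) \<bullet> nm (tln m)"
  by (simp add: unpair_tm_def)

lemma val_closed: "tvars t = {} \<Longrightarrow> val t e = val t e'"
  by (rule val_cong) simp

lemma fam_val: assumes "tenv e" "t \<in> dom (\<sigma> \<rightarrow> N \<rightarrow> \<tau>)" "s \<in> dom (\<sigma> \<rightarrow> N)" "x \<in> dom \<sigma>"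
  shows "val (fam_tm \<sigma> \<tau>) e \<bullet> t \<bullet> s \<bullet> x = val (seq_tm \<tau>) e \<bullet> (t \<bullet> x) \<bullet> (co CSuc \<bullet> (s \<bullet> x))"
  unfolding fam_tm_def using assms by (simp add: val_upd_fresh)

lemma sat_MemI:
  assumes e: "tenv e" and t: "wt s" "wt t" "ty_of s = \<sigma>" "ty_of t = \<sigma>"
    and l: "val (len_tm \<sigma>) e \<bullet> val t e = nm l" "j < l" "val s e = val (comp_tm \<sigma>) e \<bullet> val t e \<bullet> nm j"
  shows "sat (Mem \<sigma> s t) e"
proof -
  let ?v = "(max (ub s) (ub t), N)"
  have v: "?v \<notin> tvars s" "?v \<notin> tvars t" using tvars_ub by fastforce+
  have te: "tenv (e(?v := nm j))" using e by simp
  have "sat (eq \<sigma> s (comp_tm \<sigma> \<cdot> t \<cdot> V ?v)) (e(?v := nm j))"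
    by (subst sat_eq[OF te]) (use t l(3) v in \<open>simp_all add: val_upd_fresh\<close>)
  moreover have "sat (V ?v \<^bold>< len_tm \<sigma> \<cdot> t) (e(?v := nm j))"
    using l(1,2) v by (simp add: val_upd_fresh)
  ultimately show ?thesis unfolding Mem_def Let_def sat_connectives using nm_dom by (metis snd_conv)
qed

definition tyd :: "(ty \<times> ((var \<Rightarrow> 'a) \<Rightarrow> 'a)) set \<Rightarrow> bool" where
  "tyd D \<longleftrightarrow> (\<forall>w\<in>D. \<forall>i. tenv i \<longrightarrow> snd w i \<in> dom (fst w))"

lemma Gen_ty: "Gen D \<sigma> u \<Longrightarrow> tyd D \<Longrightarrow> tenv i \<Longrightarrow> u i \<in> dom \<sigma>"
proof (induction rule: Gen.induct)
  case (Gen_base \<sigma> u)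
  then show ?case unfolding tyd_def by fastforce
next
  case (Gen_app \<sigma> \<tau> u v)
  then show ?case using ap_dom by blast
qed (simp add: co_dom)

lemma Gen_tm1: "wt t \<Longrightarrow> tvars t = {} \<Longrightarrow> ty_of t = \<sigma> \<rightarrow> \<tau> \<Longrightarrow> Gen D \<sigma> u \<Longrightarrow> Gen D \<tau> (\<lambda>i. val t i \<bullet> u i)"
  using Gen_app[OF Gen_closed'[of t "\<sigma> \<rightarrow> \<tau>" D]] by blast

lemma Gen_tm2: "wt t \<Longrightarrow> tvars t = {} \<Longrightarrow> ty_of t = \<sigma> \<rightarrow> \<tau> \<rightarrow> \<rho> \<Longrightarrow> Gen D \<sigma> u \<Longrightarrow> Gen D \<tau> v \<Longrightarrow>
   Gen D \<rho> (\<lambda>i. val t i \<bullet> u i \<bullet> v i)"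
  using Gen_app[OF Gen_tm1[of t \<sigma> "\<tau> \<rightarrow> \<rho>" D u]] by blast

text \<open>Finitely many generated sequences are merged into one, so that a compactness argument yields a single
  sequence for \<open>HAC\<close> and idealization.\<close>

lemma Gen_join:
  assumes D: "tyd D" and b: "Gen D N b"
  shows "finite F \<Longrightarrow> \<forall>w\<in>F. Gen D (N \<rightarrow> fst w) (snd w) \<Longrightarrow>
    \<exists>U B. Gen D (N \<rightarrow> \<tau>) U \<and> Gen D N B \<and> (\<forall>i. tenv i \<longrightarrow> (\<forall>w\<in>F. fst w = \<tau> \<longrightarrow> (\<forall>k. lenm (nm k) (b i) \<longrightarrow>
      (\<exists>m. lenm (nm m) (B i) \<and> U i \<bullet> nm m = snd w i \<bullet> nm k))))"
proof (induction F rule: finite_induct)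
  case empty
  have "Gen D (N \<rightarrow> \<tau>) (\<lambda>i. val (zero_tm (N \<rightarrow> \<tau>)) i)" by (rule Gen_closed'; simp)
  then show ?case using b by blast
next
  case (insert w F)
  obtain U B where U: "Gen D (N \<rightarrow> \<tau>) U" "Gen D N B"
    "\<forall>i. tenv i \<longrightarrow> (\<forall>w\<in>F. fst w = \<tau> \<longrightarrow> (\<forall>k. lenm (nm k) (b i) \<longrightarrow> (\<exists>m. lenm (nm m) (B i) \<and> U i \<bullet> nm m = snd w i \<bullet> nm k)))"
    using insert.IH insert.prems by (metis insertI2)
  show ?case
  proof (cases "fst w = \<tau>")
    case False
    then have "\<forall>i. tenv i \<longrightarrow> (\<forall>v\<in>insert w F. fst v = \<tau> \<longrightarrow> (\<forall>k. lenm (nm k) (b i) \<longrightarrow>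
      (\<exists>m. lenm (nm m) (B i) \<and> U i \<bullet> nm m = snd v i \<bullet> nm k)))" using U(3) by blast
    then show ?thesis using U(1,2) by blast
  next
    case True
    let ?U = "\<lambda>i. val (join_tm \<tau>) i \<bullet> snd w i \<bullet> U i"
    \<comment> \<open>The new sequence occupies the pairs with first component 1, the one merged so
      far those with first component 0. Pairing 1 with the larger bound covers both.\<close>
    let ?B = "\<lambda>i. val pair_tm i \<bullet> nm 1 \<bullet> (co CMax \<bullet> B i \<bullet> b i)"
    have w: "Gen D (N \<rightarrow> \<tau>) (snd w)" using insert.prems True by simp
    have g: "Gen D (N \<rightarrow> \<tau>) ?U" "Gen D N ?B"
      using Gen_tm2[of "join_tm \<tau>" "N \<rightarrow> \<tau>" "N \<rightarrow> \<tau>" "N \<rightarrow> \<tau>" D "snd w" U] w U(1)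
        Gen_tm2[of pair_tm N N N D "\<lambda>i. nm 1"] Gen_nm[of D 1] Gen_max[OF U(2) b] by simp_all
    have "\<exists>m. lenm (nm m) (?B i) \<and> ?U i \<bullet> nm m = snd v i \<bullet> nm k"
      if i: "tenv i" and v: "v \<in> insert w F" "fst v = \<tau>" and k: "lenm (nm k) (b i)" for i v k
    proof -
      obtain B' b' where B: "B i = nm B'" "b i = nm b'"
        using Gen_ty[OF U(2) D i] Gen_ty[OF b D i] domN_E by blast
      note J = join_nm[OF i Gen_ty[OF w D i] Gen_ty[OF U(1) D i]]
      show ?thesis
      proof (cases "v = w")
        case True
        have "lenm (nm (prn 1 k)) (?B i)" using B i k prn_mono[of 1 1 k "max B' b'"] by simp
        moreover have "?U i \<bullet> nm (prn 1 k) = snd v i \<bullet> nm k" using J[of "prn 1 k"] True by simp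
        ultimately show ?thesis by blast
      next
        case False
        then obtain m where m: "lenm (nm m) (B i)" "U i \<bullet> nm m = snd v i \<bullet> nm k" using U(3) i v k by blast
        have "lenm (nm (prn 0 m)) (?B i)" using B i m prn_mono[of 0 1 m "max B' b'"] by simp
        moreover have "?U i \<bullet> nm (prn 0 m) = snd v i \<bullet> nm k" using J[of "prn 0 m"] m by simp
        ultimately show ?thesis by blast
      qed
    qed
    then show ?thesis using g by (intro exI[of _ ?U] exI[of _ ?B]) blast
  qed
qed

text \<open>Bracket abstraction of the name d, along the same cases as \<open>lam\<close>. It
  removes the auxiliary standard object from the witnesses found in \<open>HAC_core\<close>.\<close>

lemma Gen_abs: "Gen (insert (\<sigma>, d) D) \<rho> u \<Longrightarrow> tyd (insert (\<sigma>, d) D) \<Longrightarrow>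
  \<exists>u'. Gen D (\<sigma> \<rightarrow> \<rho>) u' \<and> (\<forall>i. tenv i \<longrightarrow> u i = u' i \<bullet> d i)"
proof (induction rule: Gen.induct)
  case (Gen_base \<rho> u)
  have d: "d i \<in> dom \<sigma>" if "tenv i" for i using Gen_base.prems that unfolding tyd_def by simp
  show ?case
  proof (cases "(\<rho>, u) = (\<sigma>, d)")
    case True
    have "Gen D (\<sigma> \<rightarrow> \<sigma>) (\<lambda>i. val (lam (0, \<sigma>) (V (0, \<sigma>))) i)" by (rule Gen_closed') simp_all
    moreover have "\<forall>i. tenv i \<longrightarrow> d i = val (lam (0, \<sigma>) (V (0, \<sigma>))) i \<bullet> d i" using d by simp
    ultimately show ?thesis using True by blast
  next
    case False
    then have u: "Gen D \<rho> u" using Gen_base.hyps Gen.Gen_base by blast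
    have "u i \<in> dom \<rho>" if "tenv i" for i using Gen_base that unfolding tyd_def by fastforce
    then have "\<forall>i. tenv i \<longrightarrow> u i = val (Cn (CPi \<rho> \<sigma>)) i \<bullet> u i \<bullet> d i" using K d by simp
    moreover have "Gen D (\<sigma> \<rightarrow> \<rho>) (\<lambda>i. val (Cn (CPi \<rho> \<sigma>)) i \<bullet> u i)" by (rule Gen_tm1[OF _ _ _ u]) simp_all
    ultimately show ?thesis by blast
  qed
next
  case (Gen_co c)
  have d: "d i \<in> dom \<sigma>" if "tenv i" for i using Gen_co.prems that unfolding tyd_def by simp
  have "\<forall>i. tenv i \<longrightarrow> co c = val (Cn (CPi (cst_ty c) \<sigma>)) i \<bullet> co c \<bullet> d i" using K[OF co_dom d] by simp
  moreover have "Gen D (\<sigma> \<rightarrow> cst_ty c) (\<lambda>i. val (Cn (CPi (cst_ty c) \<sigma>)) i \<bullet> co c)" by (rule Gen_tm1[OF _ _ _ Gen.Gen_co]) simp_all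
  ultimately show ?case by blast
next
  case (Gen_app \<delta> \<rho> u v)
  have D: "tyd D" and d: "\<And>i. tenv i \<Longrightarrow> d i \<in> dom \<sigma>" using Gen_app.prems unfolding tyd_def by simp_all
  obtain u' where u: "Gen D (\<sigma> \<rightarrow> \<delta> \<rightarrow> \<rho>) u'" "\<And>i. tenv i \<Longrightarrow> u i = u' i \<bullet> d i" using Gen_app by blast
  obtain v' where v: "Gen D (\<sigma> \<rightarrow> \<delta>) v'" "\<And>i. tenv i \<Longrightarrow> v i = v' i \<bullet> d i" using Gen_app by blast
  have "\<forall>i. tenv i \<longrightarrow> u i \<bullet> v i = val (Cn (CSigma \<sigma> \<delta> \<rho>)) i \<bullet> u' i \<bullet> v' i \<bullet> d i"
    using S[OF Gen_ty[OF u(1) D] Gen_ty[OF v(1) D] d] u(2) v(2) by simp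
  moreover have "Gen D (\<sigma> \<rightarrow> \<rho>) (\<lambda>i. val (Cn (CSigma \<sigma> \<delta> \<rho>)) i \<bullet> u' i \<bullet> v' i)" by (rule Gen_tm2[OF _ _ _ u(1) v(1)]) simp_all
  ultimately show ?case by blast
qed

definition strengthen :: "'a cnd \<Rightarrow> (ty \<times> ((var \<Rightarrow> 'a) \<Rightarrow> 'a)) set \<Rightarrow> ty \<Rightarrow> ((var \<Rightarrow> 'a) \<Rightarrow> 'a \<Rightarrow> bool) \<Rightarrow> 'a cnd" where
  "strengthen q E \<tau> \<psi> = (E \<union> fst q, \<lambda>i \<rho> b. snd q i \<rho> b \<and> (\<rho> = \<tau> \<longrightarrow> \<psi> i b))"

lemma strengthen_below: "strengthen q E \<tau> \<psi> \<preceq> q"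
  unfolding strengthen_def below_def by auto

lemma bnd_str:
  assumes "bnd n q" "n \<le> m" "supp m \<psi>" "\<And>w. w \<in> E \<Longrightarrow> (\<forall>i. tenv i \<longrightarrow> snd w i \<in> dom (fst w)) \<and> supp m (snd w)"
  shows "bnd m (strengthen q E \<tau> \<psi>)"
  unfolding bnd_def
proof
  have s: "supp m (snd q)" using assms(1,2) supp_mono unfolding bnd_def by blast
  show "\<forall>w\<in>fst (strengthen q E \<tau> \<psi>). (\<forall>i. tenv i \<longrightarrow> snd w i \<in> dom (fst w)) \<and> supp m (snd w)"
    unfolding strengthen_def fst_conv using assms(1,4) supp_mono[OF _ assms(2)] unfolding bnd_def by blast
  show "supp m (snd (strengthen q E \<tau> \<psi>))" unfolding supp_def
  proof (intro HOL.allI HOL.impI)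
    fix i i' assume "tenv i" "tenv i'" "\<forall>x. fst x < m \<longrightarrow> i x = i' x"
    then have "\<psi> i = \<psi> i'" "snd q i = snd q i'" using suppD[OF s] suppD[OF assms(3)] by blast+
    then show "snd (strengthen q E \<tau> \<psi>) i = snd (strengthen q E \<tau> \<psi>) i'" unfolding strengthen_def by simp
  qed
qed

text \<open>All members of a generated sequence below a generated bound keep the promise by
  \<open>frc_promise\<close>, and v is forced to be one of them.\<close>

lemma strengthen_generated:
  assumes r: "cond r" "r \<preceq> strengthen q E \<tau> \<psi>" and v: "generated r \<tau> v"
  shows "frc r (\<lambda>i. \<psi> i (v i))"
proof -
  obtain t b where t: "Gen (fst r) (N \<rightarrow> \<tau>) t" "Gen (fst r) N b"
    "frc r (\<lambda>i. \<exists>k. lenm (nm k) (b i) \<and> v i = t i \<bullet> nm k)" using v unfolding generated_def by blast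
  show ?thesis
  proof (rule frc_mono[OF frc_conj[OF t(3) frc_promise[OF t(1,2)] r(1)]], elim conjE exE)
    fix i k assume "\<forall>k. lenm (nm k) (b i) \<longrightarrow> snd r i \<tau> (t i \<bullet> nm k)" "lenm (nm k) (b i)" "v i = t i \<bullet> nm k"
    then have "snd r i \<tau> (v i)" by simp
    then show "\<psi> i (v i)" using r(2) unfolding strengthen_def below_def by simp
  qed
qed

text \<open>Finitely many generated sequences witness the inconsistency. Where they keep the old
  promise, the violation must concern \<psi> and an object of type \<tau>, so merging those of that
  type leaves a single sequence always containing a violation.\<close>

lemma strengthen_incons:
  assumes "frc (strengthen q E \<tau> \<psi>) (\<lambda>i. False)" "tyd (E \<union> fst q)"
  shows "\<exists>F b U B. finite F \<and> (\<forall>w\<in>F. Gen (E \<union> fst q) (N \<rightarrow> fst w) (snd w)) \<and> Gen (E \<union> fst q) N b \<and>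
    Gen (E \<union> fst q) (N \<rightarrow> \<tau>) U \<and> Gen (E \<union> fst q) N B \<and>
    (\<forall>i. tenv i \<longrightarrow> (\<forall>w\<in>F. \<forall>k. lenm (nm k) (b i) \<longrightarrow> snd q i (fst w) (snd w i \<bullet> nm k)) \<longrightarrow>
      (\<exists>m. lenm (nm m) (B i) \<and> \<not> \<psi> i (U i \<bullet> nm m)))"
proof -
  obtain F b where F: "gens (strengthen q E \<tau> \<psi>) F b" "\<And>i. tenv i \<Longrightarrow> \<not> ok (strengthen q E \<tau> \<psi>) F b i"
    using assms(1) unfolding frc_def by blast
  then have g: "finite F" "\<forall>w\<in>F. Gen (E \<union> fst q) (N \<rightarrow> fst w) (snd w)" "Gen (E \<union> fst q) N b"
    unfolding gens_def strengthen_def by simp_all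
  obtain U B where U: "Gen (E \<union> fst q) (N \<rightarrow> \<tau>) U" "Gen (E \<union> fst q) N B"
    "\<forall>i. tenv i \<longrightarrow> (\<forall>w\<in>F. fst w = \<tau> \<longrightarrow> (\<forall>k. lenm (nm k) (b i) \<longrightarrow> (\<exists>m. lenm (nm m) (B i) \<and> U i \<bullet> nm m = snd w i \<bullet> nm k)))"
    using Gen_join[OF assms(2) g(3,1,2)] by blast
  have "\<exists>m. lenm (nm m) (B i) \<and> \<not> \<psi> i (U i \<bullet> nm m)"
    if i: "tenv i" "\<forall>w\<in>F. \<forall>k. lenm (nm k) (b i) \<longrightarrow> snd q i (fst w) (snd w i \<bullet> nm k)" for i
  proof -
    obtain w k where w: "w \<in> F" "lenm (nm k) (b i)" "\<not> snd (strengthen q E \<tau> \<psi>) i (fst w) (snd w i \<bullet> nm k)"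
      using F(2)[OF i(1)] unfolding ok_def by blast
    then have "fst w = \<tau>" "\<not> \<psi> i (snd w i \<bullet> nm k)" using i(2) unfolding strengthen_def by auto
    moreover obtain m where "lenm (nm m) (B i)" "U i \<bullet> nm m = snd w i \<bullet> nm k" using U(3) i(1) w calculation(1) by blast
    ultimately show ?thesis by metis
  qed
  then show ?thesis using g U by blast
qed

text \<open>Supplies the index of a generic variable: neither the condition nor the parameters in X
  depend on variables of index n.\<close>

lemma avoid: assumes "cond q" "nenv \<eta>" "finite X" shows "\<exists>n. bnd n q \<and> (\<forall>x\<in>X. supp n (\<eta> x))"
proof -
  obtain n m where n: "bnd n q" "\<forall>x\<in>X. supp m (\<eta> x)" using assms fin_supp unfolding cond_def by blast
  have "bnd (max n m) q"
    using n(1) supp_mono[of n _ "max n m"] unfolding bnd_def by (simp add: supp_mono[of n _ "max n m"])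
  moreover have "\<forall>x\<in>X. supp (max n m) (\<eta> x)" using n(2) supp_mono max.cobounded2 by blast
  ultimately show ?thesis by blast
qed

lemma bnd_tyd: "bnd n q \<Longrightarrow> tyd (fst q)" unfolding bnd_def tyd_def by blast

end

lemma internal_Mem [simp]: "internal (Mem \<sigma> s t)"
  by (simp add: Mem_def Let_def)

section \<open>Forcing choice and idealization\<close>

context std
begin

lemma sat_supp_cong:
  assumes "\<forall>z\<in>fvars A. supp n (\<eta> z)" "tenv i" "tenv i'" "\<forall>x. fst x < n \<longrightarrow> i x = i' x"
  shows "sat A ((at \<eta> i)(x := a, y := b)) = sat A ((at \<eta> i')(x := a, y := b))"
proof (rule sat_cong)
  fix z assume "z \<in> fvars A"
  then have "at \<eta> i z = at \<eta> i' z" using at_agree[OF assms(1-3)] assms(4) by blast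
  then show "((at \<eta> i)(x := a, y := b)) z = ((at \<eta> i')(x := a, y := b)) z" by simp
qed

lemma supp_var: "supp (Suc n) (\<lambda>i. i (n, \<sigma>))"
  unfolding supp_def by simp

text \<open>Add a generic standard \<open>d\<close> with the promise that no standard \<open>b\<close> satisfies \<open>A d b\<close>. By the premise this
  is inconsistent, so a sequence generated from \<open>d\<close> always contains a witness; abstract \<open>d\<close> from it.\<close>

lemma HAC_core:
  fixes x y :: var
  defines "\<sigma> \<equiv> snd x" and "\<tau> \<equiv> snd y"
  assumes A: "internal A" and \<eta>: "nenv \<eta>" and q: "cond q" and H: "forces (AllSt x (ExSt y A)) q \<eta>"
  shows "\<exists>Y. Gen (fst q) (\<sigma> \<rightarrow> \<tau>) Y \<and> (\<forall>r a. cond r \<longrightarrow> r \<preceq> q \<longrightarrow> nam \<sigma> a \<longrightarrow> generated r \<sigma> a \<longrightarrow>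
    frc r (\<lambda>i. \<exists>l j. val (len_tm \<tau>) i \<bullet> (val (img_tm \<sigma> \<tau>) i \<bullet> Y i \<bullet> a i) = nm l \<and> j < l \<and>
      val (comp_tm \<tau>) i \<bullet> (val (img_tm \<sigma> \<tau>) i \<bullet> Y i \<bullet> a i) \<bullet> nm j \<in> dom \<tau> \<and>
      sat A ((at \<eta> i)(x := a i, y := val (comp_tm \<tau>) i \<bullet> (val (img_tm \<sigma> \<tau>) i \<bullet> Y i \<bullet> a i) \<bullet> nm j))))"
proof -
  obtain n where n: "bnd n q" "\<forall>z\<in>fvars A. supp n (\<eta> z)" using avoid[OF q \<eta> finite_fvars] by blast
  define \<phi> where "\<phi> i a b \<longleftrightarrow> sat A ((at \<eta> i)(x := a, y := b))" for i a b
  define d :: "(var \<Rightarrow> 'a) \<Rightarrow> 'a" where "d i = i (n, \<sigma>)" for i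
  define \<psi> where "\<psi> i b \<longleftrightarrow> \<not> \<phi> i (d i) b" for i b
  have \<phi>c: "\<phi> i a b = \<phi> i' a b" if "tenv i" "tenv i'" "\<forall>x. fst x < n \<longrightarrow> i x = i' x" for i i' a b
    unfolding \<phi>_def by (rule sat_supp_cong[OF n(2) that])
  have sd: "supp (Suc n) d" unfolding d_def by (rule supp_var)
  have dd: "d i \<in> dom \<sigma>" if "tenv i" for i using that unfolding d_def tenv_def by (metis snd_conv)
  have s\<psi>: "supp (Suc n) \<psi>" unfolding supp_def
  proof (intro HOL.allI HOL.impI, rule HOL.ext)
    fix i i' b assume i: "tenv i" "tenv i'" "\<forall>x. fst x < Suc n \<longrightarrow> i x = i' x"
    then have "d i = d i'" unfolding d_def by simp
    moreover have "\<phi> i (d i') b = \<phi> i' (d i') b" by (rule \<phi>c[OF i(1,2)]) (use i(3) in simp)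
    ultimately show "\<psi> i b = \<psi> i' b" unfolding \<psi>_def by simp
  qed
  let ?q = "strengthen q {(\<sigma>, d)} \<tau> \<psi>"
  have bq: "bnd (Suc n) ?q" by (rule bnd_str[OF n(1) _ s\<psi>]) (use sd dd in simp_all)
  have td: "tyd (insert (\<sigma>, d) (fst q))" using bnd_tyd[OF n(1)] dd unfolding tyd_def by simp
  \<comment> \<open>If the condition were consistent, the premise for the standard object d would
    give, below it, a standard v satisfying A together with d, against the promise.\<close>
  have inc: "frc ?q (\<lambda>i. False)"
  proof (rule ccontr)
    assume "\<not> frc ?q (\<lambda>i. False)"
    then have cq: "cond ?q" using bq unfolding cond_def by blast
    have gd: "Gen (fst ?q) \<sigma> d" by (rule Gen_base) (simp add: strengthen_def)
    have "forces (ExSt y A) ?q (\<eta>(x := d))"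
      using H Gen_nam[OF gd cq] cq strengthen_below generated_st_forced[OF Gen_generated[OF gd cq]] unfolding forces.simps \<sigma>_def by blast
    then obtain r v where r: "cond r" "r \<preceq> ?q" "nam \<tau> v" "st_forced r \<tau> v" "forces A r (\<eta>(x := d, y := v))"
      using forces_ExStD cq unfolding \<tau>_def by blast
    obtain r' where r': "cond r'" "r' \<preceq> r" "generated r' \<tau> v" using st_forcedD[OF r(4,1) below_refl] by blast
    have ne: "nenv (\<eta>(x := d, y := v))"
      using nenv_upd[OF nenv_upd[OF \<eta>]] Gen_nam[OF gd cq] r(3) unfolding \<sigma>_def \<tau>_def by blast
    have "frc r (\<lambda>i. \<phi> i (d i) (v i))" using r(5) unfolding forces_internal[OF A r(1) ne] at_upd \<phi>_def .
    then have "frc r' (\<lambda>i. \<phi> i (d i) (v i))" using frc_below r'(2) by blast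
    moreover have "frc r' (\<lambda>i. \<not> \<phi> i (d i) (v i))"
      using strengthen_generated[OF r'(1) below_trans[OF r'(2) r(2)] r'(3)] unfolding \<psi>_def .
    ultimately show False using frc_False[OF r'(1)] by blast
  qed
  have Dq: "{(\<sigma>, d)} \<union> fst q = insert (\<sigma>, d) (fst q)" by simp
  obtain F b U B where F: "finite F" "\<forall>w\<in>F. Gen (insert (\<sigma>, d) (fst q)) (N \<rightarrow> fst w) (snd w)"
    "Gen (insert (\<sigma>, d) (fst q)) N b" "Gen (insert (\<sigma>, d) (fst q)) (N \<rightarrow> \<tau>) U" "Gen (insert (\<sigma>, d) (fst q)) N B"
    "\<forall>i. tenv i \<longrightarrow> (\<forall>w\<in>F. \<forall>k. lenm (nm k) (b i) \<longrightarrow> snd q i (fst w) (snd w i \<bullet> nm k)) \<longrightarrow>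
      (\<exists>m. lenm (nm m) (B i) \<and> \<not> \<psi> i (U i \<bullet> nm m))"
    using strengthen_incons[OF inc, unfolded Dq, OF td] by blast
  \<comment> \<open>The sequences and bounds obtained may use d. Abstraction makes them functions
    generated from q alone, which can be applied to any standard object in place of d.\<close>
  have "\<forall>w\<in>F. \<exists>g. Gen (fst q) (\<sigma> \<rightarrow> N \<rightarrow> fst w) g \<and> (\<forall>i. tenv i \<longrightarrow> snd w i = g i \<bullet> d i)"
    using F(2) Gen_abs td by blast
  then obtain G where G: "\<forall>w\<in>F. Gen (fst q) (\<sigma> \<rightarrow> N \<rightarrow> fst w) (G w) \<and> (\<forall>i. tenv i \<longrightarrow> snd w i = G w i \<bullet> d i)"
    using bchoice[of F "\<lambda>w g. Gen (fst q) (\<sigma> \<rightarrow> N \<rightarrow> fst w) g \<and> (\<forall>i. tenv i \<longrightarrow> snd w i = g i \<bullet> d i)"] by blast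
  obtain b' where b': "Gen (fst q) (\<sigma> \<rightarrow> N) b'" "\<forall>i. tenv i \<longrightarrow> b i = b' i \<bullet> d i" using Gen_abs[OF F(3) td] by blast
  obtain U' where U': "Gen (fst q) (\<sigma> \<rightarrow> N \<rightarrow> \<tau>) U'" "\<forall>i. tenv i \<longrightarrow> U i = U' i \<bullet> d i" using Gen_abs[OF F(4) td] by blast
  obtain B' where B': "Gen (fst q) (\<sigma> \<rightarrow> N) B'" "\<forall>i. tenv i \<longrightarrow> B i = B' i \<bullet> d i" using Gen_abs[OF F(5) td] by blast
  \<comment> \<open>f sends an argument to its finite sequence of candidates; Y is the sequence with
    the single component f, so that by \<open>img_seq\<close> its image at an argument is this
    sequence of candidates.\<close>
  define f where "f i = val (fam_tm \<sigma> \<tau>) i \<bullet> U' i \<bullet> B' i" for i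
  define Kf where "Kf i = val (Cn (CPi (\<sigma> \<rightarrow> \<tau>) N)) i \<bullet> f i" for i
  define Y where "Y i = val (seq_tm (\<sigma> \<rightarrow> \<tau>)) i \<bullet> Kf i \<bullet> nm 1" for i
  have gf: "Gen (fst q) (\<sigma> \<rightarrow> \<tau>) f" unfolding f_def by (rule Gen_tm2[OF _ _ _ U'(1) B'(1)]) simp_all
  have gK: "Gen (fst q) (N \<rightarrow> \<sigma> \<rightarrow> \<tau>) Kf" unfolding Kf_def by (rule Gen_tm1[OF _ _ _ gf]) simp_all
  have gY: "Gen (fst q) (\<sigma> \<rightarrow> \<tau>) Y" unfolding Y_def by (rule Gen_tm2[OF _ _ _ gK Gen_nm]) simp_all
  note dom = Gen_dom[OF _ q]
  show ?thesis
  proof (rule exI[of _ Y], rule conjI[OF gY], intro HOL.allI HOL.impI)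
    fix r a assume r: "cond r" "r \<preceq> q" and a: "nam \<sigma> a" "generated r \<sigma> a"
    obtain w c where w: "Gen (fst r) (N \<rightarrow> \<sigma>) w" "Gen (fst r) N c" "frc r (\<lambda>i. \<exists>k. lenm (nm k) (c i) \<and> a i = w i \<bullet> nm k)"
      using a(2) unfolding generated_def by blast
    have mono: "Gen (fst r) \<rho> u" if "Gen (fst q) \<rho> u" for \<rho> u using Gen_mono[OF that] r(2) unfolding below_def by blast
    \<comment> \<open>The object a is only known to be w k for some k up to c. The promise required
      at a is therefore secured at all w k simultaneously: \<open>F4\<close> enumerates the
      abstracted sequences at each w k, and \<open>b4\<close> allows for the largest bound b' (w k)
      with k up to c.\<close>
    define h where "h i = val (comps_tm \<sigma>) i \<bullet> b' i \<bullet> w i" for i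
    have gh: "Gen (fst r) T1 h" unfolding h_def by (rule Gen_tm2[OF _ _ _ mono[OF b'(1)] w(1)]) simp_all
    define F4 where "F4 = (\<lambda>v. (fst v, \<lambda>i. val (unpair_tm \<sigma> (fst v)) i \<bullet> G v i \<bullet> w i)) ` F"
    define b4 where "b4 i = val pair_tm i \<bullet> c i \<bullet> (val (Cn CPhi1) i \<bullet> h i \<bullet> c i)" for i
    have gP: "Gen (fst r) N (\<lambda>i. val (Cn CPhi1) i \<bullet> h i \<bullet> c i)" by (rule Gen_tm2[OF _ _ _ gh w(2)]) simp_all
    have gb4: "Gen (fst r) N b4" unfolding b4_def by (rule Gen_tm2[OF _ _ _ w(2) gP]) simp_all
    have "Gen (fst r) (N \<rightarrow> fst v) (\<lambda>i. val (unpair_tm \<sigma> (fst v)) i \<bullet> G v i \<bullet> w i)" if "v \<in> F" for v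
      by (rule Gen_tm2[OF _ _ _ mono w(1)]) (use G that in auto)
    then have "gens r F4 b4" unfolding gens_def F4_def using F(1) gb4 by auto
    then have "frc r (ok r F4 b4)" unfolding frc_def by blast
    from frc_conj[OF w(3) this r(1)]
    show "frc r (\<lambda>i. \<exists>l j. val (len_tm \<tau>) i \<bullet> (val (img_tm \<sigma> \<tau>) i \<bullet> Y i \<bullet> a i) = nm l \<and> j < l \<and>
      val (comp_tm \<tau>) i \<bullet> (val (img_tm \<sigma> \<tau>) i \<bullet> Y i \<bullet> a i) \<bullet> nm j \<in> dom \<tau> \<and>
      sat A ((at \<eta> i)(x := a i, y := val (comp_tm \<tau>) i \<bullet> (val (img_tm \<sigma> \<tau>) i \<bullet> Y i \<bullet> a i) \<bullet> nm j)))"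
    proof (rule frc_mono, elim conjE exE)
      fix i k0 assume i: "tenv i" and ok: "ok r F4 b4 i" and k0: "lenm (nm k0) (c i)" "a i = w i \<bullet> nm k0"
      have ai: "a i \<in> dom \<sigma>" using a(1) i unfolding nam_def by blast
      \<comment> \<open>Instantiate the generic object d by the value of a. The names and the
        promise of q have support n and do not notice the change.\<close>
      define i' where "i' = i((n, \<sigma>) := a i)"
      have i': "tenv i'" unfolding i'_def using i ai by simp
      have agr: "\<forall>x. fst x < n \<longrightarrow> i x = i' x" unfolding i'_def by auto
      have same: "u i' = u i" if "Gen (fst q) \<rho> u" for \<rho> u
        using Gen_bnd[OF that n(1)] suppD[of n u i i'] i i' agr by simp
      have \<Theta>: "snd q i' = snd q i" using n(1) suppD[of n "snd q" i i'] i i' agr unfolding bnd_def by simp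
      have d': "d i' = a i" unfolding d_def i'_def by simp
      have bi: "b i' = b' i \<bullet> a i" "U i' = U' i \<bullet> a i" "B i' = B' i \<bullet> a i"
        using b'(2) U'(2) B'(2) i' same[OF b'(1)] same[OF U'(1)] same[OF B'(1)] d' by simp_all
      obtain c' where c': "c i = nm c'" using Gen_dom[OF w(2) r(1) i] domN_E by blast
      obtain m0 where m0: "b' i \<bullet> a i = nm m0" using ap_dom[OF dom[OF b'(1) i] ai] domN_E by blast
      have wi: "w i \<in> dom (N \<rightarrow> \<sigma>)" using Gen_dom[OF w(1) r(1) i] .
      have hi: "h i \<in> dom T1" using Gen_dom[OF gh r(1) i] .
      have hk: "h i \<bullet> nm k0 = nm m0" unfolding h_def using comps_nm[OF i dom[OF b'(1) i] wi] k0(2) m0 by simp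
      have le: "lenm (nm m0) (co CPhi1 \<bullet> h i \<bullet> nm c')" by (rule Phi1_bound[OF hi _ hk]) (use k0(1) c' in simp)
      then obtain M where M: "co CPhi1 \<bullet> h i \<bullet> nm c' = nm M" "m0 \<le> M" unfolding lenm_def by auto
      have b4: "b4 i = nm (prn c' M)" unfolding b4_def using c' M i by simp
      have "\<forall>v\<in>F. \<forall>k. lenm (nm k) (b i') \<longrightarrow> snd q i' (fst v) (snd v i' \<bullet> nm k)"
      proof (intro ballI HOL.allI HOL.impI)
        fix v k assume v: "v \<in> F" and k: "lenm (nm k) (b i')"
        then have "k \<le> M" using bi m0 M(2) by simp
        then have "lenm (nm (prn k0 k)) (b4 i)" using b4 prn_mono[of k0 c' k M] k0(1) c' by simp
        moreover have "(fst v, \<lambda>i. val (unpair_tm \<sigma> (fst v)) i \<bullet> G v i \<bullet> w i) \<in> F4" unfolding F4_def using v by blast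
        ultimately have "snd r i (fst v) (val (unpair_tm \<sigma> (fst v)) i \<bullet> G v i \<bullet> w i \<bullet> nm (prn k0 k))"
          using ok unfolding ok_def by fastforce
        moreover have "val (unpair_tm \<sigma> (fst v)) i \<bullet> G v i \<bullet> w i \<bullet> nm (prn k0 k) = G v i \<bullet> a i \<bullet> nm k"
          using unpair_nm[OF i dom[OF _ i] wi, of "fst v" "G v" "prn k0 k"] G v k0(2) by simp
        moreover have "snd v i' = G v i \<bullet> a i" using G v i' same d' by metis
        ultimately show "snd q i' (fst v) (snd v i' \<bullet> nm k)" using r(2) \<Theta> unfolding below_def by metis
      qed
      then obtain m where m: "lenm (nm m) (B i')" "\<not> \<psi> i' (U i' \<bullet> nm m)" using F(6) i' by blast
      obtain M' where M': "B' i \<bullet> a i = nm M'" using ap_dom[OF dom[OF B'(1) i] ai] domN_E by blast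
      have mM: "m \<le> M'" using m(1) bi M' by simp
      have Ua: "U' i \<bullet> a i \<in> dom (N \<rightarrow> \<tau>)" using ap_dom[OF dom[OF U'(1) i] ai] .
      have \<phi>m: "\<phi> i (a i) (U' i \<bullet> a i \<bullet> nm m)"
        using m(2) \<phi>c[OF i i' agr, of "a i"] bi d' unfolding \<psi>_def by simp
      have fa: "f i \<bullet> a i = val (seq_tm \<tau>) i \<bullet> (U' i \<bullet> a i) \<bullet> nm (Suc M')"
        unfolding f_def using fam_val[OF i dom[OF U'(1) i] dom[OF B'(1) i] ai] M' by simp
      have l: "val (len_tm \<tau>) i \<bullet> (f i \<bullet> a i) = nm (Suc M')" unfolding fa by (rule len_seq[OF i Ua])
      have K0: "Kf i \<bullet> nm 0 = f i" unfolding Kf_def using K[OF dom[OF gf i] nm_dom[of 0]] by simp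
      note img = img_seq[OF i ai dom[OF gf i] dom[OF gK i] K0 l, folded Y_def]
      have cm: "val (comp_tm \<tau>) i \<bullet> (val (img_tm \<sigma> \<tau>) i \<bullet> Y i \<bullet> a i) \<bullet> nm m = U' i \<bullet> a i \<bullet> nm m"
        using img(2)[of m] mM comp_seq[OF i Ua, of m "Suc M'"] fa by simp
      show "\<exists>l j. val (len_tm \<tau>) i \<bullet> (val (img_tm \<sigma> \<tau>) i \<bullet> Y i \<bullet> a i) = nm l \<and> j < l \<and>
        val (comp_tm \<tau>) i \<bullet> (val (img_tm \<sigma> \<tau>) i \<bullet> Y i \<bullet> a i) \<bullet> nm j \<in> dom \<tau> \<and>
        sat A ((at \<eta> i)(x := a i, y := val (comp_tm \<tau>) i \<bullet> (val (img_tm \<sigma> \<tau>) i \<bullet> Y i \<bullet> a i) \<bullet> nm j))"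
        by (rule exI[of _ "Suc M'"], rule exI[of _ m])
          (use img(1) mM cm \<phi>m ap_dom[OF Ua nm_dom[of m]] in \<open>simp only: \<phi>_def simp_thms less_Suc_eq_le\<close>)
    qed
  qed
qed

text \<open>The core treats arguments that are generated. Standardness only makes this dense, and
  \<open>frc_stable\<close> closes the gap, since what remains to be forced is internal.\<close>

lemma forces_HAC: "C \<in> HAC_int \<Longrightarrow> wf_fm C \<Longrightarrow> cond p \<Longrightarrow> nenv \<eta> \<Longrightarrow> forces C p \<eta>"
proof (induction rule: HAC_int.induct)
  case (1 A Y x y)
  let ?M = "Mem (snd y) (V y) (img_tm (snd x) (snd y) \<cdot> V Y \<cdot> V x)"
  show ?case unfolding forces.simps(5)
  proof (intro HOL.allI HOL.impI, rule forces_ExStI)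
    fix p' q assume p': "cond p'" "p' \<preceq> p" "forces (AllSt x (ExSt y A)) p' \<eta>" and q: "cond q" "q \<preceq> p'"
    obtain Z where Z: "Gen (fst q) (snd x \<rightarrow> snd y) Z"
      "\<And>r a. cond r \<Longrightarrow> r \<preceq> q \<Longrightarrow> nam (snd x) a \<Longrightarrow> generated r (snd x) a \<Longrightarrow>
        frc r (\<lambda>i. \<exists>l j. val (len_tm (snd y)) i \<bullet> (val (img_tm (snd x) (snd y)) i \<bullet> Z i \<bullet> a i) = nm l \<and> j < l \<and>
          val (comp_tm (snd y)) i \<bullet> (val (img_tm (snd x) (snd y)) i \<bullet> Z i \<bullet> a i) \<bullet> nm j \<in> dom (snd y) \<and>
          sat A ((at \<eta> i)(x := a i, y := val (comp_tm (snd y)) i \<bullet> (val (img_tm (snd x) (snd y)) i \<bullet> Z i \<bullet> a i) \<bullet> nm j)))"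
      using HAC_core[OF 1(1) 1(7) q(1) forces_below[OF p'(3) q(2)]] by blast
    have nZ: "nam (snd Y) Z" "st_forced q (snd Y) Z"
      using Gen_nam[OF Z(1) q(1)] generated_st_forced[OF Gen_generated[OF Z(1) q(1)]] 1(2) by simp_all
    have "forces (AllSt x (Ex y (?M \<^bold>\<and> A))) q (\<eta>(Y := Z))" unfolding forces.simps
    proof (intro HOL.allI HOL.impI)
      fix a q2 assume a: "nam (snd x) a" and q2: "cond q2" "q2 \<preceq> q" "st_forced q2 (snd x) a"
      let ?\<eta> = "\<eta>(Y := Z, x := a)"
      have ne: "nenv ?\<eta>" by (intro nenv_upd 1(7) nZ(1) a)
      have int: "internal (Ex y (?M \<^bold>\<and> A))" using 1(1) by simp
      obtain m where m: "\<forall>z\<in>fvars (Ex y (?M \<^bold>\<and> A)). supp m (?\<eta> z)" using fin_supp[OF finite_fvars ne] by blast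
      show "forces (Ex y (?M \<^bold>\<and> A)) q2 ?\<eta>" unfolding forces_internal[OF int q2(1) ne]
      proof (rule frc_stable[OF q2(1) supp_sat[OF m]])
        fix q3 assume q3: "cond q3" "q3 \<preceq> q2"
        obtain r where r: "cond r" "r \<preceq> q3" "generated r (snd x) a" using st_forcedD[OF q2(3) q3] by blast
        have rq: "r \<preceq> q" using below_trans r(2) q3(2) q2(2) by blast
        have "frc r (\<lambda>i. sat (Ex y (?M \<^bold>\<and> A)) (at ?\<eta> i))"
        proof (rule frc_mono[OF Z(2)[OF r(1) rq a r(3)]], elim exE conjE)
          fix i l j
          let ?I = "val (img_tm (snd x) (snd y)) i \<bullet> Z i \<bullet> a i"
          let ?z = "val (comp_tm (snd y)) i \<bullet> ?I \<bullet> nm j"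
          assume i: "tenv i" and l: "val (len_tm (snd y)) i \<bullet> ?I = nm l" "j < l" and z: "?z \<in> dom (snd y)"
            and sA: "sat A ((at \<eta> i)(x := a i, y := ?z))"
          let ?e = "(at ?\<eta> i)(y := ?z)"
          have te: "tenv ?e" by (rule tenv_upd[OF at_tenv[OF ne i] z])
          have xy: "x \<noteq> y" "Y \<noteq> x" "Y \<noteq> y" using 1(3) by auto
          have v: "val (img_tm (snd x) (snd y) \<cdot> V Y \<cdot> V x) ?e = ?I" "val (V y) ?e = ?z"
            using xy val_closed[of "img_tm (snd x) (snd y)" ?e i] by (simp_all add: at_def)
          have "sat ?M ?e"
          proof (rule sat_MemI[OF te, of _ _ _ l j])
            show "val (len_tm (snd y)) ?e \<bullet> val (img_tm (snd x) (snd y) \<cdot> V Y \<cdot> V x) ?e = nm l"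
              unfolding v using l(1) val_closed[of "len_tm (snd y)" ?e i] by simp
            show "val (V y) ?e = val (comp_tm (snd y)) ?e \<bullet> val (img_tm (snd x) (snd y) \<cdot> V Y \<cdot> V x) ?e \<bullet> nm j"
              unfolding v using val_closed[of "comp_tm (snd y)" ?e i] by simp
          qed (use 1(2) l(2) in simp_all)
          moreover have "sat A ?e"
          proof -
            have "sat A ?e = sat A ((at \<eta> i)(x := a i, y := ?z))"
              by (rule sat_cong) (use 1(4) in \<open>auto simp: at_def\<close>)
            then show ?thesis using sA by simp
          qed
          ultimately show "sat (Ex y (?M \<^bold>\<and> A)) (at ?\<eta> i)" unfolding sat_connectives using z by blast
        qed
        then show "\<exists>r. cond r \<and> r \<preceq> q3 \<and> frc r (\<lambda>i. sat (Ex y (?M \<^bold>\<and> A)) (at ?\<eta> i))" using r by blast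
      qed
    qed
    then show "\<exists>r u. cond r \<and> r \<preceq> q \<and> nam (snd Y) u \<and> st_forced r (snd Y) u \<and> forces (AllSt x (Ex y (?M \<^bold>\<and> A))) r (\<eta>(Y := u))"
      using q(1) below_refl nZ by blast
  qed
qed

text \<open>The object sought is a generic d, not declared standard, together with the promise that
  A holds of d and every standard b. Were this inconsistent, some generated finite sequence would
  contain, for each choice of d, a b violating A; but the premise provides a solution for that very
  sequence.\<close>

lemma forces_Idealization: "C \<in> Idealization \<Longrightarrow> wf_fm C \<Longrightarrow> cond p \<Longrightarrow> nenv \<eta> \<Longrightarrow> forces C p \<eta>"
proof (induction rule: Idealization.induct)
  case (1 A y' y x)
  have y': "snd y' = snd y" by fact
  have dist: "x \<noteq> y" "y' \<noteq> x" "y' \<noteq> y" using 1(3) by auto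
  let ?M = "Mem (snd y) (V y) (V y')"
  show ?case unfolding forces.simps(5)
  proof (intro HOL.allI HOL.impI, rule forces_ExI)
    fix p' q assume p': "cond p'" "p' \<preceq> p" "forces (AllSt y' (Ex x (All y (?M \<^bold>\<longrightarrow> A)))) p' \<eta>" and q: "cond q" "q \<preceq> p'"
    define \<sigma> where "\<sigma> = snd x"
    define \<tau> where "\<tau> = snd y"
    note \<eta> = 1(7)
    obtain n where n: "bnd n q" "\<forall>z\<in>fvars A. supp n (\<eta> z)" using avoid[OF q(1) \<eta> finite_fvars] by blast
    define \<phi> where "\<phi> i a b \<longleftrightarrow> sat A ((at \<eta> i)(x := a, y := b))" for i a b
    define d :: "(var \<Rightarrow> 'a) \<Rightarrow> 'a" where "d i = i (n, \<sigma>)" for i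
    define \<psi> where "\<psi> i b \<longleftrightarrow> \<phi> i (d i) b" for i b
    have \<phi>c: "\<phi> i a b = \<phi> i' a b" if "tenv i" "tenv i'" "\<forall>x. fst x < n \<longrightarrow> i x = i' x" for i i' a b
      unfolding \<phi>_def by (rule sat_supp_cong[OF n(2) that])
    have dd: "d i \<in> dom \<sigma>" if "tenv i" for i using that unfolding d_def tenv_def by (metis snd_conv)
    have nd: "nam (snd x) d" unfolding nam_def using dd supp_var[of n \<sigma>] unfolding d_def \<sigma>_def by blast
    have s\<psi>: "supp (Suc n) \<psi>" unfolding supp_def
    proof (intro HOL.allI HOL.impI, rule HOL.ext)
      fix i i' b assume i: "tenv i" "tenv i'" "\<forall>x. fst x < Suc n \<longrightarrow> i x = i' x"
      then have "d i = d i'" unfolding d_def by simp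
      moreover have "\<phi> i (d i') b = \<phi> i' (d i') b" by (rule \<phi>c[OF i(1,2)]) (use i(3) in simp)
      ultimately show "\<psi> i b = \<psi> i' b" unfolding \<psi>_def by simp
    qed
    let ?q = "strengthen q {} \<tau> \<psi>"
    have bq: "bnd (Suc n) ?q" by (rule bnd_str[OF n(1) _ s\<psi>]) simp_all
    have cq: "cond ?q"
    proof (rule ccontr)
      assume "\<not> cond ?q"
      then have inc: "frc ?q (\<lambda>i. False)" using bq unfolding cond_def by blast
      obtain F b U B where F: "finite F" "\<forall>w\<in>F. Gen (fst q) (N \<rightarrow> fst w) (snd w)"
        "Gen (fst q) N b" "Gen (fst q) (N \<rightarrow> \<tau>) U" "Gen (fst q) N B"
        "\<forall>i. tenv i \<longrightarrow> (\<forall>w\<in>F. \<forall>k. lenm (nm k) (b i) \<longrightarrow> snd q i (fst w) (snd w i \<bullet> nm k)) \<longrightarrow>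
          (\<exists>m. lenm (nm m) (B i) \<and> \<not> \<psi> i (U i \<bullet> nm m))"
        using strengthen_incons[OF inc, unfolded Un_empty_left, OF bnd_tyd[OF n(1)]] by blast
      \<comment> \<open>The members of U up to the bound B, coded as one standard object to which
        the premise applies; the successor includes the index B.\<close>
      define s where "s i = val (seq_tm \<tau>) i \<bullet> U i \<bullet> (val (Cn CSuc) i \<bullet> B i)" for i
      have gB: "Gen (fst q) N (\<lambda>i. val (Cn CSuc) i \<bullet> B i)" by (rule Gen_tm1[OF _ _ _ F(5)]) simp_all
      have gs: "Gen (fst q) \<tau> s" unfolding s_def by (rule Gen_tm2[OF _ _ _ F(4) gB]) simp_all
      have ns: "nam (snd y') s" using Gen_nam[OF gs q(1)] unfolding \<tau>_def y' .
      let ?\<eta> = "\<eta>(y' := s)"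
      have ne: "nenv ?\<eta>" by (rule nenv_upd[OF \<eta> ns])
      have int: "internal (Ex x (All y (?M \<^bold>\<longrightarrow> A)))" using 1(1) by simp
      have "forces (Ex x (All y (?M \<^bold>\<longrightarrow> A))) q ?\<eta>"
        using p'(3) ns q generated_st_forced[OF Gen_generated[OF gs q(1)]] y' unfolding forces.simps(7) \<tau>_def by simp
      then have X: "frc q (\<lambda>i. sat (Ex x (All y (?M \<^bold>\<longrightarrow> A))) (at ?\<eta> i))" unfolding forces_internal[OF int q(1) ne] .
      have "gens q F b" unfolding gens_def using F(1-3) by blast
      then have O: "frc q (ok q F b)" unfolding frc_def by blast
      have "frc q (\<lambda>i. False)"
      proof (rule frc_mono[OF frc_conj[OF X O q(1)]], elim conjE)
        fix i assume i: "tenv i" and ok: "ok q F b i" and st: "sat (Ex x (All y (?M \<^bold>\<longrightarrow> A))) (at ?\<eta> i)"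
        obtain a where a: "a \<in> dom \<sigma>" "\<forall>c\<in>dom \<tau>. sat ?M ((at ?\<eta> i)(x := a, y := c)) \<longrightarrow> sat A ((at ?\<eta> i)(x := a, y := c))"
          using st unfolding sat_connectives sat.simps \<sigma>_def \<tau>_def by blast
        \<comment> \<open>The solution a for the sequence takes the place of the generic d. As U and
          B have support n, the violation found at the new assignment is still a member of the same
          sequence.\<close>
        define i' where "i' = i((n, \<sigma>) := a)"
        have i': "tenv i'" unfolding i'_def using i a(1) by simp
        have agr: "\<forall>x. fst x < n \<longrightarrow> i x = i' x" unfolding i'_def by auto
        have same: "u i' = u i" if "Gen (fst q) \<rho> u" for \<rho> u
          using Gen_bnd[OF that n(1)] suppD[of n u i i'] i i' agr by simp
        have \<Theta>: "snd q i' = snd q i" using n(1) suppD[of n "snd q" i i'] i i' agr unfolding bnd_def by simp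
        have d': "d i' = a" unfolding d_def i'_def by simp
        have "\<forall>w\<in>F. \<forall>k. lenm (nm k) (b i') \<longrightarrow> snd q i' (fst w) (snd w i' \<bullet> nm k)"
        proof (intro ballI HOL.allI HOL.impI)
          fix w k assume w: "w \<in> F" and k: "lenm (nm k) (b i')"
          have "snd q i (fst w) (snd w i \<bullet> nm k)" using ok w k same[OF F(3)] unfolding ok_def by simp
          moreover have "snd w i' = snd w i" using same F(2) w by blast
          ultimately show "snd q i' (fst w) (snd w i' \<bullet> nm k)" using \<Theta> by simp
        qed
        then obtain m where m: "lenm (nm m) (B i')" "\<not> \<psi> i' (U i' \<bullet> nm m)" using F(6) i' by blast
        obtain M where M: "B i = nm M" using Gen_dom[OF F(5) q(1) i] domN_E by blast
        have mM: "m < Suc M" using m(1) same[OF F(5)] M by simp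
        have U: "U i \<in> dom (N \<rightarrow> \<tau>)" using Gen_dom[OF F(4) q(1) i] .
        have si: "s i = val (seq_tm \<tau>) i \<bullet> U i \<bullet> nm (Suc M)" unfolding s_def using M by simp
        let ?e = "(at ?\<eta> i)(x := a, y := U i \<bullet> nm m)"
        have z: "U i \<bullet> nm m \<in> dom \<tau>" using ap_dom[OF U nm_dom] .
        have te: "tenv ?e" using at_tenv[OF ne i] a(1) z unfolding \<sigma>_def \<tau>_def by (intro tenv_upd)
        have v: "val (V y) ?e = U i \<bullet> nm m" "val (V y') ?e = s i" using dist by (simp_all add: at_def)
        have "sat ?M ?e"
        proof (rule sat_MemI[OF te, of _ _ _ "Suc M" m])
          show "val (len_tm (snd y)) ?e \<bullet> val (V y') ?e = nm (Suc M)"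
            unfolding v si using len_seq[OF i U] val_closed[of "len_tm (snd y)" ?e i] unfolding \<tau>_def by simp
          show "val (V y) ?e = val (comp_tm (snd y)) ?e \<bullet> val (V y') ?e \<bullet> nm m"
            unfolding v si using comp_seq[OF i U mM] val_closed[of "comp_tm (snd y)" ?e i] unfolding \<tau>_def by simp
        qed (use y' mM in simp_all)
        then have "sat A ?e" using a(2) z by blast
        moreover have "sat A ?e = \<phi> i a (U i \<bullet> nm m)" unfolding \<phi>_def
          by (rule sat_cong) (use 1(4) in \<open>auto simp: at_def\<close>)
        ultimately show False
          using m(2) \<phi>c[OF i i' agr, of a] d' same[OF F(4)] unfolding \<psi>_def by simp
      qed
      then show False using q(1) unfolding cond_def by blast
    qed
    have "forces (AllSt y A) ?q (\<eta>(x := d))" unfolding forces.simps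
    proof (intro HOL.allI HOL.impI)
      fix v r assume v: "nam (snd y) v" and r: "cond r" "r \<preceq> ?q" "st_forced r (snd y) v"
      have ne: "nenv (\<eta>(x := d, y := v))" by (intro nenv_upd \<eta> nd v)
      obtain m where m: "\<forall>z\<in>fvars A. supp m ((\<eta>(x := d, y := v)) z)" using fin_supp[OF finite_fvars ne] by blast
      show "forces A r (\<eta>(x := d, y := v))" unfolding forces_internal[OF 1(1) r(1) ne]
      proof (rule frc_stable[OF r(1) supp_sat[OF m]])
        fix r1 assume r1: "cond r1" "r1 \<preceq> r"
        obtain r2 where r2: "cond r2" "r2 \<preceq> r1" "generated r2 \<tau> v" using st_forcedD[OF r(3) r1] unfolding \<tau>_def by blast
        have "r2 \<preceq> ?q" using below_trans r2(2) r1(2) r(2) by blast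
        then have "frc r2 (\<lambda>i. \<psi> i (v i))" using strengthen_generated[OF r2(1) _ r2(3)] by blast
        then have "frc r2 (\<lambda>i. sat A (at (\<eta>(x := d, y := v)) i))" unfolding at_upd \<psi>_def \<phi>_def .
        then show "\<exists>r. cond r \<and> r \<preceq> r1 \<and> frc r (\<lambda>i. sat A (at (\<eta>(x := d, y := v)) i))" using r2 by blast
      qed
    qed
    then show "\<exists>r u. cond r \<and> r \<preceq> q \<and> nam (snd x) u \<and> forces (AllSt y A) r (\<eta>(x := u))"
      using cq strengthen_below nd by blast
  qed
qed

section \<open>Soundness without transfer, and a generic tree without standard paths\<close>

lemma internal_E_EFA: "A \<in> E_EFA \<Longrightarrow> internal A"
proof (induction rule: E_EFA.induct)
  case (qf_ind A x)
  have "qfree_internal (fsubst x u A)" for u using qf_ind(1) by (induction A) auto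
  then show ?case using qf_ind(1) qfree_internal_imp by simp
qed simp_all

lemma internal_QF_AC: "A \<in> QF_AC_10 \<Longrightarrow> internal A"
proof (induction rule: QF_AC_10.induct)
  case (1 A x y Y)
  have "qfree_internal (fsubst y u A)" for u using 1(1) by (induction A) auto
  then show ?case using 1(1) qfree_internal_imp by simp
qed

lemma internal_sentences: "internal mu1" "internal kappa3"
  by (simp_all add: mu1_def kappa3_def Let_def binary_def)

lemma forces_B0_minus:
  assumes B: "B \<in> B0_minus \<union> {kappa3}" and w: "wf_fm B" and p: "cond p" "nenv \<eta>" shows "forces B p \<eta>"
proof -
  consider "B \<in> E_EFA" | "B \<in> EQ" | "B \<in> T_st" | "B \<in> Idealization" | "B \<in> HAC_int" | "B \<in> QF_AC_10" | "B = kappa3"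
    using B unfolding B0_minus_def E_EFA_st_def by blast
  then show ?thesis
  proof cases
    case 1
    then show ?thesis using forces_valid[OF internal_E_EFA p] sat_E_EFA w by blast
  next
    case 2
    then show ?thesis using forces_EQ w p by blast
  next
    case 3
    then show ?thesis using forces_T_st w p by blast
  next
    case 4
    then show ?thesis using forces_Idealization w p by blast
  next
    case 5
    then show ?thesis using forces_HAC w p by blast
  next
    case 6
    then show ?thesis using forces_valid[OF internal_QF_AC p] sat_QF_AC w by blast
  next
    case 7
    then show ?thesis using forces_valid[OF internal_sentences(2) p] sat_kappa3 by blast
  qed
qed

text \<open>The paths of \<open>tree m\<close> are the functions with value \<open>m\<close> at 0.\<close>

definition tree :: "nat \<Rightarrow> 'a" where
  "tree m = to1 (\<lambda>s. if s = 0 \<or> hdn s = m then 0 else 1)"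

lemma tree_dom: "tree m \<in> dom T1" unfolding tree_def by (rule to1)

lemma tree_nm: "tree m \<bullet> nm s = nm (if s = 0 \<or> hdn s = m then 0 else 1)" unfolding tree_def by (rule to1)

text \<open>The trees differ for different m, but their values are 0 and 1 only, so the family is
  uniformly bounded in spite of the unbounded parameter.\<close>

lemma Bd_tree: "Bd T1 tree"
proof -
  have "Bd N (\<lambda>m. tree m \<bullet> y m)" if y: "Bd N y" for y
  proof -
    obtain g where "\<forall>m. y m = nm (g m)" using Bd_NE[OF y] by blast
    then show ?thesis
      by (intro Bd_NI[of _ "\<lambda>m. if g m = 0 \<or> hdn (g m) = m then 0 else 1" 1]) (simp_all add: tree_nm)
  qed
  then show ?thesis using tree_dom by (simp del: Bd.simps(1))
qed

definition root_gen :: "(var \<Rightarrow> 'a) \<Rightarrow> 'a" where "root_gen i = i (0, T1)"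

text \<open>The number m is not named and hence not declared standard. By \<open>path_tree\<close>
  the promise excludes every standard function as a path of the generic tree.\<close>

definition root :: "'a cnd" where
  "root = ({(T1, root_gen)}, \<lambda>i \<rho> a. \<exists>m. root_gen i = tree m \<and> (\<rho> = T1 \<longrightarrow> a \<bullet> nm 0 \<noteq> nm m))"

text \<open>The fundamental lemma of the logical relation: constants are bounded by
  \<open>Bd_co\<close>, the generic tree by \<open>Bd_tree\<close>, and application preserves
  boundedness by definition.\<close>

lemma Gen_Bd: "Gen (fst root) \<sigma> u \<Longrightarrow> Bd \<sigma> (\<lambda>m. u (e0((0, T1) := tree m)))"
proof (induction rule: Gen.induct)
  case (Gen_base \<sigma> u)
  then have "\<sigma> = T1" "u = root_gen" unfolding root_def by simp_all
  then show ?case using Bd_tree unfolding root_gen_def by (simp del: Bd.simps)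
next
  case (Gen_co c)
  show ?case by (rule Bd_co)
next
  case (Gen_app \<sigma> \<tau> u v)
  show ?case by (rule Bd_app[OF Gen_app.IH])
qed

lemma cond_root: "cond root"
  unfolding cond_def
proof
  have "i (0, T1) \<in> dom T1" if "tenv i" for i using that unfolding tenv_def by (metis snd_conv)
  then show "\<exists>n. bnd n root" unfolding bnd_def root_def root_gen_def supp_def
    by (intro exI[of _ 1]) auto
  show "\<not> frc root (\<lambda>i. False)"
  proof
    assume "frc root (\<lambda>i. False)"
    then obtain F b where F: "gens root F b" "\<And>i. tenv i \<Longrightarrow> \<not> ok root F b i" unfolding frc_def by blast
    let ?i = "\<lambda>m. e0((0, T1) := tree m)"
    have i: "tenv (?i m)" for m using tree_dom by simp
    obtain g C where g: "\<And>m. b (?i m) = nm (g m)" "\<And>m. g m \<le> C"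
      using Bd_NE[OF Gen_Bd] F(1) unfolding gens_def by metis
    have "\<exists>L. \<forall>m v. snd w (?i m) \<bullet> nm k \<bullet> nm 0 = nm v \<longrightarrow> v \<le> L" if w: "w \<in> F" "fst w = T1" for w k
    proof -
      have "Gen (fst root) (N \<rightarrow> T1) (snd w)" using F(1) w unfolding gens_def by metis
      from Bd_NE[OF Bd_app[OF Bd_app[OF Gen_Bd[OF this] Bd_nm[of k]] Bd_nm[of 0]]]
      obtain h L where "\<forall>m. snd w (?i m) \<bullet> nm k \<bullet> nm 0 = nm (h m)" "\<forall>m. h m \<le> L" by blast
      then show ?thesis by (intro exI[of _ L]) simp
    qed
    then obtain L where L: "\<And>w k m v. w \<in> F \<Longrightarrow> fst w = T1 \<Longrightarrow> snd w (?i m) \<bullet> nm k \<bullet> nm 0 = nm v \<Longrightarrow> v \<le> L w k"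
      by metis
    let ?P = "F \<times> {..C}"
    have fin: "finite ?P" using F(1) unfolding gens_def by simp
    \<comment> \<open>Beyond every first value that the sequences in F of type 1 objects can produce
      at an index up to C. These bounds hold for all trees at once, so m may be chosen after them
      without circularity.\<close>
    define m where "m = Suc (\<Sum>(w, k)\<in>?P. L w k)"
    have "ok root F b (?i m)" unfolding ok_def
    proof (intro ballI HOL.allI HOL.impI)
      fix w k assume w: "w \<in> F" "lenm (nm k) (b (?i m))"
      then have "k \<le> C" using g(1)[of m] g(2)[of m] by simp
      then have "L w k \<le> (\<Sum>(w, k)\<in>?P. L w k)"
        using member_le_sum[of "(w, k)" ?P "\<lambda>(w, k). L w k"] fin w(1) by simp
      then have big: "snd w (?i m) \<bullet> nm k \<bullet> nm 0 \<noteq> nm m" if "fst w = T1"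
        using L[OF w(1) that, of m k m] unfolding m_def by linarith
      show "snd root (?i m) (fst w) (snd w (?i m) \<bullet> nm k)"
        unfolding root_def root_gen_def snd_conv fun_upd_same using big by blast
    qed
    then show False using F(2)[OF i] by blast
  qed
qed

lemma sat_path: "sat (All (0, N) (V (0, T1) \<cdot> (code_tm \<cdot> V (1, T1) \<cdot> V (0, N)) \<^bold>= Zr)) e \<longleftrightarrow>
  (\<forall>k. e (0, T1) \<bullet> (val code_tm e \<bullet> e (1, T1) \<bullet> nm k) = nm 0)"
  by (simp add: val_upd_fresh dom_N)

text \<open>A nonempty segment has a nonzero code with head g 0. The empty segment, with code 0, is
  accepted by every tree.\<close>

lemma path_tree:
  assumes "tenv e" "e (0, T1) = tree m" "\<And>k. e (1, T1) \<bullet> nm k = nm (g k)"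
  shows "(\<forall>k. e (0, T1) \<bullet> (val code_tm e \<bullet> e (1, T1) \<bullet> nm k) = nm 0) \<longleftrightarrow> g 0 = m"
proof -
  have d: "e (1, T1) \<in> dom T1" using assms(1) unfolding tenv_def by (metis snd_conv)
  have c: "e (0, T1) \<bullet> (val code_tm e \<bullet> e (1, T1) \<bullet> nm k) = nm (if codn g k = 0 \<or> hdn (codn g k) = m then 0 else 1)" for k
    unfolding code_nm[OF assms(1) d assms(3)] assms(2) tree_nm ..
  have h: "codn g (Suc k) \<noteq> 0" "hdn (codn g (Suc k)) = g 0" for k
    unfolding codn_Suc by (simp, rule hdn_code)
  show ?thesis
  proof
    assume "\<forall>k. e (0, T1) \<bullet> (val code_tm e \<bullet> e (1, T1) \<bullet> nm k) = nm 0"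
    then have "nm (if codn g (Suc 0) = 0 \<or> hdn (codn g (Suc 0)) = m then 0 else 1) = nm 0" using c[of "Suc 0"] by metis
    then show "g 0 = m" using h[of 0] by (simp split: if_splits)
  next
    assume m: "g 0 = m"
    have "codn g k = 0 \<or> hdn (codn g k) = m" for k using h m by (cases k) simp_all
    then show "\<forall>k. e (0, T1) \<bullet> (val code_tm e \<bullet> e (1, T1) \<bullet> nm k) = nm 0" unfolding c by simp
  qed
qed

lemma not_proves: "\<not> (B0_minus \<union> {kappa3} \<^bold>\<turnstile> (mu1 \<^bold>\<longleftrightarrow> Pi11_TRANS))"
proof
  assume pr: "B0_minus \<union> {kappa3} \<^bold>\<turnstile> (mu1 \<^bold>\<longleftrightarrow> Pi11_TRANS)"
  define \<eta> :: "var \<Rightarrow> (var \<Rightarrow> 'a) \<Rightarrow> 'a" where "\<eta> = (\<lambda>x i. e0 x)"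
  have \<eta>: "nenv \<eta>" unfolding nenv_def nam_def \<eta>_def supp_def using tenv_e0 unfolding tenv_def by simp
  let ?f = "(0, T1)" and ?g = "(1, T1)"
  let ?path = "All (0, N) (V ?f \<cdot> (code_tm \<cdot> V ?g \<cdot> V (0, N)) \<^bold>= Zr)"
  have g: "Gen (fst root) T1 root_gen" by (rule Gen_base) (simp add: root_def)
  note gn = Gen_nam[OF g cond_root]
  let ?\<eta> = "\<eta>(?f := root_gen)"
  have ne: "nenv ?\<eta>" by (rule nenv_upd[OF \<eta>]) (use gn in simp)
  have "forces (mu1 \<^bold>\<longleftrightarrow> Pi11_TRANS) root \<eta>"
    by (rule forces_sound[OF forces_B0_minus pr[unfolded proves_def] cond_root \<eta>]) simp_all
  moreover have "forces mu1 root \<eta>" by (rule forces_valid[OF internal_sentences(1) cond_root \<eta> sat_mu1])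
  ultimately have "forces Pi11_TRANS root \<eta>" by (rule forces_IffD[OF cond_root \<eta>])
  then have imp: "forces (Ex ?g ?path \<^bold>\<longrightarrow> ExSt ?g ?path) root ?\<eta>"
    using gn cond_root below_refl generated_st_forced[OF Gen_generated[OF g cond_root]]
    unfolding Pi11_TRANS_def Let_def forces.simps(7) snd_conv by blast
  have int: "internal (Ex ?g ?path)" "internal ?path" by simp_all
  \<comment> \<open>Wherever the promise is kept, the generic object is some \<open>tree m\<close>,
    and the function with constant value m is a path of it.\<close>
  have "frc root (\<lambda>i. sat (Ex ?g ?path) (at ?\<eta> i))"
  proof (rule frc_mono[OF frc_any], elim exE)
    fix i \<rho> a assume i: "tenv i" and "snd root i \<rho> a"
    then obtain m where m: "root_gen i = tree m" unfolding root_def by auto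
    let ?e = "(at ?\<eta> i)(?g := to1 (\<lambda>_. m))"
    have "tenv ?e" using at_tenv[OF ne i] to1(1) by simp
    moreover have "?e ?f = tree m" using m by (simp add: at_def)
    ultimately have "sat ?path ?e" unfolding sat_path using path_tree[of ?e m "\<lambda>_. m"] to1(2) by simp
    then show "sat (Ex ?g ?path) (at ?\<eta> i)" unfolding sat_connectives snd_conv using to1(1) by blast
  qed
  then have "forces (Ex ?g ?path) root ?\<eta>" unfolding forces_internal[OF int(1) cond_root ne] .
  then have "forces (ExSt ?g ?path) root ?\<eta>" using imp cond_root below_refl unfolding forces.simps(5) by blast
  then obtain r u where r: "cond r" "r \<preceq> root" "nam T1 u" "st_forced r T1 u" "forces ?path r (?\<eta>(?g := u))"
    using forces_ExStD cond_root unfolding snd_conv by (metis snd_conv)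
  obtain r' where r': "cond r'" "r' \<preceq> r" "generated r' T1 u" using st_forcedD[OF r(4,1) below_refl] by blast
  obtain t b where t: "Gen (fst r') (N \<rightarrow> T1) t" "Gen (fst r') N b"
    "frc r' (\<lambda>i. \<exists>k. lenm (nm k) (b i) \<and> u i = t i \<bullet> nm k)" using r'(3) unfolding generated_def by blast
  have ne': "nenv (?\<eta>(?g := u))" by (rule nenv_upd[OF ne]) (use r(3) in simp)
  have "frc r (\<lambda>i. sat ?path (at (?\<eta>(?g := u)) i))" using r(5) unfolding forces_internal[OF int(2) r(1) ne'] .
  then have path: "frc r' (\<lambda>i. sat ?path (at (?\<eta>(?g := u)) i))" using frc_below r'(2) by blast
  have below: "r' \<preceq> root" using below_trans r r' by blast
  \<comment> \<open>A standard path is a member of a generated sequence below a generated bound, so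
    by the promise its value at 0 differs from m, whereas paths of the tree have value m
    there.\<close>
  have "frc r' (\<lambda>i. False)"
  proof (rule frc_mono[OF frc_conj[OF path frc_conj[OF t(3) frc_promise[OF t(1,2)] r'(1)] r'(1)]], elim conjE exE)
    fix i k assume i: "tenv i" and s: "sat ?path (at (?\<eta>(?g := u)) i)"
      and k: "lenm (nm k) (b i)" "u i = t i \<bullet> nm k" "\<forall>k. lenm (nm k) (b i) \<longrightarrow> snd r' i T1 (t i \<bullet> nm k)"
    have "snd root i T1 (u i)" using k below unfolding below_def by metis
    then obtain m where m: "root_gen i = tree m" "u i \<bullet> nm 0 \<noteq> nm m" unfolding root_def by auto
    let ?e = "at (?\<eta>(?g := u)) i"
    have e: "tenv ?e" "?e ?f = tree m" "?e ?g = u i" using at_tenv[OF ne' i] m by (simp_all add: at_def)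
    have "u i \<in> dom T1" using r(3) i unfolding nam_def by blast
    then obtain g where g: "\<forall>k. u i \<bullet> nm k = nm (g k)" using T1_nm by blast
    have "\<And>k. ?e ?g \<bullet> nm k = nm (g k)" unfolding e(3) using g by blast
    then have "g 0 = m" using s path_tree[OF e(1,2), of g] unfolding sat_path by blast
    then show False using g m by simp
  qed
  then show False using r'(1) unfolding cond_def by blast
qed

end

theorem corollary4p10:
  shows "(B0 \<union> {kappa3} \<^bold>\<turnstile> (mu1 \<^bold>\<longleftrightarrow> Pi11_TRANS))
    \<and> \<not> (B0_minus \<union> {kappa3} \<^bold>\<turnstile> (mu1 \<^bold>\<longleftrightarrow> Pi11_TRANS))"
  using equivalence std.not_proves[OF S_std] by blast

end
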